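(* Let $\Omega$ be a domain in $\mathbb{R}^N$, $N>2$, let $2^*=2N/(N-2)$, and let $V\in L^\infty_{\mathrm{loc}}(\Omega)$. Assume that there is a positive continuous function $W$ on $\Omega$ such that the functional $Q$ below satisfies $$Q(u):=\int_\Omega\left(|\nabla u|^2+V|u|^2\right)\mathrm{d}x\ \ge\ \left(\int_\Omega W|u|^{2^*}\,\mathrm{d}x\right)^{2/2^*}\qquad \text{for all } u\in C_0^\infty(\Omega).$$ Let $\tilde V\in L^\infty_{\mathrm{loc}}(\Omega)$ be a nonzero potential satisfying $$|\tilde V|^{N/2}W^{(2-N)/2}\in L^1(\Omega),$$ and for $\lambda\in\mathbb{R}$ define $$\tilde Q_\lambda(u):=Q(u)+\lambda\int_\Omega\tilde V|u|^2\,\mathrm{d}x,\qquad u\in C_0^\infty(\Omega).$$ (i) If $\tilde Q_\lambda$ is nonnegative on $C_0^\infty(\Omega)$ and does not admit a ground state, then there is a constant $C>0$ such that $$\tilde Q_\lambda(u)\ \ge\ C\left(\int_\Omega W|u|^{2^*}\,\mathrm{d}x\right)^{2/2^*}\qquad\text{for all } u\in C_0^\infty(\Omega).$$ (ii) If $\tilde Q_\lambda$ is nonnegative on $C_0^\infty(\Omega)$ and admits a ground state $v$, then for every $\psi\in C_0^\infty(\Omega)$ such that $\int_\Omega\psi v\,\mathrm{d}x\neq0$ there are constants $C,C_1>0$ such that $$\tilde Q_\lambda(u)+C_1\left(\int_\Omega\psi u\,\mathrm{d}x\right)^2\ \ge\ C\left(\int_\Omega W|u|^{2^*}\,\mathrm{d}x\right)^{2/2^*}\qquad\text{for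 all } u\in C_0^\infty(\Omega).$$ (iii) The set $$S:=\{\lambda\in\mathbb{R}\ :\ \tilde Q_\lambda\ge0\ \text{ on } C_0^\infty(\Omega)\}$$ is a closed interval with nonempty interior, which is bounded if and only if $\tilde V$ changes its sign on a set of positive measure in $\Omega$ (that is, both $\{\tilde V>0\}$ and $\{\tilde V<0\}$ have positive measure). Moreover, $\lambda\in\partial S$ if and only if $\tilde Q_\lambda$ is critical in $\Omega$.
   Context: Functions are real-valued. Let $U\in L^\infty_{\mathrm{loc}}(\Omega)$ and suppose that the functional $F(u)=\int_\Omega(|\nabla u|^2+U|u|^2)\,\mathrm{d}x$ is nonnegative on $C_0^\infty(\Omega)$. A function $\varphi\in C^1(\Omega)$ is a ground state for $F$ if $\varphi$ is an $L^2_{\mathrm{loc}}(\Omega)$-limit of a sequence of nonnegative functions $\varphi_k\in C_0^\infty(\Omega)$ satisfying $F(\varphi_k)\to0$ and $\int_B|\varphi_k|^2\,\mathrm{d}x=1$ for all $k$, for some fixed $B\Subset\Omega$ ($B$ with compact closure contained in $\Omega$). Such a nonnegative functional $F$ is called critical (in $\Omega$) if it admits a ground state, and subcritical if it does not. These notions are applied to $F=\tilde Q_\lambda$, for which $U=V+\lambda\tilde V$. An interval in $\mathbb{R}$ may be unbounded; $\partial S$ denotes the boundary of $S$ in $\mathbb{R}$. "Nonzero" potential means not equal to $0$ almost everywhere. *)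

theory Defs
  imports "HOL-Analysis.Analysis"
begin

text \<open>Iterated Frechet derivatives along the standard basis: on an open set \<open>S\<close> this is the
  usual class \<open>C\<^sup>k(S)\<close>. Values of \<open>f\<close> outside the open set \<open>S\<close> are irrelevant.\<close>

fun C_k_on :: "nat \<Rightarrow> 'a::euclidean_space set \<Rightarrow> ('a \<Rightarrow> real) \<Rightarrow> bool" where
  "C_k_on 0 S f \<longleftrightarrow> continuous_on S f"
| "C_k_on (Suc k) S f \<longleftrightarrow>
     (\<forall>x\<in>S. f differentiable (at x)) \<and>
     (\<forall>b\<in>Basis. C_k_on k S (\<lambda>x. frechet_derivative f (at x) b))"

text \<open>\<open>C\<^sub>0\<^sup>\<infinity>(\<Omega>)\<close>; its elements are represented by their extension by zero to the whole space.\<close>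

definition test_functions :: "'a::euclidean_space set \<Rightarrow> ('a \<Rightarrow> real) set" where
  "test_functions \<Omega> =
     {u. (\<forall>k. C_k_on k UNIV u) \<and> compact (closure {x. u x \<noteq> 0}) \<and> closure {x. u x \<noteq> 0} \<subseteq> \<Omega>}"

definition Linf_loc :: "'a::euclidean_space set \<Rightarrow> ('a \<Rightarrow> real) set" where
  "Linf_loc \<Omega> =
     {V. V \<in> borel_measurable (lebesgue_on \<Omega>) \<and>
         (\<forall>K. compact K \<and> K \<subseteq> \<Omega> \<longrightarrow> (\<exists>c. AE x in lebesgue_on K. \<bar>V x\<bar> \<le> c))}"

definition grad_sq :: "('a::euclidean_space \<Rightarrow> real) \<Rightarrow> 'a \<Rightarrow> real" where
  "grad_sq u x = (\<Sum>b\<in>Basis. (frechet_derivative u (at x) b)\<^sup>2)"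

definition energy :: "'a::euclidean_space set \<Rightarrow> ('a \<Rightarrow> real) \<Rightarrow> ('a \<Rightarrow> real) \<Rightarrow> real" where
  "energy \<Omega> V u = (LINT x:\<Omega>|lebesgue. grad_sq u x + V x * \<bar>u x\<bar>\<^sup>2)"

definition perturbed_energy ::
  "'a::euclidean_space set \<Rightarrow> ('a \<Rightarrow> real) \<Rightarrow> ('a \<Rightarrow> real) \<Rightarrow> real \<Rightarrow> ('a \<Rightarrow> real) \<Rightarrow> real" where
  "perturbed_energy \<Omega> V Vt t u = energy \<Omega> V u + t * (LINT x:\<Omega>|lebesgue. Vt x * \<bar>u x\<bar>\<^sup>2)"

definition sobolev_exponent :: "nat \<Rightarrow> real" where
  "sobolev_exponent N = 2 * real N / (real N - 2)"

definition weighted_sobolev_term ::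
  "'a::euclidean_space set \<Rightarrow> ('a \<Rightarrow> real) \<Rightarrow> ('a \<Rightarrow> real) \<Rightarrow> real" where
  "weighted_sobolev_term \<Omega> W u =
     (LINT x:\<Omega>|lebesgue. W x * \<bar>u x\<bar> powr sobolev_exponent DIM('a))
       powr (2 / sobolev_exponent DIM('a))"

definition nonneg_functional ::
  "'a::euclidean_space set \<Rightarrow> (('a \<Rightarrow> real) \<Rightarrow> real) \<Rightarrow> bool" where
  "nonneg_functional \<Omega> F \<longleftrightarrow> (\<forall>u\<in>test_functions \<Omega>. F u \<ge> 0)"

text \<open>The set \<open>B\<close> is the same for the whole sequence. Nonnegativity of \<open>F\<close> is not part of
  the notion of a ground state; it is required separately.\<close>

definition ground_state ::
  "'a::euclidean_space set \<Rightarrow> (('a \<Rightarrow> real) \<Rightarrow> real) \<Rightarrow> ('a \<Rightarrow> real) \<Rightarrow> bool" where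
  "ground_state \<Omega> F \<phi> \<longleftrightarrow>
     C_k_on 1 \<Omega> \<phi> \<and>
     (\<exists>\<phi>s :: nat \<Rightarrow> 'a \<Rightarrow> real. \<exists>B.
        (\<forall>k. \<phi>s k \<in> test_functions \<Omega> \<and> (\<forall>x. \<phi>s k x \<ge> 0)) \<and>
        (\<forall>K. compact K \<and> K \<subseteq> \<Omega> \<longrightarrow>
           (\<lambda>k. LINT x:K|lebesgue. \<bar>\<phi>s k x - \<phi> x\<bar>\<^sup>2) \<longlonglongrightarrow> 0) \<and>
        (\<lambda>k. F (\<phi>s k)) \<longlonglongrightarrow> 0 \<and>
        B \<in> sets lebesgue \<and> compact (closure B) \<and> closure B \<subseteq> \<Omega> \<and>
        (\<forall>k. (LINT x:B|lebesgue. \<bar>\<phi>s k x\<bar>\<^sup>2) = 1))"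

definition critical :: "'a::euclidean_space set \<Rightarrow> (('a \<Rightarrow> real) \<Rightarrow> real) \<Rightarrow> bool" where
  "critical \<Omega> F \<longleftrightarrow> nonneg_functional \<Omega> F \<and> (\<exists>\<phi>. ground_state \<Omega> F \<phi>)"

definition nonneg_params ::
  "'a::euclidean_space set \<Rightarrow> ('a \<Rightarrow> real) \<Rightarrow> ('a \<Rightarrow> real) \<Rightarrow> real set" where
  "nonneg_params \<Omega> V Vt = {t. nonneg_functional \<Omega> (perturbed_energy \<Omega> V Vt t)}"

end

theory Submission
 imports Defs "HOL-Complex_Analysis.Great_Picard" "HOL-Library.Diagonal_Subsequence"
begin

text \<open>Write \<open>Q\<close> for the unperturbed energy, \<open>S(u)\<close> for the weighted Sobolev term and \<open>Q\<^sub>t\<close> for the perturbed energy.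
 Hoelder's inequality and the integrability condition give \<open>\<bar>\<integral>Vt u\<^sup>2\<bar> \<le> A S(u)\<close>, with arbitrarily small constant in place of \<open>A\<close>
 outside a large compact set (\<open>Vt_le_SW\<close>, \<open>Vt_tail\<close>). Call it a gap at \<open>t\<close> if \<open>Q\<^sub>t \<ge> C S\<close> for some \<open>C > 0\<close>.

 If \<open>Q\<^sub>t \<ge> 0\<close> has no gap, some test functions satisfy \<open>S(u\<^sub>k) = 1\<close> and \<open>Q\<^sub>t(u\<^sub>k) \<longlonglongrightarrow> 0\<close>. Then \<open>Q(u\<^sub>k)\<close> is bounded. As \<open>Q \<ge> S \<ge> 0\<close>,
 localization bounds the gradients on compact sets (\<open>local_H1_bound\<close>), and by Rellich a subsequence converges in
 local \<open>L\<^sup>2\<close> to some \<open>w\<close>. If \<open>w\<close> were zero, the perturbation would vanish along the sequence up to a small tail,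
 contradicting \<open>Q(u\<^sub>k) \<ge> 1\<close> (\<open>normalised_null_sequence_nonzero\<close>). By Cauchy--Schwarz for \<open>Q\<^sub>t\<close>, \<open>w\<close> solves
 \<open>-\<Delta>w + (V + t Vt) w = 0\<close> weakly. Replacing \<open>u\<^sub>k\<close> by smooth versions of \<open>\<bar>u\<^sub>k\<bar>\<close> makes \<open>w\<close> nonnegative, and then the
 regularity theorem \<open>weak_sol_regular\<close> makes it \<open>C\<^sup>1\<close>; normalised, it is a ground state. This is (i).

 For (ii), a failing estimate gives such a sequence with \<open>\<integral>\<psi> u\<^sub>k \<longlonglongrightarrow> 0\<close> as well. All limits of null sequences are multiples of the
 positive ground state \<open>v\<close> (\<open>null_limits_proportional\<close>), so \<open>w = s v\<close> with \<open>s \<integral>\<psi> v = 0\<close>; hence \<open>w = 0\<close>, which is excluded.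

 For (iii), \<open>Q\<^sub>t(u)\<close> is affine in \<open>t\<close>, so the parameter set is a closed interval. Its interior consists of the \<open>t\<close> with
 a gap (\<open>interior_nonneg_params_iff\<close>), in particular \<open>0\<close>; by (i), and because a gap excludes null sequences with mass
 on a compact set, the boundary consists of the critical parameters. The set is bounded on a side exactly if \<open>\<integral>Vt u\<^sup>2\<close> takes the
 corresponding sign.

 The two facts on weak solutions use only integrals against test functions. The regularized powers
 \<open>(\<bar>x\<bar>\<^sup>2 + e\<^sup>2)\<^sup>a\<close> replace fundamental solutions: a slightly less singular power absorbs the potential and bounds nonnegative
 solutions; convolution with the cut off fundamental solution then gives \<open>C\<^sup>1\<close>; a slightly more singular power is a barrier of
 Hopf type at a zero, which yields the dichotomy between zero and positive solutions on connected sets.\<close>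

section \<open>Smooth functions and cutoffs\<close>

abbreviation partial :: "'a::euclidean_space \<Rightarrow> ('a \<Rightarrow> real) \<Rightarrow> 'a \<Rightarrow> real" where
 "partial b f \<equiv> \<lambda>x. frechet_derivative f (at x) b"

definition smooth :: "('a::euclidean_space \<Rightarrow> real) \<Rightarrow> bool" where
 "smooth f \<longleftrightarrow> (\<forall>k. C_k_on k UNIV f)"

definition lap :: "('a::euclidean_space \<Rightarrow> real) \<Rightarrow> 'a \<Rightarrow> real" where
 "lap f x = (\<Sum>b\<in>Basis. partial b (partial b f) x)"

lemma C_k_on_SucD: "C_k_on (Suc k) S f \<Longrightarrow> C_k_on k S f"
proof (induction k arbitrary: f)
 case 0
 then show ?case
  by (auto intro!: continuous_at_imp_continuous_on differentiable_imp_continuous_within)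
next
 case (Suc k)
 then show ?case by (metis C_k_on.simps(2))
qed

lemma partial_eqI: "(f has_derivative f') (at x) \<Longrightarrow> partial b f x = f' b"
 by (simp add: frechet_derivative_at[symmetric])

lemma partial_add:
 "f differentiable (at x) \<Longrightarrow> g differentiable (at x) \<Longrightarrow>
  partial b (\<lambda>x. f x + g x) x = partial b f x + partial b g x"
 by (rule partial_eqI) (intro has_derivative_add; simp add: frechet_derivative_works[THEN iffD1])

lemma partial_mult:
 "f differentiable (at x) \<Longrightarrow> g differentiable (at x) \<Longrightarrow>
  partial b (\<lambda>x. f x * g x) x = f x * partial b g x + partial b f x * g x"
 by (rule partial_eqI[where f' = "\<lambda>h. f x * frechet_derivative g (at x) h
    + frechet_derivative f (at x) h * g x"])
   (intro has_derivative_mult; simp add: frechet_derivative_works[THEN iffD1])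

lemma partial_compose_real:
 assumes "f differentiable (at x)" "(h has_real_derivative h') (at (f x))"
 shows "(\<lambda>x. h (f x)) differentiable (at x)" "partial b (\<lambda>x. h (f x)) x = h' * partial b f x"
proof -
 have "((\<lambda>x. h (f x)) has_derivative (\<lambda>y. h' * frechet_derivative f (at x) y)) (at x)"
  using has_derivative_compose[OF assms(1)[unfolded frechet_derivative_works]
    assms(2)[unfolded has_field_derivative_def]] by simp
 then show "(\<lambda>x. h (f x)) differentiable (at x)" "partial b (\<lambda>x. h (f x)) x = h' * partial b f x"
  by (auto simp: differentiable_def intro: partial_eqI)
qed

lemma C_k_on_const: "C_k_on k S (\<lambda>x. c)"
proof (induction k arbitrary: c)
 case (Suc k)
 have "partial b (\<lambda>x. c) = (\<lambda>x. 0)" for b :: 'a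
  by (auto simp: fun_eq_iff intro!: partial_eqI[where f' = "\<lambda>_. 0"])
 with Suc show ?case by simp
qed auto

lemma C_k_on_add: "C_k_on k UNIV f \<Longrightarrow> C_k_on k UNIV g \<Longrightarrow> C_k_on k UNIV (\<lambda>x. f x + g x)"
proof (induction k arbitrary: f g)
 case (Suc k)
 then have "partial b (\<lambda>x. f x + g x) = (\<lambda>x. partial b f x + partial b g x)" for b
  by (auto simp: fun_eq_iff partial_add)
 with Suc show ?case by auto
qed (auto intro: continuous_intros)

lemma C_k_on_mult: "C_k_on k UNIV f \<Longrightarrow> C_k_on k UNIV g \<Longrightarrow> C_k_on k UNIV (\<lambda>x. f x * g x)"
proof (induction k arbitrary: f g)
 case (Suc k)
 then have "partial b (\<lambda>x. f x * g x) = (\<lambda>x. f x * partial b g x + partial b f x * g x)" for b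
  by (auto simp: fun_eq_iff partial_mult)
 with Suc.IH Suc.prems C_k_on_SucD[OF Suc.prems(1)] C_k_on_SucD[OF Suc.prems(2)] show ?case
  by (auto intro!: C_k_on_add)
qed (auto intro: continuous_intros)

lemma C_k_on_compose_real:
 assumes "\<And>n t. t \<in> T \<Longrightarrow> (G n has_real_derivative G (Suc n) t) (at t)"
  and "\<And>x. f x \<in> T"
 shows "C_k_on k UNIV f \<Longrightarrow> C_k_on k UNIV (\<lambda>x. G n (f x))"
proof (induction k arbitrary: n)
 case 0
 have "isCont (G n) (f x)" for x
  using assms DERIV_isCont by blast
 with 0 show ?case
  by (auto simp: continuous_on_eq_continuous_at intro: isCont_o2)
next
 case (Suc k)
 then have d: "f differentiable (at x)" for x by auto
 have "partial b (\<lambda>x. G n (f x)) = (\<lambda>x. G (Suc n) (f x) * partial b f x)" for b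
  using partial_compose_real[OF d assms(1)[OF assms(2)]] by blast
 with Suc C_k_on_SucD[OF Suc.prems] partial_compose_real(1)[OF d assms(1)[OF assms(2)]]
 show ?case by (auto intro!: C_k_on_mult simp del: C_k_on.simps(1))
qed

lemma smooth_differentiable: "smooth f \<Longrightarrow> f differentiable (at x)"
 unfolding smooth_def by (metis C_k_on.simps(2) UNIV_I)

lemma smooth_has_derivative: "smooth f \<Longrightarrow> (f has_derivative frechet_derivative f (at x)) (at x)"
 by (simp add: frechet_derivative_works[THEN iffD1] smooth_differentiable)

lemma smooth_partial: "smooth f \<Longrightarrow> b \<in> Basis \<Longrightarrow> smooth (partial b f)"
 unfolding smooth_def by (metis C_k_on.simps(2))

lemma smooth_continuous: "smooth f \<Longrightarrow> continuous_on S f"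
 unfolding smooth_def by (metis C_k_on.simps(1) continuous_on_subset subset_UNIV)

lemma smoothI:
 assumes "\<And>x. f differentiable (at x)" "\<And>b. b \<in> Basis \<Longrightarrow> smooth (partial b f)"
 shows "smooth f"
 unfolding smooth_def
proof
 fix k show "C_k_on k UNIV f"
  using assms by (cases k) (auto simp: smooth_def differentiable_imp_continuous_within
    intro!: continuous_at_imp_continuous_on)
qed

lemma smooth_const [simp]: "smooth (\<lambda>x. c)"
 by (simp add: smooth_def C_k_on_const)

lemma smooth_add: "smooth f \<Longrightarrow> smooth g \<Longrightarrow> smooth (\<lambda>x. f x + g x)"
 by (simp add: smooth_def C_k_on_add)

lemma smooth_mult: "smooth f \<Longrightarrow> smooth g \<Longrightarrow> smooth (\<lambda>x. f x * g x)"
 by (simp add: smooth_def C_k_on_mult)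

lemma smooth_cmult: "smooth f \<Longrightarrow> smooth (\<lambda>x. c * f x)"
 by (simp add: smooth_mult)

lemma smooth_diff: "smooth f \<Longrightarrow> smooth g \<Longrightarrow> smooth (\<lambda>x. f x - g x)"
 using smooth_add[of f "\<lambda>x. (-1) * g x"] smooth_cmult[of g "-1"] by simp

lemma smooth_sum: "(\<And>i. i \<in> I \<Longrightarrow> smooth (f i)) \<Longrightarrow> smooth (\<lambda>x. \<Sum>i\<in>I. f i x)"
 by (induction I rule: infinite_finite_induct) (auto intro: smooth_add)

lemma smooth_prod: "(\<And>i. i \<in> I \<Longrightarrow> smooth (f i)) \<Longrightarrow> smooth (\<lambda>x. \<Prod>i\<in>I. f i x)"
 by (induction I rule: infinite_finite_induct) (auto intro: smooth_mult)

lemma smooth_lap: "smooth f \<Longrightarrow> smooth (lap f)"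
 unfolding lap_def[abs_def] by (auto intro!: smooth_sum smooth_partial)

lemma smooth_grad_sq: "smooth f \<Longrightarrow> smooth (grad_sq f)"
 unfolding grad_sq_def[abs_def] power2_eq_square by (auto intro!: smooth_sum smooth_mult smooth_partial)

lemma smooth_linear:
 assumes "bounded_linear f" shows "smooth f"
proof (rule smoothI)
 have d: "(f has_derivative f) (at x)" for x
  using assms by (simp add: bounded_linear_imp_has_derivative)
 then show "f differentiable (at x)" for x by (auto simp: differentiable_def)
 show "smooth (partial b f)" for b
  using d by (simp add: partial_eqI[OF d])
qed

lemma smooth_inner: "smooth (\<lambda>x. x \<bullet> b)"
 by (rule smooth_linear) (rule bounded_linear_inner_left)

lemma partial_shift: "smooth f \<Longrightarrow> partial b (\<lambda>x. f (x - y)) x = partial b f (x - y)"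
proof (rule partial_eqI)
 assume "smooth f"
 have "((\<lambda>x. x - y) has_derivative (\<lambda>h. h)) (at x)" by (auto intro!: derivative_eq_intros)
 from has_derivative_compose[OF this smooth_has_derivative[OF \<open>smooth f\<close>]]
 show "((\<lambda>x. f (x - y)) has_derivative frechet_derivative f (at (x - y))) (at x)" .
qed

lemma smooth_shift:
 assumes "smooth f" shows "smooth (\<lambda>x. f (x - y))"
 unfolding smooth_def
proof
 fix k show "C_k_on k UNIV (\<lambda>x. f (x - y))"
  using assms
 proof (induction k arbitrary: f)
  case 0
  then show ?case
   using continuous_on_compose2[OF smooth_continuous[of f UNIV], of UNIV "\<lambda>x. x - y"]
   by (simp add: continuous_intros)
 next
  case (Suc k)
  have "((\<lambda>x. f (x - y)) has_derivative frechet_derivative f (at (x - y))) (at x)" for x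
  proof -
   have "((\<lambda>x. x - y) has_derivative (\<lambda>h. h)) (at x)" by (auto intro!: derivative_eq_intros)
   from has_derivative_compose[OF this smooth_has_derivative[OF \<open>smooth f\<close>]] show ?thesis .
  qed
  moreover have "partial b (\<lambda>x. f (x - y)) = (\<lambda>x. partial b f (x - y))" for b
   by (rule ext) (rule partial_shift[OF \<open>smooth f\<close>])
  ultimately show ?case
   using Suc.IH[OF smooth_partial[OF \<open>smooth f\<close>]] by (auto simp: differentiable_def)
 qed
qed

lemma lap_shift: "smooth f \<Longrightarrow> lap (\<lambda>x. f (x - y)) x = lap f (x - y)"
proof -
 assume f: "smooth f"
 have "partial b (partial b (\<lambda>x. f (x - y))) x = partial b (partial b f) (x - y)" if b: "b \<in> Basis" for b
 proof -
  have "partial b (\<lambda>x. f (x - y)) = (\<lambda>x. partial b f (x - y))"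
   by (rule ext) (rule partial_shift[OF f])
  then have "partial b (partial b (\<lambda>x. f (x - y))) x = partial b (\<lambda>x. partial b f (x - y)) x"
   by (rule arg_cong[where f = "\<lambda>g. partial b g x"])
  also have "\<dots> = partial b (partial b f) (x - y)"
   by (rule partial_shift[OF smooth_partial[OF f b]])
  finally show ?thesis .
 qed
 then show ?thesis unfolding lap_def by (rule sum.cong[OF refl])
qed

text \<open>The chain rule is iterated: each derivative of \<open>G n (f x)\<close> is again of that form times smooth factors.\<close>

lemma smooth_compose_gen:
 assumes "\<And>n t. t \<in> T \<Longrightarrow> (G n has_real_derivative G (Suc n) t) (at t)"
  and "\<And>x. f x \<in> T" "smooth f"
 shows "smooth (\<lambda>x. G n (f x))"
 unfolding smooth_def
proof
 fix k show "C_k_on k UNIV (\<lambda>x. G n (f x))"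
 proof (rule C_k_on_compose_real[where T = T and G = G and f = f and n = n and k = k])
  show "C_k_on k UNIV f" using assms(3) by (simp add: smooth_def)
 qed (fact assms(1,2))+
qed

lemma smooth_real_derivative:
 fixes g :: "real \<Rightarrow> real"
 assumes "smooth g"
 shows "(g has_real_derivative deriv g t) (at t)" "smooth (deriv g)"
proof -
 have *: "(g has_real_derivative partial 1 g t) (at t)" for t
 proof -
  have lin: "linear (frechet_derivative g (at t))"
   by (rule has_derivative_linear[OF smooth_has_derivative[OF assms]])
  define c where "c = partial 1 g t"
  have "frechet_derivative g (at t) = (*) c"
  proof
   show "frechet_derivative g (at t) h = c * h" for h
    using linear_cmul[OF lin, of h 1] by (simp add: mult.commute c_def)
  qed
  then have "(g has_derivative (*) c) (at t)"
   using smooth_has_derivative[OF assms, of t] by simp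
  then show ?thesis unfolding c_def[symmetric] by (simp add: has_field_derivative_def)
 qed
 then have eq: "deriv g = partial 1 g"
  by (intro ext DERIV_imp_deriv)
 show "(g has_real_derivative deriv g t) (at t)" unfolding eq by (rule *)
 show "smooth (deriv g)" unfolding eq by (rule smooth_partial[OF assms]) simp
qed

lemma smooth_compose:
 assumes "smooth (g :: real \<Rightarrow> real)" "smooth f"
 shows "smooth (\<lambda>x. g (f x))"
proof -
 have s: "smooth ((deriv ^^ n) g)" for n
  by (induction n) (auto simp: assms smooth_real_derivative(2))
 have "smooth (\<lambda>x. (deriv ^^ 0) g (f x))"
  by (rule smooth_compose_gen[where T = UNIV and G = "\<lambda>n. (deriv ^^ n) g" and n = 0])
    (use smooth_real_derivative(1)[OF s] assms(2) in auto)
 then show ?thesis by simp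
qed

lemma smooth_real_coeff:
 fixes G :: "nat \<Rightarrow> real \<Rightarrow> real"
 assumes "\<And>n t. (G n has_real_derivative G (Suc n) t) (at t)"
 shows "smooth (G n)"
 by (rule smooth_compose_gen[of UNIV G "\<lambda>t. t" n])
   (use assms smooth_linear[OF bounded_linear_ident] in auto)

lemma smooth_sin: "smooth (sin :: real \<Rightarrow> real)"
proof -
 have "smooth (\<lambda>t. sin (t + real 0 * (pi/2)))"
 proof (rule smooth_real_coeff[of "\<lambda>n t. sin (t + real n * (pi/2))" 0])
  fix n and t :: real
  have "((\<lambda>t. sin (t + real n * (pi/2))) has_real_derivative cos (t + real n * (pi/2))) (at t)"
   by (auto intro!: derivative_eq_intros)
  also have "cos (t + real n * (pi/2)) = sin (t + real (Suc n) * (pi/2))"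
   using sin_add[of "t + real n * (pi/2)" "pi/2"] by (simp add: algebra_simps add_divide_distrib)
  finally show "((\<lambda>t. sin (t + real n * (pi/2))) has_real_derivative
    sin (t + real (Suc n) * (pi/2))) (at t)" .
 qed
 then show ?thesis by simp
qed

lemma smooth_cos: "smooth (cos :: real \<Rightarrow> real)"
proof -
 have "cos = deriv (sin :: real \<Rightarrow> real)"
  by (auto simp: fun_eq_iff intro!: DERIV_imp_deriv[symmetric] DERIV_sin)
 then show ?thesis using smooth_real_derivative(2)[OF smooth_sin] by simp
qed

lemma smooth_powr:
 assumes "smooth f" "\<And>x. f x > 0" shows "smooth (\<lambda>x. f x powr a)"
proof -
 define c where "c n = (\<Prod>i<n. a - real i)" for n
 define G where "G n t = c n * t powr (a - real n)" for n t
 have "smooth (\<lambda>x. G 0 (f x))"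
 proof (rule smooth_compose_gen[where T = "{0<..}" and G = G and n = 0])
  fix n and t :: real assume t: "t \<in> {0<..}"
  have "((\<lambda>t. t powr (a - real n)) has_real_derivative (a - real n) * t powr (a - real n - 1)) (at t)"
   using t by (intro has_real_derivative_powr) auto
  from DERIV_cmult[OF this, of "c n"]
  show "(G n has_real_derivative G (Suc n) t) (at t)"
   unfolding G_def[abs_def] by (simp add: c_def algebra_simps)
 qed (use assms in auto)
 then show ?thesis by (simp add: c_def G_def)
qed

lemma lap_mult:
 assumes "smooth f" "smooth g"
 shows "lap (\<lambda>x. f x * g x) x
  = f x * lap g x + 2 * (\<Sum>b\<in>Basis. partial b f x * partial b g x) + g x * lap f x"
proof -
 note d = smooth_differentiable[OF assms(1)] smooth_differentiable[OF assms(2)]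
 have "partial b (partial b (\<lambda>x. f x * g x)) x = f x * partial b (partial b g) x
   + 2 * (partial b f x * partial b g x) + g x * partial b (partial b f) x" if b: "b \<in> Basis" for b
 proof -
  note d' = smooth_differentiable[OF smooth_partial[OF assms(1) b]]
   smooth_differentiable[OF smooth_partial[OF assms(2) b]]
  have "partial b (\<lambda>x. f x * g x) = (\<lambda>x. f x * partial b g x + partial b f x * g x)"
   using partial_mult[OF d] by (simp add: fun_eq_iff)
  then show ?thesis
   by (simp add: partial_add partial_mult d d' differentiable_mult)
 qed
 then show ?thesis
  by (simp add: lap_def sum.distrib sum_distrib_left)
qed

lemma lap_compose:
 assumes "smooth f" "\<And>x. (h has_real_derivative h1 (f x)) (at (f x))"
  and "\<And>x. (h1 has_real_derivative h2 (f x)) (at (f x))"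
 shows "lap (\<lambda>x. h (f x)) x = h1 (f x) * lap f x + h2 (f x) * grad_sq f x"
proof -
 note d = smooth_differentiable[OF assms(1)]
 have "partial b (partial b (\<lambda>x. h (f x))) x = h1 (f x) * partial b (partial b f) x
   + h2 (f x) * (partial b f x)\<^sup>2" if b: "b \<in> Basis" for b
 proof -
  note d' = smooth_differentiable[OF smooth_partial[OF assms(1) b]]
  have "partial b (\<lambda>x. h (f x)) = (\<lambda>x. h1 (f x) * partial b f x)"
   using partial_compose_real(2)[OF d assms(2)] by (simp add: fun_eq_iff)
  then show ?thesis
   using partial_compose_real[OF d assms(3), of x] d'
   by (simp add: partial_mult power2_eq_square)
 qed
 then show ?thesis
  by (simp add: lap_def grad_sq_def sum.distrib sum_distrib_left)
qed

lemma partial_norm_sq: "partial b (\<lambda>x. x \<bullet> x) x = 2 * (x \<bullet> b)"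
 by (rule partial_eqI[where f' = "\<lambda>h. x \<bullet> h + h \<bullet> x", THEN trans])
   (auto intro!: derivative_eq_intros simp: inner_commute)

lemma smooth_norm_sq: "smooth (\<lambda>x::'a::euclidean_space. x \<bullet> x)"
proof (rule smoothI)
 show "(\<lambda>x::'a. x \<bullet> x) differentiable (at x)" for x
  unfolding differentiable_def by (rule exI) (auto intro!: derivative_eq_intros)
 show "smooth (partial b (\<lambda>x::'a. x \<bullet> x))" if "b \<in> Basis" for b
  by (simp add: partial_norm_sq smooth_cmult smooth_inner)
qed

lemma lap_norm_sq: "lap (\<lambda>x. x \<bullet> x) (x::'a::euclidean_space) = 2 * real DIM('a)"
proof -
 have p: "partial b (\<lambda>x::'a. 2 * (x \<bullet> b)) x = 2" if "b \<in> Basis" for b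
  by (rule partial_eqI[where f' = "\<lambda>h. 2 * (h \<bullet> b)", THEN trans])
    (use that in \<open>auto intro!: derivative_eq_intros\<close>)
 have "lap (\<lambda>x::'a. x \<bullet> x) x = (\<Sum>b\<in>(Basis::'a set). 2)"
  unfolding lap_def partial_norm_sq by (rule sum.cong) (auto simp: p)
 then show ?thesis by simp
qed

lemma grad_sq_norm_sq: "grad_sq (\<lambda>x. x \<bullet> x) x = 4 * (x \<bullet> x)"
 by (simp add: grad_sq_def partial_norm_sq power_mult_distrib euclidean_inner[of x x]
   power2_eq_square sum_distrib_left mult.assoc)

subsection \<open>A flat function and cutoffs\<close>

text \<open>The derivatives of \<open>exp (-1/t)\<close> stay in the span of the family \<open>t\<^sup>-\<^sup>m exp (-1/t)\<close>; working with the
 whole family avoids explicit polynomials in \<open>1/t\<close>.\<close>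

definition flat :: "nat \<Rightarrow> real \<Rightarrow> real" where
 "flat m t = (if t \<le> 0 then 0 else (1/t) ^ m * exp (- (1/t)))"

lemma flat_tendsto_0: "(flat m \<longlongrightarrow> 0) (at_right 0)"
proof -
 have "((\<lambda>s::real. s ^ m / exp s) \<longlongrightarrow> 0) at_top" by (rule tendsto_power_div_exp_0)
 then have "((\<lambda>t::real. inverse t ^ m / exp (inverse t)) \<longlongrightarrow> 0) (at_right 0)"
  by (rule filterlim_compose[OF _ filterlim_inverse_at_top_right])
 moreover have "\<forall>\<^sub>F t in at_right (0::real). inverse t ^ m / exp (inverse t) = flat m t"
  by (auto simp: eventually_at_right_field flat_def exp_minus inverse_eq_divide intro!: exI[of _ 1])
 ultimately show ?thesis using Lim_transform_eventually by blast
qed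

lemma flat_has_derivative:
 "(flat m has_real_derivative (flat (m + 2) t - real m * flat (Suc m) t)) (at t)"
proof -
 consider "t < 0" | "t > 0" | "t = 0" by linarith
 then show ?thesis
 proof cases
  case 1
  have "((\<lambda>_. 0) has_real_derivative 0) (at t)" by simp
  then have "(flat m has_real_derivative 0) (at t)"
   by (rule has_field_derivative_transform_within_open[of _ _ _ "{..<0}"])
     (use 1 in \<open>auto simp: flat_def\<close>)
  with 1 show ?thesis by (simp add: flat_def)
 next
  case 2
  have d1: "((\<lambda>t. 1/t) has_real_derivative - ((1/t)^2)) (at t)"
   using 2 by (auto intro!: derivative_eq_intros simp: power2_eq_square)
  have d3: "((\<lambda>t. exp (- (1/t))) has_real_derivative exp (- (1/t)) * (1/t)^2) (at t)"
   using DERIV_fun_exp[OF DERIV_minus[OF d1]] by simp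
  have "((\<lambda>t. (1/t) ^ m * exp (- (1/t))) has_real_derivative
    real m * (- ((1/t)^2) * (1/t)^(m - Suc 0)) * exp (- (1/t)) + (exp (- (1/t)) * (1/t)^2) * (1/t)^m) (at t)"
   by (rule DERIV_mult[OF DERIV_power[OF d1] d3])
  also have "real m * (- ((1/t)^2) * (1/t)^(m - Suc 0)) * exp (- (1/t)) + (exp (- (1/t)) * (1/t)^2) * (1/t)^m
    = flat (m + 2) t - real m * flat (Suc m) t"
  proof -
   have "real m * (- (i^2) * i^(m - Suc 0)) * e + (e * i^2) * i^m = i^(m+2) * e - real m * (i^Suc m * e)"
    for i e :: real
    by (cases m) (auto simp: power2_eq_square algebra_simps)
   then show ?thesis using 2 by (simp add: flat_def)
  qed
  finally have "((\<lambda>t. (1/t) ^ m * exp (- (1/t))) has_real_derivative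
    (flat (m + 2) t - real m * flat (Suc m) t)) (at t)" .
  then show ?thesis
   by (rule has_field_derivative_transform_within_open[of _ _ _ "{0<..}"])
     (use 2 in \<open>auto simp: flat_def\<close>)
 next
  case 3
  have "((\<lambda>t. (flat m t - flat m 0) / (t - 0)) \<longlongrightarrow> 0) (at 0)"
   unfolding filterlim_at_split
  proof
   have "((\<lambda>_. 0) \<longlongrightarrow> 0) (at_left (0::real))" by simp
   then show "((\<lambda>t. (flat m t - flat m 0) / (t - 0)) \<longlongrightarrow> 0) (at_left 0)"
    by (rule Lim_transform_eventually) (auto simp: eventually_at_left_field flat_def intro!: exI[of _ "-1"])
   show "((\<lambda>t. (flat m t - flat m 0) / (t - 0)) \<longlongrightarrow> 0) (at_right 0)"
    using flat_tendsto_0[of "Suc m"]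
    by (rule Lim_transform_eventually)
      (auto simp: eventually_at_right_field flat_def intro!: exI[of _ "1"])
  qed
  then have "(flat m has_real_derivative 0) (at 0)"
   by (simp add: has_field_derivative_iff)
  with 3 show ?thesis by (simp add: flat_def)
 qed
qed

lemma smooth_flat: "smooth (flat m)"
 unfolding smooth_def
proof
 fix k show "C_k_on k UNIV (flat m)"
 proof (induction k arbitrary: m)
  case 0
  have "isCont (flat m) x" for x
   by (rule DERIV_isCont) (rule flat_has_derivative)
  then show ?case by (simp add: continuous_on_eq_continuous_at)
 next
  case (Suc k)
  have "partial b (flat m) = (\<lambda>t. b * flat (m+2) t + (- real m * b) * flat (Suc m) t)" for b
   using partial_eqI[OF flat_has_derivative[of m, unfolded has_field_derivative_def], where b = b]
   by (simp add: fun_eq_iff algebra_simps)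
  moreover have "flat m differentiable (at t)" for t
   using flat_has_derivative[of m t] by (auto simp: has_field_derivative_def differentiable_def)
  moreover have "C_k_on k UNIV (\<lambda>t. b * flat (m+2) t + (- real m * b) * flat (Suc m) t)" for b
   by (intro C_k_on_add C_k_on_mult C_k_on_const Suc)
  ultimately show ?case by (simp only: C_k_on.simps) blast
 qed
qed

lemma flat_nonneg: "flat m t \<ge> 0"
 by (simp add: flat_def)

lemma flat_pos_iff: "flat m t > 0 \<longleftrightarrow> t > 0"
 by (auto simp: flat_def zero_less_mult_iff)

text \<open>The quotient \<open>p / (p + q)\<close> of flat functions of the squared distance; the two never vanish together.\<close>

lemma ball_cutoff:
 fixes a :: "'a::euclidean_space"
 assumes "0 < r" "r < R"
 obtains \<eta> where "smooth \<eta>" "\<And>x. 0 \<le> \<eta> x" "\<And>x. \<eta> x \<le> 1"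
  "\<forall>x. dist a x \<le> r \<longrightarrow> \<eta> x = 1" "\<forall>x. dist a x \<ge> R \<longrightarrow> \<eta> x = 0"
proof
 define n where "n x = (x - a) \<bullet> (x - a)" for x
 define p where "p x = flat 0 (R^2 - n x)" for x
 define q where "q x = flat 0 (n x - r^2)" for x
 have n: "n x = (dist a x)^2" for x
  by (simp add: n_def dist_norm norm_minus_commute[of a] power2_norm_eq_inner)
 have "r^2 < R^2" using assms by (simp add: power_strict_mono)
 then have pq: "p x + q x > 0" for x
  using flat_pos_iff[of 0 "R^2 - n x"] flat_pos_iff[of 0 "n x - r^2"] flat_nonneg[of 0]
  unfolding p_def q_def by (cases "n x < R^2") (auto simp: add_pos_nonneg add_nonneg_pos)
 have sn: "smooth n" unfolding n_def[abs_def] by (rule smooth_shift[OF smooth_norm_sq])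
 have sp: "smooth p" and sq: "smooth q" unfolding p_def[abs_def] q_def[abs_def]
  by (auto intro!: smooth_compose[OF smooth_flat] smooth_diff sn)
 define \<eta> where "\<eta> x = p x * (p x + q x) powr (-1)" for x
 show "smooth \<eta>" unfolding \<eta>_def[abs_def]
  by (intro smooth_mult sp smooth_powr smooth_add sq pq)
 have e: "\<eta> x = p x / (p x + q x)" for x
  using pq[of x] by (simp add: \<eta>_def powr_minus divide_inverse)
 have nn: "p x \<ge> 0" "q x \<ge> 0" for x by (auto simp: p_def q_def flat_nonneg)
 show "0 \<le> \<eta> x" "\<eta> x \<le> 1" for x using nn[of x] pq[of x] by (auto simp: e divide_simps)
 have "\<eta> x = 1" if "dist a x \<le> r" for x
 proof -
  have "n x \<le> r^2" using that by (simp add: n power_mono)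
  then have "q x = 0" by (simp add: q_def flat_def)
  with pq[of x] show ?thesis by (simp add: e)
 qed
 then show "\<forall>x. dist a x \<le> r \<longrightarrow> \<eta> x = 1" by blast
 have "\<eta> x = 0" if "dist a x \<ge> R" for x
 proof -
  have "n x \<ge> R^2" using that assms by (simp add: n power_mono)
  then show ?thesis by (simp add: e p_def flat_def)
 qed
 then show "\<forall>x. dist a x \<ge> R \<longrightarrow> \<eta> x = 0" by blast
qed

lemma test_functions_iff:
 "u \<in> test_functions \<Omega> \<longleftrightarrow> smooth u \<and> compact (closure {x. u x \<noteq> 0}) \<and> closure {x. u x \<noteq> 0} \<subseteq> \<Omega>"
 unfolding test_functions_def smooth_def by (rule mem_Collect_eq)

lemma test_functionsI:
 assumes "smooth u" "compact K" "K \<subseteq> \<Omega>" "\<And>x. x \<notin> K \<Longrightarrow> u x = 0"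
 shows "u \<in> test_functions \<Omega>"
proof -
 have "{x. u x \<noteq> 0} \<subseteq> K" using assms(4) by blast
 then have sub: "closure {x. u x \<noteq> 0} \<subseteq> K"
  by (rule closure_minimal) (rule compact_imp_closed[OF assms(2)])
 have "compact (K \<inter> closure {x. u x \<noteq> 0})"
  by (rule compact_Int_closed[OF assms(2) closed_closure])
 then have "compact (closure {x. u x \<noteq> 0})" using sub by (simp only: Int_absorb1)
 moreover have "closure {x. u x \<noteq> 0} \<subseteq> \<Omega>" using sub assms(3) by (rule subset_trans)
 ultimately show ?thesis unfolding test_functions_iff using assms(1) by (intro conjI)
qed

lemma test_support:
 assumes "u \<in> test_functions \<Omega>"
 shows "\<exists>K. compact K \<and> K \<subseteq> \<Omega> \<and> (\<forall>x. x \<notin> K \<longrightarrow> u x = 0)"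
proof (intro exI conjI allI impI)
 show "compact (closure {x. u x \<noteq> 0})" "closure {x. u x \<noteq> 0} \<subseteq> \<Omega>"
  using assms unfolding test_functions_iff by blast+
 fix x assume *: "x \<notin> closure {x. u x \<noteq> 0}"
 show "u x = 0"
 proof (rule ccontr)
  assume "u x \<noteq> 0"
  then have "x \<in> {x. u x \<noteq> 0}" by (rule CollectI)
  from subsetD[OF closure_subset this] * show False by contradiction
 qed
qed

lemma test_smooth: "u \<in> test_functions \<Omega> \<Longrightarrow> smooth u"
 unfolding test_functions_iff by (rule conjunct1)

text \<open>Finitely many balls cover the compact set, and one minus the product of the complementary
 cutoffs is one on their union.\<close>

lemma compact_cutoff:
 fixes K :: "'a::euclidean_space set"
 assumes "compact K" "open S" "K \<subseteq> S"
 obtains \<eta> where "\<eta> \<in> test_functions S" "\<And>x. 0 \<le> \<eta> x" "\<And>x. \<eta> x \<le> 1" "\<forall>x\<in>K. \<eta> x = 1"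
proof -
 have "\<exists>r>0. cball a (2*r) \<subseteq> S" if aK: "a \<in> K" for a
 proof -
  obtain e where "e > 0" "cball a e \<subseteq> S"
   using open_contains_cball[THEN iffD1, OF assms(2)] subsetD[OF assms(3) aK] by blast
  then show ?thesis by (intro exI[of _ "e/2"]) auto
 qed
 then have "\<forall>a\<in>K. \<exists>r>0. cball a (2 * r) \<subseteq> S" by blast
 from bchoice[OF this] obtain r where r: "\<And>a. a \<in> K \<Longrightarrow> r a > 0 \<and> cball a (2 * r a) \<subseteq> S"
  by blast
 have "K \<subseteq> (\<Union>a\<in>K. ball a (r a))"
 proof
  fix x assume x: "x \<in> K"
  then have "x \<in> ball x (r x)" using r by simp
  with x show "x \<in> (\<Union>a\<in>K. ball a (r a))" by blast
 qed
 then obtain F where F: "F \<subseteq> K" "finite F" "K \<subseteq> (\<Union>a\<in>F. ball a (r a))"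
  by (rule compactE_image[OF assms(1), rotated]) simp_all
 have "\<forall>a\<in>K. \<exists>\<eta>. smooth \<eta> \<and> (\<forall>x. 0 \<le> \<eta> x \<and> \<eta> x \<le> 1) \<and>
   (\<forall>x. dist a x \<le> r a \<longrightarrow> \<eta> x = 1) \<and> (\<forall>x. dist a x \<ge> 2 * r a \<longrightarrow> \<eta> x = 0)"
 proof
  fix a assume "a \<in> K"
  then have "0 < r a" "r a < 2 * r a" using r by auto
  from ball_cutoff[OF this, of a]
  obtain \<eta> where e: "smooth \<eta>" "\<And>x. 0 \<le> \<eta> x" "\<And>x. \<eta> x \<le> 1"
   "\<forall>x. dist a x \<le> r a \<longrightarrow> \<eta> x = 1" "\<forall>x. dist a x \<ge> 2 * r a \<longrightarrow> \<eta> x = 0" by metis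
  show "\<exists>\<eta>. smooth \<eta> \<and> (\<forall>x. 0 \<le> \<eta> x \<and> \<eta> x \<le> 1) \<and>
   (\<forall>x. dist a x \<le> r a \<longrightarrow> \<eta> x = 1) \<and> (\<forall>x. dist a x \<ge> 2 * r a \<longrightarrow> \<eta> x = 0)"
   by (rule exI[of _ \<eta>]) (simp add: e)
 qed
 from bchoice[OF this] obtain c where c': "\<forall>a\<in>K. smooth (c a) \<and> (\<forall>x. 0 \<le> c a x \<and> c a x \<le> 1) \<and>
   (\<forall>x. dist a x \<le> r a \<longrightarrow> c a x = 1) \<and> (\<forall>x. dist a x \<ge> 2 * r a \<longrightarrow> c a x = 0)" ..
 then have c: "\<And>a. a \<in> K \<Longrightarrow> smooth (c a)" "\<And>a x. a \<in> K \<Longrightarrow> 0 \<le> c a x \<and> c a x \<le> 1"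
  "\<And>a x. a \<in> K \<Longrightarrow> dist a x \<le> r a \<Longrightarrow> c a x = 1"
  "\<And>a x. a \<in> K \<Longrightarrow> dist a x \<ge> 2 * r a \<Longrightarrow> c a x = 0" by blast+
 define \<eta> where "\<eta> x = 1 - (\<Prod>a\<in>F. 1 - c a x)" for x
 have sub: "\<And>a. a \<in> F \<Longrightarrow> a \<in> K" using F by auto
 show ?thesis
 proof
  show "\<eta> \<in> test_functions S"
  proof (rule test_functionsI)
   show "smooth \<eta>" unfolding \<eta>_def[abs_def]
    by (intro smooth_diff smooth_prod smooth_const c(1) sub)
   show "compact (\<Union>a\<in>F. cball a (2 * r a))" using F by auto
   show "(\<Union>a\<in>F. cball a (2 * r a)) \<subseteq> S"
    using r[OF sub] by (intro UN_least) simp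
   show "\<eta> x = 0" if "x \<notin> (\<Union>a\<in>F. cball a (2 * r a))" for x
   proof -
    have "c a x = 0" if "a \<in> F" for a
    proof (rule c(4)[OF sub[OF that]])
     have "x \<notin> cball a (2 * r a)" using \<open>x \<notin> (\<Union>a\<in>F. cball a (2 * r a))\<close> that by blast
     then show "2 * r a \<le> dist a x" by simp
    qed
    then show ?thesis by (simp add: \<eta>_def)
   qed
  qed
  have b: "0 \<le> c a x" "c a x \<le> 1" if "a \<in> F" for a x
   using c(2)[OF sub[OF that], of x] by auto
  have "(\<Prod>a\<in>F. 1 - c a x) \<le> 1" for x by (rule prod_le_1) (simp add: b)
  then show "0 \<le> \<eta> x" for x by (simp add: \<eta>_def)
  have "0 \<le> (\<Prod>a\<in>F. 1 - c a x)" for x by (rule prod_nonneg) (simp add: b)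
  then show "\<eta> x \<le> 1" for x by (simp add: \<eta>_def)
  show "\<forall>x\<in>K. \<eta> x = 1"
  proof
   fix x assume "x \<in> K"
   then obtain a where a: "a \<in> F" "x \<in> ball a (r a)" using F by auto
   then have "c a x = 1" using c(3)[OF sub[OF a(1)], of x] by simp
   with a(1) have "\<exists>a\<in>F. 1 - c a x = 0" by force
   then have "(\<Prod>a\<in>F. 1 - c a x) = 0" by (rule prod_zero[OF F(2)])
   then show "\<eta> x = 1" by (simp add: \<eta>_def)
  qed
 qed
qed

lemma test_mult: "u \<in> test_functions \<Omega> \<Longrightarrow> smooth f \<Longrightarrow> (\<lambda>x. f x * u x) \<in> test_functions \<Omega>"
proof -
 assume u: "u \<in> test_functions \<Omega>" and f: "smooth f"
 obtain K where K: "compact K" "K \<subseteq> \<Omega>" "\<forall>x. x \<notin> K \<longrightarrow> u x = 0"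
  using test_support[OF u] by blast
 show ?thesis
  by (rule test_functionsI[of _ K]) (use K f test_smooth[OF u] in \<open>auto intro: smooth_mult\<close>)
qed

lemma test_cmult: "u \<in> test_functions \<Omega> \<Longrightarrow> (\<lambda>x. c * u x) \<in> test_functions \<Omega>"
 by (rule test_mult) auto

lemma test_add:
 assumes "u \<in> test_functions \<Omega>" "v \<in> test_functions \<Omega>"
 shows "(\<lambda>x. u x + v x) \<in> test_functions \<Omega>"
proof -
 obtain K where K: "compact K" "K \<subseteq> \<Omega>" "\<forall>x. x \<notin> K \<longrightarrow> u x = 0"
  using test_support[OF assms(1)] by blast
 obtain L where L: "compact L" "L \<subseteq> \<Omega>" "\<forall>x. x \<notin> L \<longrightarrow> v x = 0"
  using test_support[OF assms(2)] by blast
 show ?thesis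
  by (rule test_functionsI[of _ "K \<union> L"])
    (use K L test_smooth[OF assms(1)] test_smooth[OF assms(2)] in \<open>auto intro: smooth_add\<close>)
qed

lemma test_diff:
 assumes "u \<in> test_functions \<Omega>" "v \<in> test_functions \<Omega>"
 shows "(\<lambda>x. u x - v x) \<in> test_functions \<Omega>"
 using test_add[OF assms(1) test_cmult[OF assms(2), of "-1"]] by simp

lemma partial_zero_outside:
 assumes "closed K" "\<And>x. x \<notin> K \<Longrightarrow> u x = (c::real)" "x \<notin> K"
 shows "partial b u x = 0"
proof -
 have "((\<lambda>_. c) has_derivative (\<lambda>_. 0)) (at x)" by simp
 then have "(u has_derivative (\<lambda>_. 0)) (at x)"
  by (rule has_derivative_transform_within_open[of _ _ _ _ "-K"]) (use assms in auto)
 then show ?thesis by (rule partial_eqI)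
qed

lemma test_partial:
 assumes "u \<in> test_functions \<Omega>" "b \<in> Basis" shows "partial b u \<in> test_functions \<Omega>"
proof -
 obtain K where K: "compact K" "K \<subseteq> \<Omega>" "\<forall>x. x \<notin> K \<longrightarrow> u x = 0"
  using test_support[OF assms(1)] by blast
 show ?thesis
  by (rule test_functionsI[of _ K])
    (use K assms test_smooth[OF assms(1)] in
     \<open>auto intro!: smooth_partial partial_zero_outside[of K] compact_imp_closed\<close>)
qed

lemma test_sum:
 "(\<And>i. i \<in> I \<Longrightarrow> f i \<in> test_functions \<Omega>) \<Longrightarrow> (\<lambda>x. \<Sum>i\<in>I. f i x) \<in> test_functions \<Omega>"
proof (induction I rule: infinite_finite_induct)
 case (insert i I)
 then show ?case by (auto intro: test_add)
qed (auto intro!: test_functionsI[of _ "{}"])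

lemma test_lap: "u \<in> test_functions \<Omega> \<Longrightarrow> lap u \<in> test_functions \<Omega>"
 unfolding lap_def[abs_def] by (intro test_sum test_partial)

lemma test_grad_sq: "u \<in> test_functions \<Omega> \<Longrightarrow> grad_sq u \<in> test_functions \<Omega>"
 unfolding grad_sq_def[abs_def] power2_eq_square
 by (intro test_sum test_mult test_partial smooth_partial) (auto intro: test_smooth)

lemma test_mono: "u \<in> test_functions A \<Longrightarrow> A \<subseteq> B \<Longrightarrow> u \<in> test_functions B"
 unfolding test_functions_iff by blast

lemma test_continuous: "u \<in> test_functions \<Omega> \<Longrightarrow> continuous_on S u"
 by (rule smooth_continuous) (rule test_smooth)

section \<open>Integrals against test functions\<close>

definition locint :: "'a::euclidean_space set \<Rightarrow> ('a \<Rightarrow> real) \<Rightarrow> bool" where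
 "locint \<Omega> g \<longleftrightarrow> (\<forall>K. compact K \<and> K \<subseteq> \<Omega> \<longrightarrow> integrable lebesgue (\<lambda>x. indicator K x * g x))"

lemma continuous_measurable_lebesgue:
 "continuous_on UNIV (f :: 'a::euclidean_space \<Rightarrow> real) \<Longrightarrow> f \<in> borel_measurable lebesgue"
 by (auto intro!: measurable_completion borel_measurable_continuous_onI)

lemma compact_support_bound:
 fixes f :: "'a::euclidean_space \<Rightarrow> real"
 assumes "continuous_on UNIV f" "compact K" "\<forall>x. x \<notin> K \<longrightarrow> f x = 0"
 shows "\<exists>c>0. \<forall>x. \<bar>f x\<bar> \<le> c"
proof -
 have "compact (f ` K)"
  using assms by (meson compact_continuous_image continuous_on_subset subset_UNIV)
 then obtain c where c: "c > 0" "\<And>x. x \<in> K \<Longrightarrow> \<bar>f x\<bar> \<le> c"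
  using compact_imp_bounded[of "f ` K"] by (auto simp: bounded_pos)
 have "\<bar>f x\<bar> \<le> c" for x
  using c assms(3) by (cases "x \<in> K") auto
 with c(1) show ?thesis by blast
qed

text \<open>A continuous function with compact support is bounded, so the product is dominated by a multiple of the indicated restriction of \<open>g\<close>.\<close>

lemma integrable_mult_compact_support:
 fixes f g :: "'a::euclidean_space \<Rightarrow> real"
 assumes g: "integrable lebesgue (\<lambda>x. indicator K x * g x)"
  and f: "continuous_on UNIV f" "compact K" "\<forall>x. x \<notin> K \<longrightarrow> f x = 0"
 shows "integrable lebesgue (\<lambda>x. g x * f x)"
proof -
 obtain c where c: "c > 0" "\<And>x. \<bar>f x\<bar> \<le> c"
  using compact_support_bound[OF f] by blast
 have "integrable lebesgue (\<lambda>x. (indicator K x * g x) * f x)"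
 proof (rule Bochner_Integration.integrable_bound)
  show "integrable lebesgue (\<lambda>x. c * (indicator K x * g x))"
   by (rule integrable_mult_right) (rule g)
  show "(\<lambda>x. (indicator K x * g x) * f x) \<in> borel_measurable lebesgue"
   by (rule borel_measurable_times[OF borel_measurable_integrable[OF g]
      continuous_measurable_lebesgue[OF f(1)]])
  show "AE x in lebesgue. norm ((indicator K x * g x) * f x) \<le> norm (c * (indicator K x * g x))"
  proof (rule AE_I2)
   fix x
   have "\<bar>f x\<bar> * \<bar>indicator K x * g x\<bar> \<le> c * \<bar>indicator K x * g x\<bar>"
    by (rule mult_right_mono) (use c in auto)
   then show "norm ((indicator K x * g x) * f x) \<le> norm (c * (indicator K x * g x))"
    using c(1) by (simp add: abs_mult mult_ac)
  qed
 qed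
 moreover have "(indicator K x * g x) * f x = g x * f x" for x
  using f(3) by (cases "x \<in> K") auto
 ultimately show ?thesis by (simp cong: Bochner_Integration.integrable_cong)
qed

lemma integrable_indicator_compact: "compact K \<Longrightarrow> integrable lebesgue (indicator K :: 'a::euclidean_space \<Rightarrow> real)"
 using lmeasurable_compact[of K] by (simp add: lmeasurable_iff_integrable)

lemma integrable_continuous_compact_support:
 fixes f :: "'a::euclidean_space \<Rightarrow> real"
 assumes "continuous_on UNIV f" "compact K" "\<forall>x. x \<notin> K \<longrightarrow> f x = 0"
 shows "integrable lebesgue f"
 using integrable_mult_compact_support[of K "\<lambda>_. 1" f] assms integrable_indicator_compact[of K]
 by simp

lemma locint_mult_integrable:
 assumes "locint \<Omega> g" "continuous_on UNIV f" "compact K" "K \<subseteq> \<Omega>" "\<forall>x. x \<notin> K \<longrightarrow> f x = 0"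
 shows "integrable lebesgue (\<lambda>x. g x * f x)"
 by (rule integrable_mult_compact_support[OF _ assms(2,3,5)])
   (use assms(1,3,4) in \<open>simp add: locint_def\<close>)

lemma locint_test:
 assumes "locint \<Omega> g" "u \<in> test_functions \<Omega>"
 shows "integrable lebesgue (\<lambda>x. g x * u x)"
proof -
 obtain K where K: "compact K" "K \<subseteq> \<Omega>" "\<forall>x. x \<notin> K \<longrightarrow> u x = 0"
  using test_support[OF assms(2)] by blast
 show ?thesis by (rule locint_mult_integrable[OF assms(1) test_continuous[OF assms(2)] K])
qed

lemma integrable_test: "u \<in> test_functions \<Omega> \<Longrightarrow> integrable lebesgue u"
proof -
 assume u: "u \<in> test_functions \<Omega>"
 obtain K where K: "compact K" "\<forall>x. x \<notin> K \<longrightarrow> u x = 0"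
  using test_support[OF u] by blast
 show ?thesis by (rule integrable_continuous_compact_support[OF test_continuous[OF u] K])
qed

lemma locint_continuous: "continuous_on UNIV f \<Longrightarrow> locint \<Omega> f"
 unfolding locint_def
proof (intro allI impI)
 fix K assume f: "continuous_on UNIV f" and K: "compact K \<and> K \<subseteq> \<Omega>"
 have "integrable lebesgue (\<lambda>x. f x * (indicator K x * 1))"
 proof -
  have "compact (f ` K)"
   using f K by (meson compact_continuous_image continuous_on_subset subset_UNIV)
  then obtain c where c: "c > 0" "\<And>x. x \<in> K \<Longrightarrow> \<bar>f x\<bar> \<le> c"
   using compact_imp_bounded[of "f ` K"] by (auto simp: bounded_pos)
  show ?thesis
  proof (rule Bochner_Integration.integrable_bound)
   show "integrable lebesgue (\<lambda>x. c * indicator K x :: real)"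
    using integrable_indicator_compact K by (intro integrable_mult_right) auto
   show "(\<lambda>x. f x * (indicator K x * 1)) \<in> borel_measurable lebesgue"
    using continuous_measurable_lebesgue[OF f] borel_measurable_integrable[OF integrable_indicator_compact[of K]] K
    by (auto intro!: borel_measurable_times)
   show "AE x in lebesgue. norm (f x * (indicator K x * 1)) \<le> norm (c * indicator K x :: real)"
    by (rule AE_I2) (use c in \<open>auto simp: indicator_def\<close>)
  qed
 qed
 then show "integrable lebesgue (\<lambda>x. indicator K x * f x)" by (simp add: mult.commute)
qed

lemma locint_add: "locint \<Omega> f \<Longrightarrow> locint \<Omega> g \<Longrightarrow> locint \<Omega> (\<lambda>x. f x + g x)"
 by (simp add: locint_def distrib_left)

lemma locint_cmult: "locint \<Omega> f \<Longrightarrow> locint \<Omega> (\<lambda>x. c * f x)"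
 by (simp add: locint_def mult.left_commute)

lemma locint_diff: "locint \<Omega> f \<Longrightarrow> locint \<Omega> g \<Longrightarrow> locint \<Omega> (\<lambda>x. f x - g x)"
 by (simp add: locint_def right_diff_distrib)

lemma locint_abs:
 assumes "locint \<Omega> f" shows "locint \<Omega> (\<lambda>x. \<bar>f x\<bar>)"
 unfolding locint_def
proof (intro allI impI)
 fix K assume "compact K \<and> K \<subseteq> \<Omega>"
 then have "integrable lebesgue (\<lambda>x. \<bar>indicator K x * f x\<bar>)"
  using assms by (auto simp: locint_def)
 then show "integrable lebesgue (\<lambda>x. indicator K x * \<bar>f x\<bar>)"
  by (simp add: abs_mult)
qed

lemma locint_mono: "locint B f \<Longrightarrow> A \<subseteq> B \<Longrightarrow> locint A f"
 unfolding locint_def by (meson subset_trans)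

lemma frechet_derivative_sum:
 assumes "smooth u"
 shows "frechet_derivative u (at x) z = (\<Sum>b\<in>Basis. (z \<bullet> b) * partial b u x)"
proof -
 have lin: "linear (frechet_derivative u (at x))"
  by (rule has_derivative_linear[OF smooth_has_derivative[OF assms]])
 have "frechet_derivative u (at x) (\<Sum>b\<in>Basis. (z \<bullet> b) *\<^sub>R b) = (\<Sum>b\<in>Basis. (z \<bullet> b) * partial b u x)"
  by (simp add: linear_sum[OF lin] linear_cmul[OF lin])
 then show ?thesis by (simp add: euclidean_representation)
qed

lemma directional_derivative:
 assumes "smooth u"
 shows "((\<lambda>t. u (x + t *\<^sub>R z)) has_real_derivative frechet_derivative u (at (x + t *\<^sub>R z)) z) (at t)"
proof -
 have "((\<lambda>t. x + t *\<^sub>R z) has_derivative (\<lambda>h. h *\<^sub>R z)) (at t)"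
  by (auto intro!: derivative_eq_intros)
 from has_derivative_compose[OF this smooth_has_derivative[OF assms]]
 have "((\<lambda>t. u (x + t *\<^sub>R z)) has_derivative
   (\<lambda>h. frechet_derivative u (at (x + t *\<^sub>R z)) (h *\<^sub>R z))) (at t)" .
 moreover have "frechet_derivative u (at (x + t *\<^sub>R z)) (h *\<^sub>R z)
   = frechet_derivative u (at (x + t *\<^sub>R z)) z * h" for h
  using linear_cmul[OF has_derivative_linear[OF smooth_has_derivative[OF assms]]] by simp
 ultimately show ?thesis by (simp add: has_field_derivative_def)
qed

lemma directional_mvt:
 assumes "smooth u"
 shows "\<exists>s. 0 < s \<and> s < 1 \<and> u (x + z) - u x = frechet_derivative u (at (x + s *\<^sub>R z)) z"
 using MVT2[of 0 1 "\<lambda>t. u (x + t *\<^sub>R z)" "\<lambda>t. frechet_derivative u (at (x + t *\<^sub>R z)) z"]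
  directional_derivative[OF assms] by auto

lemma difference_quotient_tendsto:
 assumes "smooth u"
 shows "(\<lambda>n. (u (x + (1 / real (Suc n)) *\<^sub>R z) - u x) * real (Suc n))
      \<longlonglongrightarrow> frechet_derivative u (at x) z"
proof -
 have "((\<lambda>h. (u (x + h *\<^sub>R z) - u x) / h) \<longlongrightarrow> frechet_derivative u (at x) z) (at 0)"
  using directional_derivative[OF assms, of x z 0] unfolding DERIV_def by simp
 moreover have "filterlim (\<lambda>n. 1 / real (Suc n)) (at 0) sequentially"
  unfolding filterlim_at using LIMSEQ_Suc[OF lim_1_over_n[where ?'a = real]] by (auto intro!: eventuallyI)
 ultimately show ?thesis
  using filterlim_compose[of "\<lambda>h. (u (x + h *\<^sub>R z) - u x) / h" _ "at 0" "\<lambda>n. 1 / real (Suc n)"] by simp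
qed

lemma lebesgue_integral_shift:
 fixes f :: "'a::euclidean_space \<Rightarrow> real"
 assumes "continuous_on UNIV f"
 shows "(LINT x|lebesgue. f (x + z)) = (LINT x|lebesgue. f x)"
proof -
 have f: "f \<in> borel_measurable borel" by (rule borel_measurable_continuous_onI[OF assms])
 have g: "(\<lambda>x. f (x + z)) \<in> borel_measurable borel"
  using f by measurable
 have "(LINT x|lebesgue. f (x + z)) = (\<integral>x. f (z + x) \<partial>lborel)"
  using g by (subst integral_completion) (auto simp: add.commute)
 also have "\<dots> = (\<integral>x. f x \<partial>distr lborel borel ((+) z))"
  using f by (subst integral_distr) auto
 also have "\<dots> = (\<integral>x. f x \<partial>lborel)" by (simp add: lborel_distr_plus)
 also have "\<dots> = (LINT x|lebesgue. f x)" using f by (subst integral_completion) auto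
 finally show ?thesis .
qed

text \<open>The integrals of the difference quotients vanish by translation invariance.\<close>

lemma integral_partial_eq_0:
 assumes u: "u \<in> test_functions \<Omega>" and b: "b \<in> Basis"
 shows "(LINT x|lebesgue. partial b u x) = 0"
proof -
 note s = test_smooth[OF u]
 obtain K where K: "compact K" "\<forall>x. x \<notin> K \<longrightarrow> u x = 0" using test_support[OF u] by blast
 obtain c where c: "c > 0" "\<And>x. \<bar>partial b u x\<bar> \<le> c"
  using compact_support_bound[OF test_continuous[OF test_partial[OF u b]]]
   test_support[OF test_partial[OF u b]] by blast
 define L where "L = (\<lambda>p. fst p - snd p) ` (K \<times> cball (0::'a) 1)"
 have L: "compact L" unfolding L_def
  by (intro compact_continuous_image compact_Times K compact_cball continuous_intros)
 have inL: "x \<in> L" if "x + h *\<^sub>R b \<in> K" "0 \<le> h" "h \<le> 1" for x h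
 proof -
  have "h *\<^sub>R b \<in> cball 0 1" using that b by simp
  moreover have "x = (x + h *\<^sub>R b) - h *\<^sub>R b" by simp
  ultimately show ?thesis unfolding L_def using that(1) by force
 qed
 define D where "D n x = (u (x + (1 / real (Suc n)) *\<^sub>R b) - u x) * real (Suc n)" for n x
 have contu: "continuous_on UNIV u" by (rule smooth_continuous[OF s])
 have contD: "continuous_on UNIV (D n)" for n unfolding D_def
  by (intro continuous_intros continuous_on_compose2[OF contu]) auto
 have int_u: "integrable lebesgue u" by (rule integrable_test[OF u])
 have int_sh: "integrable lebesgue (\<lambda>x. u (x + z))" for z
 proof (rule integrable_continuous_compact_support)
  show "continuous_on UNIV (\<lambda>x. u (x + z))"
   by (intro continuous_intros continuous_on_compose2[OF contu]) auto
  show "compact ((\<lambda>x. x - z) ` K)" by (intro compact_continuous_image continuous_intros K)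
  show "\<forall>x. x \<notin> (\<lambda>x. x - z) ` K \<longrightarrow> u (x + z) = 0"
  proof (intro allI impI)
   fix x assume x: "x \<notin> (\<lambda>x. x - z) ` K"
   have "x + z \<notin> K"
   proof
    assume "x + z \<in> K"
    then have "(x + z) - z \<in> (\<lambda>x. x - z) ` K" by (rule imageI)
    with x show False by simp
   qed
   with K show "u (x + z) = 0" by blast
  qed
 qed
 have D0: "(LINT x|lebesgue. D n x) = 0" for n
  unfolding D_def using lebesgue_integral_shift[OF contu] int_u int_sh by simp
 have "(\<lambda>n. LINT x|lebesgue. D n x) \<longlonglongrightarrow> (LINT x|lebesgue. partial b u x)"
 proof (rule integral_dominated_convergence)
  show "partial b u \<in> borel_measurable lebesgue"
   by (rule continuous_measurable_lebesgue[OF test_continuous[OF test_partial[OF u b]]])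
  show "D n \<in> borel_measurable lebesgue" for n by (rule continuous_measurable_lebesgue[OF contD])
  show "integrable lebesgue (\<lambda>x. c * indicator (K \<union> L) x :: real)"
   using integrable_indicator_compact[OF compact_Un[OF K(1) L]] by (rule integrable_mult_right)
  show "AE x in lebesgue. (\<lambda>n. D n x) \<longlonglongrightarrow> partial b u x"
   unfolding D_def by (rule AE_I2) (rule difference_quotient_tendsto[OF s])
  show "AE x in lebesgue. norm (D n x) \<le> c * indicator (K \<union> L) x" for n
  proof (rule AE_I2)
   fix x
   define h where "h = 1 / real (Suc n)"
   have h: "0 < h" "h \<le> 1" by (auto simp: h_def)
   have Dh: "D n x = (u (x + h *\<^sub>R b) - u x) / h" by (simp add: D_def h_def)
   show "norm (D n x) \<le> c * indicator (K \<union> L) x"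
   proof (cases "x \<in> K \<union> L")
    case False
    then have "u (x + h *\<^sub>R b) = 0" "u x = 0" using inL[of x h] h K by auto
    with False show ?thesis by (simp add: Dh)
   next
    case True
    obtain t where "u (x + h *\<^sub>R b) - u x = frechet_derivative u (at (x + t *\<^sub>R (h *\<^sub>R b))) (h *\<^sub>R b)"
     using directional_mvt[OF s] by blast
    then have "u (x + h *\<^sub>R b) - u x = h * partial b u (x + t *\<^sub>R (h *\<^sub>R b))"
     using linear_cmul[OF has_derivative_linear[OF smooth_has_derivative[OF s]]] by simp
    then have "D n x = partial b u (x + t *\<^sub>R (h *\<^sub>R b))" using h by (simp add: Dh)
    with True c show ?thesis by simp
   qed
  qed
 qed
 then show ?thesis unfolding D0 using LIMSEQ_unique[OF tendsto_const] by fastforce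
qed

lemma integration_by_parts:
 assumes u: "u \<in> test_functions \<Omega>" and f: "smooth f" and b: "b \<in> Basis"
 shows "(LINT x|lebesgue. f x * partial b u x) = - (LINT x|lebesgue. partial b f x * u x)"
proof -
 have "partial b (\<lambda>x. f x * u x) = (\<lambda>x. f x * partial b u x + partial b f x * u x)"
  by (rule ext) (rule partial_mult[OF smooth_differentiable[OF f] smooth_differentiable[OF test_smooth[OF u]]])
 then have "(LINT x|lebesgue. f x * partial b u x + partial b f x * u x) = 0"
  using integral_partial_eq_0[OF test_mult[OF u f] b] by simp
 moreover have "integrable lebesgue (\<lambda>x. f x * partial b u x)" "integrable lebesgue (\<lambda>x. partial b f x * u x)"
  by (rule integrable_test[OF test_mult] test_partial u b f smooth_partial)+
 ultimately show ?thesis by simp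
qed

lemma green_first:
 assumes u: "u \<in> test_functions \<Omega>" and f: "smooth f"
 shows "(LINT x|lebesgue. (\<Sum>b\<in>Basis. partial b f x * partial b u x)) = - (LINT x|lebesgue. lap f x * u x)"
proof -
 have "(LINT x|lebesgue. (\<Sum>b\<in>Basis. partial b f x * partial b u x))
   = (\<Sum>b\<in>Basis. LINT x|lebesgue. partial b f x * partial b u x)"
  by (rule Bochner_Integration.integral_sum)
    (rule integrable_test[OF test_mult] test_partial u f smooth_partial | assumption)+
 also have "\<dots> = (\<Sum>b\<in>Basis. - (LINT x|lebesgue. partial b (partial b f) x * u x))"
  by (rule sum.cong[OF refl]) (rule integration_by_parts[OF u smooth_partial[OF f]])
 also have "\<dots> = - (\<Sum>b\<in>Basis. LINT x|lebesgue. partial b (partial b f) x * u x)"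
  by (simp add: sum_negf)
 also have "(\<Sum>b\<in>Basis. LINT x|lebesgue. partial b (partial b f) x * u x)
   = (LINT x|lebesgue. (\<Sum>b\<in>Basis. partial b (partial b f) x * u x))"
  by (rule Bochner_Integration.integral_sum[symmetric])
    (rule integrable_test[OF test_mult] u f smooth_partial | assumption)+
 also have "\<dots> = (LINT x|lebesgue. lap f x * u x)"
  by (simp add: lap_def sum_distrib_right)
 finally show ?thesis .
qed

lemma integral_lap_eq_0:
 assumes "u \<in> test_functions \<Omega>"
 shows "(LINT x|lebesgue. lap u x) = 0"
proof -
 have "(LINT x|lebesgue. lap u x) = (\<Sum>b\<in>Basis. LINT x|lebesgue. partial b (partial b u) x)"
  unfolding lap_def
  by (rule Bochner_Integration.integral_sum) (rule integrable_test test_partial assms | assumption)+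
 also have "\<dots> = 0" using integral_partial_eq_0 test_partial[OF assms] by (intro sum.neutral) blast
 finally show ?thesis .
qed

text \<open>The quadratic polynomial \<open>s \<mapsto> \<integral>(f + s g)\<^sup>2\<close> is nonnegative.\<close>

lemma Cauchy_Schwarz_integral:
 fixes f g :: "'b \<Rightarrow> real"
 assumes "integrable M (\<lambda>x. (f x)^2)" "integrable M (\<lambda>x. (g x)^2)" "integrable M (\<lambda>x. f x * g x)"
 shows "(\<integral>x. f x * g x \<partial>M)^2 \<le> (\<integral>x. (f x)^2 \<partial>M) * (\<integral>x. (g x)^2 \<partial>M)"
proof -
 define A where "A = (\<integral>x. (f x)^2 \<partial>M)"
 define B where "B = (\<integral>x. f x * g x \<partial>M)"
 define C where "C = (\<integral>x. (g x)^2 \<partial>M)"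
 have q: "0 \<le> A + 2 * s * B + s^2 * C" for s
 proof -
  have "(\<integral>x. (f x + s * g x)^2 \<partial>M) = (\<integral>x. (f x)^2 + 2 * s * (f x * g x) + s^2 * (g x)^2 \<partial>M)"
   by (simp add: power2_eq_square algebra_simps)
  also have "\<dots> = A + 2 * s * B + s^2 * C"
   using assms by (simp add: A_def B_def C_def)
  finally show ?thesis using integral_nonneg_AE[of "\<lambda>x. (f x + s * g x)^2" M] by simp
 qed
 have "C \<ge> 0" "A \<ge> 0" by (auto simp: C_def A_def)
 have "B^2 \<le> A * C"
 proof (cases "C = 0")
  case True
  show ?thesis
  proof (rule ccontr)
   assume "\<not> ?thesis"
   then have "B \<noteq> 0" using True by auto
   with q[of "- (A + 1) / (2 * B)"] True show False by (simp add: field_simps)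
  qed
 next
  case False
  with \<open>C \<ge> 0\<close> have "C > 0" by simp
  with q[of "- B / C"] have "0 \<le> (A * C - B^2) / C" by (simp add: field_simps power2_eq_square)
  with \<open>C > 0\<close> show ?thesis by (simp add: zero_le_divide_iff)
 qed
 then show ?thesis by (simp add: A_def B_def C_def)
qed

text \<open>If \<open>f\<close> were negative on a set of positive measure, it would be negative on a compact set of
 positive measure, whose indicator is a dominated limit of squares of cutoffs.\<close>

lemma nonneg_AE_of_test_squares:
 fixes f :: "'a::euclidean_space \<Rightarrow> real"
 assumes \<Omega>: "open \<Omega>" and f: "locint \<Omega> f"
  and nn: "\<And>\<theta>. \<theta> \<in> test_functions \<Omega> \<Longrightarrow> 0 \<le> (LINT x|lebesgue. f x * (\<theta> x)^2)"
 shows "AE x in lebesgue. x \<in> \<Omega> \<longrightarrow> 0 \<le> f x"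
proof -
 have main: "AE x in lebesgue. x \<in> C \<longrightarrow> 0 \<le> f x" if C: "compact C" "C \<subseteq> \<Omega>" for C
 proof (rule ccontr)
  assume not: "\<not> (AE x in lebesgue. x \<in> C \<longrightarrow> 0 \<le> f x)"
  define g where "g x = indicator C x * f x" for x
  have g: "integrable lebesgue g" using f C by (auto simp: locint_def g_def[abs_def])
  define A where "A = {x \<in> space lebesgue. g x < 0}"
  have A: "A \<in> sets lebesgue" unfolding A_def
   using borel_measurable_integrable[OF g] by measurable
  have "x \<in> C \<and> f x < 0" if "x \<in> A" for x
   using that by (cases "x \<in> C") (auto simp: A_def g_def)
  then have AC: "A \<subseteq> C" and Af: "\<And>x. x \<in> A \<Longrightarrow> f x < 0" by auto
  have "A \<notin> null_sets lebesgue"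
  proof
   assume "A \<in> null_sets lebesgue"
   then have "AE x in lebesgue. x \<notin> A" by (rule AE_not_in)
   then have "AE x in lebesgue. x \<in> C \<longrightarrow> 0 \<le> f x"
    by (rule AE_mp) (auto simp: A_def g_def)
   with not show False by contradiction
  qed
  then have pos: "emeasure lebesgue A > 0" using A by (auto simp: null_sets_def zero_less_iff_neq_zero)
  then obtain e where e: "e > 0" "ennreal e < emeasure lebesgue A"
  proof -
   obtain y where y: "0 < y" "y < emeasure lebesgue A" using dense[OF pos] by blast
   from y(2) have "y < top" by (rule order_less_le_trans) simp
   then obtain e where "y = ennreal e" by (cases y) auto
   with y that[of e] show ?thesis by simp
  qed
  obtain T where T: "closed T" "T \<subseteq> A" "A - T \<in> lmeasurable" "emeasure lebesgue (A - T) < ennreal e"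
   using sets_lebesgue_inner_closed[OF A e(1)] by blast
  have Tc: "compact T"
   using T(1,2) AC C(1) by (meson closed_subset compact_Int_closed compact_eq_bounded_closed
     bounded_subset order_trans)
  have Tn: "T \<notin> null_sets lebesgue"
  proof
   assume Tnull: "T \<in> null_sets lebesgue"
   have "emeasure lebesgue A = emeasure lebesgue ((A - T) \<union> T)" using T(2) by (simp add: Un_absorb2)
   also have "\<dots> \<le> emeasure lebesgue (A - T) + emeasure lebesgue T"
    using T(3) Tnull by (intro emeasure_subadditive) auto
   also have "\<dots> < ennreal e" using Tnull T(4) by (simp add: null_sets_def)
   finally show False using e(2) by simp
  qed
  then have "T \<noteq> {}" by auto
  obtain X where X: "X \<in> test_functions \<Omega>" "\<And>x. 0 \<le> X x" "\<And>x. X x \<le> 1" "\<forall>x\<in>T. X x = 1"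
   using compact_cutoff[OF Tc \<Omega>] T AC C by (metis order_trans)
  define U where "U n = {x. infdist x T < 1 / real (Suc n)}" for n
  have oU: "open (U n)" for n unfolding U_def
   by (intro open_Collect_less continuous_intros)
  have "\<exists>h. h \<in> test_functions (U n) \<and> (\<forall>x. 0 \<le> h x \<and> h x \<le> 1) \<and> (\<forall>x\<in>T. h x = 1)" for n
  proof -
   have "T \<subseteq> U n" by (auto simp: U_def)
   then show ?thesis using compact_cutoff[OF Tc oU[of n]] by metis
  qed
  then obtain h where h: "\<And>n. h n \<in> test_functions (U n)" "\<And>n x. 0 \<le> h n x" "\<And>n x. h n x \<le> 1"
   "\<And>n x. x \<in> T \<Longrightarrow> h n x = 1" by metis
  define \<theta> where "\<theta> n x = h n x * X x" for n x
  have th: "\<theta> n \<in> test_functions \<Omega>" for n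
   unfolding \<theta>_def[abs_def] by (rule test_mult[OF X(1) test_smooth[OF h(1)]])
  have lim: "(\<lambda>n. LINT x|lebesgue. f x * (\<theta> n x)^2) \<longlonglongrightarrow> (LINT x|lebesgue. indicator T x * f x)"
  proof (rule integral_dominated_convergence)
   show "integrable lebesgue (\<lambda>x. \<bar>f x\<bar> * X x)" by (rule locint_test[OF locint_abs[OF f] X(1)])
   show "(\<lambda>x. f x * (\<theta> n x)^2) \<in> borel_measurable lebesgue" for n
    unfolding power2_eq_square
    by (rule borel_measurable_integrable, rule locint_test[OF f], rule test_mult[OF th test_smooth[OF th]])
   have "integrable lebesgue (\<lambda>x. indicator T x * f x)"
    using f Tc T(2) AC C(2) by (auto simp: locint_def)
   then show "(\<lambda>x. indicator T x * f x) \<in> borel_measurable lebesgue" by (rule borel_measurable_integrable)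
   show "AE x in lebesgue. norm (f x * (\<theta> n x)^2) \<le> \<bar>f x\<bar> * X x" for n
   proof (rule AE_I2)
    fix x
    have "\<theta> n x \<le> X x" unfolding \<theta>_def using mult_right_mono[OF h(3) X(2)] by simp
    moreover have t0: "0 \<le> \<theta> n x" unfolding \<theta>_def by (simp add: h X)
    moreover have "\<theta> n x \<le> 1" using \<open>\<theta> n x \<le> X x\<close> X(3)[of x] by linarith
    ultimately have "(\<theta> n x)^2 \<le> X x" unfolding power2_eq_square
     using mult_mono[of "\<theta> n x" 1 "\<theta> n x" "X x"] by simp
    then show "norm (f x * (\<theta> n x)^2) \<le> \<bar>f x\<bar> * X x"
     by (simp add: abs_mult mult_left_mono)
   qed
   show "AE x in lebesgue. (\<lambda>n. f x * (\<theta> n x)^2) \<longlonglongrightarrow> indicator T x * f x"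
   proof (rule AE_I2)
    fix x
    show "(\<lambda>n. f x * (\<theta> n x)^2) \<longlonglongrightarrow> indicator T x * f x"
    proof (cases "x \<in> T")
     case True
     then show ?thesis using h(4) X(4) by (simp add: \<theta>_def)
    next
     case False
     have d: "infdist x T > 0"
      using False T(1) \<open>T \<noteq> {}\<close> by (simp add: infdist_pos_not_in_closed)
     have "\<forall>\<^sub>F n in sequentially. 1 / real (Suc n) < infdist x T"
      using order_tendstoD(2)[OF LIMSEQ_Suc[OF lim_1_over_n[where ?'a = real]] d] by simp
     then have "\<forall>\<^sub>F n in sequentially. f x * (\<theta> n x)^2 = 0"
     proof (rule eventually_mono)
      fix n assume "1 / real (Suc n) < infdist x T"
      then have "x \<notin> U n" by (simp add: U_def)
      then have "h n x = 0" using test_support[OF h(1)[of n]] by blast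
      then show "f x * (\<theta> n x)^2 = 0" by (simp add: \<theta>_def)
     qed
     then show ?thesis using False by (simp add: tendsto_eventually)
    qed
   qed
  qed
  have "0 \<le> (LINT x|lebesgue. indicator T x * f x)"
   by (rule LIMSEQ_le_const[OF lim]) (use nn th in auto)
  moreover have int: "integrable lebesgue (\<lambda>x. - (indicator T x * f x))"
   using f Tc T(2) AC C(2) by (auto simp: locint_def)
  moreover have nnT: "AE x in lebesgue. 0 \<le> - (indicator T x * f x)"
   by (rule AE_I2) (use Af T(2) in \<open>force simp: indicator_def\<close>)
  ultimately have "(LINT x|lebesgue. - (indicator T x * f x)) = 0"
   using integral_nonneg_AE[OF nnT] by simp
  then have "AE x in lebesgue. - (indicator T x * f x) = 0"
   using integral_nonneg_eq_0_iff_AE[OF int nnT] by simp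
  then have "AE x in lebesgue. x \<notin> T"
   by (rule AE_mp) (use Af T(2) in \<open>force simp: indicator_def\<close>)
  then have "T \<in> null_sets lebesgue"
   using AE_iff_null_sets[OF fmeasurableD[OF lmeasurable_compact[OF Tc]]] by blast
  with Tn show False by contradiction
 qed
 obtain C where C: "\<And>n::nat. compact (C n)" "\<And>n. C n \<subseteq> \<Omega>" "\<Union>(range C) = \<Omega>"
  using open_Union_compact_subsets[OF \<Omega>] by metis
 have "AE x in lebesgue. \<forall>n. x \<in> C n \<longrightarrow> 0 \<le> f x"
  unfolding AE_all_countable by (intro allI main C)
 then show ?thesis by (rule AE_mp) (use C(3) in auto)
qed

section \<open>Convolutions with kernels\<close>

lemma lborel_reflect: "distr lborel borel (\<lambda>y. x - y) = (lborel :: 'a::euclidean_space measure)"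
 using lborel_affine[of "-1" x] by (simp add: density_1)

lemma lborel_translate: "distr lborel borel (\<lambda>x. x - y) = (lborel :: 'a::euclidean_space measure)"
proof -
 have "(\<lambda>x. x - y) = (+) (- y)" by auto
 then show ?thesis by (simp add: lborel_distr_plus)
qed

lemma
 fixes f :: "'a::euclidean_space \<Rightarrow> real"
 assumes "f \<in> borel_measurable borel"
 shows lebesgue_integral_translate: "(LINT x|lebesgue. f (x - y)) = (LINT x|lebesgue. f x)"
  and lebesgue_integrable_translate: "integrable lebesgue (\<lambda>x. f (x - y)) \<longleftrightarrow> integrable lebesgue f"
  and lebesgue_integral_reflect: "(LINT y|lebesgue. f (x - y)) = (LINT x|lebesgue. f x)"
  and lebesgue_integrable_reflect: "integrable lebesgue (\<lambda>y. f (x - y)) \<longleftrightarrow> integrable lebesgue f"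
proof -
 have m: "(\<lambda>x. f (x - y)) \<in> borel_measurable lborel" "(\<lambda>y. f (x - y)) \<in> borel_measurable lborel"
  "f \<in> borel_measurable lborel"
  using assms by measurable
 have "(\<integral>x. f x \<partial>lborel) = (\<integral>x. f (x - y) \<partial>lborel)"
  using integral_distr[of "\<lambda>x. x - y" lborel borel f] assms by (simp add: lborel_translate)
 then show "(LINT x|lebesgue. f (x - y)) = (LINT x|lebesgue. f x)"
  using m by (simp add: integral_completion)
 have "(\<integral>x. f x \<partial>lborel) = (\<integral>y. f (x - y) \<partial>lborel)"
  using integral_distr[of "\<lambda>y. x - y" lborel borel f] assms by (simp add: lborel_reflect)
 then show "(LINT y|lebesgue. f (x - y)) = (LINT x|lebesgue. f x)"
  using m by (simp add: integral_completion)
 have "integrable lborel f = integrable lborel (\<lambda>x. f (x - y))"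
  using integrable_distr_eq[of "\<lambda>x. x - y" lborel borel f] assms by (simp add: lborel_translate)
 then show "integrable lebesgue (\<lambda>x. f (x - y)) \<longleftrightarrow> integrable lebesgue f"
  using m by (simp add: integrable_completion)
 have "integrable lborel f = integrable lborel (\<lambda>y. f (x - y))"
  using integrable_distr_eq[of "\<lambda>y. x - y" lborel borel f] assms by (simp add: lborel_reflect)
 then show "integrable lebesgue (\<lambda>y. f (x - y)) \<longleftrightarrow> integrable lebesgue f"
  using m by (simp add: integrable_completion)
qed

lemma uniformly_continuous_compact_support:
 fixes f :: "'a::euclidean_space \<Rightarrow> real"
 assumes f: "continuous_on UNIV f" and K: "compact K" "\<forall>x. x \<notin> K \<longrightarrow> f x = 0" and e: "e > 0"
 shows "\<exists>d>0. \<forall>x y. norm (x - y) < d \<longrightarrow> \<bar>f x - f y\<bar> < e"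
proof -
 define L where "L = (\<lambda>p. fst p + snd p) ` (K \<times> cball (0::'a) 1)"
 have L: "compact L" unfolding L_def
  by (intro compact_continuous_image compact_Times K compact_cball continuous_intros)
 have inL: "y \<in> L" if "x \<in> K" "norm (x - y) \<le> 1" for x y
 proof -
  have "y - x \<in> cball 0 1" using that by (simp add: norm_minus_commute)
  moreover have "y = x + (y - x)" by simp
  ultimately show ?thesis unfolding L_def using that(1) by (intro image_eqI[of _ _ "(x, y - x)"]) auto
 qed
 have KL: "K \<subseteq> L" using inL by auto
 have "uniformly_continuous_on L f"
  by (rule compact_uniformly_continuous[OF continuous_on_subset[OF f subset_UNIV] L])
 then obtain d where d: "d > 0" "\<And>x y. x \<in> L \<Longrightarrow> y \<in> L \<Longrightarrow> dist y x < d \<Longrightarrow> dist (f y) (f x) < e"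
  using e unfolding uniformly_continuous_on_def by metis
 show ?thesis
 proof (intro exI[of _ "min d 1"] conjI allI impI)
  fix x y :: 'a assume xy: "norm (x - y) < min d 1"
  show "\<bar>f x - f y\<bar> < e"
  proof (cases "x \<in> K \<or> y \<in> K")
   case True
   then have "x \<in> L" "y \<in> L" using inL[of x y] inL[of y x] KL xy by (auto simp: norm_minus_commute)
   with d(2)[of y x] xy show ?thesis by (simp add: dist_norm)
  next
   case False
   then have "f x = 0" "f y = 0" using K(2) by blast+
   then show ?thesis using e by simp
  qed
 qed (use d in auto)
qed

text \<open>Differentiation under the integral sign; the difference quotients of the kernel converge uniformly.\<close>

lemma convolution_has_derivative:
 fixes g k :: "'a::euclidean_space \<Rightarrow> real"
 assumes g: "integrable lebesgue g" and k: "k \<in> test_functions UNIV"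
 shows "((\<lambda>y. LINT x|lebesgue. g x * k (x - y)) has_derivative
   (\<lambda>h. - (\<Sum>b\<in>Basis. (h \<bullet> b) * (LINT x|lebesgue. g x * partial b k (x - y))))) (at y)"
proof -
 have int: "integrable lebesgue (\<lambda>x. g x * f (x - y))" if f: "f \<in> test_functions UNIV" for f and y :: 'a
 proof -
  obtain K where K: "compact K" "\<forall>x. x \<notin> K \<longrightarrow> f x = 0" using test_support[OF f] by blast
  define L where "L = (\<lambda>x. x + y) ` K"
  have L: "compact L" unfolding L_def by (intro compact_continuous_image continuous_intros K)
  from L have gL: "integrable lebesgue (\<lambda>x. indicator L x * g x)"
   using integrable_mult_indicator[OF fmeasurableD[OF lmeasurable_compact] g] by simp
  have cf: "continuous_on UNIV (\<lambda>x. f (x - y))"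
   by (rule smooth_continuous[OF smooth_shift[OF test_smooth[OF f]]])
  have "f (x - y) = 0" if "x \<notin> L" for x :: 'a
  proof -
   have "x - y \<notin> K"
   proof
    assume "x - y \<in> K"
    then have "(x - y) + y \<in> L" unfolding L_def by (rule imageI)
    with that show False by simp
   qed
   with K(2) show ?thesis by blast
  qed
  then have "\<forall>x. x \<notin> L \<longrightarrow> f (x - y) = 0" by blast
  with gL cf L show ?thesis by (rule integrable_mult_compact_support)
 qed
 have pk: "partial b k \<in> test_functions UNIV" if "b \<in> Basis" for b by (rule test_partial[OF k that])
 define D where "D h = - (\<Sum>b\<in>Basis. (h \<bullet> b) * (LINT x|lebesgue. g x * partial b k (x - y)))" for h
 have lin: "bounded_linear D" unfolding D_def
  by (intro bounded_linear_minus bounded_linear_sum bounded_linear_mult_const bounded_linear_inner_left)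
 define G where "G = (LINT x|lebesgue. \<bar>g x\<bar>)"
 have G0: "G \<ge> 0" by (simp add: G_def)
 define N where "N = real DIM('a)"
 have N: "N > 0" by (simp add: N_def)
 have main: "\<exists>d>0. \<forall>y'. norm (y' - y) < d \<longrightarrow>
   norm ((LINT x|lebesgue. g x * k (x - y')) - (LINT x|lebesgue. g x * k (x - y)) - D (y' - y)) \<le> e * norm (y' - y)"
  if e: "e > 0" for e
 proof -
  define e' where "e' = e / (N * (G + 1))"
  have e': "e' > 0" using e N G0 by (simp add: e'_def)
  have "\<forall>b\<in>Basis. \<exists>d>0. \<forall>x y. norm (x - y) < d \<longrightarrow> \<bar>partial b k x - partial b k y\<bar> < e'"
  proof
   fix b :: 'a assume b: "b \<in> Basis"
   show "\<exists>d>0. \<forall>x y. norm (x - y) < d \<longrightarrow> \<bar>partial b k x - partial b k y\<bar> < e'"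
    using test_support[OF pk[OF b]] uniformly_continuous_compact_support[OF test_continuous[OF pk[OF b]] _ _ e']
    by blast
  qed
  from bchoice[OF this] obtain d where
   d: "\<forall>b\<in>Basis. d b > 0 \<and> (\<forall>x y. norm (x - y) < d b \<longrightarrow> \<bar>partial b k x - partial b k y\<bar> < e')" ..
  define d0 where "d0 = Min (d ` Basis)"
  have d0: "d0 > 0" using d by (simp add: d0_def)
  have d0b: "\<bar>partial b k x - partial b k y\<bar> < e'" if "b \<in> Basis" "norm (x - y) < d0" for b x y
  proof -
   have "d0 \<le> d b" using that(1) by (simp add: d0_def)
   with that d show ?thesis by force
  qed
  show ?thesis
  proof (intro exI[of _ d0] conjI allI impI d0)
   fix y' assume y': "norm (y' - y) < d0"
   define h where "h = y' - y"
   define R where "R x = k (x - y') - k (x - y) + (\<Sum>b\<in>Basis. (h \<bullet> b) * partial b k (x - y))" for x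
   have R: "\<bar>R x\<bar> \<le> norm h * (N * e')" for x
   proof -
    obtain s where s: "0 < s" "s < 1"
     "k ((x - y) + (- h)) - k (x - y) = frechet_derivative k (at ((x - y) + s *\<^sub>R (- h))) (- h)"
     using directional_mvt[OF test_smooth[OF k], of "x - y" "- h"] by blast
    have yy: "x - y' = (x - y) + (- h)" by (simp add: h_def)
    have "R x = (\<Sum>b\<in>Basis. (h \<bullet> b) * (partial b k (x - y) - partial b k ((x - y) + s *\<^sub>R (- h))))"
     unfolding R_def yy
     using s(3) frechet_derivative_sum[OF test_smooth[OF k], of "(x - y) + s *\<^sub>R (- h)" "- h"]
     by (simp add: right_diff_distrib sum_subtractf sum_negf)
    also have "\<bar>\<dots>\<bar> \<le> (\<Sum>b\<in>(Basis::'a set). norm h * e')"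
    proof (rule sum_norm_le[where 'a = real, unfolded real_norm_def])
     fix b :: 'a assume b: "b \<in> Basis"
     have "norm ((x - y) - ((x - y) + s *\<^sub>R (- h))) = s * norm h" using s by simp
     also have "\<dots> \<le> 1 * norm h" using s by (intro mult_right_mono) auto
     also have "\<dots> < d0" using y' by (simp add: h_def)
     finally have "\<bar>partial b k (x - y) - partial b k ((x - y) + s *\<^sub>R (- h))\<bar> \<le> e'"
      using d0b[OF b] by (intro less_imp_le)
     moreover have "\<bar>h \<bullet> b\<bar> \<le> norm h" using b by (rule Basis_le_norm)
     ultimately show "\<bar>(h \<bullet> b) * (partial b k (x - y) - partial b k ((x - y) + s *\<^sub>R (- h)))\<bar> \<le> norm h * e'"
      unfolding abs_mult by (intro mult_mono) auto
    qed
    also have "\<dots> = norm h * (N * e')" by (simp add: N_def)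
    finally show ?thesis .
   qed
   have ints: "integrable lebesgue (\<lambda>x. g x * k (x - y'))" "integrable lebesgue (\<lambda>x. g x * k (x - y))"
    "\<And>b. b \<in> Basis \<Longrightarrow> integrable lebesgue (\<lambda>x. (h \<bullet> b) * (g x * partial b k (x - y)))"
    using int k pk by auto
   have eq: "g x * R x = g x * k (x - y') - g x * k (x - y) + (\<Sum>b\<in>Basis. (h \<bullet> b) * (g x * partial b k (x - y)))" for x
    by (simp add: R_def algebra_simps sum_distrib_left)
   have intR: "integrable lebesgue (\<lambda>x. g x * R x)"
    unfolding eq by (intro Bochner_Integration.integrable_add Bochner_Integration.integrable_diff
      Bochner_Integration.integrable_sum ints)
   have "(LINT x|lebesgue. g x * R x) = (LINT x|lebesgue. g x * k (x - y')) - (LINT x|lebesgue. g x * k (x - y))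
     + (\<Sum>b\<in>Basis. (h \<bullet> b) * (LINT x|lebesgue. g x * partial b k (x - y)))"
    unfolding eq using ints by simp
   then have "norm ((LINT x|lebesgue. g x * k (x - y')) - (LINT x|lebesgue. g x * k (x - y)) - D (y' - y))
     = \<bar>LINT x|lebesgue. g x * R x\<bar>" by (simp add: D_def h_def)
   also have "\<dots> \<le> (LINT x|lebesgue. \<bar>g x * R x\<bar>)" by (rule integral_abs_bound)
   also have "\<dots> \<le> (LINT x|lebesgue. \<bar>g x\<bar> * (norm h * (N * e')))"
   proof (rule integral_mono)
    show "integrable lebesgue (\<lambda>x. \<bar>g x * R x\<bar>)" using intR by (rule integrable_abs)
    show "integrable lebesgue (\<lambda>x. \<bar>g x\<bar> * (norm h * (N * e')))" using g by simp
    show "\<bar>g x * R x\<bar> \<le> \<bar>g x\<bar> * (norm h * (N * e'))" for x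
     unfolding abs_mult by (rule mult_left_mono[OF R]) simp
   qed
   also have "\<dots> = (norm h * N) * (G * e')" by (simp add: G_def)
   also have "\<dots> \<le> (norm h * N) * ((G + 1) * e')"
    using e' N by (intro mult_left_mono mult_right_mono) auto
   also have "\<dots> = e * norm (y' - y)" using N G0 by (simp add: e'_def h_def)
   finally show "norm ((LINT x|lebesgue. g x * k (x - y')) - (LINT x|lebesgue. g x * k (x - y)) - D (y' - y))
    \<le> e * norm (y' - y)" .
  qed
 qed
 show ?thesis unfolding has_derivative_at_alt using lin main unfolding D_def by blast
qed

lemma convolution_continuous:
 assumes "integrable lebesgue g" "k \<in> test_functions UNIV"
 shows "continuous_on UNIV (\<lambda>y. LINT x|lebesgue. g x * k (x - y))"
 using has_derivative_continuous[OF convolution_has_derivative[OF assms]]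
 by (simp add: continuous_on_eq_continuous_at)

lemma C_1_onI:
 assumes "\<And>x. x \<in> S \<Longrightarrow> (f has_derivative (\<lambda>h. \<Sum>b\<in>Basis. (h \<bullet> b) * P b x)) (at x)"
  and "\<And>b. b \<in> Basis \<Longrightarrow> continuous_on S (P b)"
 shows "C_k_on 1 S f"
proof -
 have "partial b f x = P b x" if "x \<in> S" "b \<in> Basis" for x b
  unfolding partial_eqI[OF assms(1)[OF that(1)]]
  using that(2) by (simp add: inner_Basis if_distrib[of "\<lambda>t. t * _"] sum.delta cong: if_cong)
 moreover have "f differentiable (at x)" if "x \<in> S" for x
  using assms(1)[OF that] by (auto simp: differentiable_def)
 ultimately show ?thesis
  using assms(2) by (simp add: continuous_on_cong[OF refl, of S "partial _ f" "P _"])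
qed

text \<open>If smooth kernels converge in \<open>W\<^sup>1\<^sup>,\<^sup>1\<close>, their convolutions with a bounded function converge uniformly
 together with their gradients.\<close>

lemma convolution_W11_limit_C1:
 fixes g :: "'a::euclidean_space \<Rightarrow> real" and k :: "nat \<Rightarrow> 'a \<Rightarrow> real"
 assumes g: "integrable lebesgue g" "\<And>x. \<bar>g x\<bar> \<le> M"
  and k: "\<And>n. k n \<in> test_functions UNIV"
  and k0: "k0 \<in> borel_measurable borel" "integrable lebesgue k0"
   "(\<lambda>n. LINT z|lebesgue. \<bar>k n z - k0 z\<bar>) \<longlonglongrightarrow> 0"
  and D: "\<And>b. b \<in> Basis \<Longrightarrow> D b \<in> borel_measurable borel" "\<And>b. b \<in> Basis \<Longrightarrow> integrable lebesgue (D b)"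
   "\<And>b. b \<in> Basis \<Longrightarrow> (\<lambda>n. LINT z|lebesgue. \<bar>partial b (k n) z - D b z\<bar>) \<longlonglongrightarrow> 0"
 shows "C_k_on 1 UNIV (\<lambda>y. LINT x|lebesgue. g x * k0 (x - y))"
  and "\<And>y. (\<lambda>n. LINT x|lebesgue. g x * k n (x - y)) \<longlonglongrightarrow> (LINT x|lebesgue. g x * k0 (x - y))"
proof -
 have M: "M \<ge> 0" using g(2)[of 0] by simp
 have int: "integrable lebesgue (\<lambda>x. g x * f (x - y))"
  if "f \<in> borel_measurable borel" "integrable lebesgue f" for f and y :: 'a
 proof (rule Bochner_Integration.integrable_bound)
  have i: "integrable lebesgue (\<lambda>x. f (x - y))" using that lebesgue_integrable_translate by blast
  then show "integrable lebesgue (\<lambda>x. M * f (x - y))" by (rule integrable_mult_right)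
  show "(\<lambda>x. g x * f (x - y)) \<in> borel_measurable lebesgue"
   by (rule borel_measurable_times[OF borel_measurable_integrable[OF g(1)] borel_measurable_integrable[OF i]])
  show "AE x in lebesgue. norm (g x * f (x - y)) \<le> norm (M * f (x - y))"
   by (rule AE_I2) (use g(2) M in \<open>auto simp: abs_mult intro!: mult_right_mono\<close>)
 qed
 have close: "\<bar>(LINT x|lebesgue. g x * f1 (x - y)) - (LINT x|lebesgue. g x * f2 (x - y))\<bar>
   \<le> M * (LINT z|lebesgue. \<bar>f1 z - f2 z\<bar>)"
  if f: "f1 \<in> borel_measurable borel" "integrable lebesgue f1" "f2 \<in> borel_measurable borel" "integrable lebesgue f2"
  for f1 f2 and y :: 'a
 proof -
  have md: "(\<lambda>z. \<bar>f1 z - f2 z\<bar>) \<in> borel_measurable borel" using f by measurable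
  have id: "integrable lebesgue (\<lambda>x. \<bar>f1 (x - y) - f2 (x - y)\<bar>)"
   using lebesgue_integrable_translate[OF md, of y] f by simp
  have "(LINT x|lebesgue. g x * f1 (x - y)) - (LINT x|lebesgue. g x * f2 (x - y))
    = (LINT x|lebesgue. g x * f1 (x - y) - g x * f2 (x - y))"
   using int f by simp
  also have "\<bar>\<dots>\<bar> \<le> (LINT x|lebesgue. \<bar>g x * f1 (x - y) - g x * f2 (x - y)\<bar>)" by (rule integral_abs_bound)
  also have "\<dots> \<le> (LINT x|lebesgue. M * \<bar>f1 (x - y) - f2 (x - y)\<bar>)"
  proof (rule integral_mono)
   show "integrable lebesgue (\<lambda>x. \<bar>g x * f1 (x - y) - g x * f2 (x - y)\<bar>)" using int f by simp
   show "integrable lebesgue (\<lambda>x. M * \<bar>f1 (x - y) - f2 (x - y)\<bar>)" using id by simp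
   show "\<bar>g x * f1 (x - y) - g x * f2 (x - y)\<bar> \<le> M * \<bar>f1 (x - y) - f2 (x - y)\<bar>" for x
    unfolding right_diff_distrib[symmetric] abs_mult by (rule mult_right_mono) (use g(2) in auto)
  qed
  also have "\<dots> = M * (LINT z|lebesgue. \<bar>f1 z - f2 z\<bar>)"
   using lebesgue_integral_translate[OF md, of y] by simp
  finally show ?thesis .
 qed
 have bm: "f \<in> borel_measurable borel" if "f \<in> test_functions UNIV" for f :: "'a \<Rightarrow> real"
  by (rule borel_measurable_continuous_onI[OF test_continuous[OF that]])
 define P where "P n b y = - (LINT x|lebesgue. g x * partial b (k n) (x - y))" for n b y
 define Q where "Q b y = - (LINT x|lebesgue. g x * D b (x - y))" for b y
 have pk: "partial b (k n) \<in> test_functions UNIV" if "b \<in> Basis" for b n by (rule test_partial[OF k that])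
 have PQ: "\<forall>\<^sub>F n in sequentially. \<forall>y. \<bar>P n b y - Q b y\<bar> < e" if b: "b \<in> Basis" and e: "e > 0" for b e
 proof -
  have "(\<lambda>n. M * (LINT z|lebesgue. \<bar>partial b (k n) z - D b z\<bar>)) \<longlonglongrightarrow> M * 0"
   by (intro tendsto_intros D(3) b)
  then have "\<forall>\<^sub>F n in sequentially. M * (LINT z|lebesgue. \<bar>partial b (k n) z - D b z\<bar>) < e"
   using order_tendstoD(2)[of _ "M * 0" sequentially e] e by simp
  then show ?thesis
  proof (rule eventually_mono)
   fix n assume n: "M * (LINT z|lebesgue. \<bar>partial b (k n) z - D b z\<bar>) < e"
   show "\<forall>y. \<bar>P n b y - Q b y\<bar> < e"
   proof
    fix y
    show "\<bar>P n b y - Q b y\<bar> < e"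
     using close[OF bm[OF pk[OF b]] integrable_test[OF pk[OF b]] D(1)[OF b] D(2)[OF b], of n y] n
     unfolding P_def Q_def by linarith
   qed
  qed
 qed
 show lim: "(\<lambda>n. LINT x|lebesgue. g x * k n (x - y)) \<longlonglongrightarrow> (LINT x|lebesgue. g x * k0 (x - y))" for y
 proof (rule LIM_zero_cancel, rule Lim_null_comparison)
  show "\<forall>\<^sub>F n in sequentially. norm ((LINT x|lebesgue. g x * k n (x - y)) - (LINT x|lebesgue. g x * k0 (x - y)))
    \<le> M * (LINT z|lebesgue. \<bar>k n z - k0 z\<bar>)"
   by (rule always_eventually) (use close[OF bm[OF k] integrable_test[OF k] k0(1,2)] in auto)
  show "(\<lambda>n. M * (LINT z|lebesgue. \<bar>k n z - k0 z\<bar>)) \<longlonglongrightarrow> 0"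
   using tendsto_mult_right_zero[OF k0(3)] by simp
 qed
 show "C_k_on 1 UNIV (\<lambda>y. LINT x|lebesgue. g x * k0 (x - y))"
 proof (rule C_1_onI[where P = Q])
  have "\<exists>v. \<forall>y\<in>UNIV. (\<lambda>n. LINT x|lebesgue. g x * k n (x - y)) \<longlonglongrightarrow> v y \<and>
    (v has_derivative (\<lambda>h. \<Sum>b\<in>Basis. (h \<bullet> b) * Q b y)) (at y within UNIV)"
  proof (rule has_derivative_sequence)
   show "((\<lambda>y. LINT x|lebesgue. g x * k n (x - y)) has_derivative (\<lambda>h. \<Sum>b\<in>Basis. (h \<bullet> b) * P n b y))
     (at y within UNIV)" for n y
    using convolution_has_derivative[OF g(1) k, of n y] by (simp add: P_def sum_negf)
   show "\<forall>\<^sub>F n in sequentially. \<forall>y\<in>UNIV. \<forall>h. norm ((\<Sum>b\<in>Basis. (h \<bullet> b) * P n b y) - (\<Sum>b\<in>Basis. (h \<bullet> b) * Q b y))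
     \<le> e * norm h" if e: "e > 0" for e
   proof -
    define e' where "e' = e / real DIM('a)"
    have "e' > 0" using e by (simp add: e'_def)
    then have "\<forall>\<^sub>F n in sequentially. \<forall>b\<in>Basis. \<forall>y. \<bar>P n b y - Q b y\<bar> < e'"
     using PQ by (simp add: eventually_ball_finite_distrib)
    then show ?thesis
    proof (rule eventually_mono, intro ballI allI)
     fix n and y h :: 'a assume n: "\<forall>b\<in>Basis. \<forall>y. \<bar>P n b y - Q b y\<bar> < e'"
     have "(\<Sum>b\<in>Basis. (h \<bullet> b) * P n b y) - (\<Sum>b\<in>Basis. (h \<bullet> b) * Q b y)
      = (\<Sum>b\<in>Basis. (h \<bullet> b) * (P n b y - Q b y))" by (simp add: sum_subtractf right_diff_distrib)
     also have "norm \<dots> \<le> (\<Sum>b\<in>(Basis::'a set). norm h * e')"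
     proof (rule sum_norm_le)
      fix b :: 'a assume b: "b \<in> Basis"
      show "norm ((h \<bullet> b) * (P n b y - Q b y)) \<le> norm h * e'"
       unfolding real_norm_def abs_mult
       by (rule mult_mono) (use n b Basis_le_norm[OF b, of h] in \<open>auto intro: less_imp_le\<close>)
     qed
     also have "\<dots> = e * norm h" by (simp add: e'_def)
     finally show "norm ((\<Sum>b\<in>Basis. (h \<bullet> b) * P n b y) - (\<Sum>b\<in>Basis. (h \<bullet> b) * Q b y)) \<le> e * norm h" .
    qed
   qed
   show "(\<lambda>n. LINT x|lebesgue. g x * k n (x - 0)) \<longlonglongrightarrow> (LINT x|lebesgue. g x * k0 (x - 0))" by (rule lim)
  qed auto
  then obtain v where v: "\<And>y. (\<lambda>n. LINT x|lebesgue. g x * k n (x - y)) \<longlonglongrightarrow> v y"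
    "\<And>y. (v has_derivative (\<lambda>h. \<Sum>b\<in>Basis. (h \<bullet> b) * Q b y)) (at y)" by auto
  have "v = (\<lambda>y. LINT x|lebesgue. g x * k0 (x - y))"
   by (rule ext) (rule LIMSEQ_unique[OF v(1) lim])
  with v(2) show "((\<lambda>y. LINT x|lebesgue. g x * k0 (x - y)) has_derivative
    (\<lambda>h. \<Sum>b\<in>Basis. (h \<bullet> b) * Q b y)) (at y)" for y by simp
  show "continuous_on UNIV (Q b)" if b: "b \<in> Basis" for b
  proof (rule uniform_limit_theorem)
   show "uniform_limit UNIV (\<lambda>n. P n b) (Q b) sequentially"
    unfolding uniform_limit_iff dist_real_def using PQ[OF b] by auto
   show "\<forall>\<^sub>F n in sequentially. continuous_on UNIV (P n b)"
    unfolding P_def using convolution_continuous[OF g(1) pk[OF b]]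
    by (intro always_eventually allI continuous_intros)
  qed auto
 qed
qed

text \<open>Against a continuous function, convolution with an approximate identity may be moved to the other
 factor by Fubini, where it converges pointwise.\<close>

lemma approximate_identity_weak:
 fixes g \<theta> :: "'a::euclidean_space \<Rightarrow> real" and \<kappa> :: "nat \<Rightarrow> 'a \<Rightarrow> real"
 assumes g: "integrable lebesgue g" and th: "\<theta> \<in> test_functions UNIV"
  and k: "\<And>n. continuous_on UNIV (\<kappa> n)" "\<And>n z. 0 \<le> \<kappa> n z" "\<And>n z. r \<le> norm z \<Longrightarrow> \<kappa> n z = 0"
  and conc: "\<And>d e. d > 0 \<Longrightarrow> e > 0 \<Longrightarrow> \<forall>\<^sub>F n in sequentially. \<forall>z. d \<le> norm z \<longrightarrow> \<kappa> n z \<le> e"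
  and mass: "(\<lambda>n. LINT z|lebesgue. \<kappa> n z) \<longlonglongrightarrow> c"
 shows "(\<lambda>n. LINT y|lebesgue. \<theta> y * (LINT x|lebesgue. g x * \<kappa> n (x - y)))
      \<longlonglongrightarrow> c * (LINT x|lebesgue. g x * \<theta> x)"
proof -
 have kout: "\<forall>z. z \<notin> cball 0 r \<longrightarrow> \<kappa> n z = 0" for n using k(3) by auto
 have mk: "\<kappa> n \<in> borel_measurable borel" for n by (rule borel_measurable_continuous_onI[OF k(1)])
 have ik: "integrable lebesgue (\<kappa> n)" for n
  by (rule integrable_continuous_compact_support[OF k(1) compact_cball kout])
 obtain B where B: "B > 0" "\<And>x. \<bar>\<theta> x\<bar> \<le> B"
  using compact_support_bound[OF test_continuous[OF th]] test_support[OF th] by blast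
 have mth: "\<theta> \<in> borel_measurable borel" by (rule borel_measurable_continuous_onI[OF test_continuous[OF th]])
 define \<Theta> where "\<Theta> n x = (LINT y|lebesgue. \<kappa> n (x - y) * \<theta> y)" for n x
 have ikr: "integrable lebesgue (\<lambda>y. \<kappa> n (x - y))" for n x
  using lebesgue_integrable_reflect[OF mk] ik by blast
 have ikth: "integrable lebesgue (\<lambda>y. \<kappa> n (x - y) * \<theta> y)" for n x
 proof (rule Bochner_Integration.integrable_bound)
  show "integrable lebesgue (\<lambda>y. B * \<kappa> n (x - y))" using ikr by (rule integrable_mult_right)
  show "(\<lambda>y. \<kappa> n (x - y) * \<theta> y) \<in> borel_measurable lebesgue"
   by (rule borel_measurable_times[OF borel_measurable_integrable[OF ikr]
      continuous_measurable_lebesgue[OF test_continuous[OF th]]])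
  show "AE y in lebesgue. norm (\<kappa> n (x - y) * \<theta> y) \<le> norm (B * \<kappa> n (x - y))"
   by (rule AE_I2) (use k(2) B in \<open>auto simp: abs_mult mult.commute intro!: mult_right_mono\<close>)
 qed
 obtain g' where g': "g' \<in> borel_measurable borel" "AE x in lborel. g x = g' x"
  using completion_ex_borel_measurable_real[OF borel_measurable_integrable[OF g]] by auto
 then have ae: "AE x in lebesgue. g x = g' x" by (intro AE_completion)
 have mg': "g' \<in> borel_measurable lebesgue" using g'(1) by (intro measurable_completion) simp
 have ig': "integrable lborel g'"
 proof -
  have "integrable lebesgue g'"
   using g integrable_cong_AE[OF borel_measurable_integrable[OF g] mg' ae] by blast
  then show ?thesis using g'(1) by (simp add: integrable_completion)
 qed
 have Thb: "\<Theta> n \<in> borel_measurable borel" for n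
 proof -
  have "(\<lambda>p. \<kappa> n (fst p - snd p) * \<theta> (snd p)) \<in> borel_measurable (borel \<Otimes>\<^sub>M borel)"
   using mth mk[of n] by measurable
  then have "(\<lambda>x. \<integral>y. \<kappa> n (x - y) * \<theta> y \<partial>lborel) \<in> borel_measurable (lborel :: 'a measure)"
   by (intro lborel.borel_measurable_lebesgue_integral) (simp add: case_prod_unfold cong: measurable_cong_sets)
  moreover have "\<Theta> n = (\<lambda>x. \<integral>y. \<kappa> n (x - y) * \<theta> y \<partial>lborel)"
   unfolding \<Theta>_def using mk[of n] mth by (intro ext, subst integral_completion) auto
  ultimately show ?thesis by simp
 qed
 then have Thm: "\<Theta> n \<in> borel_measurable lebesgue" for n by (intro measurable_completion) simp
 have swap: "(LINT y|lebesgue. \<theta> y * (LINT x|lebesgue. g x * \<kappa> n (x - y))) = (LINT x|lebesgue. g x * \<Theta> n x)" for n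
 proof -
  have m2: "(\<lambda>p. g' (fst p) * \<kappa> n (fst p - snd p) * \<theta> (snd p)) \<in> borel_measurable (borel \<Otimes>\<^sub>M borel)"
   using g'(1) mk[of n] mth by measurable
  have inner: "(\<integral>y. \<bar>g' x * \<kappa> n (x - y) * \<theta> y\<bar> \<partial>lborel) \<le> \<bar>g' x\<bar> * (B * (LINT z|lebesgue. \<kappa> n z))" for x
  proof -
   have "(\<integral>y. \<bar>g' x * \<kappa> n (x - y) * \<theta> y\<bar> \<partial>lborel) = \<bar>g' x\<bar> * (\<integral>y. \<bar>\<kappa> n (x - y) * \<theta> y\<bar> \<partial>lborel)"
    by (simp add: abs_mult mult.assoc)
   also have "(\<integral>y. \<bar>\<kappa> n (x - y) * \<theta> y\<bar> \<partial>lborel) = (LINT y|lebesgue. \<bar>\<kappa> n (x - y) * \<theta> y\<bar>)"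
    using mk[of n] mth by (subst integral_completion) auto
   also have "\<dots> \<le> (LINT y|lebesgue. B * \<kappa> n (x - y))"
   proof (rule integral_mono)
    show "integrable lebesgue (\<lambda>y. \<bar>\<kappa> n (x - y) * \<theta> y\<bar>)" using ikth by simp
    show "integrable lebesgue (\<lambda>y. B * \<kappa> n (x - y))" using ikr by simp
    show "\<bar>\<kappa> n (x - y) * \<theta> y\<bar> \<le> B * \<kappa> n (x - y)" for y
     using mult_left_mono[OF B(2)[of y] k(2)[of n "x - y"]] k(2) by (simp add: abs_mult mult.commute)
   qed
   also have "\<dots> = B * (LINT z|lebesgue. \<kappa> n z)" using lebesgue_integral_reflect[OF mk] by simp
   finally show ?thesis by (simp add: mult_left_mono)
  qed
  have prod: "integrable (lborel \<Otimes>\<^sub>M lborel) (\<lambda>p. g' (fst p) * \<kappa> n (fst p - snd p) * \<theta> (snd p))"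
  proof (rule lborel_pair.Fubini_integrable)
   show "(\<lambda>p. g' (fst p) * \<kappa> n (fst p - snd p) * \<theta> (snd p)) \<in> borel_measurable (lborel \<Otimes>\<^sub>M lborel)"
    using m2 by (simp cong: measurable_cong_sets)
   show "AE x in lborel. integrable lborel (\<lambda>y. g' (fst (x, y)) * \<kappa> n (fst (x, y) - snd (x, y)) * \<theta> (snd (x, y)))"
   proof (rule AE_I2)
    fix x
    have "integrable lborel (\<lambda>y. \<kappa> n (x - y) * \<theta> y)"
     using ikth[of n x] mk[of n] mth by (subst (asm) integrable_completion) auto
    then show "integrable lborel (\<lambda>y. g' (fst (x, y)) * \<kappa> n (fst (x, y) - snd (x, y)) * \<theta> (snd (x, y)))"
     by (simp add: mult.assoc)
   qed
   show "integrable lborel (\<lambda>x. \<integral>y. norm (g' (fst (x, y)) * \<kappa> n (fst (x, y) - snd (x, y)) * \<theta> (snd (x, y))) \<partial>lborel)"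
   proof (rule Bochner_Integration.integrable_bound)
    show "integrable lborel (\<lambda>x. \<bar>g' x\<bar> * (B * (LINT z|lebesgue. \<kappa> n z)))" using ig' by simp
    show "(\<lambda>x. \<integral>y. norm (g' (fst (x, y)) * \<kappa> n (fst (x, y) - snd (x, y)) * \<theta> (snd (x, y))) \<partial>lborel) \<in> borel_measurable lborel"
     using m2 by (intro lborel.borel_measurable_lebesgue_integral) (simp add: case_prod_unfold cong: measurable_cong_sets)
    show "AE x in lborel. norm (\<integral>y. norm (g' (fst (x, y)) * \<kappa> n (fst (x, y) - snd (x, y)) * \<theta> (snd (x, y))) \<partial>lborel)
      \<le> norm (\<bar>g' x\<bar> * (B * (LINT z|lebesgue. \<kappa> n z)))"
    proof (rule AE_I2)
     fix x
     have "(\<integral>y. \<bar>g' x * \<kappa> n (x - y) * \<theta> y\<bar> \<partial>lborel) \<ge> 0" by simp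
     then show "norm (\<integral>y. norm (g' (fst (x, y)) * \<kappa> n (fst (x, y) - snd (x, y)) * \<theta> (snd (x, y))) \<partial>lborel)
      \<le> norm (\<bar>g' x\<bar> * (B * (LINT z|lebesgue. \<kappa> n z)))"
      using inner[of x] by simp
    qed
   qed
  qed
  have eqx: "(LINT x|lebesgue. g x * \<kappa> n (x - y)) = (\<integral>x. g' x * \<kappa> n (x - y) \<partial>lborel)" for y
  proof -
   have mm: "(\<lambda>x. \<kappa> n (x - y)) \<in> borel_measurable borel" using mk[of n] by measurable
   then have ml: "(\<lambda>x. \<kappa> n (x - y)) \<in> borel_measurable lebesgue" by (intro measurable_completion) simp
   have "(LINT x|lebesgue. g x * \<kappa> n (x - y)) = (LINT x|lebesgue. g' x * \<kappa> n (x - y))"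
    by (rule integral_cong_AE) (use ae ml mg' borel_measurable_integrable[OF g] in auto)
   also have "\<dots> = (\<integral>x. g' x * \<kappa> n (x - y) \<partial>lborel)"
    using mm g'(1) by (subst integral_completion) auto
   finally show ?thesis .
  qed
  have mI: "(\<lambda>y. \<integral>x. g' x * \<kappa> n (x - y) \<partial>lborel) \<in> borel_measurable borel"
  proof -
   have "(\<lambda>p. g' (snd p) * \<kappa> n (snd p - fst p)) \<in> borel_measurable (borel \<Otimes>\<^sub>M borel)"
    using g'(1) mk[of n] by measurable
   then have "(\<lambda>y. \<integral>x. g' x * \<kappa> n (x - y) \<partial>lborel) \<in> borel_measurable (lborel :: 'a measure)"
    by (intro lborel.borel_measurable_lebesgue_integral) (simp add: case_prod_unfold cong: measurable_cong_sets)
   then show ?thesis by simp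
  qed
  have "(LINT y|lebesgue. \<theta> y * (LINT x|lebesgue. g x * \<kappa> n (x - y)))
    = (\<integral>y. \<theta> y * (\<integral>x. g' x * \<kappa> n (x - y) \<partial>lborel) \<partial>lborel)"
   unfolding eqx using mI mth by (subst integral_completion) auto
  also have "\<dots> = (\<integral>y. (\<integral>x. g' x * \<kappa> n (x - y) * \<theta> y \<partial>lborel) \<partial>lborel)"
   by (simp add: mult.commute)
  also have "\<dots> = (\<integral>x. (\<integral>y. g' x * \<kappa> n (x - y) * \<theta> y \<partial>lborel) \<partial>lborel)"
   using lborel_pair.Fubini_integral[of "\<lambda>x y. g' x * \<kappa> n (x - y) * \<theta> y"] prod
   by (simp add: case_prod_unfold)
  also have "\<dots> = (\<integral>x. g' x * \<Theta> n x \<partial>lborel)"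
  proof (rule Bochner_Integration.integral_cong[OF refl])
   fix x
   have "\<Theta> n x = (\<integral>y. \<kappa> n (x - y) * \<theta> y \<partial>lborel)"
    unfolding \<Theta>_def using mk[of n] mth by (subst integral_completion) auto
   then show "(\<integral>y. g' x * \<kappa> n (x - y) * \<theta> y \<partial>lborel) = g' x * \<Theta> n x" by (simp add: mult.assoc)
  qed
  also have "\<dots> = (LINT x|lebesgue. g' x * \<Theta> n x)"
   by (rule integral_completion[symmetric]) (use g'(1) Thb[of n] in simp)
  also have "\<dots> = (LINT x|lebesgue. g x * \<Theta> n x)"
   by (intro integral_cong_AE) (use ae mg' Thm[of n] borel_measurable_integrable[OF g] in auto)
  finally show ?thesis .
 qed
 have Th_bound: "\<bar>\<Theta> n x\<bar> \<le> B * (LINT z|lebesgue. \<kappa> n z)" for n x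
 proof -
  have "\<bar>\<Theta> n x\<bar> \<le> (LINT y|lebesgue. \<bar>\<kappa> n (x - y) * \<theta> y\<bar>)" unfolding \<Theta>_def by (rule integral_abs_bound)
  also have "\<dots> \<le> (LINT y|lebesgue. B * \<kappa> n (x - y))"
  proof (rule integral_mono)
   show "integrable lebesgue (\<lambda>y. \<bar>\<kappa> n (x - y) * \<theta> y\<bar>)" using ikth by simp
   show "integrable lebesgue (\<lambda>y. B * \<kappa> n (x - y))" using ikr by simp
   show "\<bar>\<kappa> n (x - y) * \<theta> y\<bar> \<le> B * \<kappa> n (x - y)" for y
    using mult_left_mono[OF B(2)[of y] k(2)[of n "x - y"]] k(2) by (simp add: abs_mult mult.commute)
  qed
  also have "\<dots> = B * (LINT z|lebesgue. \<kappa> n z)" using lebesgue_integral_reflect[OF mk] by simp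
  finally show ?thesis .
 qed
 have Th_lim: "(\<lambda>n. \<Theta> n x) \<longlonglongrightarrow> c * \<theta> x" for x
 proof -
  define V where "V = (LINT z|lebesgue. indicator (cball (0::'a) r) z) + (1::real)"
  have V: "V > 0" unfolding V_def by (intro add_nonneg_pos) auto
  have mi: "(indicator (cball (0::'a) r) :: 'a \<Rightarrow> real) \<in> borel_measurable borel"
   by (intro borel_measurable_indicator borel_closed closed_cball)
  have vol: "(LINT y|lebesgue. indicator (cball (0::'a) r) (x - y)) \<le> V"
   "integrable lebesgue (\<lambda>y. indicator (cball (0::'a) r) (x - y) :: real)"
   using lebesgue_integral_reflect[OF mi, of x] lebesgue_integrable_reflect[OF mi, of x] integrable_indicator_compact[of "cball (0::'a) r"]
   by (auto simp: V_def)
  have "(\<lambda>n. \<Theta> n x - (LINT z|lebesgue. \<kappa> n z) * \<theta> x) \<longlonglongrightarrow> 0"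
  proof (rule LIMSEQ_I)
   fix e :: real assume e: "e > 0"
   define m where "m = \<bar>c\<bar> + 1"
   have m: "m > 0" by (simp add: m_def)
   define e1 where "e1 = e / (2 * m)"
   define e2 where "e2 = e / (4 * B * V + 1)"
   have BV: "B * V > 0" using B V by simp
   have e12: "e1 > 0" "e2 > 0" using e m BV by (auto simp: e1_def e2_def intro!: divide_pos_pos add_pos_pos)
   have "isCont \<theta> x" using test_continuous[OF th, of UNIV] by (simp add: continuous_on_eq_continuous_at)
   then obtain d where d: "d > 0" "\<And>y. dist y x < d \<Longrightarrow> dist (\<theta> y) (\<theta> x) < e1"
    using e12(1) unfolding continuous_at_eps_delta by blast
   have "\<forall>\<^sub>F n in sequentially. \<bar>(LINT z|lebesgue. \<kappa> n z) - c\<bar> < 1"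
    using tendstoD[OF mass, of 1] by (simp add: dist_real_def)
   with conc[OF d(1) e12(2)]
   have "\<forall>\<^sub>F n in sequentially. norm (\<Theta> n x - (LINT z|lebesgue. \<kappa> n z) * \<theta> x - 0) < e"
   proof eventually_elim
    case (elim n)
    have cn: "(LINT z|lebesgue. \<kappa> n z) \<le> m" using elim by (auto simp: m_def)
    have "\<Theta> n x - (LINT z|lebesgue. \<kappa> n z) * \<theta> x = \<Theta> n x - (LINT y|lebesgue. \<kappa> n (x - y) * \<theta> x)"
     using lebesgue_integral_reflect[OF mk, of n x] by simp
    also have "\<dots> = (LINT y|lebesgue. \<kappa> n (x - y) * \<theta> y - \<kappa> n (x - y) * \<theta> x)"
     unfolding \<Theta>_def using ikth ikr by simp
    also have "\<bar>\<dots>\<bar> \<le> (LINT y|lebesgue. \<bar>\<kappa> n (x - y) * \<theta> y - \<kappa> n (x - y) * \<theta> x\<bar>)" by (rule integral_abs_bound)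
    also have "\<dots> \<le> (LINT y|lebesgue. e1 * \<kappa> n (x - y) + (2 * B * e2) * indicator (cball (0::'a) r) (x - y))"
    proof (rule integral_mono)
     show "integrable lebesgue (\<lambda>y. \<bar>\<kappa> n (x - y) * \<theta> y - \<kappa> n (x - y) * \<theta> x\<bar>)" using ikth ikr by simp
     show "integrable lebesgue (\<lambda>y. e1 * \<kappa> n (x - y) + (2 * B * e2) * indicator (cball (0::'a) r) (x - y))"
      using ikr vol(2) by simp
     fix y
     have eq: "\<bar>\<kappa> n (x - y) * \<theta> y - \<kappa> n (x - y) * \<theta> x\<bar> = \<kappa> n (x - y) * \<bar>\<theta> y - \<theta> x\<bar>"
      unfolding right_diff_distrib[symmetric] abs_mult using k(2) by simp
     show "\<bar>\<kappa> n (x - y) * \<theta> y - \<kappa> n (x - y) * \<theta> x\<bar>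
       \<le> e1 * \<kappa> n (x - y) + (2 * B * e2) * indicator (cball (0::'a) r) (x - y)"
     proof (cases "norm (x - y) < d")
      case True
      then have "\<bar>\<theta> y - \<theta> x\<bar> \<le> e1" using d(2)[of y] by (simp add: dist_norm norm_minus_commute)
      then have "\<kappa> n (x - y) * \<bar>\<theta> y - \<theta> x\<bar> \<le> \<kappa> n (x - y) * e1" by (rule mult_left_mono) (rule k(2))
      moreover have "0 \<le> (2 * B * e2) * indicator (cball (0::'a) r) (x - y)" using B e12 by simp
      moreover have "\<kappa> n (x - y) * e1 = e1 * \<kappa> n (x - y)" by simp
      ultimately show ?thesis unfolding eq by linarith
     next
      case False
      show ?thesis
      proof (cases "x - y \<in> cball 0 r")
       case True
       have "\<kappa> n (x - y) \<le> e2" using elim(1) False by auto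
       moreover have "\<bar>\<theta> y - \<theta> x\<bar> \<le> 2 * B" using B(2)[of x] B(2)[of y] by linarith
       ultimately have "\<kappa> n (x - y) * \<bar>\<theta> y - \<theta> x\<bar> \<le> e2 * (2 * B)"
        using e12 by (intro mult_mono) auto
       moreover have "0 \<le> e1 * \<kappa> n (x - y)" using e12 k(2) by simp
       ultimately show ?thesis unfolding eq using True by (simp add: mult_ac)
      next
       case False
       then have "\<kappa> n (x - y) = 0" using kout by blast
       then show ?thesis using False by simp
      qed
     qed
    qed
    also have "\<dots> = e1 * (LINT z|lebesgue. \<kappa> n z) + (2 * B * e2) * (LINT y|lebesgue. indicator (cball (0::'a) r) (x - y))"
     using ikr vol(2) lebesgue_integral_reflect[OF mk, of n x] by simp
    also have "\<dots> \<le> e1 * m + (2 * B * e2) * V"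
     using e12 cn vol(1) B by (intro add_mono mult_left_mono) auto
    also have "\<dots> < e"
    proof -
     have "e1 * m = e / 2" using m by (simp add: e1_def)
     moreover have "(2 * B * e2) * V = e * ((2 * (B * V)) / (4 * (B * V) + 1))" by (simp add: e2_def mult_ac)
     moreover have "(2 * (B * V)) / (4 * (B * V) + 1) < 1/2" using BV by (simp add: divide_simps)
     then have "e * ((2 * (B * V)) / (4 * (B * V) + 1)) < e * (1/2)" using e by (rule mult_strict_left_mono)
     ultimately show ?thesis by linarith
    qed
    finally show ?case by simp
   qed
   then show "\<exists>n0. \<forall>n\<ge>n0. norm (\<Theta> n x - (LINT z|lebesgue. \<kappa> n z) * \<theta> x - 0) < e"
    by (simp add: eventually_sequentially)
  qed
  from tendsto_add[OF this tendsto_mult_right[OF mass, of "\<theta> x"]] show ?thesis by simp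
 qed
 obtain m where m: "\<And>n. \<bar>LINT z|lebesgue. \<kappa> n z\<bar> \<le> m"
  using convergent_imp_Bseq[OF convergentI[OF mass]] unfolding Bseq_def by auto
 have "(\<lambda>n. LINT x|lebesgue. g x * \<Theta> n x) \<longlonglongrightarrow> (LINT x|lebesgue. g x * (c * \<theta> x))"
 proof (rule integral_dominated_convergence)
  show "integrable lebesgue (\<lambda>x. \<bar>g x\<bar> * (B * m))" using g by simp
  show "(\<lambda>x. g x * \<Theta> n x) \<in> borel_measurable lebesgue" for n
   by (rule borel_measurable_times[OF borel_measurable_integrable[OF g] Thm])
  show "(\<lambda>x. g x * (c * \<theta> x)) \<in> borel_measurable lebesgue"
   using borel_measurable_integrable[OF g] continuous_measurable_lebesgue[OF test_continuous[OF th]] by simp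
  show "AE x in lebesgue. (\<lambda>n. g x * \<Theta> n x) \<longlonglongrightarrow> g x * (c * \<theta> x)"
   by (rule AE_I2) (intro tendsto_intros Th_lim)
  show "AE x in lebesgue. norm (g x * \<Theta> n x) \<le> \<bar>g x\<bar> * (B * m)" for n
  proof (rule AE_I2)
   fix x
   have "\<bar>\<Theta> n x\<bar> \<le> B * m"
    using Th_bound[of n x] mult_left_mono[of "LINT z|lebesgue. \<kappa> n z" m B] m[of n] B(1) by linarith
   then show "norm (g x * \<Theta> n x) \<le> \<bar>g x\<bar> * (B * m)" by (simp add: abs_mult mult_left_mono)
  qed
 qed
 moreover have "(LINT x|lebesgue. g x * (c * \<theta> x)) = c * (LINT x|lebesgue. g x * \<theta> x)"
  by (simp add: mult.left_commute)
 ultimately show ?thesis unfolding swap by simp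
qed

section \<open>Regularized radial kernels\<close>

text \<open>Regularized powers of the distance; \<open>kern 0 a x\<close> is \<open>\<bar>x\<bar>\<close> to the power \<open>2 a\<close>, with value \<open>0\<close> at the origin.\<close>

definition kern :: "real \<Rightarrow> real \<Rightarrow> 'a::euclidean_space \<Rightarrow> real" where
 "kern e a x = (x \<bullet> x + e^2) powr a"

lemma partial_norm_sq_add: "partial b (\<lambda>x. x \<bullet> x + c) x = 2 * (x \<bullet> b)"
 by (rule partial_eqI[where f' = "\<lambda>h. x \<bullet> h + h \<bullet> x", THEN trans])
   (auto intro!: derivative_eq_intros simp: inner_commute)

lemma smooth_norm_sq_add: "smooth (\<lambda>x::'a::euclidean_space. x \<bullet> x + c)"
 by (rule smooth_add[OF smooth_norm_sq smooth_const])

lemma lap_norm_sq_add: "lap (\<lambda>x. x \<bullet> x + c) (x::'a::euclidean_space) = 2 * real DIM('a)"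
 using lap_norm_sq[of x] by (simp add: lap_def partial_norm_sq_add partial_norm_sq)

lemma grad_sq_norm_sq_add: "grad_sq (\<lambda>x. x \<bullet> x + c) x = 4 * (x \<bullet> x)"
 using grad_sq_norm_sq[of x] by (simp add: grad_sq_def partial_norm_sq_add partial_norm_sq)

lemma norm_sq_add_pos: "e > 0 \<Longrightarrow> x \<bullet> x + e^2 > (0::real)"
 by (simp add: add_nonneg_pos)

lemma smooth_kern: "e > 0 \<Longrightarrow> smooth (kern e a)"
 unfolding kern_def[abs_def] by (rule smooth_powr[OF smooth_norm_sq_add]) (rule norm_sq_add_pos)

lemma kern_nonneg: "kern e a x \<ge> 0"
 by (simp add: kern_def)

lemma powr_has_derivative: "t > 0 \<Longrightarrow> ((\<lambda>t. c * t powr a) has_real_derivative (c * a) * t powr (a - 1)) (at t)"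
 using DERIV_cmult[OF has_real_derivative_powr[of t a], of c] by (simp add: mult.assoc)

lemma partial_kern:
 assumes "e > 0" shows "partial b (kern e a) x = 2 * a * (x \<bullet> b) * kern e (a - 1) x"
proof -
 have "partial b (\<lambda>x. 1 * (x \<bullet> x + e^2) powr a) x
   = (1 * a * (x \<bullet> x + e^2) powr (a - 1)) * partial b (\<lambda>x. x \<bullet> x + e^2) x"
  by (rule partial_compose_real(2)[OF smooth_differentiable[OF smooth_norm_sq_add]
     powr_has_derivative[OF norm_sq_add_pos[OF assms]]])
 then show ?thesis by (simp add: kern_def[abs_def] partial_norm_sq_add)
qed

lemma kern_step: "e > 0 \<Longrightarrow> kern e a x = kern e (a - 1) x * (x \<bullet> x + e^2)"
 using norm_sq_add_pos[of e x] powr_mult_base[of "x \<bullet> x + e^2" "a - 1"]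
 by (simp add: kern_def mult.commute)

lemma lap_kern:
 fixes x :: "'a::euclidean_space"
 assumes "e > 0"
 shows "lap (kern e a) x
  = 2 * a * kern e (a - 2) x * ((2 * (a - 1) + real DIM('a)) * (x \<bullet> x) + real DIM('a) * e^2)"
proof -
 define f where "f x = x \<bullet> x + e^2" for x :: 'a
 have f: "f x > 0" for x unfolding f_def by (rule norm_sq_add_pos[OF assms])
 have fs: "smooth f" unfolding f_def[abs_def] by (rule smooth_norm_sq_add)
 have "lap (\<lambda>x. f x powr a) x = (a * f x powr (a - 1)) * lap f x
   + ((a * (a - 1)) * f x powr (a - 1 - 1)) * grad_sq f x"
 proof (rule lap_compose[OF fs, where h = "\<lambda>t. t powr a" and ?h1.0 = "\<lambda>t. a * t powr (a - 1)"
    and ?h2.0 = "\<lambda>t. (a * (a - 1)) * t powr (a - 1 - 1)"])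
  show "((\<lambda>t. t powr a) has_real_derivative a * f x powr (a - 1)) (at (f x))" for x
   by (rule has_real_derivative_powr[OF f])
  show "((\<lambda>t. a * t powr (a - 1)) has_real_derivative (a * (a - 1)) * f x powr (a - 1 - 1)) (at (f x))" for x
   by (rule powr_has_derivative[OF f])
 qed
 moreover have "lap f x = 2 * real DIM('a)" unfolding f_def[abs_def] by (rule lap_norm_sq_add)
 moreover have "grad_sq f x = 4 * (x \<bullet> x)" unfolding f_def[abs_def] by (rule grad_sq_norm_sq_add)
 ultimately have "lap (kern e a) x = 2 * a * real DIM('a) * kern e (a - 1) x + 4 * a * (a - 1) * kern e (a - 2) x * (x \<bullet> x)"
  by (simp add: kern_def[abs_def] f_def)
 also have "kern e (a - 1) x = kern e (a - 2) x * (x \<bullet> x + e^2)" using kern_step[OF assms, of "a - 1" x] by simp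
 finally show ?thesis by (simp add: algebra_simps)
qed

lemma kern_antimono: "a \<le> 0 \<Longrightarrow> 0 < s \<Longrightarrow> s \<le> x \<bullet> x + e^2 \<Longrightarrow> kern e a x \<le> s powr a"
 unfolding kern_def by (rule powr_mono2') auto

lemma kern_tendsto:
 assumes "x \<noteq> 0" "e \<longlonglongrightarrow> 0" shows "(\<lambda>n. kern (e n) a x) \<longlonglongrightarrow> kern 0 a x"
 unfolding kern_def using assms by (intro tendsto_intros) auto

locale radial_cutoff =
 fixes \<eta> :: "'a::euclidean_space \<Rightarrow> real" and r :: real
 assumes dim: "DIM('a) > 2" and r: "r > 0" and \<eta>: "smooth \<eta>" "\<And>x. 0 \<le> \<eta> x" "\<And>x. \<eta> x \<le> 1"
  and \<eta>1: "\<forall>x. norm x \<le> r / 2 \<longrightarrow> \<eta> x = 1" and \<eta>0: "\<forall>x. norm x \<ge> r \<longrightarrow> \<eta> x = 0"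
begin

definition N :: real where "N = real DIM('a)"

lemma N3: "N \<ge> 3" using dim by (simp add: N_def)

text \<open>\<open>a1\<close> is half the exponent of the fundamental solution; \<open>a2\<close> is slightly larger, which leaves a strictly
 positive term of order \<open>a2 - 1\<close> in minus the Laplacian.\<close>

definition a1 :: real where "a1 = 1 - N / 2"
definition a2 :: real where "a2 = 5/4 - N / 2"

lemma \<eta>_out: "\<forall>x. x \<notin> cball 0 r \<longrightarrow> \<eta> x = 0"
 using \<eta>0 by simp

lemma \<eta>_test: "\<eta> \<in> test_functions UNIV"
 by (rule test_functionsI[OF \<eta>(1) compact_cball[of 0 r]]) (use \<eta>_out in auto)

lemma partial_\<eta>_in: "norm x < r / 2 \<Longrightarrow> partial b \<eta> x = 0"
proof (rule partial_zero_outside[where c = 1])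
 show "closed {x::'a. r / 2 \<le> norm x}" by (intro closed_Collect_le continuous_intros)
qed (use \<eta>1 in auto)

lemma partial_\<eta>_out: "norm x > r \<Longrightarrow> partial b \<eta> x = 0"
 by (rule partial_zero_outside[where c = 0 and K = "cball 0 r"]) (use \<eta>_out in auto)

lemma lap_\<eta>_in: "norm x < r / 2 \<Longrightarrow> lap \<eta> x = 0"
 unfolding lap_def
proof (intro sum.neutral ballI)
 fix b assume x: "norm x < r / 2"
 have cl: "closed {x::'a. r / 2 \<le> norm x}" by (intro closed_Collect_le continuous_intros)
 show "partial b (partial b \<eta>) x = 0"
  by (rule partial_zero_outside[OF cl, of "partial b \<eta>" 0]) (use x in \<open>simp_all add: partial_\<eta>_in\<close>)
qed

lemma lap_\<eta>_out: "norm x > r \<Longrightarrow> lap \<eta> x = 0"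
 unfolding lap_def
proof (intro sum.neutral ballI)
 fix b assume x: "norm x > r"
 show "partial b (partial b \<eta>) x = 0"
  by (rule partial_zero_outside[OF closed_cball[of 0 r], of "partial b \<eta>" 0])
    (use x in \<open>simp_all add: partial_\<eta>_out\<close>)
qed

text \<open>Chosen such that \<open>a * G1 x * kern e (a - 1) x\<close> is twice the scalar product of the gradients of \<open>\<eta>\<close> and of \<open>kern e a\<close>.\<close>

definition G1 :: "'a \<Rightarrow> real" where "G1 x = 4 * (\<Sum>b\<in>Basis. partial b \<eta> x * (x \<bullet> b))"

text \<open>The commutator of the Laplacian of a regularized kernel with the cutoff; it lives on the shell where
 the cutoff is not constant.\<close>

definition comm :: "real \<Rightarrow> real \<Rightarrow> 'a \<Rightarrow> real" where
 "comm e a x = a * G1 x * kern e (a - 1) x + lap \<eta> x * kern e a x"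

definition H :: "real \<Rightarrow> real \<Rightarrow> 'a \<Rightarrow> real" where "H e a x = \<eta> x * kern e a x"

lemma H_test: "e > 0 \<Longrightarrow> H e a \<in> test_functions UNIV"
 using test_mult[OF \<eta>_test smooth_kern[of e a]] by (simp add: H_def[abs_def] mult.commute)

lemma H_out: "norm x \<ge> r \<Longrightarrow> H e a x = 0"
 using \<eta>0 by (simp add: H_def)

lemma G1_in: "norm x < r / 2 \<Longrightarrow> G1 x = 0"
 by (simp add: G1_def partial_\<eta>_in)

lemma G1_out: "norm x > r \<Longrightarrow> G1 x = 0"
 by (simp add: G1_def partial_\<eta>_out)

lemma G1_test: "G1 \<in> test_functions UNIV"
 unfolding G1_def[abs_def]
 using test_cmult[OF test_sum[of Basis "\<lambda>b x. (x \<bullet> b) * partial b \<eta> x"]] test_mult[OF test_partial[OF \<eta>_test] smooth_inner]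
 by (simp add: mult.commute)

lemma comm_in: "norm x < r / 2 \<Longrightarrow> comm e a x = 0"
 by (simp add: comm_def G1_in lap_\<eta>_in)

lemma comm_out: "norm x > r \<Longrightarrow> comm e a x = 0"
 by (simp add: comm_def G1_out lap_\<eta>_out)

lemma lap_H:
 assumes "e > 0" shows "lap (H e a) x = \<eta> x * lap (kern e a) x + comm e a x"
proof -
 have "lap (H e a) x = \<eta> x * lap (kern e a) x + 2 * (\<Sum>b\<in>Basis. partial b \<eta> x * partial b (kern e a) x) + kern e a x * lap \<eta> x"
  unfolding H_def[abs_def] by (rule lap_mult[OF \<eta>(1) smooth_kern[OF assms]])
 also have "2 * (\<Sum>b\<in>Basis. partial b \<eta> x * partial b (kern e a) x) = a * G1 x * kern e (a - 1) x"
  by (simp add: partial_kern[OF assms] G1_def sum_distrib_left sum_distrib_right mult_ac)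
 finally show ?thesis by (simp add: comm_def)
qed

lemma shell_lower: "norm x \<ge> r / 2 \<Longrightarrow> r^2 / 4 \<le> x \<bullet> x + e^2"
proof -
 assume "norm x \<ge> r / 2"
 then have "(r/2)^2 \<le> (norm x)^2" using r by (intro power_mono) auto
 then show ?thesis by (simp add: power2_norm_eq_inner power_divide add_increasing2)
qed

lemma comm_bound:
 assumes "a \<le> 0" shows "\<exists>C\<ge>0. \<forall>e x. \<bar>comm e a x\<bar> \<le> C"
proof -
 obtain B1 where B1: "B1 > 0" "\<And>x. \<bar>G1 x\<bar> \<le> B1"
  using compact_support_bound[OF test_continuous[OF G1_test]] test_support[OF G1_test] by blast
 obtain B2 where B2: "B2 > 0" "\<And>x. \<bar>lap \<eta> x\<bar> \<le> B2"
  using compact_support_bound[OF test_continuous[OF test_lap[OF \<eta>_test]]] test_support[OF test_lap[OF \<eta>_test]] by blast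
 define C where "C = \<bar>a\<bar> * B1 * (r^2/4) powr (a - 1) + B2 * (r^2/4) powr a"
 have C: "C \<ge> 0" using B1 B2 by (simp add: C_def)
 have "\<bar>comm e a x\<bar> \<le> C" for e x
 proof (cases "norm x < r / 2")
  case True
  then show ?thesis using C by (simp add: comm_in)
 next
  case False
  then have s: "r^2 / 4 \<le> x \<bullet> x + e^2" by (intro shell_lower) simp
  have "\<bar>comm e a x\<bar> \<le> \<bar>a * G1 x * kern e (a - 1) x\<bar> + \<bar>lap \<eta> x * kern e a x\<bar>"
   unfolding comm_def by (rule abs_triangle_ineq)
  also have "\<dots> = \<bar>a\<bar> * \<bar>G1 x\<bar> * kern e (a - 1) x + \<bar>lap \<eta> x\<bar> * kern e a x"
   by (simp add: abs_mult kern_nonneg)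
  also have "\<dots> \<le> C" unfolding C_def
  proof (rule add_mono)
   have k: "kern e (a - 1) x \<le> (r^2/4) powr (a - 1)" "kern e a x \<le> (r^2/4) powr a"
    using s r assms by (auto intro!: kern_antimono)
   show "\<bar>a\<bar> * \<bar>G1 x\<bar> * kern e (a - 1) x \<le> \<bar>a\<bar> * B1 * (r^2/4) powr (a - 1)"
    using B1(1) by (intro mult_mono[OF mult_left_mono[OF B1(2)] k(1)]) (simp_all add: kern_nonneg)
   show "\<bar>lap \<eta> x\<bar> * kern e a x \<le> B2 * (r^2/4) powr a"
    using B2(1) by (intro mult_mono[OF B2(2) k(2)]) (simp_all add: kern_nonneg)
  qed
  finally show ?thesis .
 qed
 with C show ?thesis by blast
qed

lemma comm_tendsto: "e \<longlonglongrightarrow> 0 \<Longrightarrow> (\<lambda>n. comm (e n) a x) \<longlonglongrightarrow> comm 0 a x"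
proof (cases "norm x < r / 2")
 case False
 then have "x \<noteq> 0" using r by auto
 assume "e \<longlonglongrightarrow> 0"
 then show ?thesis unfolding comm_def by (intro tendsto_intros kern_tendsto \<open>x \<noteq> 0\<close>)
qed (simp add: comm_in)

text \<open>Where the commutator does not vanish, \<open>x \<bullet> x\<close> agrees with a smooth positive function.\<close>

lemma comm0_test: "comm 0 a \<in> test_functions UNIV"
proof -
 obtain \<zeta> :: "'a \<Rightarrow> real" where z: "smooth \<zeta>" "\<And>x. 0 \<le> \<zeta> x" "\<And>x. \<zeta> x \<le> 1"
  "\<forall>x. dist 0 x \<le> r/4 \<longrightarrow> \<zeta> x = 1" "\<forall>x. dist 0 x \<ge> r/2 \<longrightarrow> \<zeta> x = 0"
  using ball_cutoff[of "r/4" "r/2" "0::'a"] r by auto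
 define \<theta> where "\<theta> x = x \<bullet> x + \<zeta> x" for x
 have th: "\<theta> x > 0" for x
 proof (cases "x = 0")
  case True
  then show ?thesis using z(4) r by (simp add: \<theta>_def)
 next
  case False
  then show ?thesis using z(2) by (simp add: \<theta>_def add_pos_nonneg)
 qed
 have ths: "smooth \<theta>" unfolding \<theta>_def[abs_def] by (rule smooth_add[OF smooth_norm_sq z(1)])
 have "comm 0 a x = a * (\<theta> x powr (a - 1) * G1 x) + \<theta> x powr a * lap \<eta> x" for x
 proof (cases "norm x < r / 2")
  case True
  then show ?thesis by (simp add: comm_in G1_in lap_\<eta>_in)
 next
  case False
  then have "\<theta> x = x \<bullet> x" using z(5) by (simp add: \<theta>_def)
  then show ?thesis by (simp add: comm_def kern_def)
 qed
 then have "comm 0 a = (\<lambda>x. a * (\<theta> x powr (a - 1) * G1 x) + \<theta> x powr a * lap \<eta> x)" by (rule ext)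
 then show ?thesis
  by (simp only:) (intro test_add test_cmult test_mult G1_test test_lap \<eta>_test smooth_powr ths th)
qed

lemma comm_test: "e > 0 \<Longrightarrow> comm e a \<in> test_functions UNIV"
 unfolding comm_def[abs_def]
 using test_add[OF test_cmult[OF test_mult[OF G1_test smooth_kern[of e "a - 1"]], of a]
   test_mult[OF test_lap[OF \<eta>_test] smooth_kern[of e a]]]
 by (simp add: mult_ac)

lemma integral_comm_tendsto:
 assumes "a \<le> 0" "e \<longlonglongrightarrow> 0" "\<And>n. e n > 0"
 shows "(\<lambda>n. LINT x|lebesgue. comm (e n) a x) \<longlonglongrightarrow> (LINT x|lebesgue. comm 0 a x)"
proof -
 obtain C where C: "C \<ge> 0" "\<And>e x. \<bar>comm e a x\<bar> \<le> C" using comm_bound[OF assms(1)] by blast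
 show ?thesis
 proof (rule integral_dominated_convergence)
  show "comm 0 a \<in> borel_measurable lebesgue"
   by (rule continuous_measurable_lebesgue[OF test_continuous[OF comm0_test]])
  show "comm (e n) a \<in> borel_measurable lebesgue" for n
   by (rule continuous_measurable_lebesgue[OF test_continuous[OF comm_test[OF assms(3)]]])
  show "integrable lebesgue (\<lambda>x. C * indicator (cball (0::'a) r) x)"
   by (rule integrable_mult_right) (rule integrable_indicator_compact[OF compact_cball])
  show "AE x in lebesgue. (\<lambda>n. comm (e n) a x) \<longlonglongrightarrow> comm 0 a x"
   by (rule AE_I2) (rule comm_tendsto[OF assms(2)])
  show "AE x in lebesgue. norm (comm (e n) a x) \<le> C * indicator (cball (0::'a) r) x" for n
  proof (rule AE_I2)
   fix x show "norm (comm (e n) a x) \<le> C * indicator (cball (0::'a) r) x"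
    using C(2)[of "e n" x] comm_out[of x "e n" a] by (cases "norm x \<le> r") auto
  qed
 qed
qed

lemma integral_H_identity:
 assumes "e > 0"
 shows "(LINT x|lebesgue. \<eta> x * (- lap (kern e a) x)) = (LINT x|lebesgue. comm e a x)"
  "integrable lebesgue (\<lambda>x. \<eta> x * (- lap (kern e a) x))"
proof -
 have i: "integrable lebesgue (\<lambda>x. \<eta> x * lap (kern e a) x)"
  using integrable_test[OF test_mult[OF \<eta>_test smooth_lap[OF smooth_kern[OF assms]]]] by (simp add: mult.commute)
 then show "integrable lebesgue (\<lambda>x. \<eta> x * (- lap (kern e a) x))" by simp
 have "0 = (LINT x|lebesgue. lap (H e a) x)" by (rule integral_lap_eq_0[OF H_test[OF assms], symmetric])
 also have "\<dots> = (LINT x|lebesgue. \<eta> x * lap (kern e a) x) + (LINT x|lebesgue. comm e a x)"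
  unfolding lap_H[OF assms] using i integrable_test[OF comm_test[OF assms]] by simp
 finally show "(LINT x|lebesgue. \<eta> x * (- lap (kern e a) x)) = (LINT x|lebesgue. comm e a x)" by simp
qed

text \<open>The cut off kernel \<open>- lap (kern e a1)\<close>: an approximate identity whose mass tends to a positive constant as \<open>e\<close> tends to \<open>0\<close>.\<close>

definition kap :: "real \<Rightarrow> 'a \<Rightarrow> real" where
 "kap e x = \<eta> x * (N * (N - 2) * e^2 * kern e (a1 - 2) x)"

lemma lap_kern_a1: "e > 0 \<Longrightarrow> - lap (kern e a1) x = N * (N - 2) * e^2 * kern e (a1 - 2) (x :: 'a)"
proof -
 assume "e > 0"
 have *: "2 * (a1 - 1) + N = 0" "2 * a1 = - (N - 2)" by (auto simp: a1_def)
 show ?thesis using lap_kern[OF \<open>e > 0\<close>, of a1 x] unfolding N_def[symmetric] * by (simp add: algebra_simps)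
qed

lemma lap_H_a1: "e > 0 \<Longrightarrow> lap (H e a1) x = - kap e x + comm e a1 x"
 using lap_kern_a1[of e x] by (simp add: lap_H kap_def algebra_simps)

lemma lap_kern_a2: "e > 0 \<Longrightarrow> - lap (kern e a2) (x :: 'a) \<ge> - a2 * kern e (a2 - 1) x"
proof -
 assume e: "e > 0"
 have *: "2 * (a2 - 1) + N = 1/2" by (simp add: a2_def)
 have "- lap (kern e a2) x = (- a2) * (kern e (a2 - 2) x * (x \<bullet> x + 2 * N * e^2))"
  using lap_kern[OF e, of a2 x] unfolding N_def[symmetric] * by (simp add: algebra_simps)
 moreover have "kern e (a2 - 1) x = kern e (a2 - 2) x * (x \<bullet> x + e^2)"
  using kern_step[OF e, of "a2 - 1" x] by simp
 moreover have "x \<bullet> x + e^2 \<le> x \<bullet> x + 2 * N * e^2" using N3 by (simp add: mult_le_cancel_right1)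
 ultimately show ?thesis using N3 kern_nonneg[of e "a2 - 2" x]
  by (auto simp: a2_def intro!: mult_left_mono)
qed

lemma kap_nonneg: "kap e x \<ge> 0"
 using N3 \<eta>(2) kern_nonneg[of e "a1 - 2" x] by (auto simp: kap_def intro!: mult_nonneg_nonneg)

lemma kap_out: "norm x \<ge> r \<Longrightarrow> kap e x = 0"
 using \<eta>0 by (simp add: kap_def)

lemma kap_continuous: "e > 0 \<Longrightarrow> continuous_on UNIV (kap e)"
 unfolding kap_def[abs_def]
 by (intro continuous_intros smooth_continuous smooth_kern \<eta>)

lemma kap_mass: "e > 0 \<Longrightarrow> (LINT x|lebesgue. kap e x) = (LINT x|lebesgue. comm e a1 x)"
 using integral_H_identity(1)[of e a1] by (simp add: lap_kern_a1 kap_def)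

lemma kap_small:
 assumes "e > 0" "d > 0" "norm x \<ge> d"
 shows "kap e x \<le> N * (N - 2) * e^2 * (d^2) powr (a1 - 2)"
proof -
 have "d^2 \<le> (norm x)^2" using assms by (intro power_mono) auto
 then have "d^2 \<le> x \<bullet> x + e^2" by (simp add: power2_norm_eq_inner add_increasing2)
 then have k: "kern e (a1 - 2) x \<le> (d^2) powr (a1 - 2)"
  using assms N3 by (intro kern_antimono) (auto simp: a1_def)
 have "kap e x \<le> 1 * (N * (N - 2) * e^2 * (d^2) powr (a1 - 2))" unfolding kap_def
  using N3 kern_nonneg[of e "a1 - 2" x]
  by (intro mult_mono[OF \<eta>(3) mult_left_mono[OF k]]) (auto intro!: mult_nonneg_nonneg)
 then show ?thesis by simp
qed

definition eps :: "nat \<Rightarrow> real" where "eps n = (r / 2) / real (Suc n)"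

lemma eps_pos: "eps n > 0" using r by (simp add: eps_def)

lemma eps_le: "eps n \<le> r / 2" using r by (simp add: eps_def divide_simps)

lemma eps_lim: "eps \<longlonglongrightarrow> 0"
 unfolding eps_def[abs_def] by real_asymp

definition c0 :: real where "c0 = (LINT x|lebesgue. comm 0 a1 x)"

lemma a1_le: "a1 \<le> 0" and a2_neg: "a2 < 0" using N3 by (auto simp: a1_def a2_def)

lemma kap_mass_lim: "(\<lambda>n. LINT x|lebesgue. kap (eps n) x) \<longlonglongrightarrow> c0"
 using integral_comm_tendsto[OF a1_le eps_lim eps_pos] by (simp add: kap_mass[OF eps_pos] c0_def)

text \<open>By scaling, the mass inside the ball of radius \<open>e\<close> does not depend on \<open>e\<close>.\<close>

lemma c0_pos: "c0 > 0"
proof -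
 define m where "m = N * (N - 2) * 2 powr (a1 - 2) * unit_ball_vol N"
 have m: "m > 0" unfolding m_def using N3 by (intro mult_pos_pos unit_ball_vol_pos) auto
 have "m \<le> (LINT x|lebesgue. kap (eps n) x)" for n
 proof -
  define e where "e = eps n"
  have e: "e > 0" "e \<le> r / 2" using eps_pos eps_le by (auto simp: e_def)
  have "N * (N - 2) * e^2 * (2 * e^2) powr (a1 - 2) * measure lebesgue (cball (0::'a) e)
    = (LINT x|lebesgue. (N * (N - 2) * e^2 * (2 * e^2) powr (a1 - 2)) * indicator (cball (0::'a) e) x)"
   by simp
  also have "\<dots> \<le> (LINT x|lebesgue. kap e x)"
  proof (rule integral_mono)
   show "integrable lebesgue (\<lambda>x. (N * (N - 2) * e^2 * (2 * e^2) powr (a1 - 2)) * indicator (cball (0::'a) e) x)"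
    by (rule integrable_mult_right) (rule integrable_indicator_compact[OF compact_cball])
   show "integrable lebesgue (kap e)"
    using integral_H_identity(2)[OF e(1), of a1] by (simp add: lap_kern_a1[OF e(1)] kap_def[abs_def])
   fix x :: 'a
   show "N * (N - 2) * e^2 * (2 * e^2) powr (a1 - 2) * indicator (cball 0 e) x \<le> kap e x"
   proof (cases "norm x \<le> e")
    case True
    then have "(norm x)^2 \<le> e^2" by (intro power_mono) auto
    then have "x \<bullet> x + e^2 \<le> 2 * e^2" by (simp add: power2_norm_eq_inner)
    then have "(2 * e^2) powr (a1 - 2) \<le> kern e (a1 - 2) x"
     unfolding kern_def using norm_sq_add_pos[OF e(1)] a1_le by (intro powr_mono2') auto
    moreover have "\<eta> x = 1" using True e \<eta>1 by simp
    ultimately show ?thesis using N3 True by (simp add: kap_def mult_left_mono)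
   qed (use kap_nonneg in auto)
  qed
  also have "measure lebesgue (cball (0::'a) e) = unit_ball_vol N * e powr N"
   using content_cball[of e "0::'a"] e by (simp add: N_def powr_realpow)
  also have "N * (N - 2) * e^2 * (2 * e^2) powr (a1 - 2) * (unit_ball_vol N * e powr N) = m"
  proof -
   have "(2 * e^2) powr (a1 - 2) = 2 powr (a1 - 2) * e powr (2 * (a1 - 2))"
    using e by (simp add: powr_mult powr_powr flip: powr_numeral)
   moreover have "e^2 * (e powr (2 * (a1 - 2)) * e powr N) = 1"
   proof -
    have "e^2 = e powr 2" using e by simp
    then have "e^2 * (e powr (2 * (a1 - 2)) * e powr N) = e powr (2 + (2 * (a1 - 2) + N))"
     by (simp only: powr_add)
    also have "2 + (2 * (a1 - 2) + N) = 0" by (simp add: a1_def)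
    finally show ?thesis using e by simp
   qed
   moreover have "A * s * (t * p) * (u * q) = A * t * u * (s * (p * q))" for A s t p u q :: real
    by (simp add: mult_ac)
   ultimately show ?thesis unfolding m_def by (simp only: mult_1_right)
  qed
  finally show ?thesis by (simp add: e_def)
 qed
 then have "m \<le> c0" by (intro LIMSEQ_le_const[OF kap_mass_lim]) auto
 with m show ?thesis by simp
qed

end

section \<open>Regularity of nonnegative weak solutions\<close>

text \<open>Both derivatives fall on the test function, so \<open>w\<close> needs no derivatives and \<open>U\<close> no continuity.\<close>

definition weak_sol :: "'a::euclidean_space set \<Rightarrow> ('a \<Rightarrow> real) \<Rightarrow> ('a \<Rightarrow> real) \<Rightarrow> bool" where
 "weak_sol \<Omega> U w \<longleftrightarrow>
   (\<forall>\<psi>\<in>test_functions \<Omega>. (LINT x|lebesgue. w x * (U x * \<psi> x - lap \<psi> x)) = 0)"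

lemma borel_imp_lebesgue: "f \<in> borel_measurable borel \<Longrightarrow> f \<in> borel_measurable lebesgue"
 by (auto intro!: measurable_completion)

lemma kern0_measurable: "kern e a \<in> borel_measurable borel"
 unfolding kern_def by measurable

context radial_cutoff
begin

text \<open>Testing minus the Laplacian of the regularized kernels with exponent \<open>a2\<close> bounds the integrals of
 the kernels with exponent \<open>a2 - 1\<close> uniformly; the bound passes to the singular kernel by Fatou.\<close>

lemma integrable_singular_kernel: "integrable lebesgue (\<lambda>z. \<eta> z * kern 0 (a2 - 1) z)"
proof -
 obtain C where C: "C \<ge> 0" "\<And>e x. \<bar>comm e a2 x\<bar> \<le> C" using comm_bound[of a2] a2_neg by fastforce
 define K where "K = C * measure lebesgue (cball (0::'a) r) / (- a2)"
 define f where "f n z = \<eta> z * kern (eps n) (a2 - 1) z" for n z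
 have fnn: "f n z \<ge> 0" for n z unfolding f_def by (intro mult_nonneg_nonneg \<eta> kern_nonneg)
 have fi: "integrable lebesgue (f n)" for n
  using integrable_test[OF test_mult[OF \<eta>_test smooth_kern[OF eps_pos]]]
  by (simp add: f_def[abs_def] mult.commute)
 have fle: "(LINT z|lebesgue. f n z) \<le> K" for n
 proof -
  have "(- a2) * (LINT z|lebesgue. f n z) = (LINT z|lebesgue. (- a2) * f n z)" by simp
  also have "\<dots> \<le> (LINT z|lebesgue. \<eta> z * (- lap (kern (eps n) a2) z))"
  proof (rule integral_mono)
   show "integrable lebesgue (\<lambda>z. (- a2) * f n z)" using fi by simp
   show "integrable lebesgue (\<lambda>z. \<eta> z * (- lap (kern (eps n) a2) z))"
    by (rule integral_H_identity(2)[OF eps_pos])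
   show "(- a2) * f n z \<le> \<eta> z * (- lap (kern (eps n) a2) z)" for z
    using mult_left_mono[OF lap_kern_a2[OF eps_pos, of n z] \<eta>(2)[of z]] by (simp add: f_def algebra_simps)
  qed
  also have "\<dots> = (LINT z|lebesgue. comm (eps n) a2 z)" by (rule integral_H_identity(1)[OF eps_pos])
  also have "\<dots> \<le> (LINT z|lebesgue. C * indicator (cball (0::'a) r) z)"
  proof (rule integral_mono)
   show "integrable lebesgue (comm (eps n) a2)" by (rule integrable_test[OF comm_test[OF eps_pos]])
   show "integrable lebesgue (\<lambda>z. C * indicator (cball (0::'a) r) z)"
    by (rule integrable_mult_right) (rule integrable_indicator_compact[OF compact_cball])
   show "comm (eps n) a2 z \<le> C * indicator (cball (0::'a) r) z" for z
    using C(2)[of "eps n" z] comm_out[of z "eps n" a2] by (cases "norm z \<le> r") auto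
  qed
  also have "\<dots> = C * measure lebesgue (cball (0::'a) r)" by simp
  finally show ?thesis unfolding K_def
   by (subst pos_le_divide_eq) (use a2_neg in \<open>auto simp: mult.commute\<close>)
 qed
 show ?thesis
 proof (rule integrableI_nonneg)
  show "(\<lambda>z. \<eta> z * kern 0 (a2 - 1) z) \<in> borel_measurable lebesgue"
   by (intro borel_measurable_times borel_imp_lebesgue[OF kern0_measurable]
     continuous_measurable_lebesgue[OF smooth_continuous[OF \<eta>(1)]])
  show "AE z in lebesgue. 0 \<le> \<eta> z * kern 0 (a2 - 1) z"
   by (intro AE_I2 mult_nonneg_nonneg \<eta> kern_nonneg)
  have "(\<integral>\<^sup>+ z. ennreal (\<eta> z * kern 0 (a2 - 1) z) \<partial>lebesgue) \<le> (\<integral>\<^sup>+ z. liminf (\<lambda>n. ennreal (f n z)) \<partial>lebesgue)"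
  proof (rule nn_integral_mono)
   fix z :: 'a
   show "ennreal (\<eta> z * kern 0 (a2 - 1) z) \<le> liminf (\<lambda>n. ennreal (f n z))"
   proof (cases "z = 0")
    case True
    then show ?thesis by (simp add: kern_def)
   next
    case False
    then have "(\<lambda>n. f n z) \<longlonglongrightarrow> \<eta> z * kern 0 (a2 - 1) z"
     unfolding f_def by (intro tendsto_intros kern_tendsto eps_lim)
    then have "(\<lambda>n. ennreal (f n z)) \<longlonglongrightarrow> ennreal (\<eta> z * kern 0 (a2 - 1) z)"
     by (rule tendsto_ennrealI)
    then show ?thesis by (simp add: lim_imp_Liminf)
   qed
  qed
  also have "\<dots> \<le> liminf (\<lambda>n. \<integral>\<^sup>+ z. ennreal (f n z) \<partial>lebesgue)"
   by (rule nn_integral_liminf) (use fi in \<open>auto intro!: measurable_compose[OF borel_measurable_integrable measurable_ennreal]\<close>)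
  also have "\<dots> \<le> liminf (\<lambda>n. ennreal K)"
   by (intro Liminf_mono always_eventually allI)
     (use fi fnn fle in \<open>simp add: nn_integral_eq_integral ennreal_leI\<close>)
  also have "\<dots> < \<infinity>" by (simp add: Liminf_const)
  finally show "(\<integral>\<^sup>+ z. ennreal (\<eta> z * kern 0 (a2 - 1) z) \<partial>lebesgue) < \<infinity>" .
 qed
qed

lemma AE_nonzero: "AE z in lebesgue. z \<noteq> (0::'a)"
proof -
 have "{0::'a} \<in> null_sets lebesgue" by (simp add: negligible_iff_null_sets[symmetric])
 then show ?thesis using AE_not_in[of "{0::'a}" lebesgue] by simp
qed

lemma kern_le_kern0: "a \<le> 0 \<Longrightarrow> z \<noteq> 0 \<Longrightarrow> kern e a z \<le> kern 0 a (z :: 'a)"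
 using kern_antimono[of a "z \<bullet> z" z e] by (simp add: kern_def)

lemma kern0_split: "kern 0 (a + b) z = kern 0 a z * kern 0 b (z :: 'a)"
 by (simp add: kern_def powr_add)

definition grad_H0 :: "'a \<Rightarrow> 'a \<Rightarrow> real" where
 "grad_H0 b z = partial b \<eta> z * kern 0 a1 z + \<eta> z * (2 * a1 * (z \<bullet> b) * kern 0 (a1 - 1) z)"

lemma partial_H:
 "e > 0 \<Longrightarrow> partial b (H e a) z = partial b \<eta> z * kern e a z + \<eta> z * (2 * a * (z \<bullet> b) * kern e (a - 1) z)"
 unfolding H_def[abs_def]
 by (simp add: partial_mult[OF smooth_differentiable[OF \<eta>(1)] smooth_differentiable[OF smooth_kern]] partial_kern)

text \<open>The exponents \<open>a1\<close> and \<open>a1 - 1/2\<close> of the kernel and of its gradient exceed the exponent \<open>a2 - 1\<close> of the integrable kernel, by \<open>3/4\<close> and \<open>1/4\<close>.\<close>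

lemma kernel_dominated:
 obtains B where "integrable lebesgue B"
  "\<And>e z. z \<noteq> 0 \<Longrightarrow> \<bar>H e a1 z\<bar> \<le> B z"
  "\<And>e b z. b \<in> Basis \<Longrightarrow> z \<noteq> 0 \<Longrightarrow>
    \<bar>partial b \<eta> z * kern e a1 z + \<eta> z * (2 * a1 * (z \<bullet> b) * kern e (a1 - 1) z)\<bar> \<le> B z"
proof -
 define w where "w z = \<eta> z * kern 0 (a2 - 1) z" for z
 have wnn: "w z \<ge> 0" for z unfolding w_def by (intro mult_nonneg_nonneg \<eta> kern_nonneg)
 have "\<forall>b\<in>Basis. \<exists>c>0. \<forall>x. \<bar>partial b \<eta> x\<bar> \<le> c"
 proof
  fix b :: 'a assume b: "b \<in> Basis"
  show "\<exists>c>0. \<forall>x. \<bar>partial b \<eta> x\<bar> \<le> c"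
   using compact_support_bound[OF test_continuous[OF test_partial[OF \<eta>_test b]]]
    test_support[OF test_partial[OF \<eta>_test b]] by blast
 qed
 from bchoice[OF this] obtain c where c: "\<forall>b\<in>Basis. c b > 0 \<and> (\<forall>x. \<bar>partial b \<eta> x\<bar> \<le> c b)" ..
 define m where "m = (\<Sum>b\<in>Basis. c b)"
 have m: "\<bar>partial b \<eta> x\<bar> \<le> m" if b: "b \<in> Basis" for b x
 proof -
  have "c b \<le> m" unfolding m_def by (rule member_le_sum) (use b c in \<open>auto intro: less_imp_le\<close>)
  moreover have "\<bar>partial b \<eta> x\<bar> \<le> c b" using b c by blast
  ultimately show ?thesis by linarith
 qed
 have m0: "m \<ge> 0" unfolding m_def by (rule sum_nonneg) (use c in \<open>auto intro: less_imp_le\<close>)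
 define m1 where "m1 = m * (r^2/4) powr a1"
 define m2 where "m2 = 2 * \<bar>a1\<bar> * (r^2) powr (1/4)"
 define m3 where "m3 = (r^2) powr (3/4)"
 have m123: "m1 \<ge> 0" "m2 \<ge> 0" "m3 \<ge> 0" using m0 by (auto simp: m1_def m2_def m3_def)
 define B where "B z = m1 * indicator (cball (0::'a) r) z + (m2 + m3) * w z" for z
 have w0: "kern 0 p z \<le> (r^2) powr p" if "norm z \<le> r" "p > 0" for z :: 'a and p
 proof -
  have "z \<bullet> z \<le> r^2" using that power_mono[of "norm z" r 2] by (simp add: power2_norm_eq_inner)
  then show ?thesis using that(2) by (simp add: kern_def powr_mono2)
 qed
 show ?thesis
 proof (rule that[of B])
  show "integrable lebesgue B" unfolding B_def w_def
   by (intro Bochner_Integration.integrable_add integrable_mult_right integrable_singular_kernel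
     integrable_indicator_compact compact_cball)
  fix e and z :: 'a assume z: "z \<noteq> 0"
  have B3: "m3 * w z \<le> B z" "m2 * w z + m1 * indicator (cball (0::'a) r) z \<le> B z"
   using m123 wnn[of z] by (auto simp: B_def algebra_simps)
  show "\<bar>H e a1 z\<bar> \<le> B z"
  proof (cases "norm z \<le> r")
   case True
   have "kern e a1 z \<le> kern 0 a1 z" by (rule kern_le_kern0[OF a1_le z])
   also have "\<dots> = kern 0 (a2 - 1) z * kern 0 (3/4) z"
    using kern0_split[of "a2 - 1" "3/4" z] by (simp add: a1_def a2_def)
   also have "\<dots> \<le> kern 0 (a2 - 1) z * m3"
    unfolding m3_def by (rule mult_left_mono[OF w0[OF True]]) (auto simp: kern_nonneg)
   finally have "\<eta> z * kern e a1 z \<le> \<eta> z * (kern 0 (a2 - 1) z * m3)" by (rule mult_left_mono) (rule \<eta>)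
   then have "\<eta> z * kern e a1 z \<le> m3 * w z" by (simp add: w_def mult_ac)
   with B3 show ?thesis by (simp add: H_def abs_mult \<eta> kern_nonneg)
  next
   case False
   then have "H e a1 z = 0" by (intro H_out) simp
   moreover have "0 \<le> B z" using m123 wnn[of z] by (simp add: B_def)
   ultimately show ?thesis by simp
  qed
  fix b :: 'a assume b: "b \<in> Basis"
  have p1: "\<bar>partial b \<eta> z * kern e a1 z\<bar> \<le> m1 * indicator (cball (0::'a) r) z"
  proof (cases "norm z < r / 2 \<or> norm z > r")
   case True
   then have "partial b \<eta> z = 0" using partial_\<eta>_in partial_\<eta>_out by blast
   then show ?thesis using m123 by simp
  next
   case False
   then have k: "kern e a1 z \<le> (r^2/4) powr a1"
    using shell_lower[of z e] r a1_le by (intro kern_antimono) auto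
   show ?thesis using False mult_mono[OF m[OF b, of z] k m0 kern_nonneg]
    by (simp add: m1_def abs_mult kern_nonneg)
  qed
  have p2: "\<bar>\<eta> z * (2 * a1 * (z \<bullet> b) * kern e (a1 - 1) z)\<bar> \<le> m2 * w z"
  proof (cases "norm z \<le> r")
   case True
   have nz: "norm z = kern 0 (1/2) z"
    by (simp add: kern_def norm_eq_sqrt_inner powr_half_sqrt)
   have "\<bar>z \<bullet> b\<bar> \<le> kern 0 (1/2) z" using Basis_le_norm[OF b, of z] nz by simp
   moreover have "kern e (a1 - 1) z \<le> kern 0 (a1 - 1) z" using a1_le z by (intro kern_le_kern0) auto
   ultimately have "\<bar>z \<bullet> b\<bar> * kern e (a1 - 1) z \<le> kern 0 (1/2) z * kern 0 (a1 - 1) z"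
    by (intro mult_mono) (auto simp: kern_nonneg)
   also have "\<dots> = kern 0 (a2 - 1) z * kern 0 (1/4) z"
    using kern0_split[of "1/2" "a1 - 1" z] kern0_split[of "a2 - 1" "1/4" z] by (simp add: a1_def a2_def)
   also have "\<dots> \<le> kern 0 (a2 - 1) z * (r^2) powr (1/4)"
    by (rule mult_left_mono[OF w0[OF True]]) (auto simp: kern_nonneg)
   finally have "(2 * \<bar>a1\<bar> * \<eta> z) * (\<bar>z \<bullet> b\<bar> * kern e (a1 - 1) z)
     \<le> (2 * \<bar>a1\<bar> * \<eta> z) * (kern 0 (a2 - 1) z * (r^2) powr (1/4))"
    by (rule mult_left_mono) (simp add: \<eta>)
   then show ?thesis by (simp add: abs_mult \<eta> kern_nonneg m2_def w_def mult_ac)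
  next
   case False
   then show ?thesis using \<eta>0 m123 wnn[of z] by simp
  qed
  show "\<bar>partial b \<eta> z * kern e a1 z + \<eta> z * (2 * a1 * (z \<bullet> b) * kern e (a1 - 1) z)\<bar> \<le> B z"
   using abs_triangle_ineq[of "partial b \<eta> z * kern e a1 z" "\<eta> z * (2 * a1 * (z \<bullet> b) * kern e (a1 - 1) z)"]
    p1 p2 B3(2) by linarith
 qed
qed

lemma L1_tendsto_zero:
 fixes f :: "nat \<Rightarrow> 'a \<Rightarrow> real"
 assumes B: "integrable lebesgue B"
  and f: "\<And>n. f n \<in> borel_measurable borel" "f0 \<in> borel_measurable borel"
  and b: "\<And>n z. z \<noteq> 0 \<Longrightarrow> \<bar>f n z\<bar> \<le> B z" "\<And>z. z \<noteq> 0 \<Longrightarrow> \<bar>f0 z\<bar> \<le> B z"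
  and l: "\<And>z. z \<noteq> 0 \<Longrightarrow> (\<lambda>n. f n z) \<longlonglongrightarrow> f0 z"
 shows "(\<lambda>n. LINT z|lebesgue. \<bar>f n z - f0 z\<bar>) \<longlonglongrightarrow> 0" "integrable lebesgue f0"
proof -
 have m: "f n \<in> borel_measurable lebesgue" "f0 \<in> borel_measurable lebesgue" for n
  using f by (auto intro: measurable_completion)
 have "(\<lambda>n. LINT z|lebesgue. \<bar>f n z - f0 z\<bar>) \<longlonglongrightarrow> (\<integral>z. (0::real) \<partial>(lebesgue :: 'a measure))"
 proof (rule integral_dominated_convergence)
  show "integrable lebesgue (\<lambda>z. 2 * B z)" using B by simp
  show "(\<lambda>z. \<bar>f n z - f0 z\<bar>) \<in> borel_measurable lebesgue" for n
   by (intro borel_measurable_abs borel_measurable_diff m)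
  show "AE z in lebesgue. (\<lambda>n. \<bar>f n z - f0 z\<bar>) \<longlonglongrightarrow> 0"
   using AE_nonzero
  proof (rule AE_mp, intro AE_I2 impI)
   fix z :: 'a assume "z \<noteq> 0"
   from LIM_zero[OF l[OF this]] show "(\<lambda>n. \<bar>f n z - f0 z\<bar>) \<longlonglongrightarrow> 0"
    by (rule tendsto_rabs_zero)
  qed
  show "AE z in lebesgue. norm \<bar>f n z - f0 z\<bar> \<le> 2 * B z" for n
   using AE_nonzero
  proof (rule AE_mp, intro AE_I2 impI)
   fix z :: 'a assume z: "z \<noteq> 0"
   show "norm \<bar>f n z - f0 z\<bar> \<le> 2 * B z" using b(1)[OF z, of n] b(2)[OF z] by simp
  qed
 qed simp
 then show "(\<lambda>n. LINT z|lebesgue. \<bar>f n z - f0 z\<bar>) \<longlonglongrightarrow> 0" by simp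
 show "integrable lebesgue f0"
 proof (rule Bochner_Integration.integrable_bound[OF B m(2)])
  show "AE z in lebesgue. norm (f0 z) \<le> norm (B z)"
   using AE_nonzero
  proof (rule AE_mp, intro AE_I2 impI)
   fix z :: 'a assume z: "z \<noteq> 0"
   show "norm (f0 z) \<le> norm (B z)" using b(2)[OF z] by simp
  qed
 qed
qed

lemma
 shows H_L1: "(\<lambda>n. LINT z|lebesgue. \<bar>H (eps n) a1 z - H 0 a1 z\<bar>) \<longlonglongrightarrow> 0"
  and H0_integrable: "integrable lebesgue (H 0 a1)"
  and H0_measurable: "H 0 a1 \<in> borel_measurable borel"
  and partial_H_L1: "b \<in> Basis \<Longrightarrow> (\<lambda>n. LINT z|lebesgue. \<bar>partial b (H (eps n) a1) z - grad_H0 b z\<bar>) \<longlonglongrightarrow> 0"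
  and grad_H0_integrable: "b \<in> Basis \<Longrightarrow> integrable lebesgue (grad_H0 b)"
  and grad_H0_measurable: "b \<in> Basis \<Longrightarrow> grad_H0 b \<in> borel_measurable borel"
proof -
 obtain B where B: "integrable lebesgue B"
  "\<And>e z. z \<noteq> 0 \<Longrightarrow> \<bar>H e a1 z\<bar> \<le> B z"
  "\<And>e b z. b \<in> Basis \<Longrightarrow> z \<noteq> 0 \<Longrightarrow>
    \<bar>partial b \<eta> z * kern e a1 z + \<eta> z * (2 * a1 * (z \<bullet> b) * kern e (a1 - 1) z)\<bar> \<le> B z"
  using kernel_dominated by metis
 have m\<eta>: "\<eta> \<in> borel_measurable borel" by (rule borel_measurable_continuous_onI[OF smooth_continuous[OF \<eta>(1)]])
 have m: "H e a1 \<in> borel_measurable borel" for e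
  unfolding H_def[abs_def] by (rule borel_measurable_times[OF m\<eta> kern0_measurable])
 show "H 0 a1 \<in> borel_measurable borel" by (rule m)
 have l: "(\<lambda>n. H (eps n) a1 z) \<longlonglongrightarrow> H 0 a1 z" if "z \<noteq> 0" for z
  unfolding H_def by (intro tendsto_intros kern_tendsto that eps_lim)
 show "(\<lambda>n. LINT z|lebesgue. \<bar>H (eps n) a1 z - H 0 a1 z\<bar>) \<longlonglongrightarrow> 0" "integrable lebesgue (H 0 a1)"
  using L1_tendsto_zero[OF B(1) m m B(2) B(2) l] by blast+
 assume b: "b \<in> Basis"
 have mp: "partial b (H (eps n) a1) \<in> borel_measurable borel" for n
  by (rule borel_measurable_continuous_onI[OF test_continuous[OF test_partial[OF H_test[OF eps_pos] b]]])
 show mg: "grad_H0 b \<in> borel_measurable borel"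
  unfolding grad_H0_def[abs_def]
  using borel_measurable_continuous_onI[OF test_continuous[OF test_partial[OF \<eta>_test b]]] m\<eta>
   kern0_measurable[of 0 a1, where ?'a = 'a] kern0_measurable[of 0 "a1 - 1", where ?'a = 'a] by measurable
 have B3: "\<bar>partial b (H (eps n) a1) z\<bar> \<le> B z" if "z \<noteq> 0" for n z
  using B(3)[OF b that, of "eps n"] by (simp add: partial_H[OF eps_pos])
 have B4: "\<bar>grad_H0 b z\<bar> \<le> B z" if "z \<noteq> 0" for z
  using B(3)[OF b that, of 0] by (simp add: grad_H0_def)
 have lp: "(\<lambda>n. partial b (H (eps n) a1) z) \<longlonglongrightarrow> grad_H0 b z" if "z \<noteq> 0" for z
  unfolding partial_H[OF eps_pos] grad_H0_def by (intro tendsto_intros kern_tendsto that eps_lim)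
 show "(\<lambda>n. LINT z|lebesgue. \<bar>partial b (H (eps n) a1) z - grad_H0 b z\<bar>) \<longlonglongrightarrow> 0" "integrable lebesgue (grad_H0 b)"
  using L1_tendsto_zero[OF B(1) mp mg B3 B4 lp] by blast+
qed

lemma kap_test: "e > 0 \<Longrightarrow> kap e \<in> test_functions UNIV"
 unfolding kap_def[abs_def]
 using test_mult[OF \<eta>_test smooth_cmult[OF smooth_kern[of e "a1 - 2"], of "N * (N - 2) * e^2"]]
 by (simp add: mult.commute)

lemma kap_conc:
 assumes "d > 0" "e > 0"
 shows "\<forall>\<^sub>F n in sequentially. \<forall>z. d \<le> norm z \<longrightarrow> kap (eps n) z \<le> e"
proof -
 have "(\<lambda>n. N * (N - 2) * (eps n)^2 * (d^2) powr (a1 - 2)) \<longlonglongrightarrow> N * (N - 2) * 0^2 * (d^2) powr (a1 - 2)"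
  by (intro tendsto_intros eps_lim)
 then have "\<forall>\<^sub>F n in sequentially. N * (N - 2) * (eps n)^2 * (d^2) powr (a1 - 2) < e"
  using order_tendstoD(2)[of _ "N * (N - 2) * 0^2 * (d^2) powr (a1 - 2)" sequentially e] assms(2) by simp
 then show ?thesis
  by (rule eventually_mono) (use kap_small[OF eps_pos assms(1)] in \<open>meson less_imp_le order_trans\<close>)
qed

lemma kap_weak:
 assumes "integrable lebesgue g" "\<theta> \<in> test_functions UNIV"
 shows "(\<lambda>n. LINT y|lebesgue. \<theta> y * (LINT x|lebesgue. g x * kap (eps n) (x - y)))
      \<longlonglongrightarrow> c0 * (LINT x|lebesgue. g x * \<theta> x)"
 by (rule approximate_identity_weak[where r = r, OF assms])
   (auto simp: kap_continuous[OF eps_pos] kap_nonneg kap_out kap_conc kap_mass_lim)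

lemma shift_test:
 assumes "f \<in> test_functions UNIV" "\<And>z. norm z > r \<Longrightarrow> f z = 0" "cball y r \<subseteq> \<Omega>"
 shows "(\<lambda>x. f (x - y)) \<in> test_functions \<Omega>"
proof (rule test_functionsI[where K = "cball y r"])
 show "smooth (\<lambda>x. f (x - y))" by (rule smooth_shift[OF test_smooth[OF assms(1)]])
 show "f (x - y) = 0" if "x \<notin> cball y r" for x
  using that by (intro assms(2)) (simp add: dist_norm norm_minus_commute)
qed (use assms in auto)

lemma cball_shift: "y \<in> ball x0 r \<Longrightarrow> cball y r \<subseteq> cball (x0::'a) (2 * r)"
 by (auto simp: dist_norm) (smt (verit) norm_triangle_ineq4 norm_minus_commute dist_norm dist_triangle)

text \<open>Testing with the sum of two translated kernels: the strictly positive part of minus the Laplacian of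
 the second kernel absorbs the potential, so the mollified solution is bounded by the integral of the solution.\<close>

lemma nonneg_weak_sol_locally_bounded:
 fixes x0 :: 'a
 assumes sub: "cball x0 (2 * r) \<subseteq> \<Omega>" and w: "locint \<Omega> w" "locint \<Omega> (\<lambda>x. U x * w x)" "weak_sol \<Omega> U w"
  and nn: "AE x in lebesgue. x \<in> \<Omega> \<longrightarrow> 0 \<le> w x"
  and U: "AE x in lebesgue. x \<in> cball x0 (2 * r) \<longrightarrow> \<bar>U x\<bar> \<le> K"
  and K: "K \<ge> 0" "K * ((2 * r^2) powr (3/4) + 2 * r^2) \<le> 1/4"
 shows "\<exists>M. AE x in lebesgue. x \<in> ball x0 r \<longrightarrow> w x \<le> M"
proof -
 obtain C1 where C1: "C1 \<ge> 0" "\<And>e x. \<bar>comm e a1 x\<bar> \<le> C1" using comm_bound[OF a1_le] by blast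
 obtain C2 where C2: "C2 \<ge> 0" "\<And>e x. \<bar>comm e a2 x\<bar> \<le> C2" using comm_bound[of a2] a2_neg by fastforce
 define C where "C = C1 + C2"
 define Q where "Q = cball x0 (2 * r)"
 define g where "g x = indicator Q x * w x" for x
 have gi: "integrable lebesgue g" unfolding g_def[abs_def] using w(1) sub by (simp add: locint_def Q_def)
 have gnn: "AE x in lebesgue. 0 \<le> g x"
  by (rule eventually_mono[OF nn]) (use sub in \<open>auto simp: g_def Q_def indicator_def\<close>)
 have bound: "(LINT x|lebesgue. g x * kap (eps n) (x - y)) \<le> C * (LINT x|lebesgue. g x)" if y: "y \<in> ball x0 r" for n and y :: 'a
 proof -
  define e where "e = eps n"
  have e: "e > 0" "e \<le> r / 2" using eps_pos eps_le by (auto simp: e_def)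
  have yQ: "cball y r \<subseteq> Q" unfolding Q_def by (rule cball_shift[OF y])
  then have yO: "cball y r \<subseteq> \<Omega>" using sub by (auto simp: Q_def)
  define P where "P z = H e a1 z + H e a2 z" for z
  have Pt: "P \<in> test_functions UNIV" unfolding P_def[abs_def] by (intro test_add H_test e)
  have P_out: "P z = 0" if "norm z > r" for z using that by (simp add: P_def H_out)
  define \<psi> where "\<psi> x = P (x - y)" for x
  have psi: "\<psi> \<in> test_functions \<Omega>" unfolding \<psi>_def[abs_def] by (rule shift_test[OF Pt P_out yO])
  have lapP: "lap P z = lap (H e a1) z + lap (H e a2) z" for z
  proof -
   note d = smooth_differentiable[OF test_smooth[OF H_test[OF e(1)]]]
   have "partial b P = (\<lambda>z. partial b (H e a1) z + partial b (H e a2) z)" for b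
    unfolding P_def[abs_def] by (rule ext) (rule partial_add[OF d d])
   then have "partial b (partial b P) z = partial b (partial b (H e a1)) z + partial b (partial b (H e a2)) z"
    if "b \<in> Basis" for b
    by (simp only:) (rule partial_add[OF smooth_differentiable smooth_differentiable];
      rule smooth_partial[OF test_smooth[OF H_test[OF e(1)]] that])
   then show ?thesis by (simp add: lap_def sum.distrib)
  qed
  have low: "- K * P z - lap P z \<ge> kap e z - C * indicator (cball 0 r) z" for z
  proof (cases "norm z \<le> r")
   case False
   then have "P z = 0" "lap P z = 0" "kap e z = 0"
    using partial_zero_outside[of "cball 0 r" _ 0 z]
    by (auto simp: P_out kap_out lapP lap_H[OF e(1)] comm_out \<eta>0)
   then show ?thesis using False by simp
  next
   case True
   define s where "s = z \<bullet> z + e^2"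
   have s0: "s > 0" unfolding s_def by (rule norm_sq_add_pos[OF e(1)])
   have "(norm z)^2 \<le> r^2" using True by (intro power_mono) auto
   moreover have "e^2 \<le> r^2" using e r by (intro power_mono) auto
   ultimately have s2: "s \<le> 2 * r^2" by (simp add: s_def power2_norm_eq_inner)
   have k1: "kern e a1 z = kern e (a2 - 1) z * s powr (3/4)"
    by (simp add: kern_def s_def[symmetric] a1_def a2_def flip: powr_add)
   have k2: "kern e a2 z = kern e (a2 - 1) z * s" using kern_step[OF e(1), of a2 z] by (simp add: s_def)
   have "K * (s powr (3/4) + s) \<le> K * ((2 * r^2) powr (3/4) + 2 * r^2)"
    using s0 s2 K(1) by (intro mult_left_mono add_mono powr_mono2) auto
   also have "\<dots> \<le> - a2" using K(2) N3 by (simp add: a2_def)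
   finally have "kern e (a2 - 1) z * (K * (s powr (3/4) + s)) \<le> kern e (a2 - 1) z * (- a2)"
    by (rule mult_left_mono) (rule kern_nonneg)
   then have "K * (kern e a1 z + kern e a2 z) \<le> - a2 * kern e (a2 - 1) z"
    by (simp add: k1 k2 algebra_simps)
   also have "\<dots> \<le> - lap (kern e a2) z" by (rule lap_kern_a2[OF e(1)])
   finally have "\<eta> z * (K * (kern e a1 z + kern e a2 z)) \<le> \<eta> z * (- lap (kern e a2) z)"
    by (rule mult_left_mono) (rule \<eta>)
   then have "K * P z \<le> \<eta> z * (- lap (kern e a2) z)" by (simp add: P_def H_def algebra_simps)
   moreover have "- lap P z = kap e z - comm e a1 z + \<eta> z * (- lap (kern e a2) z) - comm e a2 z"
    by (simp add: lapP lap_H_a1[OF e(1)] lap_H[OF e(1), of a2])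
   moreover have "\<bar>comm e a1 z\<bar> \<le> C1" "\<bar>comm e a2 z\<bar> \<le> C2" using C1 C2 by auto
   ultimately show ?thesis using True by (simp add: C_def)
  qed
  have Pnn: "P z \<ge> 0" for z by (simp add: P_def H_def \<eta> kern_nonneg)
  have kt: "(\<lambda>x. kap e (x - y)) \<in> test_functions \<Omega>"
   by (rule shift_test[OF kap_test[OF e(1)] _ yO]) (simp add: kap_out)
  have out: "x \<notin> Q \<Longrightarrow> norm (x - y) > r" for x
   using yQ by (force simp: dist_norm norm_minus_commute)
  have eq1: "w x * kap e (x - y) = g x * kap e (x - y)" for x
   using out[of x] by (cases "x \<in> Q") (auto simp: g_def kap_out)
  have int1: "integrable lebesgue (\<lambda>x. g x * kap e (x - y))"
   using locint_test[OF w(1) kt] by (simp add: eq1)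
  have int2: "integrable lebesgue (\<lambda>x. w x * (U x * \<psi> x - lap \<psi> x))"
   using locint_test[OF w(2) psi] locint_test[OF w(1) test_lap[OF psi]]
   by (simp add: right_diff_distrib mult_ac)
  have "(LINT x|lebesgue. g x * kap e (x - y) - C * g x) \<le> (LINT x|lebesgue. w x * (U x * \<psi> x - lap \<psi> x))"
  proof (rule integral_mono_AE)
   show "integrable lebesgue (\<lambda>x. g x * kap e (x - y) - C * g x)" using int1 gi by simp
   show "integrable lebesgue (\<lambda>x. w x * (U x * \<psi> x - lap \<psi> x))" by (rule int2)
   show "AE x in lebesgue. g x * kap e (x - y) - C * g x \<le> w x * (U x * \<psi> x - lap \<psi> x)"
    using U gnn
   proof eventually_elim
    case (elim x)
    show ?case
    proof (cases "x \<in> Q")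
     case False
     then have o: "norm (x - y) > r" by (rule out)
     have "lap P (x - y) = 0"
      using o by (simp add: lapP lap_H[OF e(1)] comm_out \<eta>0)
     then have "\<psi> x = 0" "lap \<psi> x = 0"
      using o lap_shift[OF test_smooth[OF Pt], of y x] by (auto simp: \<psi>_def[abs_def] P_out)
     then show ?thesis using False by (simp add: g_def)
    next
     case True
     then have ux: "\<bar>U x\<bar> \<le> K" and wx: "w x \<ge> 0" "g x = w x" using elim by (auto simp: Q_def g_def)
     have lx: "lap \<psi> x = lap P (x - y)" unfolding \<psi>_def[abs_def] by (rule lap_shift[OF test_smooth[OF Pt]])
     have "- K \<le> U x" using ux by linarith
     then have "- K * P (x - y) \<le> U x * P (x - y)" by (rule mult_right_mono) (rule Pnn)
     then have "U x * \<psi> x - lap \<psi> x \<ge> kap e (x - y) - C * indicator (cball 0 r) (x - y)"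
      using low[of "x - y"] unfolding lx by (simp add: \<psi>_def)
     moreover have "C * indicator (cball 0 r) (x - y) \<le> C"
      using C1(1) C2(1) by (simp add: C_def indicator_def)
     ultimately have "kap e (x - y) - C \<le> U x * \<psi> x - lap \<psi> x" by linarith
     then have "w x * (kap e (x - y) - C) \<le> w x * (U x * \<psi> x - lap \<psi> x)" by (rule mult_left_mono) (rule wx)
     then show ?thesis by (simp add: wx algebra_simps)
    qed
   qed
  qed
  also have "\<dots> = 0" using w(3) psi by (simp add: weak_sol_def)
  finally show ?thesis using int1 gi by (simp add: e_def)
 qed
 define M where "M = C * (LINT x|lebesgue. g x) / c0"
 have "AE x in lebesgue. x \<in> ball x0 r \<longrightarrow> 0 \<le> M - w x"
 proof (rule nonneg_AE_of_test_squares)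
  have bO: "ball x0 r \<subseteq> \<Omega>" using sub r by auto
  show "locint (ball x0 r) (\<lambda>x. M - w x)"
   by (intro locint_diff locint_continuous locint_mono[OF w(1) bO]) simp
  fix \<theta> assume th: "\<theta> \<in> test_functions (ball x0 r)"
  define t where "t y = (\<theta> y)^2" for y
  have tt: "t \<in> test_functions (ball x0 r)" unfolding t_def[abs_def] power2_eq_square by (rule test_mult[OF th test_smooth[OF th]])
  have tU: "t \<in> test_functions UNIV" by (rule test_mono[OF tt]) simp
  have t0: "t y = 0" if "y \<notin> ball x0 r" for y using test_support[OF tt] that by blast
  have "c0 * (LINT x|lebesgue. g x * t x) \<le> (LINT y|lebesgue. t y * (C * (LINT x|lebesgue. g x)))"
  proof (rule LIMSEQ_le_const2[OF kap_weak[OF gi tU]], intro exI allI impI)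
   fix n
   show "(LINT y|lebesgue. t y * (LINT x|lebesgue. g x * kap (eps n) (x - y))) \<le> (LINT y|lebesgue. t y * (C * (LINT x|lebesgue. g x)))"
   proof (rule integral_mono)
    show "integrable lebesgue (\<lambda>y. t y * (C * (LINT x|lebesgue. g x)))" using integrable_test[OF tU] by simp
    obtain L where L: "compact L" "\<forall>x. x \<notin> L \<longrightarrow> t x = 0" using test_support[OF tU] by blast
    show "integrable lebesgue (\<lambda>y. t y * (LINT x|lebesgue. g x * kap (eps n) (x - y)))"
     by (rule integrable_continuous_compact_support[OF _ L(1)])
       (use L in \<open>auto intro!: continuous_on_mult test_continuous[OF tU] convolution_continuous[OF gi kap_test[OF eps_pos]]\<close>)
    fix y show "t y * (LINT x|lebesgue. g x * kap (eps n) (x - y)) \<le> t y * (C * (LINT x|lebesgue. g x))"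
     using bound[of y n] t0[of y] by (cases "y \<in> ball x0 r") (auto simp: t_def intro: mult_left_mono)
   qed
  qed
  also have "\<dots> = c0 * (LINT y|lebesgue. M * t y)" using c0_pos by (simp add: M_def)
  finally have "(LINT x|lebesgue. g x * t x) \<le> (LINT y|lebesgue. M * t y)" using c0_pos by simp
  moreover have "(\<lambda>x. w x * t x) = (\<lambda>x. g x * t x)"
  proof
   fix x show "w x * t x = g x * t x"
    using t0[of x] r by (cases "x \<in> ball x0 r") (auto simp: g_def Q_def indicator_def)
  qed
  moreover have "integrable lebesgue (\<lambda>x. w x * t x)" by (rule locint_test[OF locint_mono[OF w(1) bO] tt])
  ultimately have "integrable lebesgue (\<lambda>x. w x * t x)" "(LINT x|lebesgue. w x * t x) \<le> (LINT y|lebesgue. M * t y)"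
   by (simp_all only:)
  then show "0 \<le> (LINT x|lebesgue. (M - w x) * (\<theta> x)^2)"
   using integrable_test[OF tU] by (simp add: t_def[symmetric] left_diff_distrib)
 qed simp
 then show ?thesis by (intro exI[of _ M]) simp
qed

text \<open>The mollifications of a locally bounded weak solution are convolutions of bounded functions with the
 commutator kernel and with the cut off fundamental solution; both converge in \<open>C\<^sup>1\<close>.\<close>

lemma bounded_weak_sol_C1:
 fixes x0 :: 'a
 assumes sub: "cball x0 (2 * r) \<subseteq> \<Omega>" and w: "locint \<Omega> w" "locint \<Omega> (\<lambda>x. U x * w x)" "weak_sol \<Omega> U w"
  and bw: "AE x in lebesgue. x \<in> cball x0 (2 * r) \<longrightarrow> \<bar>w x\<bar> \<le> M"
  and U: "AE x in lebesgue. x \<in> cball x0 (2 * r) \<longrightarrow> \<bar>U x\<bar> \<le> K"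
  and nn: "M \<ge> 0" "K \<ge> 0"
 shows "\<exists>v. C_k_on 1 UNIV v \<and> (AE x in lebesgue. x \<in> ball x0 r \<longrightarrow> w x = v x)"
proof -
 define Q where "Q = cball x0 (2 * r)"
 \<comment> \<open>Truncation changes the functions on a null set only and makes their bounds hold everywhere.\<close>
 define cut where "cut m t = max (-m) (min m t)" for m t :: real
 define g0 where "g0 x = indicator Q x * w x" for x
 define h0 where "h0 x = indicator Q x * (U x * w x)" for x
 define g where "g x = cut M (g0 x)" for x
 define h where "h x = cut (K * M) (h0 x)" for x
 have g0i: "integrable lebesgue g0" and h0i: "integrable lebesgue h0"
  unfolding g0_def[abs_def] h0_def[abs_def] using w sub by (simp_all add: locint_def Q_def)
 have gM: "\<bar>g x\<bar> \<le> M" and hM: "\<bar>h x\<bar> \<le> K * M" for x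
  using nn mult_nonneg_nonneg[OF nn(2,1)] by (auto simp: g_def h_def cut_def abs_le_iff)
 have gae: "AE x in lebesgue. g0 x = g x"
  by (rule eventually_mono[OF bw]) (use nn in \<open>auto simp: g_def g0_def cut_def Q_def indicator_def\<close>)
 have hae: "AE x in lebesgue. h0 x = h x"
  using bw U
 proof eventually_elim
  case (elim x)
  show ?case
  proof (cases "x \<in> Q")
   case True
   then have "\<bar>U x\<bar> * \<bar>w x\<bar> \<le> K * M" using elim nn by (intro mult_mono) (auto simp: Q_def)
   then have "\<bar>U x * w x\<bar> \<le> K * M" by (simp add: abs_mult)
   then show ?thesis using True by (auto simp: h_def h0_def cut_def)
  next
   case False
   then show ?thesis using mult_nonneg_nonneg[OF nn(2,1)] by (auto simp: h_def h0_def cut_def)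
  qed
 qed
 have gm: "g \<in> borel_measurable lebesgue" "h \<in> borel_measurable lebesgue"
  unfolding g_def[abs_def] h_def[abs_def] cut_def
  using borel_measurable_integrable[OF g0i] borel_measurable_integrable[OF h0i] by auto
 have gi: "integrable lebesgue g" and hi: "integrable lebesgue h"
  using integrable_cong_AE[OF borel_measurable_integrable[OF g0i] gm(1) gae] g0i
   integrable_cong_AE[OF borel_measurable_integrable[OF h0i] gm(2) hae] h0i by auto
 have repl: "(LINT x|lebesgue. g x * k (x - y)) = (LINT x|lebesgue. w x * k (x - y))"
   "integrable lebesgue (\<lambda>x. w x * k (x - y))"
   "(LINT x|lebesgue. h x * k (x - y)) = (LINT x|lebesgue. U x * w x * k (x - y))"
   "integrable lebesgue (\<lambda>x. U x * w x * k (x - y))"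
  if k: "k \<in> test_functions UNIV" "\<And>z. norm z > r \<Longrightarrow> k z = 0" and y: "y \<in> ball x0 r" for k and y :: 'a
 proof -
  have yQ: "cball y r \<subseteq> Q" unfolding Q_def by (rule cball_shift[OF y])
  then have yO: "cball y r \<subseteq> \<Omega>" using sub by (auto simp: Q_def)
  note kt = shift_test[OF k yO]
  show "integrable lebesgue (\<lambda>x. w x * k (x - y))" by (rule locint_test[OF w(1) kt])
  show "integrable lebesgue (\<lambda>x. U x * w x * k (x - y))" by (rule locint_test[OF w(2) kt])
  have out: "x \<notin> Q \<Longrightarrow> k (x - y) = 0" for x
   using yQ by (intro k(2)) (force simp: dist_norm norm_minus_commute)
  have mk: "(\<lambda>x. k (x - y)) \<in> borel_measurable lebesgue"
   by (rule continuous_measurable_lebesgue[OF test_continuous[OF kt]])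
  have "(LINT x|lebesgue. g x * k (x - y)) = (LINT x|lebesgue. g0 x * k (x - y))"
   by (rule integral_cong_AE)
     (use gae gm mk borel_measurable_integrable[OF g0i] in \<open>auto elim: eventually_mono\<close>)
  also have "(\<lambda>x. g0 x * k (x - y)) = (\<lambda>x. w x * k (x - y))"
  proof
   fix x show "g0 x * k (x - y) = w x * k (x - y)" using out[of x] by (cases "x \<in> Q") (auto simp: g0_def)
  qed
  finally show "(LINT x|lebesgue. g x * k (x - y)) = (LINT x|lebesgue. w x * k (x - y))" .
  have "(LINT x|lebesgue. h x * k (x - y)) = (LINT x|lebesgue. h0 x * k (x - y))"
   by (rule integral_cong_AE)
     (use hae gm mk borel_measurable_integrable[OF h0i] in \<open>auto elim: eventually_mono\<close>)
  also have "(\<lambda>x. h0 x * k (x - y)) = (\<lambda>x. U x * w x * k (x - y))"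
  proof
   fix x show "h0 x * k (x - y) = U x * w x * k (x - y)" using out[of x] by (cases "x \<in> Q") (auto simp: h0_def)
  qed
  finally show "(LINT x|lebesgue. h x * k (x - y)) = (LINT x|lebesgue. U x * w x * k (x - y))" .
 qed
 have ident: "(LINT x|lebesgue. g x * kap (eps n) (x - y))
   = (LINT x|lebesgue. g x * comm (eps n) a1 (x - y)) - (LINT x|lebesgue. h x * H (eps n) a1 (x - y))"
  if y: "y \<in> ball x0 r" for n and y :: 'a
 proof -
  note kr = repl[OF kap_test[OF eps_pos, of n] _ y]
  note cr = repl[OF comm_test[OF eps_pos, of n a1] _ y]
  note Hr = repl[OF H_test[OF eps_pos, of n a1] _ y]
  have yO: "cball y r \<subseteq> \<Omega>" using cball_shift[OF y] sub by auto
  define \<psi> where "\<psi> x = H (eps n) a1 (x - y)" for x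
  have psi: "\<psi> \<in> test_functions \<Omega>" unfolding \<psi>_def[abs_def]
   by (rule shift_test[OF H_test[OF eps_pos] _ yO]) (simp add: H_out)
  have lp: "lap \<psi> x = - kap (eps n) (x - y) + comm (eps n) a1 (x - y)" for x
   unfolding \<psi>_def[abs_def] lap_shift[OF test_smooth[OF H_test[OF eps_pos]]] by (rule lap_H_a1[OF eps_pos])
  have "w x * (U x * \<psi> x - lap \<psi> x) = U x * w x * H (eps n) a1 (x - y) + w x * kap (eps n) (x - y)
    - w x * comm (eps n) a1 (x - y)" for x unfolding lp by (simp add: \<psi>_def algebra_simps)
  moreover have "(LINT x|lebesgue. w x * (U x * \<psi> x - lap \<psi> x)) = 0"
   using w(3) psi unfolding weak_sol_def by blast
  ultimately have "0 = (LINT x|lebesgue. U x * w x * H (eps n) a1 (x - y) + w x * kap (eps n) (x - y)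
    - w x * comm (eps n) a1 (x - y))"
   by (simp only:)
  also have "\<dots> = (LINT x|lebesgue. U x * w x * H (eps n) a1 (x - y)) + (LINT x|lebesgue. w x * kap (eps n) (x - y))
    - (LINT x|lebesgue. w x * comm (eps n) a1 (x - y))"
   using kr(2) cr(2) Hr(4) by (simp add: kap_out comm_out H_out)
  finally show ?thesis using kr(1) cr(1) Hr(3) by (simp add: kap_out comm_out H_out)
 qed
 define v where "v y = (1 / c0) * ((LINT x|lebesgue. g x * comm 0 a1 (x - y)) + (-1) * (LINT x|lebesgue. h x * H 0 a1 (x - y)))" for y
 have "C_k_on 1 UNIV (\<lambda>y. LINT x|lebesgue. g x * comm 0 a1 (x - y))"
 proof (rule C_1_onI[where P = "\<lambda>b y. - (LINT x|lebesgue. g x * partial b (comm 0 a1) (x - y))"])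
  show "((\<lambda>y. LINT x|lebesgue. g x * comm 0 a1 (x - y)) has_derivative
    (\<lambda>h. \<Sum>b\<in>Basis. (h \<bullet> b) * - (LINT x|lebesgue. g x * partial b (comm 0 a1) (x - y)))) (at y)" for y
   using convolution_has_derivative[OF gi comm0_test, of a1 y] by (simp add: sum_negf)
  show "continuous_on UNIV (\<lambda>y. - (LINT x|lebesgue. g x * partial b (comm 0 a1) (x - y)))" if "b \<in> Basis" for b
   by (intro continuous_on_minus convolution_continuous[OF gi] test_partial[OF comm0_test that])
 qed
 moreover have W11: "C_k_on 1 UNIV (\<lambda>y. LINT x|lebesgue. h x * H 0 a1 (x - y))"
  "(\<lambda>n. LINT x|lebesgue. h x * H (eps n) a1 (x - y)) \<longlonglongrightarrow> (LINT x|lebesgue. h x * H 0 a1 (x - y))" for y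
  using convolution_W11_limit_C1[OF hi hM H_test[OF eps_pos] H0_measurable H0_integrable H_L1
    grad_H0_measurable grad_H0_integrable partial_H_L1] by blast+
 ultimately have vC1: "C_k_on 1 UNIV v" unfolding v_def[abs_def]
  by (intro C_k_on_mult C_k_on_add C_k_on_const)
 have glim: "(\<lambda>n. LINT x|lebesgue. g x * comm (eps n) a1 (x - y)) \<longlonglongrightarrow> (LINT x|lebesgue. g x * comm 0 a1 (x - y))" for y
 proof -
  obtain C where C: "C \<ge> 0" "\<And>e x. \<bar>comm e a1 x\<bar> \<le> C" using comm_bound[OF a1_le] by blast
  show ?thesis
  proof (rule integral_dominated_convergence)
   show "integrable lebesgue (\<lambda>x. \<bar>g x\<bar> * C)" using gi by simp
   have "(\<lambda>x. comm 0 a1 (x - y)) \<in> borel_measurable lebesgue"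
    by (rule continuous_measurable_lebesgue[OF smooth_continuous[OF smooth_shift[OF test_smooth[OF comm0_test]]]])
   then show "(\<lambda>x. g x * comm 0 a1 (x - y)) \<in> borel_measurable lebesgue" using gm(1) by simp
   have "(\<lambda>x. comm (eps n) a1 (x - y)) \<in> borel_measurable lebesgue" for n
    by (rule continuous_measurable_lebesgue[OF smooth_continuous[OF smooth_shift[OF test_smooth[OF comm_test[OF eps_pos]]]]])
   then show "(\<lambda>x. g x * comm (eps n) a1 (x - y)) \<in> borel_measurable lebesgue" for n using gm(1) by simp
   show "AE x in lebesgue. (\<lambda>n. g x * comm (eps n) a1 (x - y)) \<longlonglongrightarrow> g x * comm 0 a1 (x - y)"
    by (rule AE_I2) (intro tendsto_intros comm_tendsto eps_lim)
   show "AE x in lebesgue. norm (g x * comm (eps n) a1 (x - y)) \<le> \<bar>g x\<bar> * C" for n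
    by (rule AE_I2) (simp add: abs_mult C mult_left_mono)
  qed
 qed
 obtain m where m: "\<And>n. \<bar>LINT z|lebesgue. kap (eps n) z\<bar> \<le> m"
  using convergent_imp_Bseq[OF convergentI[OF kap_mass_lim]] unfolding Bseq_def by auto
 have kbound: "\<bar>LINT x|lebesgue. g x * kap (eps n) (x - y)\<bar> \<le> M * m" for n and y :: 'a
 proof -
  have mk: "kap (eps n) \<in> borel_measurable borel" by (rule borel_measurable_continuous_onI[OF kap_continuous[OF eps_pos]])
  have ik: "integrable lebesgue (\<lambda>x. kap (eps n) (x - y))"
   using lebesgue_integrable_translate[OF mk] integrable_test[OF kap_test[OF eps_pos]] by blast
  have "\<bar>LINT x|lebesgue. g x * kap (eps n) (x - y)\<bar> \<le> (LINT x|lebesgue. \<bar>g x * kap (eps n) (x - y)\<bar>)"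
   by (rule integral_abs_bound)
  also have "\<dots> \<le> (LINT x|lebesgue. M * kap (eps n) (x - y))"
  proof (rule integral_mono_AE')
   show "integrable lebesgue (\<lambda>x. M * kap (eps n) (x - y))" using ik by simp
   show "AE x in lebesgue. \<bar>g x * kap (eps n) (x - y)\<bar> \<le> M * kap (eps n) (x - y)"
    by (rule AE_I2) (use gM kap_nonneg in \<open>auto simp: abs_mult intro!: mult_right_mono\<close>)
  qed (simp add: kap_nonneg nn)
  also have "\<dots> = M * (LINT z|lebesgue. kap (eps n) z)" using lebesgue_integral_translate[OF mk] by simp
  also have "\<dots> \<le> M * m" using m[of n] nn by (intro mult_left_mono) auto
  finally show ?thesis .
 qed
 have klim: "(\<lambda>n. LINT x|lebesgue. g x * kap (eps n) (x - y)) \<longlonglongrightarrow> c0 * v y" if "y \<in> ball x0 r" for y :: 'a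
  unfolding ident[OF that] using tendsto_diff[OF glim[of y] W11(2)[of y]] c0_pos by (simp add: v_def)
 have key: "(LINT x|lebesgue. w x * (\<theta> x)^2) = (LINT x|lebesgue. v x * (\<theta> x)^2)"
  "integrable lebesgue (\<lambda>x. w x * (\<theta> x)^2)" "integrable lebesgue (\<lambda>x. v x * (\<theta> x)^2)"
  if th: "\<theta> \<in> test_functions (ball x0 r)" for \<theta>
 proof -
  define t where "t y = (\<theta> y)^2" for y
  have tt: "t \<in> test_functions (ball x0 r)" unfolding t_def[abs_def] power2_eq_square by (rule test_mult[OF th test_smooth[OF th]])
  have tU: "t \<in> test_functions UNIV" by (rule test_mono[OF tt]) simp
  have t0: "t y = 0" if "y \<notin> ball x0 r" for y using test_support[OF tt] that by blast
  have contv: "continuous_on UNIV v"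
   using vC1 by (auto simp: intro!: differentiable_imp_continuous_on simp: differentiable_on_def)
  show iv: "integrable lebesgue (\<lambda>x. v x * (\<theta> x)^2)"
   unfolding t_def[symmetric] by (rule locint_test[OF locint_continuous[OF contv] tU])
  have bO: "ball x0 r \<subseteq> \<Omega>" using sub r by auto
  show "integrable lebesgue (\<lambda>x. w x * (\<theta> x)^2)"
   unfolding t_def[symmetric] by (rule locint_test[OF locint_mono[OF w(1) bO] tt])
  have "(\<lambda>n. LINT y|lebesgue. t y * (LINT x|lebesgue. g x * kap (eps n) (x - y))) \<longlonglongrightarrow> (LINT y|lebesgue. t y * (c0 * v y))"
  proof (rule integral_dominated_convergence)
   show "integrable lebesgue (\<lambda>y. \<bar>t y\<bar> * (M * m))" using integrable_test[OF tU] by simp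
   show "(\<lambda>y. t y * (c0 * v y)) \<in> borel_measurable lebesgue"
    by (intro continuous_measurable_lebesgue continuous_intros test_continuous[OF tU] contv)
   show "(\<lambda>y. t y * (LINT x|lebesgue. g x * kap (eps n) (x - y))) \<in> borel_measurable lebesgue" for n
    by (intro continuous_measurable_lebesgue continuous_on_mult test_continuous[OF tU]
      convolution_continuous[OF gi kap_test[OF eps_pos]])
   show "AE y in lebesgue. (\<lambda>n. t y * (LINT x|lebesgue. g x * kap (eps n) (x - y))) \<longlonglongrightarrow> t y * (c0 * v y)"
   proof (rule AE_I2)
    fix y show "(\<lambda>n. t y * (LINT x|lebesgue. g x * kap (eps n) (x - y))) \<longlonglongrightarrow> t y * (c0 * v y)"
     using t0[of y] tendsto_mult_left[OF klim, of y "t y"] by (cases "y \<in> ball x0 r") auto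
   qed
   show "AE y in lebesgue. norm (t y * (LINT x|lebesgue. g x * kap (eps n) (x - y))) \<le> \<bar>t y\<bar> * (M * m)" for n
    by (rule AE_I2) (simp only: real_norm_def abs_mult, rule mult_left_mono[OF kbound], simp)
  qed
  from LIMSEQ_unique[OF kap_weak[OF gi tU] this]
  have "c0 * (LINT x|lebesgue. g x * t x) = c0 * (LINT y|lebesgue. v y * t y)"
   by (simp add: mult.left_commute mult.commute)
  then have "(LINT x|lebesgue. g x * t x) = (LINT y|lebesgue. v y * t y)" using c0_pos by simp
  moreover have "(LINT x|lebesgue. g x * t x) = (LINT x|lebesgue. g0 x * t x)"
   by (rule integral_cong_AE)
     (use gae gm continuous_measurable_lebesgue[OF test_continuous[OF tU]] borel_measurable_integrable[OF g0i]
      in \<open>auto elim: eventually_mono\<close>)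
  moreover have "(\<lambda>x. g0 x * t x) = (\<lambda>x. w x * t x)"
  proof
   fix x show "g0 x * t x = w x * t x"
    using t0[of x] r by (cases "x \<in> ball x0 r") (auto simp: g0_def Q_def indicator_def)
  qed
  ultimately show "(LINT x|lebesgue. w x * (\<theta> x)^2) = (LINT x|lebesgue. v x * (\<theta> x)^2)"
   by (simp add: t_def)
 qed
 have contv: "continuous_on UNIV v"
  using vC1 by (auto simp: intro!: differentiable_imp_continuous_on simp: differentiable_on_def)
 have bO: "ball x0 r \<subseteq> \<Omega>" using sub r by auto
 have lv: "locint (ball x0 r) v" by (rule locint_continuous[OF contv])
 have lw: "locint (ball x0 r) w" by (rule locint_mono[OF w(1) bO])
 have "AE x in lebesgue. x \<in> ball x0 r \<longrightarrow> 0 \<le> v x - w x"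
  by (rule nonneg_AE_of_test_squares[OF open_ball locint_diff[OF lv lw]])
    (use key in \<open>simp add: left_diff_distrib\<close>)
 moreover have "AE x in lebesgue. x \<in> ball x0 r \<longrightarrow> 0 \<le> w x - v x"
  by (rule nonneg_AE_of_test_squares[OF open_ball locint_diff[OF lw lv]])
    (use key in \<open>simp add: left_diff_distrib\<close>)
 ultimately have "AE x in lebesgue. x \<in> ball x0 r \<longrightarrow> w x = v x" by eventually_elim auto
 with vC1 show ?thesis by blast
qed

end

text \<open>Boundedness on a ball comes first; it is the hypothesis of the \<open>C\<^sup>1\<close> estimate on a ball of a third of the radius.\<close>

lemma weak_sol_regular_local:
 fixes \<Omega> :: "'a::euclidean_space set"
 assumes dim: "DIM('a) > 2" and \<Omega>: "open \<Omega>" and w: "locint \<Omega> w" "locint \<Omega> (\<lambda>x. U x * w x)" "weak_sol \<Omega> U w"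
  and nn: "AE x in lebesgue. x \<in> \<Omega> \<longrightarrow> 0 \<le> w x"
  and U: "\<And>K. compact K \<Longrightarrow> K \<subseteq> \<Omega> \<Longrightarrow> \<exists>c. AE x in lebesgue. x \<in> K \<longrightarrow> \<bar>U x\<bar> \<le> c"
  and p: "p \<in> \<Omega>"
 shows "\<exists>r>0. \<exists>v. ball p r \<subseteq> \<Omega> \<and> C_k_on 1 UNIV v \<and> (AE x in lebesgue. x \<in> ball p r \<longrightarrow> w x = v x)"
proof -
 obtain R where R: "R > 0" "cball p R \<subseteq> \<Omega>" using \<Omega> p open_contains_cball by metis
 obtain c where "AE x in lebesgue. x \<in> cball p R \<longrightarrow> \<bar>U x\<bar> \<le> c" using U[OF compact_cball R(2)] by blast
 then have c: "AE x in lebesgue. x \<in> cball p R \<longrightarrow> \<bar>U x\<bar> \<le> \<bar>c\<bar>" by eventually_elim auto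
 \<comment> \<open>So small that the potential is absorbed by the second kernel.\<close>
 define r where "r = min (R / 2) (1 / (16 * (\<bar>c\<bar> + 1)))"
 have r: "r > 0" "2 * r \<le> R" "r \<le> 1 / (16 * (\<bar>c\<bar> + 1))" using R(1) by (auto simp: r_def)
 have "1 / (16 * (\<bar>c\<bar> + 1)) \<le> 1 / 16" by (simp add: divide_simps)
 then have r1: "r \<le> 1/16" using r(3) by linarith
 have small: "\<bar>c\<bar> * ((2 * r^2) powr (3/4) + 2 * r^2) \<le> 1/4"
 proof -
  have rr: "r^2 \<le> r * (1/16)" unfolding power2_eq_square using r r1 by (intro mult_left_mono) auto
  then have "(2 * r^2) powr (3/4) \<le> (2 * r^2) powr (1/2)" using r r1 by (intro powr_mono') auto
  also have "\<dots> = sqrt (2 * r^2)" by (simp add: powr_half_sqrt)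
  also have "\<dots> \<le> 2 * r" by (rule real_le_lsqrt) (use r in \<open>auto simp: power_mult_distrib\<close>)
  finally have "(2 * r^2) powr (3/4) + 2 * r^2 \<le> 4 * r" using rr r by linarith
  then have "\<bar>c\<bar> * ((2 * r^2) powr (3/4) + 2 * r^2) \<le> \<bar>c\<bar> * (4 * r)" by (rule mult_left_mono) simp
  also have "\<dots> \<le> \<bar>c\<bar> * (4 * (1 / (16 * (\<bar>c\<bar> + 1))))" using r(3) by (intro mult_left_mono) auto
  also have "\<dots> \<le> 1/4" by (simp add: divide_simps)
  finally show ?thesis .
 qed
 have cutoff: "\<exists>\<eta>::'a \<Rightarrow> real. radial_cutoff \<eta> s" if s: "s > 0" for s
 proof -
  obtain \<eta> :: "'a \<Rightarrow> real" where e: "smooth \<eta>" "\<And>x. 0 \<le> \<eta> x" "\<And>x. \<eta> x \<le> 1"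
   "\<forall>x. dist 0 x \<le> s/2 \<longrightarrow> \<eta> x = 1" "\<forall>x. dist 0 x \<ge> s \<longrightarrow> \<eta> x = 0"
   using ball_cutoff[of "s/2" s "0::'a"] s by auto
  have "radial_cutoff \<eta> s" by unfold_locales (use dim s e in auto)
  then show ?thesis by blast
 qed
 obtain \<eta> :: "'a \<Rightarrow> real" where e1: "radial_cutoff \<eta> r" using cutoff[OF r(1)] ..
 have r3: "r / 3 > 0" using r(1) by simp
 obtain \<zeta> :: "'a \<Rightarrow> real" where e2: "radial_cutoff \<zeta> (r / 3)" using cutoff[OF r3] ..
 have sub: "cball p (2 * r) \<subseteq> \<Omega>" and sub3: "cball p (2 * (r / 3)) \<subseteq> \<Omega>"
  using R r by (auto simp: subset_iff)
 have U1: "AE x in lebesgue. x \<in> cball p (2 * r) \<longrightarrow> \<bar>U x\<bar> \<le> \<bar>c\<bar>"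
  and U3: "AE x in lebesgue. x \<in> cball p (2 * (r / 3)) \<longrightarrow> \<bar>U x\<bar> \<le> \<bar>c\<bar>"
  using c r by (auto elim!: eventually_mono)
 obtain M where M: "AE x in lebesgue. x \<in> ball p r \<longrightarrow> w x \<le> M"
  using radial_cutoff.nonneg_weak_sol_locally_bounded[OF e1 sub w nn U1 _ small] by auto
 have M3: "AE x in lebesgue. x \<in> cball p (2 * (r / 3)) \<longrightarrow> \<bar>w x\<bar> \<le> \<bar>M\<bar>"
  using M nn
 proof eventually_elim
  case (elim x)
  show ?case
  proof
   assume x: "x \<in> cball p (2 * (r / 3))"
   then have "x \<in> ball p r" "x \<in> \<Omega>" using sub3 r by auto
   with elim show "\<bar>w x\<bar> \<le> \<bar>M\<bar>" by auto
  qed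
 qed
 have "\<exists>v. C_k_on 1 UNIV v \<and> (AE x in lebesgue. x \<in> ball p (r / 3) \<longrightarrow> w x = v x)"
  by (rule radial_cutoff.bounded_weak_sol_C1[OF e2 sub3 w M3 U3]) auto
 moreover have "ball p (r / 3) \<subseteq> \<Omega>" using sub3 r by auto
 ultimately show ?thesis using r3 by blast
qed

lemma open_AE_continuous_eq:
 fixes f g :: "'a::euclidean_space \<Rightarrow> real"
 assumes "open S" "continuous_on S f" "continuous_on S g" "AE x in lebesgue. x \<in> S \<longrightarrow> f x = g x" "x \<in> S"
 shows "f x = g x"
proof (rule ccontr)
 assume "f x \<noteq> g x"
 define E where "E = S \<inter> (\<lambda>x. f x - g x) -` (- {0})"
 have "open E" unfolding E_def
  by (rule continuous_open_preimage[OF continuous_on_diff[OF assms(2,3)] assms(1)]) auto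
 moreover have "x \<in> E" using \<open>f x \<noteq> g x\<close> assms(5) by (simp add: E_def)
 moreover have "negligible E"
 proof -
  have "AE x in lebesgue. x \<notin> E" using assms(4) by eventually_elim (auto simp: E_def)
  then show ?thesis
   using AE_iff_null_sets[of E lebesgue] \<open>open E\<close> by (simp add: negligible_iff_null_sets)
 qed
 ultimately show False using open_not_negligible by blast
qed

lemma C_1_continuous: "C_k_on 1 S f \<Longrightarrow> continuous_on S f"
 by (auto simp: differentiable_imp_continuous_within intro!: continuous_at_imp_continuous_on)

text \<open>The local representatives agree on overlaps by continuity.\<close>

theorem weak_sol_regular:
 fixes \<Omega> :: "'a::euclidean_space set"
 assumes dim: "DIM('a) > 2" and \<Omega>: "open \<Omega>" and w: "locint \<Omega> w" "locint \<Omega> (\<lambda>x. U x * w x)" "weak_sol \<Omega> U w"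
  and nn: "AE x in lebesgue. x \<in> \<Omega> \<longrightarrow> 0 \<le> w x"
  and U: "\<And>K. compact K \<Longrightarrow> K \<subseteq> \<Omega> \<Longrightarrow> \<exists>c. AE x in lebesgue. x \<in> K \<longrightarrow> \<bar>U x\<bar> \<le> c"
 shows "\<exists>v. C_k_on 1 \<Omega> v \<and> (AE x in lebesgue. x \<in> \<Omega> \<longrightarrow> w x = v x)"
proof -
 have "\<forall>p\<in>\<Omega>. \<exists>q. fst q > 0 \<and> ball p (fst q) \<subseteq> \<Omega> \<and> C_k_on 1 UNIV (snd q) \<and>
   (AE x in lebesgue. x \<in> ball p (fst q) \<longrightarrow> w x = snd q x)"
  using weak_sol_regular_local[OF dim \<Omega> w nn U] by simp
 from bchoice[OF this] obtain q where q: "\<forall>p\<in>\<Omega>. fst (q p) > 0 \<and> ball p (fst (q p)) \<subseteq> \<Omega> \<and> C_k_on 1 UNIV (snd (q p)) \<and>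
   (AE x in lebesgue. x \<in> ball p (fst (q p)) \<longrightarrow> w x = snd (q p) x)" ..
 define R where "R p = fst (q p)" for p
 define V where "V p = snd (q p)" for p
 have RV: "R p > 0" "ball p (R p) \<subseteq> \<Omega>" "C_k_on 1 UNIV (V p)"
  "AE x in lebesgue. x \<in> ball p (R p) \<longrightarrow> w x = V p x" if "p \<in> \<Omega>" for p
  using q that unfolding R_def V_def by blast+
 define v where "v x = V x x" for x
 have vV: "v x = V p x" if p: "p \<in> \<Omega>" "x \<in> ball p (R p)" for p x
 proof -
  have x: "x \<in> \<Omega>" using RV(2)[OF p(1)] p(2) by blast
  have "V x x = V p x"
  proof (rule open_AE_continuous_eq[of "ball x (R x) \<inter> ball p (R p)" "V x" "V p" x])
   show "AE y in lebesgue. y \<in> ball x (R x) \<inter> ball p (R p) \<longrightarrow> V x y = V p y"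
    using RV(4)[OF x] RV(4)[OF p(1)] by eventually_elim auto
  qed (use RV[OF x] RV[OF p(1)] p in \<open>auto intro: continuous_on_subset[OF C_1_continuous]\<close>)
  then show ?thesis by (simp add: v_def)
 qed
 have dv: "(v has_derivative frechet_derivative (V p) (at x)) (at x)" if p: "p \<in> \<Omega>" "x \<in> ball p (R p)" for p x
 proof (rule has_derivative_transform_within_open[of "V p" _ _ _ "ball p (R p)"])
  have "V p differentiable (at x)" using RV(3)[OF p(1)] by simp
  then show "(V p has_derivative frechet_derivative (V p) (at x)) (at x)" unfolding frechet_derivative_works .
 qed (use p vV in auto)
 have "C_k_on 1 \<Omega> v"
 proof -
  have "v differentiable (at x)" if "x \<in> \<Omega>" for x
   using dv[OF that, of x] RV(1)[OF that] by (auto simp: differentiable_def)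
  moreover have "continuous_on \<Omega> (partial b v)" if b: "b \<in> Basis" for b
   unfolding continuous_on_eq_continuous_at[OF \<Omega>]
  proof
   fix p assume p: "p \<in> \<Omega>"
   have "continuous_on UNIV (partial b (V p))" using RV(3)[OF p] b by simp
   then have "continuous_on (ball p (R p)) (partial b v)"
    using partial_eqI[OF dv[OF p], of _ b]
    by (subst continuous_on_cong[OF refl, of _ _ "partial b (V p)"]) (auto intro: continuous_on_subset)
   then show "isCont (partial b v) p"
    using RV(1)[OF p] by (simp add: continuous_on_eq_continuous_at)
  qed
  ultimately show ?thesis by simp
 qed
 moreover have "AE x in lebesgue. x \<in> \<Omega> \<longrightarrow> w x = v x"
 proof -
  obtain F where F: "F \<subseteq> (\<lambda>p. ball p (R p)) ` \<Omega>" "countable F" "\<Union>F = \<Union>((\<lambda>p. ball p (R p)) ` \<Omega>)"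
   using Lindelof[of "(\<lambda>p. ball p (R p)) ` \<Omega>"] by auto
  have "AE x in lebesgue. \<forall>B\<in>F. x \<in> B \<longrightarrow> w x = v x"
  proof (rule AE_ball_countable'[OF _ F(2)])
   fix B assume "B \<in> F"
   then obtain p where p: "p \<in> \<Omega>" "B = ball p (R p)" using F(1) by auto
   show "AE x in lebesgue. x \<in> B \<longrightarrow> w x = v x"
    using RV(4)[OF p(1)] by eventually_elim (use vV[OF p(1)] p(2) in auto)
  qed
  then show ?thesis
  proof (rule eventually_mono, intro impI)
   fix x assume a: "\<forall>B\<in>F. x \<in> B \<longrightarrow> w x = v x" and x: "x \<in> \<Omega>"

   have "x \<in> ball x (R x)" using RV(1)[OF x] by simp
   then have "x \<in> \<Union>F" unfolding F(3) using x by blast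
   then obtain B where "B \<in> F" "x \<in> B" by blast
   with a show "w x = v x" by blast
  qed
 qed
 ultimately show ?thesis by blast
qed

section \<open>A strong maximum principle\<close>

text \<open>A smooth convex substitute for the positive part, and its derivative.\<close>

definition hinge :: "real \<Rightarrow> real" where "hinge t = t * flat 0 t"
definition hinge' :: "real \<Rightarrow> real" where "hinge' t = flat 0 t + flat 1 t"

lemma mult_flat: "t * flat (Suc m) t = flat m t"
 by (simp add: flat_def)

lemma hinge_has_derivative: "(hinge has_real_derivative hinge' t) (at t)"
proof -
 have "((\<lambda>t. t * flat 0 t) has_real_derivative 1 * flat 0 t + (flat (0 + 2) t - real 0 * flat (Suc 0) t) * t) (at t)"
  by (rule DERIV_mult[OF DERIV_ident flat_has_derivative])
 moreover have "flat (0 + 2) t * t = flat 1 t" using mult_flat[of t 1] by (simp add: mult.commute numeral_2_eq_2)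
 ultimately show ?thesis by (simp add: hinge_def[abs_def] hinge'_def)
qed

lemma hinge'_has_derivative: "(hinge' has_real_derivative flat 3 t) (at t)"
proof -
 have "((\<lambda>t. flat 0 t + flat 1 t) has_real_derivative
   (flat (0 + 2) t - real 0 * flat (Suc 0) t) + (flat (1 + 2) t - real 1 * flat (Suc 1) t)) (at t)"
  by (rule DERIV_add[OF flat_has_derivative flat_has_derivative])
 then show ?thesis by (simp add: hinge'_def[abs_def] numeral_3_eq_3 numeral_2_eq_2)
qed

lemma smooth_hinge: "smooth hinge"
 unfolding hinge_def[abs_def] by (rule smooth_mult[OF smooth_linear[OF bounded_linear_ident] smooth_flat])

lemma hinge_le: "hinge t \<le> t * hinge' t"
 using flat_nonneg[of 1 t] by (cases "t \<le> 0") (auto simp: hinge_def hinge'_def flat_def distrib_left)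

lemma hinge'_nonneg: "0 \<le> hinge' t"
 by (simp add: hinge'_def flat_nonneg)

lemma hinge'_pos: "t > 0 \<Longrightarrow> 0 < hinge' t"
 using flat_pos_iff[of 0 t] flat_nonneg[of 1 t] by (simp add: hinge'_def)

lemma hinge'_mono: "s \<le> t \<Longrightarrow> hinge' s \<le> hinge' t"
 by (rule DERIV_nonneg_imp_nondecreasing[of s t hinge']) (use hinge'_has_derivative flat_nonneg in blast)+

lemma hinge'_le_1: "hinge' t \<le> 1"
proof (cases "t \<le> 0")
 case False
 have "(1 + 1/t) * exp (- (1/t)) \<le> exp (1/t) * exp (- (1/t))"
  by (intro mult_right_mono exp_ge_add_one_self) auto
 then show ?thesis using False by (simp add: hinge'_def flat_def distrib_right exp_minus)
qed (simp add: hinge'_def flat_def)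

lemma hinge_out: "t \<le> 0 \<Longrightarrow> hinge t = 0" and hinge'_out: "t \<le> 0 \<Longrightarrow> hinge' t = 0"
 by (auto simp: hinge_def hinge'_def flat_def)

lemma hinge_nonneg: "0 \<le> hinge t"
 by (simp add: hinge_def flat_def)

text \<open>The barrier is a convex increasing function of a power of the regularized distance that is slightly more
 singular than the fundamental solution. Away from the centre it is a subsolution of
 \<open>-\<Delta> + K\<close>, strict where it is positive; its defect near the centre has size \<open>e powr (2 * a - 2)\<close>, which times the integral of a function
 vanishing linearly at the centre tends to zero with \<open>e\<close>.\<close>

lemma barrier_estimate:
 fixes z :: "'a::euclidean_space" and e R K :: real
 defines "N \<equiv> real DIM('a)" and "a \<equiv> 3/4 - real DIM('a) / 2"
 defines "P \<equiv> \<lambda>z::'a. hinge (kern e a z - (R^2) powr a)"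
 assumes dim: "DIM('a) > 2" and e: "e > 0" and R: "R > 0" and K: "K \<ge> 0" "R^2 * K \<le> 1/8"
 shows "z \<bullet> z \<ge> 4 * N * e^2 \<Longrightarrow>
   K * P z - lap P z \<le> - (hinge' (kern e a z - (R^2) powr a) * kern e (a - 1) z / 16)"
  and "K * P z - lap P z \<le> ((N - 3/2) * N + 1/8) * (e^2) powr (a - 1)"
proof -
 have N3: "N \<ge> 3" using dim by (simp add: N_def)
 define A where "A = (R^2) powr a"
 have A0: "A \<ge> 0" by (simp add: A_def)
 define s where "s = z \<bullet> z + e^2"
 have s: "s > 0" "e^2 \<le> s" unfolding s_def using norm_sq_add_pos[OF e, of z] by auto
 define h1 where "h1 = hinge' (kern e a z - A)"
 have h1: "0 \<le> h1" "h1 \<le> 1" by (auto simp: h1_def hinge'_nonneg hinge'_le_1)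
 define k1 where "k1 = kern e (a - 1) z"
 define k2 where "k2 = kern e (a - 2) z"
 have k0: "kern e a z = k1 * s" and k12: "k1 = k2 * s"
  using kern_step[OF e, of a z] kern_step[OF e, of "a - 1" z] by (simp_all add: k1_def k2_def s_def)
 have knn: "k1 \<ge> 0" "k2 \<ge> 0" by (simp_all add: k1_def k2_def kern_nonneg)
 have lapk: "lap (kern e a) z = (N - 3/2) * (k2 * (z \<bullet> z / 2 - N * e^2))"
 proof -
  have *: "2 * (a - 1) + N = - 1/2" "2 * a = - (N - 3/2)" by (auto simp: a_def N_def)
  have gen: "- m * k * ((- 1/2) * q + t) = m * (k * (q / 2 - t))" for m k q t :: real
   by (simp add: algebra_simps)
  show ?thesis using lap_kern[OF e, of a z] unfolding N_def[symmetric] * gen k2_def[symmetric] .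
 qed
 have lapP: "lap P z = h1 * lap (kern e a) z + flat 3 (kern e a z - A) * grad_sq (kern e a) z"
  unfolding P_def A_def[symmetric] h1_def
 proof (rule lap_compose[OF smooth_kern[OF e], where h = "\<lambda>t. hinge (t - A)" and ?h1.0 = "\<lambda>t. hinge' (t - A)" and ?h2.0 = "\<lambda>t. flat 3 (t - A)"])
  fix x :: 'a
  have sh: "((\<lambda>t. t - A) has_real_derivative 1) (at (kern e a x))" by (auto intro!: derivative_eq_intros)
  show "((\<lambda>t. hinge (t - A)) has_real_derivative hinge' (kern e a x - A)) (at (kern e a x))"
   using DERIV_chain2[OF hinge_has_derivative sh] by simp
  show "((\<lambda>t. hinge' (t - A)) has_real_derivative flat 3 (kern e a x - A)) (at (kern e a x))"
   using DERIV_chain2[OF hinge'_has_derivative sh] by simp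
 qed
 have "0 \<le> flat 3 (kern e a z - A) * grad_sq (kern e a) z"
  by (intro mult_nonneg_nonneg flat_nonneg) (simp add: grad_sq_def sum_nonneg)
 then have lapP_ge: "- lap P z \<le> - (h1 * lap (kern e a) z)" using lapP by linarith
 have KP: "K * P z \<le> h1 * (k1 / 8)"
 proof (cases "kern e a z \<le> A")
  case True
  then have "P z = 0" by (simp add: P_def A_def[symmetric] hinge_out)
  then show ?thesis using h1 knn by simp
 next
  case False
  have "s < R^2"
  proof (rule ccontr)
   assume "\<not> s < R^2"
   then have "kern e a z \<le> A" unfolding A_def
    using R N3 by (intro kern_antimono) (auto simp: a_def N_def s_def)
   with False show False by simp
  qed
  then have Ks: "K * s \<le> 1/8" using mult_left_mono[of s "R^2" K] K by (simp add: mult.commute)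
  have "P z \<le> (kern e a z - A) * h1" unfolding P_def A_def[symmetric] h1_def by (rule hinge_le)
  also have "\<dots> \<le> kern e a z * h1" using A0 h1 by (intro mult_right_mono) auto
  finally have "K * P z \<le> K * (kern e a z * h1)" using K(1) by (rule mult_left_mono)
  also have "\<dots> = (K * s) * (k1 * h1)" by (simp add: k0)
  also have "\<dots> \<le> (1/8) * (k1 * h1)" using Ks knn h1 by (intro mult_right_mono) auto
  finally show ?thesis by (simp add: mult_ac)
 qed
 show "K * P z - lap P z \<le> - (hinge' (kern e a z - (R^2) powr a) * kern e (a - 1) z / 16)"
  if far: "z \<bullet> z \<ge> 4 * N * e^2"
 proof -
  have "s / 8 \<le> z \<bullet> z / 2 - N * e^2"
  proof -
   define t where "t = N * e^2"
   have "1 * e^2 \<le> N * e^2" using N3 by (intro mult_right_mono) auto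
   then have t: "e^2 \<le> t" by (simp add: t_def)
   have f: "4 * t \<le> z \<bullet> z" using far by (simp add: t_def)
   have "(q + p) / 8 \<le> q / 2 - t" if "p \<le> t" "4 * t \<le> q" "0 \<le> p" for p q :: real
    using that by simp
   from this[OF t f] show ?thesis unfolding s_def t_def[symmetric] by simp
  qed
  then have "k2 * (s / 8) \<le> k2 * (z \<bullet> z / 2 - N * e^2)" by (rule mult_left_mono) (rule knn)
  then have kk: "k1 / 8 \<le> k2 * (z \<bullet> z / 2 - N * e^2)" by (simp add: k12)
  have "(3/2) * (k1 / 8) \<le> (N - 3/2) * (k2 * (z \<bullet> z / 2 - N * e^2))"
   using N3 knn by (intro mult_mono[OF _ kk]) auto
  then have "h1 * ((3/2) * (k1 / 8)) \<le> h1 * lap (kern e a) z" unfolding lapk by (rule mult_left_mono) (rule h1)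
  then have "K * P z - lap P z \<le> - (h1 * k1 / 16)" using KP lapP_ge by (simp add: algebra_simps)
  then show ?thesis by (simp add: h1_def k1_def A_def)
 qed
 have ke: "k1 \<le> (e^2) powr (a - 1)" unfolding k1_def
  using e N3 s(2) by (intro kern_antimono) (auto simp: a_def N_def s_def)
 have "k2 * e^2 \<le> k1" unfolding k12 by (rule mult_left_mono[OF s(2) knn(2)])
 moreover have "- (k2 * (z \<bullet> z / 2 - N * e^2)) \<le> N * (k2 * e^2)"
  using mult_nonneg_nonneg[OF knn(2), of "z \<bullet> z / 2"] by (simp add: algebra_simps)
 ultimately have "- (k2 * (z \<bullet> z / 2 - N * e^2)) \<le> N * k1"
  using mult_left_mono[of "k2 * e^2" k1 N] N3 by linarith
 then have "(N - 3/2) * - (k2 * (z \<bullet> z / 2 - N * e^2)) \<le> (N - 3/2) * (N * k1)"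
  using N3 by (intro mult_left_mono) auto
 then have "- lap (kern e a) z \<le> (N - 3/2) * N * k1" unfolding lapk by (simp add: mult.assoc)
 then have "h1 * (- lap (kern e a) z) \<le> h1 * ((N - 3/2) * N * k1)" by (rule mult_left_mono) (rule h1)
 then have "K * P z - lap P z \<le> h1 * (((N - 3/2) * N + 1/8) * k1)"
  using KP lapP_ge by (simp add: algebra_simps)
 also have "\<dots> \<le> 1 * (((N - 3/2) * N + 1/8) * (e^2) powr (a - 1))"
  using N3 knn h1 ke by (intro mult_mono mult_left_mono) auto
 finally show "K * P z - lap P z \<le> ((N - 3/2) * N + 1/8) * (e^2) powr (a - 1)" by simp
qed

text \<open>The barrier is a test function; its strict negativity on a shell then forces the integral of \<open>w\<close> over the shell to be at most the
 vanishing contribution of the centre.\<close>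

lemma weak_sol_zero_spreads:
 fixes \<Omega> :: "'a::euclidean_space set"
 assumes dim: "DIM('a) > 2" and sub: "cball x0 R \<subseteq> \<Omega>" and R: "R > 0"
  and w: "locint \<Omega> w" "locint \<Omega> (\<lambda>x. U x * w x)" "weak_sol \<Omega> U w"
  and nn: "AE x in lebesgue. x \<in> \<Omega> \<longrightarrow> 0 \<le> w x"
  and U: "AE x in lebesgue. x \<in> cball x0 R \<longrightarrow> \<bar>U x\<bar> \<le> K"
  and K: "K \<ge> 0" "R^2 * K \<le> 1/8"
  and lip: "d > 0" "L \<ge> 0" "AE x in lebesgue. norm (x - x0) < d \<longrightarrow> w x \<le> L * norm (x - x0)"
 shows "AE x in lebesgue. x \<in> ball x0 (R / 2) \<longrightarrow> w x = 0"
proof -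
 define N where "N = real DIM('a)"
 have N3: "N \<ge> 3" using dim by (simp add: N_def)
 define a where "a = 3/4 - real DIM('a) / 2"
 have a0: "a < 0" using dim by (simp add: a_def)
 define A where "A = (R^2) powr a"
 define P where "P e = (\<lambda>z::'a. hinge (kern e a z - A))" for e
 define C where "C = (N - 3/2) * N + 1/8"
 have C: "C \<ge> 0" using N3 by (simp add: C_def)
 define Q where "Q = cball x0 R"
 define g where "g x = indicator Q x * w x" for x
 have gi: "integrable lebesgue g" unfolding g_def[abs_def] using w(1) sub by (simp add: locint_def Q_def)
 have gnn: "AE x in lebesgue. 0 \<le> g x"
  by (rule eventually_mono[OF nn]) (use sub in \<open>auto simp: g_def Q_def indicator_def\<close>)
 define \<rho> where "\<rho> e = 2 * sqrt N * e" for e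
 have rho2: "(\<rho> e)^2 = 4 * N * e^2" for e using N3 by (simp add: \<rho>_def power_mult_distrib)
 have P_smooth: "smooth (P e)" if "e > 0" for e
  unfolding P_def by (rule smooth_compose[OF smooth_hinge smooth_diff[OF smooth_kern[OF that] smooth_const]])
 have P_out: "P e z = 0" if "norm z \<ge> R" for e z
 proof -
  have "R^2 \<le> (norm z)^2" using that R by (intro power_mono) auto
  then have "R^2 \<le> z \<bullet> z + e^2" by (simp add: power2_norm_eq_inner add_increasing2)
  then have "kern e a z \<le> A" unfolding A_def using R a0 by (intro kern_antimono) auto
  then show ?thesis by (simp add: P_def hinge_out)
 qed
 have weak: "0 \<le> (LINT x|lebesgue. g x * (K * P e (x - x0) - lap (P e) (x - x0)))"
  "integrable lebesgue (\<lambda>x. g x * (K * P e (x - x0) - lap (P e) (x - x0)))" if e: "e > 0" for e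
 proof -
  define \<psi> where "\<psi> x = P e (x - x0)" for x
  have psi: "\<psi> \<in> test_functions \<Omega>"
  proof (rule test_functionsI[where K = Q])
   show "smooth \<psi>" unfolding \<psi>_def[abs_def] by (rule smooth_shift[OF P_smooth[OF e]])
   show "compact Q" "Q \<subseteq> \<Omega>" using sub by (auto simp: Q_def)
   show "\<psi> x = 0" if "x \<notin> Q" for x
    unfolding \<psi>_def by (rule P_out) (use that in \<open>auto simp: Q_def dist_norm norm_minus_commute\<close>)
  qed
  have out: "\<psi> x = 0" "lap \<psi> x = 0" if "x \<notin> Q" for x
  proof -
   have cl: "closed Q" by (simp add: Q_def)
   have z: "\<And>x. x \<notin> Q \<Longrightarrow> \<psi> x = 0"
    unfolding \<psi>_def by (rule P_out) (auto simp: Q_def dist_norm norm_minus_commute)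
   then show "\<psi> x = 0" using that by blast
   have z1: "\<And>x. x \<notin> Q \<Longrightarrow> partial b \<psi> x = 0" for b by (rule partial_zero_outside[OF cl, of \<psi> 0]) (use z in auto)
   then have "partial b (partial b \<psi>) x = 0" for b
    by (intro partial_zero_outside[OF cl, of "partial b \<psi>" 0]) (use that in auto)
   then show "lap \<psi> x = 0" by (simp add: lap_def)
  qed
  have lapsi: "lap \<psi> x = lap (P e) (x - x0)" for x unfolding \<psi>_def[abs_def] by (rule lap_shift[OF P_smooth[OF e]])
  have eq: "g x * (K * P e (x - x0) - lap (P e) (x - x0)) = w x * (K * \<psi> x - lap \<psi> x)" for x
   using out[of x] unfolding lapsi[symmetric] by (cases "x \<in> Q") (auto simp: g_def \<psi>_def)
  have i1: "integrable lebesgue (\<lambda>x. w x * \<psi> x)" "integrable lebesgue (\<lambda>x. w x * lap \<psi> x)"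
   "integrable lebesgue (\<lambda>x. U x * w x * \<psi> x)"
   by (rule locint_test[OF w(1) psi] locint_test[OF w(1) test_lap[OF psi]] locint_test[OF w(2) psi])+
  have i2: "integrable lebesgue (\<lambda>x. w x * (K * \<psi> x - lap \<psi> x))"
   using i1 by (simp add: right_diff_distrib mult.left_commute)
  then show "integrable lebesgue (\<lambda>x. g x * (K * P e (x - x0) - lap (P e) (x - x0)))" unfolding eq .
  have "0 = (LINT x|lebesgue. w x * (U x * \<psi> x - lap \<psi> x))" using w(3) psi unfolding weak_sol_def by simp
  also have "\<dots> \<le> (LINT x|lebesgue. w x * (K * \<psi> x - lap \<psi> x))"
  proof (rule integral_mono_AE)
   show "integrable lebesgue (\<lambda>x. w x * (U x * \<psi> x - lap \<psi> x))"
    using i1 by (simp add: right_diff_distrib mult_ac)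
   show "AE x in lebesgue. w x * (U x * \<psi> x - lap \<psi> x) \<le> w x * (K * \<psi> x - lap \<psi> x)"
    using U nn
   proof eventually_elim
    case (elim x)
    show ?case
    proof (cases "x \<in> Q")
     case True
     then have "w x \<ge> 0" "U x \<le> K" using elim sub by (auto simp: Q_def)
     moreover have "\<psi> x \<ge> 0" by (simp add: \<psi>_def P_def hinge_nonneg)
     ultimately show ?thesis by (intro mult_left_mono diff_right_mono mult_right_mono)
    qed (simp add: out)
   qed
  qed (rule i2)
  finally show "0 \<le> (LINT x|lebesgue. g x * (K * P e (x - x0) - lap (P e) (x - x0)))" unfolding eq .
 qed
 have zero: "AE x in lebesgue. \<delta> \<le> norm (x - x0) \<and> norm (x - x0) \<le> R / 2 \<longrightarrow> w x = 0" if d: "\<delta> > 0" for \<delta>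
 proof -
  define D where "D = {x. \<delta> \<le> norm (x - x0) \<and> norm (x - x0) \<le> R / 2}"
  have Dc: "closed D" unfolding D_def by (intro closed_Collect_conj closed_Collect_le continuous_intros)
  have DQ: "D \<subseteq> Q" using R by (auto simp: D_def Q_def dist_norm norm_minus_commute)
  have gD: "integrable lebesgue (\<lambda>x. indicator D x * g x)"
   using integrable_mult_indicator[OF _ gi, of D] Dc by simp
  define \<eta>0 where "\<eta>0 = hinge' ((R^2 / 2) powr a - A) * (R^2) powr (a - 1) / 16"
  have "A < (R^2 / 2) powr a" unfolding A_def using R a0 by (intro powr_less_mono2_neg) auto
  then have eta0: "\<eta>0 > 0" using R hinge'_pos by (simp add: \<eta>0_def)
  define B where "B = C * (L * unit_ball_vol N * (2 * sqrt N) * (2 * sqrt N) powr N)"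
  have est: "\<eta>0 * (LINT x|lebesgue. indicator D x * g x) \<le> B * sqrt e"
   if e: "e > 0" "\<rho> e < d" "\<rho> e \<le> \<delta>" "e \<le> R / 2" for e
  proof -
   define E where "E = cball x0 (\<rho> e)"
   have rho: "\<rho> e > 0" using e N3 by (simp add: \<rho>_def)
   have low: "K * P e z - lap (P e) z \<le> C * (e^2) powr (a - 1) * indicator (cball 0 (\<rho> e)) z - \<eta>0 * indicator {z. \<delta> \<le> norm z \<and> norm z \<le> R / 2} z"
    if nz: "norm z \<noteq> \<rho> e" for z
   proof (cases "norm z < \<rho> e")
    case True
    have "K * P e z - lap (P e) z \<le> C * (e^2) powr (a - 1)"
     using barrier_estimate(2)[OF dim e(1) R K, of z] by (simp add: P_def A_def a_def C_def N_def)
    then show ?thesis using True e by (simp add: indicator_def)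
   next
    case False
    then have far: "\<rho> e < norm z" using nz by simp
    then have "(\<rho> e)^2 \<le> (norm z)^2" using rho by (intro power_mono) auto
    then have "z \<bullet> z \<ge> 4 * N * e^2" by (simp add: rho2 power2_norm_eq_inner)
    then have main: "K * P e z - lap (P e) z \<le> - (hinge' (kern e a z - A) * kern e (a - 1) z / 16)"
     using barrier_estimate(1)[OF dim e(1) R K, of z] by (simp add: P_def A_def a_def N_def)
    have "0 \<le> hinge' (kern e a z - A) * kern e (a - 1) z / 16" by (simp add: hinge'_nonneg kern_nonneg)
    moreover have "\<eta>0 \<le> hinge' (kern e a z - A) * kern e (a - 1) z / 16" if z: "norm z \<le> R / 2"
    proof -
     have "(norm z)^2 \<le> (R/2)^2" "e^2 \<le> (R/2)^2" using z e by (auto intro!: power_mono)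
     then have s: "z \<bullet> z + e^2 \<le> R^2 / 2" by (simp add: power2_norm_eq_inner power_divide)
     have sp: "0 < z \<bullet> z + e^2" by (rule norm_sq_add_pos[OF e(1)])
     have "(R^2/2) powr a \<le> kern e a z" unfolding kern_def using s sp a0 by (intro powr_mono2') auto
     moreover have "(R^2) powr (a - 1) \<le> kern e (a - 1) z" unfolding kern_def
      using s sp a0 R by (intro powr_mono2') (auto intro: order_trans[OF s])
     ultimately show ?thesis unfolding \<eta>0_def
      by (intro divide_right_mono mult_mono hinge'_mono) (auto simp: hinge'_nonneg)
    qed
    ultimately show ?thesis using main far by (auto simp: indicator_def)
   qed
   have null: "AE x in lebesgue. norm (x - x0) \<noteq> \<rho> e"
   proof -
    have "negligible (sphere x0 (\<rho> e))" by (rule negligible_sphere)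
    then have "AE x in lebesgue. x \<notin> sphere x0 (\<rho> e)" by (intro AE_not_in) (simp add: negligible_iff_null_sets)
    then show ?thesis by (rule eventually_mono) (auto simp: dist_norm norm_minus_commute)
   qed
   have gE: "integrable lebesgue (\<lambda>x. indicator E x * g x)"
    using integrable_mult_indicator[OF _ gi, of E] by (simp add: E_def)
   have "0 \<le> (LINT x|lebesgue. g x * (K * P e (x - x0) - lap (P e) (x - x0)))" by (rule weak(1)[OF e(1)])
   also have "\<dots> \<le> (LINT x|lebesgue. C * (e^2) powr (a - 1) * (indicator E x * g x) - \<eta>0 * (indicator D x * g x))"
   proof (rule integral_mono_AE[OF weak(2)[OF e(1)]])
    show "integrable lebesgue (\<lambda>x. C * (e^2) powr (a - 1) * (indicator E x * g x) - \<eta>0 * (indicator D x * g x))"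
     using gE gD by simp
    show "AE x in lebesgue. g x * (K * P e (x - x0) - lap (P e) (x - x0))
      \<le> C * (e^2) powr (a - 1) * (indicator E x * g x) - \<eta>0 * (indicator D x * g x)"
     using null gnn
    proof eventually_elim
     case (elim x)
     have iE: "indicator (cball 0 (\<rho> e)) (x - x0) = (indicator E x :: real)"
      by (auto simp: E_def indicator_def dist_norm norm_minus_commute)
     have iD: "indicator {z. \<delta> \<le> norm z \<and> norm z \<le> R / 2} (x - x0) = (indicator D x :: real)"
      by (auto simp: D_def indicator_def)
     have "g x * (K * P e (x - x0) - lap (P e) (x - x0)) \<le> g x * (C * (e^2) powr (a - 1) * indicator E x - \<eta>0 * indicator D x)"
      using low[OF elim(1)] unfolding iE iD by (rule mult_left_mono) (rule elim(2))
     then show ?case by (simp add: algebra_simps)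
    qed
   qed
   also have "\<dots> = C * (e^2) powr (a - 1) * (LINT x|lebesgue. indicator E x * g x) - \<eta>0 * (LINT x|lebesgue. indicator D x * g x)"
    using gE gD by simp
   finally have 1: "\<eta>0 * (LINT x|lebesgue. indicator D x * g x) \<le> C * (e^2) powr (a - 1) * (LINT x|lebesgue. indicator E x * g x)"
    by simp
   have "(LINT x|lebesgue. indicator E x * g x) \<le> (LINT x|lebesgue. (L * \<rho> e) * indicator E x)"
   proof (rule integral_mono_AE[OF gE])
    show "integrable lebesgue (\<lambda>x. (L * \<rho> e) * indicator E x)"
     unfolding E_def by (rule integrable_mult_right) (rule integrable_indicator_compact[OF compact_cball])
    show "AE x in lebesgue. indicator E x * g x \<le> (L * \<rho> e) * indicator E x"
     using lip(3)
    proof (rule eventually_mono)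
     fix x assume l: "norm (x - x0) < d \<longrightarrow> w x \<le> L * norm (x - x0)"
     show "indicator E x * g x \<le> (L * \<rho> e) * indicator E x"
     proof (cases "x \<in> E")
      case True
      then have n: "norm (x - x0) \<le> \<rho> e" by (simp add: E_def dist_norm norm_minus_commute)
      then have "w x \<le> L * norm (x - x0)" using l e(2) by simp
      also have "\<dots> \<le> L * \<rho> e" using n lip(2) by (rule mult_left_mono)
      finally show ?thesis using True lip(2) rho by (simp add: g_def indicator_def)
     qed simp
    qed
   qed
   also have "\<dots> = L * \<rho> e * measure lebesgue E" by (simp add: E_def)
   also have "measure lebesgue E = unit_ball_vol N * (\<rho> e) powr N"
    using content_cball[of "\<rho> e" x0] rho by (simp add: E_def N_def powr_realpow)
   finally have 2: "(LINT x|lebesgue. indicator E x * g x) \<le> L * \<rho> e * (unit_ball_vol N * (\<rho> e) powr N)" .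
   have "C * (e^2) powr (a - 1) * (LINT x|lebesgue. indicator E x * g x)
     \<le> C * (e^2) powr (a - 1) * (L * \<rho> e * (unit_ball_vol N * (\<rho> e) powr N))"
    using 2 C by (intro mult_left_mono) auto
   also have "\<dots> = B * sqrt e"
   proof -
    have "(\<rho> e) powr N = (2 * sqrt N) powr N * e powr N"
     unfolding \<rho>_def using e N3 by (intro powr_mult)
    moreover have "(e^2) powr (a - 1) = e powr (2 * (a - 1))"
     using e by (simp add: powr_powr flip: powr_numeral)
    moreover have "e powr (2 * (a - 1)) * e * e powr N = sqrt e"
    proof -
     have "e powr (2 * (a - 1)) * e * e powr N = e powr (2 * (a - 1)) * e powr 1 * e powr N" using e by simp
     also have "\<dots> = e powr (2 * (a - 1) + 1 + N)" by (simp only: powr_add)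
     also have "2 * (a - 1) + 1 + N = 1/2" by (simp add: a_def N_def)
     finally show ?thesis using e by (simp add: powr_half_sqrt)
    qed
    moreover have "c * p * (l * (q * y) * (u * (t * r))) = c * (l * u * q * t) * (p * y * r)" for c p l q y u t r :: real
     by (simp add: mult_ac)
    ultimately show ?thesis by (simp only: B_def \<rho>_def)
   qed
   finally show ?thesis using 1 by linarith
  qed
  have "\<eta>0 * (LINT x|lebesgue. indicator D x * g x) \<le> 0"
  proof (rule tendsto_lowerbound)
   have "((\<lambda>e. B * sqrt e) \<longlongrightarrow> B * sqrt 0) (at_right 0)" by (intro tendsto_intros)
   then show "((\<lambda>e. B * sqrt e) \<longlongrightarrow> 0) (at_right 0)" by simp
   have "\<forall>\<^sub>F e in at_right 0. e < min (d / (2 * sqrt N)) (min (\<delta> / (2 * sqrt N)) (R / 2))"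
    by (rule eventually_at_rightI[of 0 "min (d / (2 * sqrt N)) (min (\<delta> / (2 * sqrt N)) (R / 2))"])
      (use lip(1) d R N3 in auto)
   then show "\<forall>\<^sub>F e in at_right 0. \<eta>0 * (LINT x|lebesgue. indicator D x * g x) \<le> B * sqrt e"
    using eventually_at_right_less[of 0]
   proof eventually_elim
    case (elim e)
    have q: "2 * sqrt N > 0" using N3 by simp
    show ?case
     by (rule est) (use elim q in \<open>auto simp: \<rho>_def pos_less_divide_eq mult.commute\<close>)
   qed
  qed simp
  then have le0: "(LINT x|lebesgue. indicator D x * g x) \<le> 0" using eta0 by (simp add: mult_le_0_iff)
  have Dnn: "AE x in lebesgue. 0 \<le> indicator D x * g x" using gnn by eventually_elim (simp add: indicator_def)
  have "(LINT x|lebesgue. indicator D x * g x) = 0" using le0 integral_nonneg_AE[OF Dnn] by linarith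
  then have "AE x in lebesgue. indicator D x * g x = 0" using integral_nonneg_eq_0_iff_AE[OF gD Dnn] by simp
  then show ?thesis
   by (rule eventually_mono) (use DQ in \<open>auto simp: g_def D_def indicator_def subset_iff split: if_splits\<close>)
 qed
 \<comment> \<open>The shells exhaust the punctured ball.\<close>
 have "AE x in lebesgue. \<forall>n. 1 / real (Suc n) \<le> norm (x - x0) \<and> norm (x - x0) \<le> R / 2 \<longrightarrow> w x = 0"
  unfolding AE_all_countable by (intro allI zero) simp
 moreover have "AE x in lebesgue. x \<noteq> x0"
 proof -
  have "{x0} \<in> null_sets lebesgue" by (simp add: negligible_iff_null_sets[symmetric])
  then show ?thesis using AE_not_in[of "{x0}" lebesgue] by simp
 qed
 ultimately show ?thesis
 proof eventually_elim
  case (elim x)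
  show ?case
  proof
   assume x: "x \<in> ball x0 (R / 2)"
   have "0 < norm (x - x0)" using elim(2) by simp
   then obtain n where "1 / real (Suc n) < norm (x - x0)" using nat_approx_posE by blast
   then show "w x = 0" using elim(1) x by (auto simp: dist_norm norm_minus_commute intro: less_imp_le)
  qed
 qed
qed

text \<open>At a zero, the \<open>C\<^sup>1\<close> representative is bounded by a multiple of the distance, so it vanishes nearby: the zero set is open and closed.\<close>

theorem weak_sol_dichotomy:
 fixes \<Omega> :: "'a::euclidean_space set"
 assumes dim: "DIM('a) > 2" and \<Omega>: "open \<Omega>" "connected \<Omega>"
  and w: "locint \<Omega> w" "locint \<Omega> (\<lambda>x. U x * w x)" "weak_sol \<Omega> U w"
  and nn: "AE x in lebesgue. x \<in> \<Omega> \<longrightarrow> 0 \<le> w x"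
  and U: "\<And>K. compact K \<Longrightarrow> K \<subseteq> \<Omega> \<Longrightarrow> \<exists>c. AE x in lebesgue. x \<in> K \<longrightarrow> \<bar>U x\<bar> \<le> c"
 shows "(AE x in lebesgue. x \<in> \<Omega> \<longrightarrow> w x = 0) \<or> (AE x in lebesgue. x \<in> \<Omega> \<longrightarrow> 0 < w x)"
proof -
 obtain v where v: "C_k_on 1 \<Omega> v" "AE x in lebesgue. x \<in> \<Omega> \<longrightarrow> w x = v x"
  using weak_sol_regular[OF dim \<Omega>(1) w nn U] by blast
 have cv: "continuous_on \<Omega> v" by (rule C_1_continuous[OF v(1)])
 have "\<exists>s>0. ball x0 s \<subseteq> {x\<in>\<Omega>. v x = 0}" if x0: "x0 \<in> \<Omega>" "v x0 = 0" for x0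
 proof -
  obtain R0 where R0: "R0 > 0" "cball x0 R0 \<subseteq> \<Omega>" using \<Omega>(1) x0 open_contains_cball by metis
  obtain c where "AE x in lebesgue. x \<in> cball x0 R0 \<longrightarrow> \<bar>U x\<bar> \<le> c" using U[OF compact_cball R0(2)] by blast
  then have c: "AE x in lebesgue. x \<in> cball x0 R0 \<longrightarrow> \<bar>U x\<bar> \<le> \<bar>c\<bar>" by eventually_elim auto
  define m where "m = 1 / (8 * (\<bar>c\<bar> + 1))"
  have m: "m > 0" by (simp add: m_def add_nonneg_pos)
  \<comment> \<open>Then \<open>R\<^sup>2 \<bar>c\<bar> \<le> 1/8\<close>, as the barrier requires.\<close>
  define R where "R = min R0 (min 1 m)"
  have R': "R > 0" "R \<le> R0" "R \<le> 1" "R \<le> m" using R0 m by (auto simp: R_def)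
  then have R: "R > 0" "R \<le> R0" "R \<le> 1" "R \<le> 1 / (8 * (\<bar>c\<bar> + 1))" by (simp_all only: m_def)
  have small: "R^2 * \<bar>c\<bar> \<le> 1/8"
  proof -
   have "R^2 \<le> R" using R by (simp add: power2_eq_square mult_left_le_one_le)
   then have "R^2 * \<bar>c\<bar> \<le> R * \<bar>c\<bar>" by (rule mult_right_mono) simp
   also have "\<dots> \<le> (1 / (8 * (\<bar>c\<bar> + 1))) * \<bar>c\<bar>" using R(4) by (rule mult_right_mono) simp
   also have "\<dots> \<le> 1/8" by (simp add: divide_simps)
   finally show ?thesis .
  qed
  have sub: "cball x0 R \<subseteq> \<Omega>" using R R0 by auto
  have "v differentiable (at x0)" using v(1) x0 by simp
  then obtain D where D: "(v has_derivative D) (at x0)" unfolding differentiable_def by blast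
  obtain B where B: "B > 0" "\<And>h. norm (D h) \<le> norm h * B"
   using bounded_linear.pos_bounded[OF has_derivative_bounded_linear[OF D]] by blast
  obtain d where d: "d > 0" "\<And>y. norm (y - x0) < d \<Longrightarrow> norm (v y - v x0 - D (y - x0)) \<le> 1 * norm (y - x0)"
   using D unfolding has_derivative_at_alt by (meson zero_less_one)
  have vlip: "v y \<le> (1 + B) * norm (y - x0)" if "norm (y - x0) < d" for y
   using d(2)[OF that] B(2)[of "y - x0"] x0(2) by (simp add: algebra_simps)
  have wz: "AE x in lebesgue. x \<in> ball x0 (R / 2) \<longrightarrow> w x = 0"
  proof (rule weak_sol_zero_spreads[OF dim sub R(1) w nn _ _ small, of "min d R" "1 + B"])
   show "AE x in lebesgue. x \<in> cball x0 R \<longrightarrow> \<bar>U x\<bar> \<le> \<bar>c\<bar>"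
    using c by (rule eventually_mono) (use R(2) in auto)
   show "AE x in lebesgue. norm (x - x0) < min d R \<longrightarrow> w x \<le> (1 + B) * norm (x - x0)"
    using v(2)
   proof (rule eventually_mono, intro impI)
    fix x assume "x \<in> \<Omega> \<longrightarrow> w x = v x" and x: "norm (x - x0) < min d R"
    moreover have "x \<in> \<Omega>" using x sub by (auto simp: dist_norm norm_minus_commute)
    ultimately show "w x \<le> (1 + B) * norm (x - x0)" using vlip[of x] by simp
   qed
  qed (use d B R in auto)
  have "ball x0 (R / 2) \<subseteq> cball x0 R" using R(1) by auto
  then have bs: "ball x0 (R / 2) \<subseteq> \<Omega>" using sub by blast
  have ae: "AE x in lebesgue. x \<in> ball x0 (R / 2) \<longrightarrow> v x = 0"
   using wz v(2) by eventually_elim (metis bs subsetD)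
  have "v x = 0" if "x \<in> ball x0 (R / 2)" for x
   by (rule open_AE_continuous_eq[of "ball x0 (R / 2)" v "\<lambda>_. 0" x, OF open_ball continuous_on_subset[OF cv bs] continuous_on_const ae that])
  then show ?thesis using R(1) bs by (intro exI[of _ "R / 2"]) auto
 qed
 then have oZ: "open {x\<in>\<Omega>. v x = 0}" unfolding open_contains_ball by blast
 have oP: "open (\<Omega> \<inter> v -` (- {0}))" by (rule continuous_open_preimage[OF cv \<Omega>(1)]) auto
 have "{x\<in>\<Omega>. v x = 0} \<inter> \<Omega> = {} \<or> (\<Omega> \<inter> v -` (- {0})) \<inter> \<Omega> = {}"
  by (rule connectedD[OF \<Omega>(2) oZ oP]) auto
 then show ?thesis
 proof
  assume "{x\<in>\<Omega>. v x = 0} \<inter> \<Omega> = {}"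
  then have nz: "v x \<noteq> 0" if "x \<in> \<Omega>" for x using that by blast
  have "AE x in lebesgue. x \<in> \<Omega> \<longrightarrow> 0 < w x"
   using nn v(2) by eventually_elim (use nz in force)
  then show ?thesis ..
 next
  assume "(\<Omega> \<inter> v -` (- {0})) \<inter> \<Omega> = {}"
  then have z: "v x = 0" if "x \<in> \<Omega>" for x using that by blast
  have "AE x in lebesgue. x \<in> \<Omega> \<longrightarrow> w x = 0"
   using v(2) by eventually_elim (use z in auto)
  then show ?thesis ..
 qed
qed

section \<open>Compactness in local \<open>L\<^sup>2\<close>\<close>

lemma translate_add_test:
 assumes "u \<in> test_functions UNIV" shows "(\<lambda>y. u (y + z)) \<in> test_functions UNIV"
proof -
 obtain K where K: "compact K" "\<forall>x. x \<notin> K \<longrightarrow> u x = 0" using test_support[OF assms] by blast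
 show ?thesis
 proof (rule test_functionsI[where K = "(\<lambda>x. x - z) ` K"])
  show "smooth (\<lambda>y. u (y + z))" using smooth_shift[OF test_smooth[OF assms], of "- z"] by simp
  show "compact ((\<lambda>x. x - z) ` K)" by (intro compact_continuous_image continuous_intros K)
  fix y assume y: "y \<notin> (\<lambda>x. x - z) ` K"
  have "y + z \<notin> K"
  proof
   assume "y + z \<in> K"
   then have "(y + z) - z \<in> (\<lambda>x. x - z) ` K" by (rule imageI)
   with y show False by simp
  qed
  with K show "u (y + z) = 0" by blast
 qed simp
qed

lemma test_square: "u \<in> test_functions \<Omega> \<Longrightarrow> (\<lambda>x. (u x)^2) \<in> test_functions \<Omega>"
 unfolding power2_eq_square by (rule test_mult[OF _ test_smooth])

text \<open>The translation is split into many small ones, to which the definition of the derivative applies.\<close>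

lemma translation_L2_le:
 fixes u :: "'a::euclidean_space \<Rightarrow> real"
 assumes u: "u \<in> test_functions UNIV"
 shows "(LINT y|lebesgue. (u (y + z) - u y)^2) \<le> (z \<bullet> z) * (LINT y|lebesgue. grad_sq u y)"
proof -
 note s = test_smooth[OF u]
 define T where "T h = (LINT y|lebesgue. (u (y + h) - u y)^2)" for h
 have dt: "(\<lambda>y. u (y + h) - u (y + h')) \<in> test_functions UNIV" for h h'
  by (intro test_diff translate_add_test u)
 have Tshift: "(LINT y|lebesgue. (u (y + a + h) - u (y + a))^2) = T h" for a h
 proof -
  have c: "continuous_on UNIV (\<lambda>y. (u (y + h) - u y)^2)"
   using test_continuous[OF test_square[OF dt[of h 0]]] by simp
  show ?thesis using lebesgue_integral_shift[OF c, of a] by (simp add: T_def)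
 qed
 define D where "D n y = (u (y + (1 / real (Suc n)) *\<^sub>R z) - u y) * real (Suc n)" for n y
 have le: "T z \<le> (LINT y|lebesgue. (D n y)^2)" for n
 proof -
  define m where "m = Suc n"
  define h where "h = (1 / real m) *\<^sub>R z"
  have tel: "u (y + z) - u y = (\<Sum>i<m. u (y + real i *\<^sub>R h + h) - u (y + real i *\<^sub>R h))" for y
  proof -
   have "(\<Sum>i<m. u (y + real (Suc i) *\<^sub>R h) - u (y + real i *\<^sub>R h)) = u (y + real m *\<^sub>R h) - u (y + real 0 *\<^sub>R h)"
    by (rule sum_lessThan_telescope)
   moreover have "real m *\<^sub>R h = z" by (simp add: h_def m_def)
   moreover have "y + real (Suc i) *\<^sub>R h = y + real i *\<^sub>R h + h" for i by (simp add: algebra_simps)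
   ultimately show ?thesis by (simp add: add.assoc)
  qed
  have int: "integrable lebesgue (\<lambda>y. (u (y + real i *\<^sub>R h + h) - u (y + real i *\<^sub>R h))^2)" for i
   using integrable_test[OF test_square[OF dt[of "real i *\<^sub>R h + h" "real i *\<^sub>R h"]]] by (simp add: add.assoc)
  have "T z \<le> (LINT y|lebesgue. real m * (\<Sum>i<m. (u (y + real i *\<^sub>R h + h) - u (y + real i *\<^sub>R h))^2))"
   unfolding T_def
  proof (rule integral_mono)
   show "integrable lebesgue (\<lambda>y. (u (y + z) - u y)^2)"
    using integrable_test[OF test_square[OF dt[of z 0]]] by simp
   show "integrable lebesgue (\<lambda>y. real m * (\<Sum>i<m. (u (y + real i *\<^sub>R h + h) - u (y + real i *\<^sub>R h))^2))"
    by (intro integrable_mult_right Bochner_Integration.integrable_sum int)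
   show "(u (y + z) - u y)^2 \<le> real m * (\<Sum>i<m. (u (y + real i *\<^sub>R h + h) - u (y + real i *\<^sub>R h))^2)" for y
    unfolding tel using sum_squared_le_sum_of_squares[of "\<lambda>i. u (y + real i *\<^sub>R h + h) - u (y + real i *\<^sub>R h)" "{..<m}"]
    by (simp add: mult.commute)
  qed
  also have "\<dots> = real m * (\<Sum>i<m. T h)"
   using int by (simp add: Tshift)
  also have "\<dots> = (LINT y|lebesgue. (real m * (u (y + h) - u y))^2)"
  proof -
   have "(LINT y|lebesgue. (real m * (u (y + h) - u y))^2) = (LINT y|lebesgue. (real m)^2 * (u (y + h) - u y)^2)"
    by (simp only: power_mult_distrib)
   also have "\<dots> = (real m)^2 * T h" by (simp add: T_def)
   also have "\<dots> = real m * (\<Sum>i<m. T h)" by (simp add: power2_eq_square)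
   finally show ?thesis by (rule sym)
  qed
  also have "\<dots> = (LINT y|lebesgue. (D n y)^2)" by (simp add: D_def h_def m_def mult.commute)
  finally show ?thesis .
 qed
 define \<phi> where "\<phi> y = frechet_derivative u (at y) z" for y
 have phi: "\<phi> y = (\<Sum>b\<in>Basis. (z \<bullet> b) * partial b u y)" for y
  unfolding \<phi>_def by (rule frechet_derivative_sum[OF s])
 have phit: "\<phi> \<in> test_functions UNIV" unfolding phi[abs_def] by (intro test_sum test_cmult test_partial u)
 obtain c where c: "c > 0" "\<And>y. \<bar>\<phi> y\<bar> \<le> c"
  using compact_support_bound[OF test_continuous[OF phit]] test_support[OF phit] by blast
 obtain K where K: "compact K" "\<forall>x. x \<notin> K \<longrightarrow> u x = 0" using test_support[OF u] by blast
 define L where "L = (\<lambda>p. fst p - snd p *\<^sub>R z) ` (K \<times> {0..1::real})"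
 have L: "compact L" unfolding L_def
  by (intro compact_continuous_image compact_Times K compact_Icc continuous_intros)
 have inL: "y \<in> L" if "y + t *\<^sub>R z \<in> K" "0 \<le> t" "t \<le> 1" for y t
 proof -
  have "y = (y + t *\<^sub>R z) - t *\<^sub>R z" by simp
  then show ?thesis unfolding L_def using that by (intro image_eqI[of _ _ "(y + t *\<^sub>R z, t)"]) auto
 qed
 have "(\<lambda>n. LINT y|lebesgue. (D n y)^2) \<longlonglongrightarrow> (LINT y|lebesgue. (\<phi> y)^2)"
 proof (rule integral_dominated_convergence)
  show "(\<lambda>y. (\<phi> y)^2) \<in> borel_measurable lebesgue"
   by (rule continuous_measurable_lebesgue[OF test_continuous[OF test_square[OF phit]]])
  have "D n \<in> test_functions UNIV" for n
   unfolding D_def using test_cmult[OF dt[of "(1 / real (Suc n)) *\<^sub>R z" 0], of "real (Suc n)"] by (simp add: mult.commute)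
  then show "(\<lambda>y. (D n y)^2) \<in> borel_measurable lebesgue" for n
   by (intro continuous_measurable_lebesgue test_continuous[OF test_square])
  show "integrable lebesgue (\<lambda>y. c^2 * indicator L y)"
   by (rule integrable_mult_right) (rule integrable_indicator_compact[OF L])
  show "AE y in lebesgue. (\<lambda>n. (D n y)^2) \<longlonglongrightarrow> (\<phi> y)^2"
   unfolding D_def \<phi>_def by (rule AE_I2) (intro tendsto_power difference_quotient_tendsto[OF s])
  show "AE y in lebesgue. norm ((D n y)^2) \<le> c^2 * indicator L y" for n
  proof (rule AE_I2)
   fix y
   define t where "t = 1 / real (Suc n)"
   have t: "0 < t" "t \<le> 1" by (auto simp: t_def)
   have Dt: "D n y = (u (y + t *\<^sub>R z) - u y) / t" by (simp add: D_def t_def)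
   show "norm ((D n y)^2) \<le> c^2 * indicator L y"
   proof (cases "y \<in> L")
    case False
    have "y + t *\<^sub>R z \<notin> K" "y + 0 *\<^sub>R z \<notin> K" using False inL[of y t] inL[of y 0] t by auto
    then have "u (y + t *\<^sub>R z) = 0" "u y = 0" using K(2) by auto
    then show ?thesis using False by (simp add: Dt)
   next
    case True
    obtain q where "u (y + t *\<^sub>R z) - u y = frechet_derivative u (at (y + q *\<^sub>R (t *\<^sub>R z))) (t *\<^sub>R z)"
     using directional_mvt[OF s] by blast
    then have "u (y + t *\<^sub>R z) - u y = t * \<phi> (y + q *\<^sub>R (t *\<^sub>R z))"
     using linear_cmul[OF has_derivative_linear[OF smooth_has_derivative[OF s]]] by (simp add: \<phi>_def)
    then have "D n y = \<phi> (y + q *\<^sub>R (t *\<^sub>R z))" using t by (simp add: Dt)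
    then have "\<bar>D n y\<bar> \<le> c" using c(2) by simp
    then show ?thesis using True c(1) abs_le_square_iff[of "D n y" c] by simp
   qed
  qed
 qed
 then have "T z \<le> (LINT y|lebesgue. (\<phi> y)^2)" by (rule LIMSEQ_le_const) (use le in auto)
 also have "\<dots> \<le> (LINT y|lebesgue. (z \<bullet> z) * grad_sq u y)"
 proof (rule integral_mono)
  show "integrable lebesgue (\<lambda>y. (\<phi> y)^2)" by (rule integrable_test[OF test_square[OF phit]])
  show "integrable lebesgue (\<lambda>y. (z \<bullet> z) * grad_sq u y)" using integrable_test[OF test_grad_sq[OF u]] by simp
  show "(\<phi> y)^2 \<le> (z \<bullet> z) * grad_sq u y" for y
   using Cauchy_Schwarz_ineq_sum[of "\<lambda>b. z \<bullet> b" "\<lambda>b. partial b u y" Basis]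
   by (simp add: phi grad_sq_def euclidean_inner[of z z] power2_eq_square)
 qed
 finally show ?thesis by (simp add: T_def)
qed

lemma ex_mollifier:
 assumes "\<epsilon> > 0"
 shows "\<exists>j :: 'a::euclidean_space \<Rightarrow> real. j \<in> test_functions UNIV \<and> (\<forall>z. 0 \<le> j z) \<and> (\<forall>z. norm z \<ge> \<epsilon> \<longrightarrow> j z = 0)
  \<and> (LINT z|lebesgue. j z) = 1"
proof -
 obtain \<eta> :: "'a \<Rightarrow> real" where e: "smooth \<eta>" "\<And>x. 0 \<le> \<eta> x" "\<And>x. \<eta> x \<le> 1"
  "\<forall>x. dist 0 x \<le> \<epsilon>/2 \<longrightarrow> \<eta> x = 1" "\<forall>x. dist 0 x \<ge> \<epsilon> \<longrightarrow> \<eta> x = 0"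
  using ball_cutoff[of "\<epsilon>/2" \<epsilon> "0::'a"] assms by auto
 have t: "\<eta> \<in> test_functions UNIV"
  by (rule test_functionsI[where K = "cball 0 \<epsilon>"]) (use e in auto)
 have "0 < measure lebesgue (cball (0::'a) (\<epsilon>/2))" using content_cball_pos[of "\<epsilon>/2" "0::'a"] assms by simp
 also have "\<dots> = (LINT z|lebesgue. indicator (cball (0::'a) (\<epsilon>/2)) z)" by simp
 also have "\<dots> \<le> (LINT z|lebesgue. \<eta> z)"
 proof (rule integral_mono)
  show "integrable lebesgue (indicator (cball (0::'a) (\<epsilon>/2)) :: 'a \<Rightarrow> real)"
   by (rule integrable_indicator_compact[OF compact_cball])
  show "integrable lebesgue \<eta>" by (rule integrable_test[OF t])
  show "indicator (cball 0 (\<epsilon>/2)) z \<le> \<eta> z" for z using e(2,4) by (auto simp: indicator_def)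
 qed
 finally have pos: "0 < (LINT z|lebesgue. \<eta> z)" .
 define c where "c = 1 / (LINT z|lebesgue. \<eta> z)"
 have c: "c > 0" "c * (LINT z|lebesgue. \<eta> z) = 1" using pos by (auto simp: c_def)
 show ?thesis
  by (rule exI[of _ "\<lambda>z. c * \<eta> z"]) (use c e test_cmult[OF t, of c] in auto)
qed

text \<open>By Cauchy--Schwarz with respect to the density \<open>j\<close>, the error is an average of translation errors over shifts of length at most \<open>\<epsilon>\<close>.\<close>

lemma mollifier_error:
 fixes u j :: "'a::euclidean_space \<Rightarrow> real"
 assumes u: "u \<in> test_functions UNIV" and j: "j \<in> test_functions UNIV" "\<forall>z. 0 \<le> j z"
  "\<forall>z. norm z \<ge> \<epsilon> \<longrightarrow> j z = 0" "(LINT z|lebesgue. j z) = 1" and eps: "\<epsilon> > 0"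
 defines "A \<equiv> \<lambda>y. LINT x|lebesgue. u x * j (x - y)"
 shows "integrable lebesgue (\<lambda>y. (u y - A y)^2)"
  and "(LINT y|lebesgue. (u y - A y)^2) \<le> \<epsilon>^2 * (LINT y|lebesgue. grad_sq u y)"
proof -
 have cu: "continuous_on UNIV u" by (rule test_continuous[OF u])
 have cj: "continuous_on UNIV j" by (rule test_continuous[OF j(1)])
 have mu: "u \<in> borel_measurable borel" and mj: "j \<in> borel_measurable borel"
  by (auto intro: borel_measurable_continuous_onI cu cj)
 have A: "A y = (LINT z|lebesgue. u (y + z) * j z)" for y
 proof -
  have "(\<lambda>z. u (y + z) * j z) \<in> borel_measurable borel" using mu mj by measurable
  from lebesgue_integral_translate[OF this, of y] show ?thesis by (simp add: A_def)
 qed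
 define F where "F = (\<lambda>(y, z). (u y - u (y + z))^2 * j z)"
 obtain K where K: "compact K" "\<forall>x. x \<notin> K \<longrightarrow> u x = 0" using test_support[OF u] by blast
 define L where "L = (\<lambda>p. fst p - snd p) ` (K \<times> cball (0::'a) \<epsilon>)"
 have L: "compact L" unfolding L_def
  by (intro compact_continuous_image compact_Times K compact_cball continuous_intros)
 have cF: "continuous_on UNIV F" unfolding F_def case_prod_unfold
  by (intro continuous_intros continuous_on_compose2[OF cu] continuous_on_compose2[OF cj]) auto
 have F0: "F p = 0" if "p \<notin> (K \<union> L) \<times> cball 0 \<epsilon>" for p
 proof (cases "snd p \<in> cball 0 \<epsilon>")
  case False
  then show ?thesis using j(3) by (auto simp: F_def case_prod_unfold)
 next
  case True
  then have n: "fst p \<notin> K" "fst p \<notin> L" using that by (auto simp: mem_Times_iff)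
  have "fst p + snd p \<notin> K"
  proof
   assume a: "fst p + snd p \<in> K"
   have "fst p = (fst p + snd p) - snd p" by simp
   then have "fst p \<in> L" unfolding L_def using a True by (intro image_eqI[of _ _ "(fst p + snd p, snd p)"]) auto
   with n show False by simp
  qed
  then show ?thesis using n K(2) by (simp add: F_def case_prod_unfold)
 qed
 have iF: "integrable (lborel \<Otimes>\<^sub>M lborel) F"
 proof -
  have "integrable lebesgue F"
   by (rule integrable_continuous_compact_support[OF cF compact_Times[OF compact_Un[OF K(1) L] compact_cball[of 0 \<epsilon>]]])
     (use F0 in blast)
  then have "integrable lborel F"
   using borel_measurable_continuous_onI[OF cF] by (simp add: integrable_completion)
  then show ?thesis by (simp add: lborel_prod)
 qed
 have cont1: "continuous_on UNIV (\<lambda>z. F (y, z))" "continuous_on UNIV (\<lambda>y. F (y, z))" for y z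
  by (rule continuous_on_compose2[OF cF]; intro continuous_intros subset_UNIV)+
 have ileb: "(LINT z|lebesgue. F (y, z)) = (\<integral>z. F (y, z) \<partial>lborel)" "(LINT y|lebesgue. F (y, z)) = (\<integral>y. F (y, z) \<partial>lborel)" for y z
  using borel_measurable_continuous_onI[OF cont1(1)] borel_measurable_continuous_onI[OF cont1(2)]
  by (auto simp: integral_completion)
 have iFz: "integrable lebesgue (\<lambda>z. F (y, z))" for y
  by (rule integrable_continuous_compact_support[OF cont1(1) compact_cball[of 0 \<epsilon>]]) (use F0 in auto)
 define J where "J y = (LINT z|lebesgue. F (y, z))" for y
 have iJ: "integrable lborel J"
  using lborel_pair.integrable_fst'[OF iF] unfolding J_def ileb .
 then have iJ': "integrable lebesgue J" by (simp add: integrable_completion borel_measurable_integrable)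
 have jensen: "(u y - A y)^2 \<le> J y" for y
 proof -
  define d where "d z = u y - u (y + z)" for z
  have cd: "continuous_on UNIV d" unfolding d_def by (intro continuous_intros continuous_on_compose2[OF cu]) auto
  have ij: "integrable lebesgue j" by (rule integrable_test[OF j(1)])
  have i1: "integrable lebesgue (\<lambda>z. d z * j z)" by (rule locint_test[OF locint_continuous[OF cd] j(1)])
  have i2: "integrable lebesgue (\<lambda>z. (d z)^2 * j z)"
   by (rule locint_test[OF locint_continuous[OF continuous_on_power[OF cd]] j(1)])
  have i3: "integrable lebesgue (\<lambda>z. u (y + z) * j z)"
   by (rule locint_test[OF locint_continuous j(1)]) (intro continuous_intros continuous_on_compose2[OF cu], auto)
  define m where "m = u y - A y"
  have "(LINT z|lebesgue. d z * j z) = (LINT z|lebesgue. u y * j z - u (y + z) * j z)"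
   by (simp add: d_def left_diff_distrib)
  also have "\<dots> = m" using ij i3 j(4) by (simp add: m_def A)
  finally have dm: "(LINT z|lebesgue. d z * j z) = m" .
  have "0 \<le> (LINT z|lebesgue. (d z - m)^2 * j z)" using j(2) by (intro integral_nonneg_AE AE_I2) simp
  also have "\<dots> = (LINT z|lebesgue. (d z)^2 * j z - (2 * m) * (d z * j z) + m^2 * j z)"
   by (simp add: power2_eq_square algebra_simps)
  also have "\<dots> = (LINT z|lebesgue. (d z)^2 * j z) - (2 * m) * m + m^2"
   using i1 i2 ij j(4) dm by simp
  finally have "0 \<le> (LINT z|lebesgue. (d z)^2 * j z) - m^2" by (simp add: power2_eq_square)
  moreover have "(LINT z|lebesgue. (d z)^2 * j z) = J y" by (simp add: J_def F_def d_def)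
  ultimately show ?thesis by (simp add: m_def)
 qed
 have cA: "continuous_on UNIV A" unfolding A_def by (rule convolution_continuous[OF integrable_test[OF u] j(1)])
 show int: "integrable lebesgue (\<lambda>y. (u y - A y)^2)"
 proof (rule Bochner_Integration.integrable_bound[OF iJ'])
  show "(\<lambda>y. (u y - A y)^2) \<in> borel_measurable lebesgue"
   by (intro continuous_measurable_lebesgue continuous_intros cu cA)
  show "AE y in lebesgue. norm ((u y - A y)^2) \<le> norm (J y)"
  proof (rule AE_I2)
   fix y have "0 \<le> (u y - A y)^2" by simp
   with jensen[of y] show "norm ((u y - A y)^2) \<le> norm (J y)" by simp
  qed
 qed
 have "(LINT y|lebesgue. (u y - A y)^2) \<le> (LINT y|lebesgue. J y)" by (rule integral_mono[OF int iJ' jensen])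
 also have "\<dots> = (\<integral>y. (\<integral>z. F (y, z) \<partial>lborel) \<partial>lborel)"
  using borel_measurable_integrable[OF iJ] unfolding J_def ileb by (simp add: integral_completion)
 also have "\<dots> = (\<integral>z. (\<integral>y. F (y, z) \<partial>lborel) \<partial>lborel)"
  using lborel_pair.Fubini_integral[of "\<lambda>y z. F (y, z)"] iF by simp
 also have "\<dots> \<le> (\<integral>z. (\<epsilon>^2 * (LINT y|lebesgue. grad_sq u y)) * j z \<partial>lborel)"
 proof (rule integral_mono)
  show "integrable lborel (\<lambda>z. \<integral>y. F (y, z) \<partial>lborel)"
  proof -
   have "integrable (lborel \<Otimes>\<^sub>M lborel) (\<lambda>(z, y). F (y, z))" by (rule lborel_pair.integrable_product_swap[OF iF])
   from lborel_pair.integrable_fst'[OF this] show ?thesis by simp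
  qed
  show "integrable lborel (\<lambda>z. (\<epsilon>^2 * (LINT y|lebesgue. grad_sq u y)) * j z)"
   using integrable_test[OF j(1)] mj by (simp add: integrable_completion)
  fix z
  have "(\<integral>y. F (y, z) \<partial>lborel) = (LINT y|lebesgue. (u (y + z) - u y)^2 * j z)"
   unfolding ileb(2)[symmetric] by (simp add: F_def power2_commute)
  also have "\<dots> = (LINT y|lebesgue. (u (y + z) - u y)^2) * j z" by simp
  also have "\<dots> \<le> ((z \<bullet> z) * (LINT y|lebesgue. grad_sq u y)) * j z"
   using translation_L2_le[OF u, of z] j(2) by (intro mult_right_mono) auto
  also have "\<dots> \<le> (\<epsilon>^2 * (LINT y|lebesgue. grad_sq u y)) * j z"
  proof (cases "norm z < \<epsilon>")
   case True
   then have "(norm z)^2 \<le> \<epsilon>^2" by (intro power_mono) auto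
   moreover have "0 \<le> (LINT y|lebesgue. grad_sq u y)" by (simp add: grad_sq_def sum_nonneg)
   ultimately show ?thesis using j(2) by (intro mult_right_mono) (auto simp: power2_norm_eq_inner)
  next
   case False
   then show ?thesis using j(3) by simp
  qed
  finally show "(\<integral>y. F (y, z) \<partial>lborel) \<le> (\<epsilon>^2 * (LINT y|lebesgue. grad_sq u y)) * j z" .
 qed
 also have "\<dots> = \<epsilon>^2 * (LINT y|lebesgue. grad_sq u y)"
  using j(4) mj by (simp add: integral_completion)
 finally show "(LINT y|lebesgue. (u y - A y)^2) \<le> \<epsilon>^2 * (LINT y|lebesgue. grad_sq u y)" .
qed

text \<open>Rellich: mollification is uniformly close to the identity on bounded sets of \<open>H\<^sup>1\<close>, and the mollified
 functions form a relatively compact family by the theorem of Arzela and Ascoli.\<close>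

lemma Rellich_total_boundedness:
 fixes w :: "nat \<Rightarrow> 'a::euclidean_space \<Rightarrow> real"
 assumes w: "\<And>n. w n \<in> test_functions UNIV" and K: "compact K" "\<And>n x. x \<notin> K \<Longrightarrow> w n x = 0"
  and C: "\<And>n. (LINT x|lebesgue. (w n x)^2) \<le> C" "\<And>n. (LINT x|lebesgue. grad_sq (w n) x) \<le> C" and e: "e > 0"
 shows "\<exists>r::nat \<Rightarrow> nat. strict_mono r \<and> (\<forall>i j. (LINT x|lebesgue. (w (r i) x - w (r j) x)^2) \<le> e)"
proof -
 have "0 \<le> (LINT x|lebesgue. (w 0 x)^2)" by simp
 with C(1)[of 0] have C0: "C \<ge> 0" by linarith
 define V where "V = measure lebesgue K"
 have V0: "V \<ge> 0" by (simp add: V_def)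
 define \<epsilon> where "\<epsilon> = sqrt (e / (12 * (C + 1)))"
 have eps: "\<epsilon> > 0" using e C0 by (simp add: \<epsilon>_def)
 have eps2: "\<epsilon>^2 * C \<le> e / 12"
 proof -
  have "\<epsilon>^2 * C = (e / 12) * (C / (C + 1))" using e C0 by (simp add: \<epsilon>_def)
  also have "\<dots> \<le> (e / 12) * 1" using e C0 by (intro mult_left_mono) auto
  finally show ?thesis by simp
 qed
 obtain j :: "'a \<Rightarrow> real" where j: "j \<in> test_functions UNIV" "\<forall>z. 0 \<le> j z" "\<forall>z. norm z \<ge> \<epsilon> \<longrightarrow> j z = 0" "(LINT z|lebesgue. j z) = 1"
  using ex_mollifier[OF eps] by blast
 define A where "A n y = (LINT x|lebesgue. w n x * j (x - y))" for n y
 have L1: "(LINT x|lebesgue. \<bar>w n x\<bar>) \<le> V + C" for n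
 proof -
  have "(LINT x|lebesgue. \<bar>w n x\<bar>) \<le> (LINT x|lebesgue. indicator K x + (w n x)^2)"
  proof (rule integral_mono)
   show "integrable lebesgue (\<lambda>x. \<bar>w n x\<bar>)" using integrable_test[OF w] by simp
   show "integrable lebesgue (\<lambda>x. indicator K x + (w n x)^2)"
    by (intro Bochner_Integration.integrable_add integrable_indicator_compact[OF K(1)] integrable_test[OF test_square[OF w]])
   show "\<bar>w n x\<bar> \<le> indicator K x + (w n x)^2" for x
   proof (cases "x \<in> K")
    case True
    have "0 \<le> (\<bar>w n x\<bar> - 1)^2" by simp
    then have "2 * \<bar>w n x\<bar> \<le> 1 + (w n x)^2" by (simp add: power2_eq_square algebra_simps)
    then show ?thesis using True by simp
   qed (simp add: K(2))
  qed
  also have "\<dots> = V + (LINT x|lebesgue. (w n x)^2)"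
   using integrable_indicator_compact[OF K(1)] integrable_test[OF test_square[OF w]] by (simp add: V_def)
  finally show ?thesis using C(1)[of n] by linarith
 qed
 have VC: "V + C \<ge> 0" using V0 C0 by simp
 have sj: "(\<lambda>x. j (x - y)) \<in> test_functions UNIV" for y
  using translate_add_test[OF j(1), of "- y"] by simp
 have intA: "integrable lebesgue (\<lambda>x. w n x * j (x - y))" for n y
  by (rule locint_test[OF locint_continuous[OF test_continuous[OF w]] sj])
 have Adiff: "\<bar>A n y - A n y'\<bar> \<le> c * (V + C)" if c: "c \<ge> 0" "\<And>x. \<bar>j (x - y) - j (x - y')\<bar> \<le> c" for n y y' c
 proof -
  have "A n y - A n y' = (LINT x|lebesgue. w n x * (j (x - y) - j (x - y')))"
   using intA by (simp add: A_def right_diff_distrib)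
  also have "\<bar>\<dots>\<bar> \<le> (LINT x|lebesgue. \<bar>w n x * (j (x - y) - j (x - y'))\<bar>)" by (rule integral_abs_bound)
  also have "\<dots> \<le> (LINT x|lebesgue. c * \<bar>w n x\<bar>)"
  proof (rule integral_mono)
   show "integrable lebesgue (\<lambda>x. \<bar>w n x * (j (x - y) - j (x - y'))\<bar>)"
    using intA by (simp add: right_diff_distrib)
   show "integrable lebesgue (\<lambda>x. c * \<bar>w n x\<bar>)" using integrable_test[OF w] by simp
   show "\<bar>w n x * (j (x - y) - j (x - y'))\<bar> \<le> c * \<bar>w n x\<bar>" for x
    unfolding abs_mult mult.commute[of "\<bar>w n x\<bar>"] by (rule mult_right_mono[OF c(2)]) simp
  qed
  also have "\<dots> = c * (LINT x|lebesgue. \<bar>w n x\<bar>)" by simp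
  also have "\<dots> \<le> c * (V + C)" using L1 c(1) by (rule mult_left_mono)
  finally show ?thesis .
 qed
 obtain B where B: "B > 0" "\<And>z. \<bar>j z\<bar> \<le> B"
  using compact_support_bound[OF test_continuous[OF j(1)]] test_support[OF j(1)] by blast
 have Abound: "norm (A n y) \<le> B * (V + C)" for n y
 proof -
  have "\<bar>A n y\<bar> \<le> (LINT x|lebesgue. \<bar>w n x * j (x - y)\<bar>)" unfolding A_def by (rule integral_abs_bound)
  also have "\<dots> \<le> (LINT x|lebesgue. B * \<bar>w n x\<bar>)"
  proof (rule integral_mono)
   show "integrable lebesgue (\<lambda>x. \<bar>w n x * j (x - y)\<bar>)" using intA by simp
   show "integrable lebesgue (\<lambda>x. B * \<bar>w n x\<bar>)" using integrable_test[OF w] by simp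
   show "\<bar>w n x * j (x - y)\<bar> \<le> B * \<bar>w n x\<bar>" for x
    unfolding abs_mult mult.commute[of "\<bar>w n x\<bar>"] by (rule mult_right_mono[OF B(2)]) simp
  qed
  also have "\<dots> = B * (LINT x|lebesgue. \<bar>w n x\<bar>)" by simp
  also have "\<dots> \<le> B * (V + C)" using L1 B(1) by (intro mult_left_mono) auto
  finally show ?thesis by simp
 qed
 have equi: "\<exists>d. 0 < d \<and> (\<forall>n y. y \<in> K \<and> norm (x - y) < d \<longrightarrow> norm (A n x - A n y) < t)" if t: "0 < t" for x t
 proof -
  define c where "c = t / (V + C + 1)"
  have c: "c > 0" using t VC by (simp add: c_def)
  obtain L where L: "compact L" "\<forall>x. x \<notin> L \<longrightarrow> j x = 0" using test_support[OF j(1)] by blast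
  obtain d where d: "d > 0" "\<And>p q. norm (p - q) < d \<Longrightarrow> \<bar>j p - j q\<bar> < c"
   using uniformly_continuous_compact_support[OF test_continuous[OF j(1)] L c] by blast
  show ?thesis
  proof (intro exI[of _ d] conjI allI impI d(1))
   fix n y assume y: "y \<in> K \<and> norm (x - y) < d"
   have "\<bar>j (p - x) - j (p - y)\<bar> \<le> c" for p
    using d(2)[of "p - x" "p - y"] y by (simp add: norm_minus_commute less_imp_le)
   then have "\<bar>A n x - A n y\<bar> \<le> c * (V + C)" using c by (intro Adiff) auto
   also have "\<dots> < t" using t VC by (simp add: c_def divide_simps)
   finally show "norm (A n x - A n y) < t" by simp
  qed
 qed
 obtain g k where k: "strict_mono (k :: nat \<Rightarrow> nat)"
  "\<And>t. 0 < t \<Longrightarrow> \<exists>N. \<forall>n x. n \<ge> N \<and> x \<in> K \<longrightarrow> norm (A (k n) x - g x) < t"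
  using Arzela_Ascoli[OF K(1) Abound equi] by metis
 define t where "t = sqrt (e / (24 * (V + 1)))"
 have t: "t > 0" using e V0 by (simp add: t_def)
 obtain N where N: "\<And>n x. n \<ge> N \<Longrightarrow> x \<in> K \<Longrightarrow> norm (A (k n) x - g x) < t" using k(2)[OF t] by blast
 define r where "r i = k (i + N)" for i
 have r: "strict_mono r" using k(1) unfolding r_def strict_mono_def by simp
 have "(LINT x|lebesgue. (w (r i) x - w (r l) x)^2) \<le> e" for i l
 proof -
  define E where "E n x = (w n x - A n x)^2" for n x
  have iE: "integrable lebesgue (E n)" for n
   unfolding E_def[abs_def] A_def by (rule mollifier_error(1)[OF w j eps])
  have E_le: "(LINT x|lebesgue. E n x) \<le> e / 12" for n
  proof -
   have "(LINT x|lebesgue. E n x) \<le> \<epsilon>^2 * (LINT x|lebesgue. grad_sq (w n) x)"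
    unfolding E_def A_def by (rule mollifier_error(2)[OF w j eps])
   also have "\<dots> \<le> \<epsilon>^2 * C" using C(2) by (intro mult_left_mono) auto
   finally show ?thesis using eps2 by linarith
  qed
  have "(LINT x|lebesgue. (w (r i) x - w (r l) x)^2)
    \<le> (LINT x|lebesgue. 3 * E (r i) x + 3 * E (r l) x + (3 * (2 * t)^2) * indicator K x)"
  proof (rule integral_mono)
   show "integrable lebesgue (\<lambda>x. (w (r i) x - w (r l) x)^2)"
    by (rule integrable_test[OF test_square[OF test_diff[OF w w]]])
   show "integrable lebesgue (\<lambda>x. 3 * E (r i) x + 3 * E (r l) x + (3 * (2 * t)^2) * indicator K x)"
    by (intro Bochner_Integration.integrable_add integrable_mult_right iE integrable_indicator_compact K)
   fix x
   show "(w (r i) x - w (r l) x)^2 \<le> 3 * E (r i) x + 3 * E (r l) x + (3 * (2 * t)^2) * indicator K x"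
   proof (cases "x \<in> K")
    case False
    then show ?thesis by (simp add: K(2) E_def)
   next
    case True
    have "\<bar>A (r i) x - g x\<bar> < t" "\<bar>A (r l) x - g x\<bar> < t" using N[of _ x] True by (auto simp: r_def)
    then have "\<bar>A (r i) x - A (r l) x\<bar> \<le> \<bar>2 * t\<bar>" by linarith
    then have q: "(A (r i) x - A (r l) x)^2 \<le> (2 * t)^2" by (simp only: abs_le_square_iff)
    have "(p + s + v)^2 \<le> 3 * p^2 + 3 * s^2 + 3 * v^2" for p s v :: real
    proof -
     have "0 \<le> (p - s)^2 + (s - v)^2 + (p - v)^2" by simp
     then show ?thesis by (simp add: power2_eq_square algebra_simps)
    qed
    from this[of "w (r i) x - A (r i) x" "A (r i) x - A (r l) x" "- (w (r l) x - A (r l) x)"]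
    have "(w (r i) x - w (r l) x)^2 \<le> 3 * E (r i) x + 3 * (A (r i) x - A (r l) x)^2 + 3 * E (r l) x"
     by (simp add: E_def power2_commute)
    then show ?thesis using q True by simp
   qed
  qed
  also have "\<dots> = 3 * (LINT x|lebesgue. E (r i) x) + 3 * (LINT x|lebesgue. E (r l) x) + (3 * (2 * t)^2) * V"
   using iE integrable_indicator_compact[OF K(1)] by (simp add: V_def)
  also have "(3 * (2 * t)^2) * V \<le> e / 2"
  proof -
   have "(3 * (2 * t)^2) * V = 12 * t^2 * V" by (simp add: power_mult_distrib)
   also have "t^2 = (e / 24) / (V + 1)" using e V0 by (simp add: t_def)
   also have "12 * ((e / 24) / (V + 1)) * V = (e / 2) * (V / (V + 1))"
   proof -
    have "12 * ((e / 24) / d) * V = (e / 2) * (V / d)" for d :: real by simp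
    then show ?thesis .
   qed
   also have "\<dots> \<le> (e / 2) * 1" using e V0 by (intro mult_left_mono) auto
   finally show ?thesis by simp
  qed
  finally show ?thesis using E_le[of "r i"] E_le[of "r l"] by linarith
 qed
 with r show ?thesis by blast
qed

text \<open>A diagonal subsequence is Cauchy so fast on every compact set that its increments are summable almost
 everywhere; Fatou turns the pointwise limit into a limit in local \<open>L\<^sup>2\<close>.\<close>

lemma L2_loc_compactness:
 fixes u :: "nat \<Rightarrow> 'a::euclidean_space \<Rightarrow> real"
 assumes \<Omega>: "open \<Omega>" and u: "\<And>n. u n \<in> test_functions \<Omega>"
  and tb: "\<And>K e s. compact K \<Longrightarrow> K \<subseteq> \<Omega> \<Longrightarrow> e > 0 \<Longrightarrow> strict_mono (s :: nat \<Rightarrow> nat) \<Longrightarrow>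
   \<exists>r::nat \<Rightarrow> nat. strict_mono r \<and> (\<forall>i j. (LINT x|lebesgue. indicator K x * (u (s (r i)) x - u (s (r j)) x)^2) \<le> e)"
 shows "\<exists>r w. strict_mono (r :: nat \<Rightarrow> nat) \<and> w \<in> borel_measurable borel \<and>
   (\<forall>K. compact K \<and> K \<subseteq> \<Omega> \<longrightarrow> integrable lebesgue (\<lambda>x. indicator K x * (w x)^2) \<and>
    (\<forall>n. integrable lebesgue (\<lambda>x. indicator K x * (u (r n) x - w x)^2)) \<and>
    (\<lambda>n. LINT x|lebesgue. indicator K x * (u (r n) x - w x)^2) \<longlonglongrightarrow> 0)"
proof -
 obtain C where C: "\<And>n::nat. compact (C n)" "\<And>n. C n \<subseteq> \<Omega>" "\<And>n. C n \<subseteq> interior (C (Suc n))" "\<Union>(range C) = \<Omega>"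
  "\<forall>K. compact K \<and> K \<subseteq> \<Omega> \<longrightarrow> (\<exists>N. \<forall>n\<ge>N. K \<subseteq> C n)"
  using open_Union_compact_subsets[OF \<Omega>] by metis
 have Cmono: "C m \<subseteq> C n" if "m \<le> n" for m n
  by (rule lift_Suc_mono_le[OF _ that]) (use C(3) interior_subset in blast)
 define I where "I K p q = (LINT x|lebesgue. indicator K x * (p x - q x)^2)" for K :: "'a set" and p q :: "'a \<Rightarrow> real"
 define P where "P n s \<longleftrightarrow> (\<forall>i j. I (C n) (u (s i)) (u (s j)) \<le> (1/4)^n)" for n and s :: "nat \<Rightarrow> nat"
 interpret subseqs P
 proof
  fix n and s :: "nat \<Rightarrow> nat" assume "strict_mono s"
  then show "\<exists>r'. strict_mono r' \<and> P n (s \<circ> r')"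
   using tb[OF C(1,2), of "(1/4)^n" s n] by (auto simp: P_def I_def)
 qed
 \<comment> \<open>Condition \<open>P k\<close> holds along the diagonal sequence from index \<open>Suc k\<close> on.\<close>
 define r where "r k = diagseq (Suc k)" for k
 have rm: "strict_mono r" unfolding r_def strict_mono_def
  using subseq_diagseq by (simp add: strict_mono_def)
 define v where "v k = u (r k)" for k
 have fast: "I (C k) (v i) (v j) \<le> (1/4)^k" if "k \<le> i" "k \<le> j" for i j k
 proof -
  have "P k (diagseq \<circ> (+) (Suc k))" by (rule diagseq_holds) (auto simp: P_def)
  then have "I (C k) (u (diagseq (Suc k + (i - k)))) (u (diagseq (Suc k + (j - k)))) \<le> (1/4)^k"
   unfolding P_def o_def by blast
  then show ?thesis using that by (simp add: v_def r_def)
 qed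
 have vt: "v k \<in> test_functions \<Omega>" for k unfolding v_def by (rule u)
 have vm: "v k \<in> borel_measurable borel" for k by (rule borel_measurable_continuous_onI[OF test_continuous[OF vt]])
 have Cs: "C k \<in> sets lebesgue" "C k \<in> sets borel" for k
  using compact_imp_closed[OF C(1)] by (auto intro: borel_closed)
 have iv: "integrable lebesgue (\<lambda>x. indicator (C k) x * (v i x - v j x)^2)" for i j k
  using integrable_mult_indicator[OF Cs(1) integrable_test[OF test_square[OF test_diff[OF vt vt]]]] by simp
 have conv: "AE x in lebesgue. x \<in> C m \<longrightarrow> convergent (\<lambda>k. v k x)" for m
 proof -
  define f where "f k x = indicator (C m) x * \<bar>v (Suc (k + m)) x - v (k + m) x\<bar>" for k x
  define V where "V = measure lebesgue (C m)"
  have fm: "f k \<in> borel_measurable borel" for k unfolding f_def using vm Cs(2)[of m] by measurable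
  have fnn: "f k x \<ge> 0" for k x by (simp add: f_def)
  have fint: "(\<integral>\<^sup>+ x. ennreal (f k x) \<partial>lebesgue) \<le> ennreal ((1/2)^k * (V + 1))" for k
  proof -
   \<comment> \<open>The inequality \<open>t \<le> a + t\<^sup>2 / a\<close> turns the square bound \<open>a\<^sup>2\<close> into a summable \<open>L\<^sup>1\<close> bound of order \<open>a\<close>.\<close>
   define a :: real where "a = (1/2)^k"
   have a: "a > 0" "a \<le> 1" by (auto simp: a_def power_le_one)
   have "(1/4::real)^k = a^2" by (simp add: a_def power2_eq_square flip: power_mult_distrib)
   have le: "f k x \<le> a * indicator (C m) x + (1 / a) * (indicator (C m) x * (v (Suc (k + m)) x - v (k + m) x)^2)" for x
   proof -
    define t where "t = \<bar>v (Suc (k + m)) x - v (k + m) x\<bar>"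
    have "0 \<le> (t - a)^2" by simp
    then have "2 * (t * a) \<le> a^2 + t^2" by (simp add: power2_eq_square algebra_simps)
    moreover have "t * a \<ge> 0" using a by (simp add: t_def)
    ultimately have "t * a \<le> a^2 + t^2" by linarith
    then have "t \<le> a + (1 / a) * t^2" using a by (simp add: field_simps power2_eq_square)
    then show ?thesis by (cases "x \<in> C m") (auto simp: f_def t_def)
   qed
   have ig: "integrable lebesgue (\<lambda>x. a * indicator (C m) x + (1 / a) * (indicator (C m) x * (v (Suc (k + m)) x - v (k + m) x)^2))"
    by (intro Bochner_Integration.integrable_add integrable_mult_right integrable_indicator_compact C iv)
   have "(\<integral>\<^sup>+ x. ennreal (f k x) \<partial>lebesgue) \<le>
     (\<integral>\<^sup>+ x. ennreal (a * indicator (C m) x + (1 / a) * (indicator (C m) x * (v (Suc (k + m)) x - v (k + m) x)^2)) \<partial>lebesgue)"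
    by (intro nn_integral_mono ennreal_leI le)
   also have "\<dots> = ennreal (LINT x|lebesgue. a * indicator (C m) x + (1 / a) * (indicator (C m) x * (v (Suc (k + m)) x - v (k + m) x)^2))"
    by (rule nn_integral_eq_integral[OF ig]) (use a in simp)
   also have "\<dots> \<le> ennreal (a * (V + 1))"
   proof (rule ennreal_leI)
    have "(LINT x|lebesgue. a * indicator (C m) x + (1 / a) * (indicator (C m) x * (v (Suc (k + m)) x - v (k + m) x)^2))
      = a * V + (1 / a) * I (C m) (v (Suc (k + m))) (v (k + m))"
     using integrable_indicator_compact[OF C(1)] iv by (simp add: V_def I_def)
    also have "I (C m) (v (Suc (k + m))) (v (k + m)) \<le> I (C (k + m)) (v (Suc (k + m))) (v (k + m))"
     unfolding I_def using Cmono[of m "k + m"]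
     by (intro integral_mono iv mult_right_mono) (auto simp: indicator_def)
    also have "\<dots> \<le> (1/4)^(k + m)" by (rule fast) auto
    also have "\<dots> \<le> (1/4)^k" by (rule power_decreasing) auto
    finally have "(LINT x|lebesgue. a * indicator (C m) x + (1 / a) * (indicator (C m) x * (v (Suc (k + m)) x - v (k + m) x)^2))
      \<le> a * V + (1 / a) * (1/4)^k" using a by (simp add: divide_right_mono)
    also have "\<dots> = a * (V + 1)" using a \<open>(1/4::real)^k = a^2\<close> by (simp add: power2_eq_square algebra_simps)
    finally show "(LINT x|lebesgue. a * indicator (C m) x + (1 / a) * (indicator (C m) x * (v (Suc (k + m)) x - v (k + m) x)^2))
      \<le> a * (V + 1)" .
   qed
   finally show ?thesis by (simp add: a_def)
  qed
  have V: "V \<ge> 0" by (simp add: V_def)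
  have "(\<integral>\<^sup>+ x. (\<Sum>k. ennreal (f k x)) \<partial>lebesgue) = (\<Sum>k. \<integral>\<^sup>+ x. ennreal (f k x) \<partial>lebesgue)"
   by (rule nn_integral_suminf) (intro measurable_compose[OF borel_imp_lebesgue[OF fm] measurable_ennreal])
  also have "\<dots> \<le> (\<Sum>k. ennreal ((1/2)^k * (V + 1)))" by (intro suminf_le fint) auto
  also have "\<dots> < \<infinity>"
  proof -
   have "summable (\<lambda>k. (1/2)^k * (V + 1))" by (intro summable_mult2 summable_geometric) simp
   then show ?thesis using V by (simp add: suminf_ennreal2)
  qed
  finally have "AE x in lebesgue. (\<Sum>k. ennreal (f k x)) \<noteq> \<infinity>"
   by (intro nn_integral_PInf_AE) (auto intro!: borel_measurable_suminf_order measurable_compose[OF borel_imp_lebesgue[OF fm] measurable_ennreal])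
  then show ?thesis
  proof (rule eventually_mono, intro impI)
   fix x assume fin: "(\<Sum>k. ennreal (f k x)) \<noteq> \<infinity>" and x: "x \<in> C m"
   have "summable (\<lambda>k. f k x)" by (rule summable_suminf_not_top) (use fin fnn in \<open>auto simp: infinity_ennreal_def\<close>)
   then have "summable (\<lambda>k. \<bar>v (Suc (k + m)) x - v (k + m) x\<bar>)" using x by (simp add: f_def)
   then have "summable (\<lambda>k. v (Suc (k + m)) x - v (k + m) x)" by (rule summable_rabs_cancel)
   then have "convergent (\<lambda>n. \<Sum>k<n. v (Suc (k + m)) x - v (k + m) x)" by (simp add: summable_iff_convergent)
   moreover have "(\<Sum>k<n. v (Suc (k + m)) x - v (k + m) x) = v (n + m) x - v m x" for n
    using sum_lessThan_telescope[of "\<lambda>k. v (k + m) x" n] by simp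
   ultimately have "convergent (\<lambda>n. v (n + m) x - v m x)" by simp
   then have "convergent (\<lambda>n. v (n + m) x)" using convergent_add[OF _ convergent_const[of "v m x"]] by fastforce
   then obtain l where "(\<lambda>n. v (n + m) x) \<longlonglongrightarrow> l" by (auto simp: convergent_def)
   then have "(\<lambda>n. v n x) \<longlonglongrightarrow> l" by (rule LIMSEQ_offset)
   then show "convergent (\<lambda>k. v k x)" by (auto simp: convergent_def)
  qed
 qed
 define w where "w x = lim (\<lambda>k. v k x)" for x
 have wm: "w \<in> borel_measurable borel" unfolding w_def by (rule borel_measurable_lim_metric[OF vm])
 have close: "integrable lebesgue (\<lambda>x. indicator (C k) x * (v i x - w x)^2) \<and>
   (LINT x|lebesgue. indicator (C k) x * (v i x - w x)^2) \<le> (1/4)^k" if ik: "k \<le> i" for i k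
 proof -
  have "(\<integral>\<^sup>+ x. ennreal (indicator (C k) x * (v i x - w x)^2) \<partial>lebesgue)
    \<le> (\<integral>\<^sup>+ x. liminf (\<lambda>j. ennreal (indicator (C k) x * (v i x - v j x)^2)) \<partial>lebesgue)"
  proof (rule nn_integral_mono_AE)
   show "AE x in lebesgue. ennreal (indicator (C k) x * (v i x - w x)^2)
     \<le> liminf (\<lambda>j. ennreal (indicator (C k) x * (v i x - v j x)^2))"
    using conv[of k]
   proof (rule eventually_mono)
    fix x assume c: "x \<in> C k \<longrightarrow> convergent (\<lambda>k. v k x)"
    show "ennreal (indicator (C k) x * (v i x - w x)^2) \<le> liminf (\<lambda>j. ennreal (indicator (C k) x * (v i x - v j x)^2))"
    proof (cases "x \<in> C k")
     case True
     then have "(\<lambda>j. v j x) \<longlonglongrightarrow> w x" using c by (simp add: convergent_LIMSEQ_iff w_def)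
     then have "(\<lambda>j. indicator (C k) x * (v i x - v j x)^2) \<longlonglongrightarrow> indicator (C k) x * (v i x - w x)^2"
      by (intro tendsto_intros)
     then have "(\<lambda>j. ennreal (indicator (C k) x * (v i x - v j x)^2)) \<longlonglongrightarrow> ennreal (indicator (C k) x * (v i x - w x)^2)"
      by (rule tendsto_ennrealI)
     from lim_imp_Liminf[OF trivial_limit_sequentially this] show ?thesis by (simp only: order_refl)
    qed simp
   qed
  qed
  also have "\<dots> \<le> liminf (\<lambda>j. \<integral>\<^sup>+ x. ennreal (indicator (C k) x * (v i x - v j x)^2) \<partial>lebesgue)"
   by (rule nn_integral_liminf) (intro measurable_compose[OF borel_measurable_integrable[OF iv] measurable_ennreal])
  also have "\<dots> \<le> liminf (\<lambda>j. ennreal ((1/4)^k))"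
  proof (rule Liminf_mono)
   show "\<forall>\<^sub>F j in sequentially. (\<integral>\<^sup>+ x. ennreal (indicator (C k) x * (v i x - v j x)^2) \<partial>lebesgue) \<le> ennreal ((1/4)^k)"
    using eventually_ge_at_top[of k]
   proof (rule eventually_mono)
    fix j assume "k \<le> j"
    from fast[OF ik this] show "(\<integral>\<^sup>+ x. ennreal (indicator (C k) x * (v i x - v j x)^2) \<partial>lebesgue) \<le> ennreal ((1/4)^k)"
     using iv by (simp add: nn_integral_eq_integral I_def ennreal_leI)
   qed
  qed
  also have "\<dots> = ennreal ((1/4)^k)" by (simp add: Liminf_const)
  finally have le: "(\<integral>\<^sup>+ x. ennreal (indicator (C k) x * (v i x - w x)^2) \<partial>lebesgue) \<le> ennreal ((1/4)^k)" .
  have m: "(\<lambda>x. indicator (C k) x * (v i x - w x)^2) \<in> borel_measurable lebesgue"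
   by (rule borel_imp_lebesgue) (use vm[of i] wm Cs(2)[of k] in measurable)
  have int: "integrable lebesgue (\<lambda>x. indicator (C k) x * (v i x - w x)^2)"
   by (rule integrableI_nonneg[OF m]) (use le in \<open>auto intro: order_le_less_trans\<close>)
  moreover have "(LINT x|lebesgue. indicator (C k) x * (v i x - w x)^2) \<le> (1/4)^k"
   using le by (subst (asm) nn_integral_eq_integral[OF int]) auto
  ultimately show ?thesis ..
 qed
 have fin: "integrable lebesgue (\<lambda>x. indicator K x * (w x)^2) \<and>
   (\<forall>n. integrable lebesgue (\<lambda>x. indicator K x * (u (r n) x - w x)^2)) \<and>
   (\<lambda>n. LINT x|lebesgue. indicator K x * (u (r n) x - w x)^2) \<longlonglongrightarrow> 0" if K: "compact K" "K \<subseteq> \<Omega>" for K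
 proof -
  obtain N where N: "\<And>n. n \<ge> N \<Longrightarrow> K \<subseteq> C n" using C(5) K by blast
  have Ks: "K \<in> sets borel" "K \<in> sets lebesgue" using compact_imp_closed[OF K(1)] by (auto intro: borel_closed)
  have iKv: "integrable lebesgue (\<lambda>x. indicator K x * (v i x)^2)" for i
   using integrable_mult_indicator[OF Ks(2) integrable_test[OF test_square[OF vt]]] by simp
  have vK: "integrable lebesgue (\<lambda>x. indicator K x * (v i x - w x)^2)" if "N \<le> i" for i
  proof (rule Bochner_Integration.integrable_bound[OF conjunct1[OF close[OF that]]])
   show "(\<lambda>x. indicator K x * (v i x - w x)^2) \<in> borel_measurable lebesgue"
    by (rule borel_imp_lebesgue) (use vm[of i] wm Ks in measurable)
   show "AE x in lebesgue. norm (indicator K x * (v i x - w x)^2) \<le> norm (indicator (C N) x * (v i x - w x)^2)"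
    by (rule AE_I2) (use N[of N] in \<open>auto simp: indicator_def\<close>)
  qed
  have iw: "integrable lebesgue (\<lambda>x. indicator K x * (w x)^2)"
  proof (rule Bochner_Integration.integrable_bound)
   show "integrable lebesgue (\<lambda>x. 2 * (indicator K x * (v N x - w x)^2) + 2 * (indicator K x * (v N x)^2))"
    using vK[of N] iKv by simp
   show "(\<lambda>x. indicator K x * (w x)^2) \<in> borel_measurable lebesgue"
    by (rule borel_imp_lebesgue) (use wm Ks in measurable)
   show "AE x in lebesgue. norm (indicator K x * (w x)^2) \<le> norm (2 * (indicator K x * (v N x - w x)^2) + 2 * (indicator K x * (v N x)^2))"
   proof (rule AE_I2)
    fix x
    have "0 \<le> (2 * v N x - w x)^2" by simp
    then have "(w x)^2 \<le> 2 * (v N x - w x)^2 + 2 * (v N x)^2"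
     by (simp add: power2_eq_square algebra_simps)
    then show "norm (indicator K x * (w x)^2) \<le> norm (2 * (indicator K x * (v N x - w x)^2) + 2 * (indicator K x * (v N x)^2))"
     by (cases "x \<in> K") auto
   qed
  qed
  have vK': "integrable lebesgue (\<lambda>x. indicator K x * (v i x - w x)^2)" for i
  proof (rule Bochner_Integration.integrable_bound)
   show "integrable lebesgue (\<lambda>x. 2 * (indicator K x * (v i x)^2) + 2 * (indicator K x * (w x)^2))"
    using iw iKv by simp
   show "(\<lambda>x. indicator K x * (v i x - w x)^2) \<in> borel_measurable lebesgue"
    by (rule borel_imp_lebesgue) (use vm[of i] wm Ks in measurable)
   show "AE x in lebesgue. norm (indicator K x * (v i x - w x)^2) \<le> norm (2 * (indicator K x * (v i x)^2) + 2 * (indicator K x * (w x)^2))"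
   proof (rule AE_I2)
    fix x
    have "0 \<le> (v i x + w x)^2" by simp
    then have "(v i x - w x)^2 \<le> 2 * (v i x)^2 + 2 * (w x)^2"
     by (simp add: power2_eq_square algebra_simps)
    then show "norm (indicator K x * (v i x - w x)^2) \<le> norm (2 * (indicator K x * (v i x)^2) + 2 * (indicator K x * (w x)^2))"
     by (cases "x \<in> K") auto
   qed
  qed
  have "(\<lambda>n. LINT x|lebesgue. indicator K x * (v n x - w x)^2) \<longlonglongrightarrow> 0"
  proof (rule tendsto_sandwich)
   show "\<forall>\<^sub>F n in sequentially. 0 \<le> (LINT x|lebesgue. indicator K x * (v n x - w x)^2)"
    by (intro always_eventually allI integral_nonneg_AE AE_I2) simp
   show "\<forall>\<^sub>F n in sequentially. (LINT x|lebesgue. indicator K x * (v n x - w x)^2) \<le> (1/4)^n"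
    using eventually_ge_at_top[of N]
   proof (rule eventually_mono)
    fix n assume n: "N \<le> n"
    have "(LINT x|lebesgue. indicator K x * (v n x - w x)^2) \<le> (LINT x|lebesgue. indicator (C n) x * (v n x - w x)^2)"
     by (rule integral_mono[OF vK' conjunct1[OF close[OF order_refl]]]) (use N[OF n] in \<open>auto simp: indicator_def\<close>)
    also have "\<dots> \<le> (1/4)^n" using close[of n n] by blast
    finally show "(LINT x|lebesgue. indicator K x * (v n x - w x)^2) \<le> (1/4)^n" .
   qed
   show "(\<lambda>n. (1/4::real)^n) \<longlonglongrightarrow> 0" by (rule LIMSEQ_power_zero) simp
  qed simp
  then show ?thesis using iw vK' by (simp add: v_def)
 qed
 show ?thesis using rm wm fin by blast
qed

section \<open>Energies\<close>

lemma Linf_loc_AE_bound: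
 assumes "P \<in> Linf_loc \<Omega>" "compact K" "K \<subseteq> \<Omega>"
 shows "\<exists>c. AE x in lebesgue. x \<in> K \<longrightarrow> \<bar>P x\<bar> \<le> c"
proof -
 have "K \<inter> space lebesgue \<in> sets lebesgue" using lmeasurable_compact[OF assms(2)] by (simp add: fmeasurableD)
 moreover obtain c where "AE x in lebesgue_on K. \<bar>P x\<bar> \<le> c" using assms by (auto simp: Linf_loc_def)
 ultimately show ?thesis by (auto simp: AE_restrict_space_iff)
qed

lemma Linf_loc_measurable:
 assumes "P \<in> Linf_loc \<Omega>" "open \<Omega>"
 shows "(\<lambda>x. indicator \<Omega> x * P x) \<in> borel_measurable lebesgue"
 using assms borel_measurable_restrict_space_iff[of \<Omega> lebesgue P] by (simp add: Linf_loc_def)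

lemma locint_mult_Linf:
 assumes P: "P \<in> Linf_loc \<Omega>" and \<Omega>: "open \<Omega>" and g: "locint \<Omega> g"
 shows "locint \<Omega> (\<lambda>x. P x * g x)"
 unfolding locint_def
proof (intro allI impI)
 fix K assume K: "compact K \<and> K \<subseteq> \<Omega>"
 obtain c where c: "AE x in lebesgue. x \<in> K \<longrightarrow> \<bar>P x\<bar> \<le> c" using Linf_loc_AE_bound[OF P] K by blast
 have gK: "integrable lebesgue (\<lambda>x. indicator K x * g x)" using g K by (simp add: locint_def)
 show "integrable lebesgue (\<lambda>x. indicator K x * (P x * g x))"
 proof (rule Bochner_Integration.integrable_bound)
  show "integrable lebesgue (\<lambda>x. c * (indicator K x * g x))" using gK by (rule integrable_mult_right)
  have "(\<lambda>x. (indicator \<Omega> x * P x) * (indicator K x * g x)) \<in> borel_measurable lebesgue"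
   by (intro borel_measurable_times Linf_loc_measurable[OF P \<Omega>] borel_measurable_integrable[OF gK])
  moreover have "(\<lambda>x. (indicator \<Omega> x * P x) * (indicator K x * g x)) = (\<lambda>x. indicator K x * (P x * g x))"
   using K by (auto simp: indicator_def fun_eq_iff)
  ultimately show "(\<lambda>x. indicator K x * (P x * g x)) \<in> borel_measurable lebesgue" by simp
  show "AE x in lebesgue. norm (indicator K x * (P x * g x)) \<le> norm (c * (indicator K x * g x))"
   using c
  proof (rule eventually_mono)
   fix x assume "x \<in> K \<longrightarrow> \<bar>P x\<bar> \<le> c"
   then show "norm (indicator K x * (P x * g x)) \<le> norm (c * (indicator K x * g x))"
    by (cases "x \<in> K") (auto simp: abs_mult intro!: mult_right_mono)
  qed
 qed
qed

lemma locint_one: "locint \<Omega> (\<lambda>_. 1)"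
 by (rule locint_continuous) simp

lemma locint_Linf: "P \<in> Linf_loc \<Omega> \<Longrightarrow> open \<Omega> \<Longrightarrow> locint \<Omega> P"
 using locint_mult_Linf[OF _ _ locint_one] by fastforce

lemma Linf_loc_combine:
 assumes "P \<in> Linf_loc \<Omega>" "Q \<in> Linf_loc \<Omega>"
 shows "(\<lambda>x. P x + t * Q x) \<in> Linf_loc \<Omega>"
 unfolding Linf_loc_def
proof (intro CollectI conjI allI impI)
 show "(\<lambda>x. P x + t * Q x) \<in> borel_measurable (lebesgue_on \<Omega>)"
  using assms by (auto simp: Linf_loc_def)
 fix K assume K: "compact K \<and> K \<subseteq> \<Omega>"
 obtain c d where "AE x in lebesgue_on K. \<bar>P x\<bar> \<le> c" "AE x in lebesgue_on K. \<bar>Q x\<bar> \<le> d"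
  using assms K unfolding Linf_loc_def by blast
 then have "AE x in lebesgue_on K. \<bar>P x + t * Q x\<bar> \<le> c + \<bar>t\<bar> * d"
 proof eventually_elim
  case (elim x)
  have "\<bar>P x + t * Q x\<bar> \<le> \<bar>P x\<bar> + \<bar>t\<bar> * \<bar>Q x\<bar>" by (simp add: abs_mult[symmetric] abs_triangle_ineq)
  also have "\<dots> \<le> c + \<bar>t\<bar> * d" using elim by (intro add_mono mult_left_mono) auto
  finally show ?case .
 qed
 then show "\<exists>c. AE x in lebesgue_on K. \<bar>P x + t * Q x\<bar> \<le> c" by blast
qed

lemma set_lint_supported:
 assumes "\<And>x. x \<notin> S \<Longrightarrow> f x = (0::real)"
 shows "(LINT x:S|M. f x) = (\<integral>x. f x \<partial>M)"
 unfolding set_lebesgue_integral_def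
 by (intro Bochner_Integration.integral_cong refl) (use assms in \<open>auto simp: indicator_def\<close>)

lemma test_outside: "u \<in> test_functions \<Omega> \<Longrightarrow> x \<notin> \<Omega> \<Longrightarrow> u x = 0"
 using test_support by blast

text \<open>The energy as integrals over the whole space; for test functions it is \<open>energy\<close>, without reference to the domain.\<close>

definition en :: "('a::euclidean_space \<Rightarrow> real) \<Rightarrow> ('a \<Rightarrow> real) \<Rightarrow> real" where
 "en U u = (LINT x|lebesgue. grad_sq u x) + (LINT x|lebesgue. U x * (u x)^2)"

text \<open>The bilinear form of the energy, with both derivatives moved to the second argument.\<close>

definition form :: "('a::euclidean_space \<Rightarrow> real) \<Rightarrow> ('a \<Rightarrow> real) \<Rightarrow> ('a \<Rightarrow> real) \<Rightarrow> real" where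
 "form U u \<psi> = (LINT x|lebesgue. u x * (U x * \<psi> x - lap \<psi> x))"

lemma energy_eq_en:
 assumes "V \<in> Linf_loc \<Omega>" "open \<Omega>" "u \<in> test_functions \<Omega>"
 shows "energy \<Omega> V u = en V u"
proof -
 have "energy \<Omega> V u = (LINT x|lebesgue. grad_sq u x + V x * (u x)^2)"
  unfolding energy_def power2_abs
  by (rule set_lint_supported) (simp add: test_outside[OF assms(3)] test_outside[OF test_grad_sq[OF assms(3)]])
 also have "\<dots> = en V u" unfolding en_def
  by (rule Bochner_Integration.integral_add[OF integrable_test[OF test_grad_sq[OF assms(3)]]
     locint_test[OF locint_Linf[OF assms(1,2)] test_square[OF assms(3)]]])
 finally show ?thesis .
qed

lemma perturbed_energy_eq_en:
 assumes "V \<in> Linf_loc \<Omega>" "Vt \<in> Linf_loc \<Omega>" "open \<Omega>" "u \<in> test_functions \<Omega>"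
 shows "perturbed_energy \<Omega> V Vt t u = en V u + t * (LINT x|lebesgue. Vt x * (u x)^2)"
  and "perturbed_energy \<Omega> V Vt t u = en (\<lambda>x. V x + t * Vt x) u"
proof -
 have "(LINT x:\<Omega>|lebesgue. Vt x * \<bar>u x\<bar>\<^sup>2) = (LINT x|lebesgue. Vt x * (u x)^2)"
  unfolding power2_abs by (rule set_lint_supported) (simp add: test_outside[OF assms(4)])
 then show 1: "perturbed_energy \<Omega> V Vt t u = en V u + t * (LINT x|lebesgue. Vt x * (u x)^2)"
  by (simp add: perturbed_energy_def energy_eq_en[OF assms(1,3,4)])
 have i: "integrable lebesgue (\<lambda>x. V x * (u x)^2)" "integrable lebesgue (\<lambda>x. Vt x * (u x)^2)"
  by (rule locint_test[OF locint_Linf test_square[OF assms(4)]]; rule assms)+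
 have "(LINT x|lebesgue. (V x + t * Vt x) * (u x)^2) = (LINT x|lebesgue. V x * (u x)^2 + t * (Vt x * (u x)^2))"
  by (simp add: distrib_right mult.assoc)
 also have "\<dots> = (LINT x|lebesgue. V x * (u x)^2) + t * (LINT x|lebesgue. Vt x * (u x)^2)" using i by simp
 finally show "perturbed_energy \<Omega> V Vt t u = en (\<lambda>x. V x + t * Vt x) u" unfolding 1 by (simp add: en_def)
qed

lemma partial_cmult:
 assumes "smooth f" shows "partial b (\<lambda>x. s * f x) x = s * partial b f x"
proof -
 have "((\<lambda>x. s * f x) has_derivative (\<lambda>h. s * frechet_derivative f (at x) h)) (at x)"
  by (rule has_derivative_mult_right[OF smooth_has_derivative[OF assms]])
 then show ?thesis by (rule partial_eqI)
qed

lemma en_combine: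
 assumes U: "U \<in> Linf_loc \<Omega>" "open \<Omega>" and u: "u \<in> test_functions \<Omega>" "\<psi> \<in> test_functions \<Omega>"
 shows "en U (\<lambda>x. u x + s * \<psi> x) = en U u + 2 * s * form U u \<psi> + s^2 * en U \<psi>"
proof -
 note lU = locint_Linf[OF U]
 define c where "c x = (\<Sum>b\<in>Basis. partial b \<psi> x * partial b u x)" for x
 have gs: "grad_sq (\<lambda>x. u x + s * \<psi> x) x = grad_sq u x + 2 * s * c x + s^2 * grad_sq \<psi> x" for x
 proof -
  have "partial b (\<lambda>x. u x + s * \<psi> x) x = partial b u x + s * partial b \<psi> x" for b
   using partial_add[OF smooth_differentiable[OF test_smooth[OF u(1)]]
     smooth_differentiable[OF test_smooth[OF test_cmult[OF u(2), of s]]]]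
   by (simp add: partial_cmult[OF test_smooth[OF u(2)]])
  then show ?thesis
   by (simp add: grad_sq_def c_def power2_eq_square algebra_simps sum.distrib sum_distrib_left)
 qed
 have ic: "integrable lebesgue c" unfolding c_def[abs_def]
  by (intro integrable_test[where \<Omega> = \<Omega>] test_sum test_mult test_partial u smooth_partial test_smooth[OF u(2)])
 have cc: "(LINT x|lebesgue. c x) = - (LINT x|lebesgue. lap \<psi> x * u x)"
  unfolding c_def by (rule green_first[OF u(1) test_smooth[OF u(2)]])
 have ig: "integrable lebesgue (grad_sq u)" "integrable lebesgue (grad_sq \<psi>)"
  by (rule integrable_test[OF test_grad_sq], rule u)+
 have iU: "integrable lebesgue (\<lambda>x. U x * (u x)^2)" "integrable lebesgue (\<lambda>x. U x * (\<psi> x)^2)"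
  by (rule locint_test[OF lU test_square], rule u)+
 have iUc: "integrable lebesgue (\<lambda>x. U x * (\<psi> x * u x))"
  by (rule locint_test[OF lU test_mult[OF u(1) test_smooth[OF u(2)]]])
 have il: "integrable lebesgue (\<lambda>x. lap \<psi> x * u x)"
  by (rule integrable_test[OF test_mult[OF u(1) smooth_lap[OF test_smooth[OF u(2)]]]])
 have A: "(LINT x|lebesgue. grad_sq (\<lambda>x. u x + s * \<psi> x) x)
   = (LINT x|lebesgue. grad_sq u x) + 2 * s * (LINT x|lebesgue. c x) + s^2 * (LINT x|lebesgue. grad_sq \<psi> x)"
  unfolding gs using ic ig by simp
 have "(LINT x|lebesgue. U x * (u x + s * \<psi> x)^2)
   = (LINT x|lebesgue. U x * (u x)^2 + 2 * s * (U x * (\<psi> x * u x)) + s^2 * (U x * (\<psi> x)^2))"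
  by (simp add: power2_eq_square algebra_simps)
 also have "\<dots> = (LINT x|lebesgue. U x * (u x)^2) + 2 * s * (LINT x|lebesgue. U x * (\<psi> x * u x)) + s^2 * (LINT x|lebesgue. U x * (\<psi> x)^2)"
  using iU iUc by simp
 finally have B: "(LINT x|lebesgue. U x * (u x + s * \<psi> x)^2) = (LINT x|lebesgue. U x * (u x)^2)
   + 2 * s * (LINT x|lebesgue. U x * (\<psi> x * u x)) + s^2 * (LINT x|lebesgue. U x * (\<psi> x)^2)" .
 have F: "form U u \<psi> = (LINT x|lebesgue. U x * (\<psi> x * u x)) - (LINT x|lebesgue. lap \<psi> x * u x)"
 proof -
  have "form U u \<psi> = (LINT x|lebesgue. U x * (\<psi> x * u x) - lap \<psi> x * u x)"
   unfolding form_def by (simp add: algebra_simps)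
  then show ?thesis using iUc il by simp
 qed
 show ?thesis unfolding en_def A B F cc by (simp add: algebra_simps)
qed

lemma en_scale:
 assumes "U \<in> Linf_loc \<Omega>" "open \<Omega>" "u \<in> test_functions \<Omega>"
 shows "en U (\<lambda>x. s * u x) = s^2 * en U u"
proof -
 have z: "(\<lambda>_. 0) \<in> test_functions \<Omega>" by (rule test_functionsI[of _ "{}"]) auto
 have "form U (\<lambda>_. 0) u = 0" by (simp add: form_def)
 moreover have "en U (\<lambda>_. 0) = 0"
  using partial_zero_outside[of "{}" "\<lambda>_. 0" 0] by (simp add: en_def grad_sq_def)
 ultimately show ?thesis using en_combine[OF assms(1,2) z assms(3), of s] by simp
qed

text \<open>The energy of \<open>u + s * \<psi>\<close> is a nonnegative quadratic polynomial in \<open>s\<close>.\<close>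

lemma form_Cauchy_Schwarz:
 assumes U: "U \<in> Linf_loc \<Omega>" "open \<Omega>" and u: "u \<in> test_functions \<Omega>" "\<psi> \<in> test_functions \<Omega>"
  and nn: "\<And>u. u \<in> test_functions \<Omega> \<Longrightarrow> 0 \<le> en U u"
 shows "(form U u \<psi>)^2 \<le> en U u * en U \<psi>"
proof -
 have q: "0 \<le> en U u + 2 * s * form U u \<psi> + s^2 * en U \<psi>" for s
  using nn[OF test_add[OF u(1) test_cmult[OF u(2), of s]]] en_combine[OF U u, of s] by simp
 show ?thesis
 proof (cases "en U \<psi> = 0")
  case True
  have "form U u \<psi> = 0"
  proof (rule ccontr)
   assume "form U u \<psi> \<noteq> 0"
   with q[of "- (en U u + 1) / (2 * form U u \<psi>)"] True show False by (simp add: field_simps)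
  qed
  then show ?thesis using True by simp
 next
  case False
  then have p: "en U \<psi> > 0" using nn[OF u(2)] by simp
  with q[of "- form U u \<psi> / en U \<psi>"] have "0 \<le> (en U u * en U \<psi> - (form U u \<psi>)^2) / en U \<psi>"
   by (simp add: field_simps power2_eq_square)
  with p show ?thesis by (simp add: zero_le_divide_iff)
 qed
qed

text \<open>The parallelogram law, with the nonnegative energy of the sum dropped.\<close>

lemma en_diff_le:
 assumes U: "U \<in> Linf_loc \<Omega>" "open \<Omega>" and u: "u \<in> test_functions \<Omega>" "v \<in> test_functions \<Omega>"
  and nn: "\<And>u. u \<in> test_functions \<Omega> \<Longrightarrow> 0 \<le> en U u"
 shows "en U (\<lambda>x. u x - s * v x) \<le> 2 * en U u + 2 * (s^2 * en U v)"
proof -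
 have "en U (\<lambda>x. u x - s * v x) = en U u - 2 * s * form U u v + s^2 * en U v"
  using en_combine[OF U u, of "-s"] by simp
 moreover have "0 \<le> en U u + 2 * s * form U u v + s^2 * en U v"
  using en_combine[OF U u, of s] nn[OF test_add[OF u(1) test_cmult[OF u(2), of s]]] by simp
 ultimately show ?thesis by linarith
qed

text \<open>A smooth, nonnegative substitute for the absolute value: \<open>sqrt (u\<^sup>2 + \<epsilon>\<^sup>2) - \<epsilon>\<close> has a smaller gradient.\<close>

lemma smooth_abs:
 assumes U: "U \<in> Linf_loc \<Omega>" "open \<Omega>" and u: "u \<in> test_functions \<Omega>" and d: "\<delta> > 0"
 shows "\<exists>\<phi>\<in>test_functions \<Omega>. (\<forall>x. 0 \<le> \<phi> x) \<and> en U \<phi> \<le> en U u + \<delta> \<and> (\<forall>x. \<bar>\<phi> x - \<bar>u x\<bar>\<bar> \<le> \<delta>)"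
proof -
 obtain K where K: "compact K" "K \<subseteq> \<Omega>" "\<forall>x. x \<notin> K \<longrightarrow> u x = 0" using test_support[OF u] by blast
 have cu: "continuous_on UNIV (\<lambda>x. \<bar>u x\<bar>)" by (intro continuous_intros test_continuous[OF u])
 have iUu: "integrable lebesgue (\<lambda>x. \<bar>U x\<bar> * \<bar>u x\<bar>)"
  by (rule locint_mult_integrable[OF locint_abs[OF locint_Linf[OF U]] cu K(1,2)]) (use K in auto)
 define m where "m = (LINT x|lebesgue. \<bar>U x\<bar> * \<bar>u x\<bar>)"
 have m: "m \<ge> 0" by (simp add: m_def)
 \<comment> \<open>The zero-order term changes by at most \<open>2 \<epsilon> m\<close>.\<close>
 define \<epsilon> where "\<epsilon> = min \<delta> (\<delta> / (2 * (m + 1)))"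
 have e: "\<epsilon> > 0" "\<epsilon> \<le> \<delta>" using d m by (auto simp: \<epsilon>_def)
 have em: "2 * \<epsilon> * m \<le> \<delta>"
 proof -
  have "\<epsilon> \<le> \<delta> / (2 * (m + 1))" by (simp add: \<epsilon>_def)
  then have "2 * \<epsilon> * m \<le> 2 * (\<delta> / (2 * (m + 1))) * m" using m by (intro mult_right_mono) auto
  also have "\<dots> = \<delta> * (m / (m + 1))" using m by (simp add: field_simps)
  also have "\<dots> \<le> \<delta> * 1" using d m by (intro mult_left_mono) auto
  finally show ?thesis by simp
 qed
 define q where "q x = (u x)^2 + \<epsilon>^2" for x
 have qp: "q x > 0" for x using e by (simp add: q_def add_nonneg_pos)
 have qs: "smooth q" unfolding q_def[abs_def] by (intro smooth_add test_smooth[OF test_square[OF u]] smooth_const)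
 define \<phi> where "\<phi> x = q x powr (1/2) - \<epsilon>" for x
 have ph: "\<phi> x = sqrt (q x) - \<epsilon>" for x using qp[of x] by (simp add: \<phi>_def powr_half_sqrt less_imp_le)
 have b1: "\<epsilon> \<le> sqrt (q x)" for x unfolding q_def using e by (intro real_le_rsqrt) auto
 have b2: "sqrt (q x) \<le> \<bar>u x\<bar> + \<epsilon>" for x
 proof (rule real_le_lsqrt)
  show "q x \<le> (\<bar>u x\<bar> + \<epsilon>)^2" using e by (simp add: q_def power2_sum)
 qed (use e in auto)
 have b3: "\<bar>u x\<bar> \<le> sqrt (q x)" for x unfolding q_def by (intro real_le_rsqrt) simp
 have p1: "0 \<le> \<phi> x" "\<phi> x \<le> \<bar>u x\<bar>" "\<bar>u x\<bar> - \<epsilon> \<le> \<phi> x" for x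
  using b1[of x] b2[of x] b3[of x] by (auto simp: ph)
 have pt: "\<phi> \<in> test_functions \<Omega>"
 proof (rule test_functionsI[OF _ K(1,2)])
  show "smooth \<phi>" unfolding \<phi>_def[abs_def] by (intro smooth_diff smooth_powr qs qp smooth_const)
  show "\<phi> x = 0" if "x \<notin> K" for x using p1(1,2)[of x] K(3) that by simp
 qed
 have grad: "grad_sq \<phi> x \<le> grad_sq u x" for x
 proof -
  have "(partial b \<phi> x)^2 \<le> (partial b u x)^2" for b
  proof -
   have "((\<lambda>t. t powr (1/2) - \<epsilon>) has_real_derivative (1/2) * q x powr (1/2 - 1)) (at (q x))"
    using DERIV_diff[OF has_real_derivative_powr[OF qp[of x], of "1/2"] DERIV_const[of \<epsilon>]] by simp
   from partial_compose_real(2)[OF smooth_differentiable[OF qs] this, of b]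
   have "partial b \<phi> x = (1/2) * q x powr (1/2 - 1) * partial b q x" by (simp add: \<phi>_def[abs_def])
   moreover have "partial b q x = 2 * u x * partial b u x"
   proof -
    have "((\<lambda>t. t^2 + \<epsilon>^2) has_real_derivative 2 * u x) (at (u x))" by (auto intro!: derivative_eq_intros)
    from partial_compose_real(2)[OF smooth_differentiable[OF test_smooth[OF u]] this, of b]
    show ?thesis by (simp add: q_def[abs_def])
   qed
   moreover have "q x powr (1/2 - 1) = 1 / sqrt (q x)"
    using qp[of x] by (simp add: powr_minus powr_half_sqrt less_imp_le inverse_eq_divide)
   ultimately have pe: "partial b \<phi> x = (u x / sqrt (q x)) * partial b u x" by simp
   have "(u x / sqrt (q x))^2 \<le> 1"
   proof -
    have "(u x)^2 \<le> q x" by (simp add: q_def)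
    then show ?thesis using qp[of x] by (simp add: power_divide less_imp_le)
   qed
   from mult_right_mono[OF this, of "(partial b u x)^2"] show ?thesis
    unfolding pe power_mult_distrib by simp
  qed
  then show ?thesis unfolding grad_sq_def by (rule sum_mono)
 qed
 have "(LINT x|lebesgue. U x * (\<phi> x)^2) \<le> (LINT x|lebesgue. U x * (u x)^2 + 2 * \<epsilon> * (\<bar>U x\<bar> * \<bar>u x\<bar>))"
 proof (rule integral_mono)
  show "integrable lebesgue (\<lambda>x. U x * (\<phi> x)^2)" by (rule locint_test[OF locint_Linf[OF U] test_square[OF pt]])
  show "integrable lebesgue (\<lambda>x. U x * (u x)^2 + 2 * \<epsilon> * (\<bar>U x\<bar> * \<bar>u x\<bar>))"
   using locint_test[OF locint_Linf[OF U] test_square[OF u]] iUu by simp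
  fix x
  have "(u x)^2 - (\<phi> x)^2 = (\<bar>u x\<bar> - \<phi> x) * (\<bar>u x\<bar> + \<phi> x)" by (simp add: power2_eq_square algebra_simps)
  also have "\<dots> \<le> \<epsilon> * (2 * \<bar>u x\<bar>)" using p1[of x] e by (intro mult_mono) auto
  finally have a: "(u x)^2 - (\<phi> x)^2 \<le> \<epsilon> * (2 * \<bar>u x\<bar>)" .
  have "(\<phi> x)^2 \<le> (u x)^2" using power_mono[OF p1(2,1), of x 2] by simp
  then have "\<bar>(\<phi> x)^2 - (u x)^2\<bar> \<le> \<epsilon> * (2 * \<bar>u x\<bar>)" using a by simp
  then have "\<bar>U x\<bar> * \<bar>(\<phi> x)^2 - (u x)^2\<bar> \<le> \<bar>U x\<bar> * (\<epsilon> * (2 * \<bar>u x\<bar>))" by (rule mult_left_mono) simp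
  then have "U x * ((\<phi> x)^2 - (u x)^2) \<le> \<bar>U x\<bar> * (\<epsilon> * (2 * \<bar>u x\<bar>))"
   using abs_ge_self[of "U x * ((\<phi> x)^2 - (u x)^2)"] by (simp add: abs_mult)
  then show "U x * (\<phi> x)^2 \<le> U x * (u x)^2 + 2 * \<epsilon> * (\<bar>U x\<bar> * \<bar>u x\<bar>)" by (simp add: algebra_simps)
 qed
 also have "\<dots> = (LINT x|lebesgue. U x * (u x)^2) + 2 * \<epsilon> * m"
  using locint_test[OF locint_Linf[OF U] test_square[OF u]] iUu by (simp add: m_def)
 finally have "(LINT x|lebesgue. U x * (\<phi> x)^2) \<le> (LINT x|lebesgue. U x * (u x)^2) + \<delta>" using em by linarith
 moreover have "(LINT x|lebesgue. grad_sq \<phi> x) \<le> (LINT x|lebesgue. grad_sq u x)"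
  by (rule integral_mono[OF integrable_test[OF test_grad_sq[OF pt]] integrable_test[OF test_grad_sq[OF u]] grad])
 ultimately have "en U \<phi> \<le> en U u + \<delta>" by (simp add: en_def)
 moreover have "\<bar>\<phi> x - \<bar>u x\<bar>\<bar> \<le> \<delta>" for x using p1[of x] e by auto
 ultimately show ?thesis using pt p1(1) by (intro bexI[of _ \<phi>]) auto
qed

text \<open>The partition \<open>sin\<^sup>2 + cos\<^sup>2 = 1\<close> gives the localization identity without square roots of cutoffs.\<close>

lemma localization_identity:
 assumes U: "U \<in> Linf_loc \<Omega>" "open \<Omega>" and u: "u \<in> test_functions \<Omega>" and X: "smooth X"
 shows "en U (\<lambda>x. sin (X x) * u x) + en U (\<lambda>x. cos (X x) * u x)
  = en U u + (LINT x|lebesgue. grad_sq X x * (u x)^2)"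
proof -
 define s where "s x = sin (X x)" for x
 define c where "c x = cos (X x)" for x
 have sc: "(s x)^2 + (c x)^2 = 1" for x by (simp add: s_def c_def)
 have ss: "smooth s" and sc': "smooth c" unfolding s_def[abs_def] c_def[abs_def]
  by (rule smooth_compose[OF smooth_sin X] smooth_compose[OF smooth_cos X])+
 have ts: "(\<lambda>x. s x * u x) \<in> test_functions \<Omega>" and tc: "(\<lambda>x. c x * u x) \<in> test_functions \<Omega>"
  by (rule test_mult[OF u ss] test_mult[OF u sc'])+
 have ps: "partial b s x = c x * partial b X x" "partial b c x = - s x * partial b X x" for b x
  unfolding s_def[abs_def] c_def[abs_def]
  by (rule partial_compose_real(2)[OF smooth_differentiable[OF X]], rule DERIV_sin DERIV_cos)+
 note du = smooth_differentiable[OF test_smooth[OF u]]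
 have g: "grad_sq (\<lambda>x. s x * u x) x + grad_sq (\<lambda>x. c x * u x) x = grad_sq u x + grad_sq X x * (u x)^2" for x
 proof -
  have "(partial b (\<lambda>x. s x * u x) x)^2 + (partial b (\<lambda>x. c x * u x) x)^2
    = (partial b u x)^2 + (partial b X x)^2 * (u x)^2" for b
  proof -
   have alg: "(p * d + c1 * k * v)^2 + (c1 * d + - p * k * v)^2 = d^2 + k^2 * v^2"
    if "p^2 + c1^2 = 1" for p c1 d k v :: real
   proof -
    have "(p * d + c1 * k * v)^2 + (c1 * d + - p * k * v)^2 = (p^2 + c1^2) * (d^2 + k^2 * v^2)"
     by (simp add: power2_eq_square algebra_simps)
    then show ?thesis using that by simp
   qed
   have e1: "partial b (\<lambda>x. s x * u x) x = s x * partial b u x + c x * partial b X x * u x"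
    using partial_mult[OF smooth_differentiable[OF ss] du] by (simp add: ps)
   have e2: "partial b (\<lambda>x. c x * u x) x = c x * partial b u x + - s x * partial b X x * u x"
    using partial_mult[OF smooth_differentiable[OF sc'] du] by (simp add: ps)
   show ?thesis unfolding e1 e2 by (rule alg[OF sc])
  qed
  then show ?thesis unfolding grad_sq_def by (simp add: sum.distrib[symmetric] sum_distrib_right)
 qed
 have i1: "integrable lebesgue (grad_sq (\<lambda>x. s x * u x))" "integrable lebesgue (grad_sq (\<lambda>x. c x * u x))"
  "integrable lebesgue (grad_sq u)" by (rule integrable_test[OF test_grad_sq], rule ts tc u)+
 have i2: "integrable lebesgue (\<lambda>x. grad_sq X x * (u x)^2)"
  by (rule integrable_test[OF test_mult[OF test_square[OF u] smooth_grad_sq[OF X]]])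
 have i3: "integrable lebesgue (\<lambda>x. U x * (s x * u x)^2)" "integrable lebesgue (\<lambda>x. U x * (c x * u x)^2)"
  by (rule locint_test[OF locint_Linf[OF U] test_square], rule ts tc)+
 have "(LINT x|lebesgue. grad_sq (\<lambda>x. s x * u x) x) + (LINT x|lebesgue. grad_sq (\<lambda>x. c x * u x) x)
   = (LINT x|lebesgue. grad_sq (\<lambda>x. s x * u x) x + grad_sq (\<lambda>x. c x * u x) x)" using i1 by simp
 also have "\<dots> = (LINT x|lebesgue. grad_sq u x) + (LINT x|lebesgue. grad_sq X x * (u x)^2)"
  unfolding g using i1 i2 by simp
 finally have A: "(LINT x|lebesgue. grad_sq (\<lambda>x. s x * u x) x) + (LINT x|lebesgue. grad_sq (\<lambda>x. c x * u x) x)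
   = (LINT x|lebesgue. grad_sq u x) + (LINT x|lebesgue. grad_sq X x * (u x)^2)" .
 have "(LINT x|lebesgue. U x * (s x * u x)^2) + (LINT x|lebesgue. U x * (c x * u x)^2)
   = (LINT x|lebesgue. U x * (s x * u x)^2 + U x * (c x * u x)^2)" using i3 by simp
 also have "(\<lambda>x. U x * (s x * u x)^2 + U x * (c x * u x)^2) = (\<lambda>x. U x * (u x)^2)"
 proof
  fix x
  have "U x * (s x * u x)^2 + U x * (c x * u x)^2 = ((s x)^2 + (c x)^2) * (U x * (u x)^2)"
   by (simp add: power_mult_distrib algebra_simps)
  then show "U x * (s x * u x)^2 + U x * (c x * u x)^2 = U x * (u x)^2" by (simp add: sc)
 qed
 finally show ?thesis using A by (simp add: en_def s_def[symmetric] c_def[symmetric])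
qed

section \<open>Convergence in local \<open>L\<^sup>2\<close>\<close>

text \<open>Convergence in local \<open>L\<^sup>2\<close>. Measurability is asked on compact subsets only: a ground state is arbitrary outside the domain.\<close>

definition L2conv :: "'a::euclidean_space set \<Rightarrow> (nat \<Rightarrow> 'a \<Rightarrow> real) \<Rightarrow> ('a \<Rightarrow> real) \<Rightarrow> bool" where
 "L2conv \<Omega> u w \<longleftrightarrow> (\<forall>K. compact K \<and> K \<subseteq> \<Omega> \<longrightarrow>
   (\<lambda>x. indicator K x * w x) \<in> borel_measurable lebesgue \<and>
   integrable lebesgue (\<lambda>x. indicator K x * (w x)^2) \<and>
   (\<lambda>n. LINT x|lebesgue. indicator K x * (u n x - w x)^2) \<longlonglongrightarrow> 0)"

lemma integrable_on_compact:
 fixes f :: "'a::euclidean_space \<Rightarrow> real"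
 assumes "compact K" "continuous_on K f"
 shows "integrable lebesgue (\<lambda>x. indicator K x * f x)"
proof -
 have "integrable lborel (\<lambda>x. indicator K x *\<^sub>R f x)" by (rule borel_integrable_compact[OF assms])
 then show ?thesis by (simp add: integrable_completion borel_measurable_integrable)
qed

lemma sets_compact: "compact K \<Longrightarrow> K \<in> sets lebesgue"
 by (rule fmeasurableD[OF lmeasurable_compact])

lemma integrable_product_L2:
 fixes f g :: "'b \<Rightarrow> real"
 assumes "f \<in> borel_measurable M" "g \<in> borel_measurable M" "integrable M (\<lambda>x. (f x)^2)" "integrable M (\<lambda>x. (g x)^2)"
 shows "integrable M (\<lambda>x. f x * g x)"
proof (rule Bochner_Integration.integrable_bound)
 show "integrable M (\<lambda>x. (f x)^2 + (g x)^2)" using assms by simp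
 show "(\<lambda>x. f x * g x) \<in> borel_measurable M" using assms by simp
 show "AE x in M. norm (f x * g x) \<le> norm ((f x)^2 + (g x)^2)"
 proof (rule AE_I2)
  fix x
  have "0 \<le> (\<bar>f x\<bar> - \<bar>g x\<bar>)^2" by simp
  then have "2 * (\<bar>f x\<bar> * \<bar>g x\<bar>) \<le> (f x)^2 + (g x)^2" by (simp add: power2_eq_square algebra_simps)
  moreover have "0 \<le> \<bar>f x\<bar> * \<bar>g x\<bar>" by simp
  ultimately have "\<bar>f x\<bar> * \<bar>g x\<bar> \<le> (f x)^2 + (g x)^2" by linarith
  then show "norm (f x * g x) \<le> norm ((f x)^2 + (g x)^2)" by (simp add: abs_mult)
 qed
qed

lemma indicator_square: "(indicator K x * (t::real))^2 = indicator K x * t^2"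
 by (simp add: indicator_def)

context
 fixes \<Omega> :: "'a::euclidean_space set" and u :: "nat \<Rightarrow> 'a \<Rightarrow> real" and w :: "'a \<Rightarrow> real"
 assumes u: "\<And>n. u n \<in> test_functions \<Omega>" and uw: "L2conv \<Omega> u w"
begin

lemma L2conv_measurable:
 assumes "compact K" "K \<subseteq> \<Omega>"
 shows "(\<lambda>x. indicator K x * w x) \<in> borel_measurable lebesgue" "(\<lambda>x. indicator K x * u n x) \<in> borel_measurable lebesgue"
  "(\<lambda>x. indicator K x * (u n x - w x)) \<in> borel_measurable lebesgue"
proof -
 show 1: "(\<lambda>x. indicator K x * w x) \<in> borel_measurable lebesgue" using uw assms by (simp add: L2conv_def)
 show 2: "(\<lambda>x. indicator K x * u n x) \<in> borel_measurable lebesgue"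
  by (rule borel_measurable_integrable[OF integrable_on_compact[OF assms(1) test_continuous[OF u]]])
 show "(\<lambda>x. indicator K x * (u n x - w x)) \<in> borel_measurable lebesgue"
  using borel_measurable_diff[OF 2 1] by (simp add: right_diff_distrib)
qed

lemma L2conv_integrable:
 assumes "compact K" "K \<subseteq> \<Omega>"
 shows "integrable lebesgue (\<lambda>x. indicator K x * (w x)^2)" "integrable lebesgue (\<lambda>x. indicator K x * (u n x)^2)"
  "integrable lebesgue (\<lambda>x. indicator K x * (u n x - w x)^2)"
proof -
 show 1: "integrable lebesgue (\<lambda>x. indicator K x * (w x)^2)" using uw assms by (simp add: L2conv_def)
 show 2: "integrable lebesgue (\<lambda>x. indicator K x * (u n x)^2)"
  by (rule integrable_on_compact[OF assms(1) test_continuous[OF test_square[OF u]]])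
 have "integrable lebesgue (\<lambda>x. (indicator K x * u n x) * (indicator K x * w x))"
  by (rule integrable_product_L2) (use L2conv_measurable[OF assms] 1 2 in \<open>simp_all add: indicator_square\<close>)
 then have "integrable lebesgue (\<lambda>x. indicator K x * (u n x)^2 - 2 * ((indicator K x * u n x) * (indicator K x * w x)) + indicator K x * (w x)^2)"
  using 1 2 by simp
 moreover have "indicator K x * (u n x)^2 - 2 * ((indicator K x * u n x) * (indicator K x * w x)) + indicator K x * (w x)^2
   = indicator K x * (u n x - w x)^2" for x
  by (simp add: indicator_def power2_eq_square algebra_simps)
 ultimately show "integrable lebesgue (\<lambda>x. indicator K x * (u n x - w x)^2)" by simp
qed

lemma L2conv_locint: "locint \<Omega> w"
 unfolding locint_def
proof (intro allI impI)
 fix K assume K: "compact K \<and> K \<subseteq> \<Omega>"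
 then have K1: "compact K" "K \<subseteq> \<Omega>" by auto
 have i: "integrable lebesgue (indicator K :: 'a \<Rightarrow> real)" by (rule integrable_indicator_compact[OF K1(1)])
 have "(\<lambda>x. (indicator K x :: real)^2) = indicator K" by (auto simp: indicator_def)
 then have i2: "integrable lebesgue (\<lambda>x. (indicator K x :: real)^2)" using i by simp
 have i3: "integrable lebesgue (\<lambda>x. (indicator K x * w x)^2)"
  using L2conv_integrable(1)[OF K1] by (simp only: indicator_square)
 have "integrable lebesgue (\<lambda>x. indicator K x * (indicator K x * w x))"
  by (rule integrable_product_L2[OF borel_measurable_integrable[OF i] L2conv_measurable(1)[OF K1] i2 i3])
 moreover have "indicator K x * (indicator K x * w x) = indicator K x * w x" for x by (simp add: indicator_def)
 ultimately show "integrable lebesgue (\<lambda>x. indicator K x * w x)" by simp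
qed

lemma L2conv_pairing:
 assumes K: "compact K" "K \<subseteq> \<Omega>" and g: "g \<in> borel_measurable lebesgue" "integrable lebesgue (\<lambda>x. (g x)^2)"
  "\<And>x. x \<notin> K \<Longrightarrow> g x = 0"
 shows "(\<lambda>n. LINT x|lebesgue. u n x * g x) \<longlonglongrightarrow> (LINT x|lebesgue. w x * g x)"
  and "integrable lebesgue (\<lambda>x. w x * g x)" "integrable lebesgue (\<lambda>x. u n x * g x)"
proof -
 have eq: "(indicator K x * f x) * g x = f x * g x" for f :: "'a \<Rightarrow> real" and x
  using g(3)[of x] by (cases "x \<in> K") auto
 have iw: "integrable lebesgue (\<lambda>x. w x * g x)"
  using integrable_product_L2[OF L2conv_measurable(1)[OF K] g(1) _ g(2)] L2conv_integrable(1)[OF K]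
  by (simp add: indicator_square eq)
 have iu: "integrable lebesgue (\<lambda>x. u n x * g x)" for n
  using integrable_product_L2[OF L2conv_measurable(2)[OF K, of n] g(1) _ g(2)] L2conv_integrable(2)[OF K, of n]
  by (simp add: indicator_square eq)
 show "integrable lebesgue (\<lambda>x. w x * g x)" "integrable lebesgue (\<lambda>x. u n x * g x)" by (rule iw iu)+
 define G where "G = (LINT x|lebesgue. (g x)^2)"
 have CS: "((LINT x|lebesgue. u n x * g x) - (LINT x|lebesgue. w x * g x))^2
   \<le> (LINT x|lebesgue. indicator K x * (u n x - w x)^2) * G" for n
 proof -
  have eq2: "(indicator K x * (u n x - w x)) * g x = u n x * g x - w x * g x" for x
   using eq[where f = "\<lambda>x. u n x - w x" and x = x] by (simp add: left_diff_distrib)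
  have i: "integrable lebesgue (\<lambda>x. (indicator K x * (u n x - w x)) * g x)"
   unfolding eq2 using iu[of n] iw by simp
  have "(LINT x|lebesgue. u n x * g x) - (LINT x|lebesgue. w x * g x) = (LINT x|lebesgue. (indicator K x * (u n x - w x)) * g x)"
   unfolding eq2 using iu[of n] iw by simp
  then show ?thesis
   using Cauchy_Schwarz_integral[of lebesgue "\<lambda>x. indicator K x * (u n x - w x)" g] i g(2) L2conv_integrable(3)[OF K, of n]
   by (simp add: indicator_square G_def)
 qed
 have lim: "(\<lambda>n. (LINT x|lebesgue. indicator K x * (u n x - w x)^2) * G) \<longlonglongrightarrow> 0 * G"
  using uw K by (intro tendsto_intros) (simp add: L2conv_def)
 have "(\<lambda>n. ((LINT x|lebesgue. u n x * g x) - (LINT x|lebesgue. w x * g x))^2) \<longlonglongrightarrow> 0"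
  by (rule tendsto_sandwich[where f = "\<lambda>_. 0", OF _ always_eventually[OF allI[OF CS]] tendsto_const])
    (use lim in simp_all)
 then have "(\<lambda>n. (LINT x|lebesgue. u n x * g x) - (LINT x|lebesgue. w x * g x)) \<longlonglongrightarrow> 0"
  by (simp add: power_tendsto_0_iff)
 then show "(\<lambda>n. LINT x|lebesgue. u n x * g x) \<longlonglongrightarrow> (LINT x|lebesgue. w x * g x)" by (rule LIM_zero_cancel)
qed

text \<open>Expand \<open>u\<^sup>2 = (u - w)\<^sup>2 + 2 u w - w\<^sup>2\<close>; the middle term is a pairing with \<open>w\<close> cut off to \<open>K\<close>.\<close>

lemma L2conv_norm:
 assumes K: "compact K" "K \<subseteq> \<Omega>"
 shows "(\<lambda>n. LINT x|lebesgue. indicator K x * (u n x)^2) \<longlonglongrightarrow> (LINT x|lebesgue. indicator K x * (w x)^2)"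
proof -
 define g where "g x = indicator K x * w x" for x
 have g: "g \<in> borel_measurable lebesgue" "integrable lebesgue (\<lambda>x. (g x)^2)" "\<And>x. x \<notin> K \<Longrightarrow> g x = 0"
  using L2conv_measurable(1)[OF K] L2conv_integrable(1)[OF K] by (simp_all add: g_def[abs_def] indicator_square)
 note P = L2conv_pairing[OF K g]
 have "(\<lambda>n. (LINT x|lebesgue. indicator K x * (u n x - w x)^2) + 2 * (LINT x|lebesgue. u n x * g x) - (LINT x|lebesgue. w x * g x))
   \<longlonglongrightarrow> 0 + 2 * (LINT x|lebesgue. w x * g x) - (LINT x|lebesgue. w x * g x)"
  using uw K by (intro tendsto_intros P(1)) (simp add: L2conv_def)
 moreover have "(LINT x|lebesgue. indicator K x * (u n x - w x)^2) + 2 * (LINT x|lebesgue. u n x * g x) - (LINT x|lebesgue. w x * g x)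
   = (LINT x|lebesgue. indicator K x * (u n x)^2)" for n
 proof -
  have "(LINT x|lebesgue. indicator K x * (u n x - w x)^2) + 2 * (LINT x|lebesgue. u n x * g x) - (LINT x|lebesgue. w x * g x)
   = (LINT x|lebesgue. indicator K x * (u n x - w x)^2 + 2 * (u n x * g x) - w x * g x)"
   using L2conv_integrable(3)[OF K, of n] P(2) P(3)[of n] by simp
  also have "(\<lambda>x. indicator K x * (u n x - w x)^2 + 2 * (u n x * g x) - w x * g x) = (\<lambda>x. indicator K x * (u n x)^2)"
   by (rule ext) (simp add: g_def indicator_def power2_eq_square algebra_simps)
  finally show ?thesis .
 qed
 moreover have "(LINT x|lebesgue. w x * g x) = (LINT x|lebesgue. indicator K x * (w x)^2)"
  by (simp add: g_def power2_eq_square mult_ac)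
 ultimately show ?thesis by simp
qed

lemma L2conv_by_domination:
 assumes a: "\<And>n. a n \<in> test_functions \<Omega>"
  and b: "\<And>K. compact K \<Longrightarrow> K \<subseteq> \<Omega> \<Longrightarrow> (\<lambda>x. indicator K x * b x) \<in> borel_measurable lebesgue \<and>
   integrable lebesgue (\<lambda>x. indicator K x * (b x)^2)"
  and F: "\<And>K n. compact K \<Longrightarrow> K \<subseteq> \<Omega> \<Longrightarrow> integrable lebesgue (\<lambda>x. indicator K x * F n x)"
   "\<And>K. compact K \<Longrightarrow> K \<subseteq> \<Omega> \<Longrightarrow> (\<lambda>n. LINT x|lebesgue. indicator K x * F n x) \<longlonglongrightarrow> 0"
  and le: "\<And>n x. (a n x - b x)^2 \<le> F n x"
 shows "L2conv \<Omega> a b"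
 unfolding L2conv_def
proof (intro allI impI conjI)
 fix K assume K: "compact K \<and> K \<subseteq> \<Omega>"
 show "(\<lambda>x. indicator K x * b x) \<in> borel_measurable lebesgue" "integrable lebesgue (\<lambda>x. indicator K x * (b x)^2)"
  using b K by blast+
 have "(LINT x|lebesgue. indicator K x * (a n x - b x)^2) \<le> (LINT x|lebesgue. indicator K x * F n x)" for n
 proof (rule integral_mono_AE')
  show "integrable lebesgue (\<lambda>x. indicator K x * F n x)" using F(1) K by blast
  show "AE x in lebesgue. indicator K x * (a n x - b x)^2 \<le> indicator K x * F n x"
   by (rule AE_I2) (rule mult_left_mono[OF le], simp)
  show "AE x in lebesgue. 0 \<le> indicator K x * F n x"
   by (rule AE_I2) (intro mult_nonneg_nonneg order_trans[OF zero_le_power2 le], simp)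
 qed
 then show "(\<lambda>n. LINT x|lebesgue. indicator K x * (a n x - b x)^2) \<longlonglongrightarrow> 0"
  by (intro tendsto_sandwich[OF _ _ tendsto_const F(2)]) (use K in auto)
qed

lemma L2conv_abs:
 assumes a: "\<And>n. a n \<in> test_functions \<Omega>" and close: "\<And>n x. \<bar>a n x - \<bar>u n x\<bar>\<bar> \<le> d n" "d \<longlonglongrightarrow> 0"
 shows "L2conv \<Omega> a (\<lambda>x. \<bar>w x\<bar>)"
proof (rule L2conv_by_domination[OF a, where F = "\<lambda>n x. 2 * (d n)^2 + 2 * (u n x - w x)^2"])
 fix K assume K: "compact K" "K \<subseteq> \<Omega>"
 have "(\<lambda>x. \<bar>indicator K x * w x\<bar>) \<in> borel_measurable lebesgue"
  using L2conv_measurable(1)[OF K] by (rule borel_measurable_abs)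
 then show "(\<lambda>x. indicator K x * \<bar>w x\<bar>) \<in> borel_measurable lebesgue \<and> integrable lebesgue (\<lambda>x. indicator K x * \<bar>w x\<bar>^2)"
  using L2conv_integrable(1)[OF K] by (simp add: abs_mult)
 have i: "integrable lebesgue (indicator K :: 'a \<Rightarrow> real)" by (rule integrable_indicator_compact[OF K(1)])
 have eq: "indicator K x * (2 * (d n)^2 + 2 * (u n x - w x)^2) = (2 * (d n)^2) * indicator K x + 2 * (indicator K x * (u n x - w x)^2)" for n x
  by (simp add: distrib_left)
 show "integrable lebesgue (\<lambda>x. indicator K x * (2 * (d n)^2 + 2 * (u n x - w x)^2))" for n
  unfolding eq by (intro Bochner_Integration.integrable_add integrable_mult_right i L2conv_integrable(3)[OF K])
 have "(LINT x|lebesgue. indicator K x * (2 * (d n)^2 + 2 * (u n x - w x)^2))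
   = (2 * (d n)^2) * (LINT x|lebesgue. indicator K x) + 2 * (LINT x|lebesgue. indicator K x * (u n x - w x)^2)" for n
  unfolding eq using i L2conv_integrable(3)[OF K, of n] by simp
 moreover have "(\<lambda>n. (2 * (d n)^2) * (LINT x|lebesgue. indicator K x) + 2 * (LINT x|lebesgue. indicator K x * (u n x - w x)^2))
   \<longlonglongrightarrow> (2 * 0^2) * (LINT x|lebesgue. indicator K x) + 2 * 0"
  using uw K by (intro tendsto_intros close(2)) (simp add: L2conv_def)
 ultimately show "(\<lambda>n. LINT x|lebesgue. indicator K x * (2 * (d n)^2 + 2 * (u n x - w x)^2)) \<longlonglongrightarrow> 0" by simp
next
 fix n x
 have "\<bar>a n x - \<bar>w x\<bar>\<bar> \<le> d n + \<bar>u n x - w x\<bar>" using close(1)[of n x] by linarith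
 then have "\<bar>a n x - \<bar>w x\<bar>\<bar>^2 \<le> (d n + \<bar>u n x - w x\<bar>)^2" by (intro power_mono) auto
 moreover have "0 \<le> (d n - \<bar>u n x - w x\<bar>)^2" by simp
 ultimately show "(a n x - \<bar>w x\<bar>)^2 \<le> 2 * (d n)^2 + 2 * (u n x - w x)^2"
  by (simp add: power2_sum power2_diff)
qed

lemma L2conv_scale:
 assumes c: "c \<longlonglongrightarrow> (c0::real)"
 shows "L2conv \<Omega> (\<lambda>n x. c n * u n x) (\<lambda>x. c0 * w x)"
proof (rule L2conv_by_domination[where F = "\<lambda>n x. 2 * (c n)^2 * (u n x - w x)^2 + 2 * (c n - c0)^2 * (w x)^2"])
 show "(\<lambda>x. c n * u n x) \<in> test_functions \<Omega>" for n by (rule test_cmult[OF u])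
 fix K assume K: "compact K" "K \<subseteq> \<Omega>"
 show "(\<lambda>x. indicator K x * (c0 * w x)) \<in> borel_measurable lebesgue \<and> integrable lebesgue (\<lambda>x. indicator K x * (c0 * w x)^2)"
  using borel_measurable_times[OF borel_measurable_const L2conv_measurable(1)[OF K], of c0]
   integrable_mult_right[OF L2conv_integrable(1)[OF K], of "c0^2"]
  by (simp add: power_mult_distrib mult.left_commute)
 have eq: "indicator K x * (2 * (c n)^2 * (u n x - w x)^2 + 2 * (c n - c0)^2 * (w x)^2)
   = (2 * (c n)^2) * (indicator K x * (u n x - w x)^2) + (2 * (c n - c0)^2) * (indicator K x * (w x)^2)" for n x
  by (simp add: distrib_left mult_ac)
 show "integrable lebesgue (\<lambda>x. indicator K x * (2 * (c n)^2 * (u n x - w x)^2 + 2 * (c n - c0)^2 * (w x)^2))" for n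
  unfolding eq by (intro Bochner_Integration.integrable_add integrable_mult_right L2conv_integrable[OF K])
 have "(LINT x|lebesgue. indicator K x * (2 * (c n)^2 * (u n x - w x)^2 + 2 * (c n - c0)^2 * (w x)^2))
   = (2 * (c n)^2) * (LINT x|lebesgue. indicator K x * (u n x - w x)^2) + (2 * (c n - c0)^2) * (LINT x|lebesgue. indicator K x * (w x)^2)" for n
  unfolding eq using L2conv_integrable(1)[OF K] L2conv_integrable(3)[OF K, of n] by simp
 moreover have "(\<lambda>n. (2 * (c n)^2) * (LINT x|lebesgue. indicator K x * (u n x - w x)^2) + (2 * (c n - c0)^2) * (LINT x|lebesgue. indicator K x * (w x)^2))
   \<longlonglongrightarrow> (2 * c0^2) * 0 + (2 * (c0 - c0)^2) * (LINT x|lebesgue. indicator K x * (w x)^2)"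
  using uw K by (intro tendsto_intros c) (simp add: L2conv_def)
 ultimately show "(\<lambda>n. LINT x|lebesgue. indicator K x * (2 * (c n)^2 * (u n x - w x)^2 + 2 * (c n - c0)^2 * (w x)^2)) \<longlonglongrightarrow> 0"
  by simp
next
 fix n x
 define p where "p = c n * (u n x - w x)"
 define q where "q = (c n - c0) * w x"
 have "0 \<le> (p - q)^2" by simp
 then have "(p + q)^2 \<le> 2 * p^2 + 2 * q^2" by (simp add: power2_sum power2_diff)
 moreover have "c n * u n x - c0 * w x = p + q" by (simp add: p_def q_def algebra_simps)
 ultimately show "(c n * u n x - c0 * w x)^2 \<le> 2 * (c n)^2 * (u n x - w x)^2 + 2 * (c n - c0)^2 * (w x)^2"
  by (simp add: p_def q_def power_mult_distrib)
qed

lemma L2conv_diff: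
 assumes u': "\<And>n. u' n \<in> test_functions \<Omega>" and uw': "\<And>K. compact K \<Longrightarrow> K \<subseteq> \<Omega> \<Longrightarrow>
   (\<lambda>x. indicator K x * w' x) \<in> borel_measurable lebesgue \<and>
   integrable lebesgue (\<lambda>x. indicator K x * (w' x)^2) \<and>
   (\<forall>n. integrable lebesgue (\<lambda>x. indicator K x * (u' n x - w' x)^2)) \<and>
   (\<lambda>n. LINT x|lebesgue. indicator K x * (u' n x - w' x)^2) \<longlonglongrightarrow> 0"
 shows "L2conv \<Omega> (\<lambda>n x. u n x - s * u' n x) (\<lambda>x. w x - s * w' x)"
proof (rule L2conv_by_domination[where F = "\<lambda>n x. 2 * (u n x - w x)^2 + 2 * s^2 * (u' n x - w' x)^2"])
 show "(\<lambda>x. u n x - s * u' n x) \<in> test_functions \<Omega>" for n by (rule test_diff[OF u test_cmult[OF u']])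
 fix K assume K: "compact K" "K \<subseteq> \<Omega>"
 note W = uw'[OF K]
 have m: "(\<lambda>x. indicator K x * (w x - s * w' x)) \<in> borel_measurable lebesgue"
 proof -
  have "(\<lambda>x. indicator K x * w x - s * (indicator K x * w' x)) \<in> borel_measurable lebesgue"
   by (intro borel_measurable_diff borel_measurable_times borel_measurable_const L2conv_measurable(1)[OF K] conjunct1[OF W])
  moreover have "(\<lambda>x. indicator K x * w x - s * (indicator K x * w' x)) = (\<lambda>x. indicator K x * (w x - s * w' x))"
   by (auto simp: algebra_simps)
  ultimately show ?thesis by simp
 qed
 moreover have "integrable lebesgue (\<lambda>x. indicator K x * (w x - s * w' x)^2)"
 proof (rule Bochner_Integration.integrable_bound)
  show "integrable lebesgue (\<lambda>x. 2 * (indicator K x * (w x)^2) + (2 * s^2) * (indicator K x * (w' x)^2))"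
   using W L2conv_integrable(1)[OF K] by simp
  show "(\<lambda>x. indicator K x * (w x - s * w' x)^2) \<in> borel_measurable lebesgue"
   using borel_measurable_power[OF m, of 2] by (simp add: indicator_square)
  show "AE x in lebesgue. norm (indicator K x * (w x - s * w' x)^2) \<le> norm (2 * (indicator K x * (w x)^2) + (2 * s^2) * (indicator K x * (w' x)^2))"
  proof (rule AE_I2)
   fix x
   have "0 \<le> (w x + s * w' x)^2" by simp
   then have "(w x - s * w' x)^2 \<le> 2 * (w x)^2 + 2 * s^2 * (w' x)^2"
    by (simp add: power2_sum power2_diff power_mult_distrib)
   then show "norm (indicator K x * (w x - s * w' x)^2) \<le> norm (2 * (indicator K x * (w x)^2) + (2 * s^2) * (indicator K x * (w' x)^2))"
    by (cases "x \<in> K") auto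
  qed
 qed
 ultimately show "(\<lambda>x. indicator K x * (w x - s * w' x)) \<in> borel_measurable lebesgue \<and> integrable lebesgue (\<lambda>x. indicator K x * (w x - s * w' x)^2)" ..
 have eq: "indicator K x * (2 * (u n x - w x)^2 + 2 * s^2 * (u' n x - w' x)^2)
   = 2 * (indicator K x * (u n x - w x)^2) + (2 * s^2) * (indicator K x * (u' n x - w' x)^2)" for n x
  by (simp add: distrib_left mult_ac)
 show "integrable lebesgue (\<lambda>x. indicator K x * (2 * (u n x - w x)^2 + 2 * s^2 * (u' n x - w' x)^2))" for n
  unfolding eq using W by (intro Bochner_Integration.integrable_add integrable_mult_right L2conv_integrable(3)[OF K]) blast
 have "(LINT x|lebesgue. indicator K x * (2 * (u n x - w x)^2 + 2 * s^2 * (u' n x - w' x)^2))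
   = 2 * (LINT x|lebesgue. indicator K x * (u n x - w x)^2) + (2 * s^2) * (LINT x|lebesgue. indicator K x * (u' n x - w' x)^2)" for n
  unfolding eq using W L2conv_integrable(3)[OF K, of n] by simp
 moreover have "(\<lambda>n. 2 * (LINT x|lebesgue. indicator K x * (u n x - w x)^2) + (2 * s^2) * (LINT x|lebesgue. indicator K x * (u' n x - w' x)^2))
   \<longlonglongrightarrow> 2 * 0 + (2 * s^2) * 0"
  using uw K W by (intro tendsto_intros) (auto simp: L2conv_def)
 ultimately show "(\<lambda>n. LINT x|lebesgue. indicator K x * (2 * (u n x - w x)^2 + 2 * s^2 * (u' n x - w' x)^2)) \<longlonglongrightarrow> 0" by simp
next
 fix n x
 define p where "p = u n x - w x"
 define q where "q = s * (u' n x - w' x)"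
 have "0 \<le> (p + q)^2" by simp
 then have "(p - q)^2 \<le> 2 * p^2 + 2 * q^2" by (simp add: power2_sum power2_diff)
 moreover have "u n x - s * u' n x - (w x - s * w' x) = p - q" by (simp add: p_def q_def algebra_simps)
 moreover have "2 * p^2 + 2 * q^2 = 2 * (u n x - w x)^2 + 2 * s^2 * (u' n x - w' x)^2"
  by (simp add: p_def q_def power_mult_distrib)
 ultimately show "(u n x - s * u' n x - (w x - s * w' x))^2 \<le> 2 * (u n x - w x)^2 + 2 * s^2 * (u' n x - w' x)^2"
  by (simp only:)
qed

lemma L2conv_AE_cong:
 assumes v: "continuous_on \<Omega> v" "AE x in lebesgue. x \<in> \<Omega> \<longrightarrow> w x = v x"
 shows "L2conv \<Omega> u v"
 unfolding L2conv_def
proof (intro allI impI)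
 fix K assume K': "compact K \<and> K \<subseteq> \<Omega>"
 then have K: "compact K" "K \<subseteq> \<Omega>" by auto
 have cv: "continuous_on K v" by (rule continuous_on_subset[OF v(1) K(2)])
 have iv: "integrable lebesgue (\<lambda>x. indicator K x * v x)" "integrable lebesgue (\<lambda>x. indicator K x * (v x)^2)"
  "integrable lebesgue (\<lambda>x. indicator K x * (u n x - v x)^2)" for n
  by (intro integrable_on_compact[OF K(1)] continuous_intros cv test_continuous[OF u])+
 have "(LINT x|lebesgue. indicator K x * (u n x - v x)^2) = (LINT x|lebesgue. indicator K x * (u n x - w x)^2)" for n
 proof (rule integral_cong_AE)
  show "AE x in lebesgue. indicator K x * (u n x - v x)^2 = indicator K x * (u n x - w x)^2"
   using v(2) by (rule eventually_mono) (use K(2) in \<open>auto simp: indicator_def\<close>)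
 qed (rule borel_measurable_integrable[OF iv(3)] borel_measurable_integrable[OF L2conv_integrable(3)[OF K]])+
 then show "(\<lambda>x. indicator K x * v x) \<in> borel_measurable lebesgue \<and> integrable lebesgue (\<lambda>x. indicator K x * (v x)^2) \<and>
   (\<lambda>n. LINT x|lebesgue. indicator K x * (u n x - v x)^2) \<longlonglongrightarrow> 0"
  using iv borel_measurable_integrable[OF iv(1)] uw K by (simp add: L2conv_def)
qed

text \<open>Along a null sequence of a nonnegative form the bilinear form vanishes in the limit by Cauchy--Schwarz.\<close>

lemma null_sequence_limit_weak_sol:
 assumes U: "U \<in> Linf_loc \<Omega>" "open \<Omega>" and nn: "\<And>u. u \<in> test_functions \<Omega> \<Longrightarrow> 0 \<le> en U u"
  and null: "(\<lambda>n. en U (u n)) \<longlonglongrightarrow> 0"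
 shows "weak_sol \<Omega> U w"
 unfolding weak_sol_def
proof
 fix \<psi> assume psi: "\<psi> \<in> test_functions \<Omega>"
 obtain K where K: "compact K" "K \<subseteq> \<Omega>" "\<forall>x. x \<notin> K \<longrightarrow> \<psi> x = 0" using test_support[OF psi] by blast
 obtain L where L: "compact L" "L \<subseteq> \<Omega>" "\<forall>x. x \<notin> L \<longrightarrow> lap \<psi> x = 0" using test_support[OF test_lap[OF psi]] by blast
 define g where "g x = U x * \<psi> x - lap \<psi> x" for x
 note lU = locint_Linf[OF U]
 have lUU: "locint \<Omega> (\<lambda>x. U x * U x)" by (rule locint_mult_Linf[OF U lU])
 have i1: "integrable lebesgue (\<lambda>x. U x * \<psi> x)" by (rule locint_test[OF lU psi])
 have gi: "integrable lebesgue g" unfolding g_def[abs_def] using i1 integrable_test[OF test_lap[OF psi]] by simp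
 have "integrable lebesgue (\<lambda>x. U x * U x * (\<psi> x)^2 - 2 * (U x * (lap \<psi> x * \<psi> x)) + (lap \<psi> x)^2)"
  using locint_test[OF lUU test_square[OF psi]] locint_test[OF lU test_mult[OF psi smooth_lap[OF test_smooth[OF psi]]]]
   integrable_test[OF test_square[OF test_lap[OF psi]]] by simp
 moreover have "U x * U x * (\<psi> x)^2 - 2 * (U x * (lap \<psi> x * \<psi> x)) + (lap \<psi> x)^2 = (g x)^2" for x
  by (simp add: g_def power2_eq_square algebra_simps)
 ultimately have g2: "integrable lebesgue (\<lambda>x. (g x)^2)" by simp
 have g0: "g x = 0" if "x \<notin> K \<union> L" for x using that K(3) L(3) by (simp add: g_def)
 have "(\<lambda>n. form U (u n) \<psi>) \<longlonglongrightarrow> (LINT x|lebesgue. w x * g x)"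
  unfolding form_def g_def[symmetric]
  by (rule L2conv_pairing(1)[OF compact_Un[OF K(1) L(1)] Un_least[OF K(2) L(2)] borel_measurable_integrable[OF gi] g2 g0])
 moreover have "(\<lambda>n. form U (u n) \<psi>) \<longlonglongrightarrow> 0"
 proof -
  have lim: "(\<lambda>n. en U (u n) * en U \<psi>) \<longlonglongrightarrow> 0 * en U \<psi>" by (intro tendsto_intros null)
  have "(\<lambda>n. (form U (u n) \<psi>)^2) \<longlonglongrightarrow> 0"
   by (rule tendsto_sandwich[where f = "\<lambda>_. 0", OF _ always_eventually[OF allI[OF form_Cauchy_Schwarz[OF U u psi nn]]] tendsto_const])
     (use lim in simp_all)
  then show ?thesis by (simp add: power_tendsto_0_iff)
 qed
 ultimately have "(LINT x|lebesgue. w x * g x) = 0" by (rule LIMSEQ_unique)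
 then show "(LINT x|lebesgue. w x * (U x * \<psi> x - lap \<psi> x)) = 0" by (simp add: g_def)
qed

text \<open>Taking the modulus does not increase the energy, up to the small error of its smooth substitute.\<close>

lemma null_sequence_abs:
 assumes U: "U \<in> Linf_loc \<Omega>" "open \<Omega>" and nn: "\<And>u. u \<in> test_functions \<Omega> \<Longrightarrow> 0 \<le> en U u"
  and null: "(\<lambda>n. en U (u n)) \<longlonglongrightarrow> 0"
 shows "\<exists>\<phi>. (\<forall>n. \<phi> n \<in> test_functions \<Omega> \<and> (\<forall>x. 0 \<le> \<phi> n x)) \<and> (\<lambda>n. en U (\<phi> n)) \<longlonglongrightarrow> 0 \<and> L2conv \<Omega> \<phi> (\<lambda>x. \<bar>w x\<bar>)"
proof -
 define d where "d n = 1 / real (Suc n)" for n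
 have d1: "d n > 0" for n by (simp add: d_def)
 have d2: "d \<longlonglongrightarrow> 0" unfolding d_def[abs_def] by (rule LIMSEQ_Suc[OF lim_1_over_n])
 note d = d1 d2
 have "\<forall>n. \<exists>\<phi>. \<phi> \<in> test_functions \<Omega> \<and> (\<forall>x. 0 \<le> \<phi> x) \<and> en U \<phi> \<le> en U (u n) + d n \<and> (\<forall>x. \<bar>\<phi> x - \<bar>u n x\<bar>\<bar> \<le> d n)"
  using smooth_abs[OF U u d(1)] by blast
 from choice[OF this] obtain \<phi> where ph: "\<forall>n. \<phi> n \<in> test_functions \<Omega> \<and> (\<forall>x. 0 \<le> \<phi> n x) \<and> en U (\<phi> n) \<le> en U (u n) + d n \<and>
   (\<forall>x. \<bar>\<phi> n x - \<bar>u n x\<bar>\<bar> \<le> d n)" ..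
 have "L2conv \<Omega> \<phi> (\<lambda>x. \<bar>w x\<bar>)" by (rule L2conv_abs[OF _ _ d(2)]) (use ph in auto)
 moreover have "(\<lambda>n. en U (\<phi> n)) \<longlonglongrightarrow> 0"
 proof (rule tendsto_sandwich[OF _ _ tendsto_const])
  show "(\<lambda>n. en U (u n) + d n) \<longlonglongrightarrow> 0" using tendsto_add[OF null d(2)] by simp
 qed (use ph nn in auto)
 ultimately show ?thesis using ph by blast
qed

end

section \<open>The weighted Sobolev term\<close>

text \<open>Young's inequality for the functions divided by their integrals; a small \<open>e\<close> added to the divisors covers vanishing integrals.\<close>

lemma Hoelder_powers:
 fixes f g :: "'b \<Rightarrow> real"
 assumes f: "integrable M f" "\<And>x. 0 \<le> f x" and g: "integrable M g" "\<And>x. 0 \<le> g x"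
  and ab: "\<alpha> > 0" "\<beta> > 0" "\<alpha> + \<beta> = 1"
 shows "integrable M (\<lambda>x. f x powr \<alpha> * g x powr \<beta>)"
  and "(\<integral>x. f x powr \<alpha> * g x powr \<beta> \<partial>M) \<le> (\<integral>x. f x \<partial>M) powr \<alpha> * (\<integral>x. g x \<partial>M) powr \<beta>"
proof -
 have young: "f x powr \<alpha> * g x powr \<beta> \<le> (s powr \<alpha> * t powr \<beta>) * (\<alpha> * f x / s + \<beta> * g x / t)"
  if st: "s > 0" "t > 0" for s t x
 proof (cases "f x = 0 \<or> g x = 0")
  case True
  then show ?thesis using f(2)[of x] g(2)[of x] ab st by (auto intro!: mult_nonneg_nonneg add_nonneg_nonneg)
 next
  case False
  then have p: "f x > 0" "g x > 0" using f(2)[of x] g(2)[of x] by auto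
  have "(f x / s) powr \<alpha> * (g x / t) powr \<beta> \<le> \<alpha> * (f x / s) + \<beta> * (g x / t)"
   by (rule Youngs_inequality_0) (use ab p st in auto)
  then have "(s powr \<alpha> * t powr \<beta>) * ((f x / s) powr \<alpha> * (g x / t) powr \<beta>) \<le> (s powr \<alpha> * t powr \<beta>) * (\<alpha> * (f x / s) + \<beta> * (g x / t))"
   by (rule mult_left_mono) simp
  moreover have "(s powr \<alpha> * t powr \<beta>) * ((f x / s) powr \<alpha> * (g x / t) powr \<beta>) = f x powr \<alpha> * g x powr \<beta>"
   using p st by (simp add: powr_divide)
  ultimately show ?thesis by simp
 qed
 show int: "integrable M (\<lambda>x. f x powr \<alpha> * g x powr \<beta>)"
 proof (rule Bochner_Integration.integrable_bound)
  show "integrable M (\<lambda>x. \<alpha> * f x + \<beta> * g x)" using f g by simp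
  show "(\<lambda>x. f x powr \<alpha> * g x powr \<beta>) \<in> borel_measurable M"
   using f(1) g(1) by (simp add: borel_measurable_integrable)
  show "AE x in M. norm (f x powr \<alpha> * g x powr \<beta>) \<le> norm (\<alpha> * f x + \<beta> * g x)"
   using young[of 1 1] by (intro AE_I2) (simp add: order_trans[OF _ abs_ge_self])
 qed
 define F where "F = (\<integral>x. f x \<partial>M)"
 define G where "G = (\<integral>x. g x \<partial>M)"
 have FG: "0 \<le> F" "0 \<le> G" unfolding F_def G_def using f(2) g(2) by (simp_all add: integral_nonneg_AE)
 have bound: "(\<integral>x. f x powr \<alpha> * g x powr \<beta> \<partial>M) \<le> (F + e) powr \<alpha> * (G + e) powr \<beta>" if e: "e > 0" for e
 proof -
  have pos: "F + e > 0" "G + e > 0" using FG e by auto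
  have "(\<integral>x. f x powr \<alpha> * g x powr \<beta> \<partial>M)
    \<le> (\<integral>x. ((F + e) powr \<alpha> * (G + e) powr \<beta>) * (\<alpha> * f x / (F + e) + \<beta> * g x / (G + e)) \<partial>M)"
   by (intro integral_mono int young pos) (use f(1) g(1) in simp)
  also have "\<dots> = ((F + e) powr \<alpha> * (G + e) powr \<beta>) * (\<alpha> * F / (F + e) + \<beta> * G / (G + e))"
   using f(1) g(1) by (simp add: F_def G_def)
  also have "\<dots> \<le> ((F + e) powr \<alpha> * (G + e) powr \<beta>) * 1"
  proof (rule mult_left_mono)
   have "\<alpha> * F / (F + e) \<le> \<alpha>" "\<beta> * G / (G + e) \<le> \<beta>" using pos ab e by (simp_all add: field_simps)
   then show "\<alpha> * F / (F + e) + \<beta> * G / (G + e) \<le> 1" using ab(3) by linarith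
  qed simp
  finally show ?thesis by simp
 qed
 have lim: "(\<lambda>n. (F + 1 / real (Suc n)) powr \<alpha> * (G + 1 / real (Suc n)) powr \<beta>) \<longlonglongrightarrow> (F + 0) powr \<alpha> * (G + 0) powr \<beta>"
  using FG ab by (intro tendsto_mult tendsto_powr' tendsto_add tendsto_const LIMSEQ_Suc[OF lim_1_over_n]) auto
 have "(\<integral>x. f x powr \<alpha> * g x powr \<beta> \<partial>M) \<le> (F + 0) powr \<alpha> * (G + 0) powr \<beta>"
  by (rule LIMSEQ_le_const[OF lim]) (use bound in auto)
 then show "(\<integral>x. f x powr \<alpha> * g x powr \<beta> \<partial>M) \<le> (\<integral>x. f x \<partial>M) powr \<alpha> * (\<integral>x. g x \<partial>M) powr \<beta>"
  by (simp add: F_def G_def)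
qed

locale sobolev_weight =
 fixes \<Omega> :: "'a::euclidean_space set" and V W :: "'a \<Rightarrow> real"
 assumes dim: "DIM('a) > 2" and opn: "open \<Omega>" and conn: "connected \<Omega>" and ne: "\<Omega> \<noteq> {}"
  and V: "V \<in> Linf_loc \<Omega>"
  and W: "continuous_on \<Omega> W" "\<And>x. x \<in> \<Omega> \<Longrightarrow> W x > 0"
  and energy_ge: "\<And>u. u \<in> test_functions \<Omega> \<Longrightarrow> energy \<Omega> V u \<ge> weighted_sobolev_term \<Omega> W u"
begin

abbreviation SW :: "('a \<Rightarrow> real) \<Rightarrow> real" where "SW u \<equiv> weighted_sobolev_term \<Omega> W u"

lemma SW_eq: "SW u = (LINT x|lebesgue. indicator \<Omega> x * (W x * \<bar>u x\<bar> powr (2 * real DIM('a) / (real DIM('a) - 2)))) powr ((real DIM('a) - 2) / real DIM('a))"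
proof -
 have "2 / sobolev_exponent DIM('a) = (real DIM('a) - 2) / real DIM('a)"
  using dim by (simp add: sobolev_exponent_def field_simps)
 then show ?thesis by (simp add: weighted_sobolev_term_def sobolev_exponent_def set_lebesgue_integral_def)
qed

lemma SW_nonneg: "0 \<le> SW u" by (simp add: SW_eq)

lemma en_ge: "u \<in> test_functions \<Omega> \<Longrightarrow> SW u \<le> en V u"
 using energy_ge[of u] energy_eq_en[OF V opn, of u] by simp

lemma SW_scale: "SW (\<lambda>x. c * u x) = c^2 * SW u"
proof (cases "c = 0")
 case False
 have "(LINT x|lebesgue. indicator \<Omega> x * (W x * \<bar>c * u x\<bar> powr (2 * real DIM('a) / (real DIM('a) - 2))))
   = (LINT x|lebesgue. \<bar>c\<bar> powr (2 * real DIM('a) / (real DIM('a) - 2)) * (indicator \<Omega> x * (W x * \<bar>u x\<bar> powr (2 * real DIM('a) / (real DIM('a) - 2)))))"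
  by (simp add: abs_mult powr_mult mult_ac)
 then have eq: "(LINT x|lebesgue. indicator \<Omega> x * (W x * \<bar>c * u x\<bar> powr (2 * real DIM('a) / (real DIM('a) - 2))))
   = \<bar>c\<bar> powr (2 * real DIM('a) / (real DIM('a) - 2)) * (LINT x|lebesgue. indicator \<Omega> x * (W x * \<bar>u x\<bar> powr (2 * real DIM('a) / (real DIM('a) - 2))))" by simp
 have "0 \<le> (LINT x|lebesgue. indicator \<Omega> x * (W x * \<bar>u x\<bar> powr (2 * real DIM('a) / (real DIM('a) - 2))))"
  by (rule integral_nonneg_AE, rule AE_I2) (use W(2) in \<open>auto simp: indicator_def less_imp_le\<close>)
 moreover have "(\<bar>c\<bar> powr (2 * real DIM('a) / (real DIM('a) - 2))) powr ((real DIM('a) - 2) / real DIM('a)) = c^2"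
 proof -
  have "(2 * real DIM('a) / (real DIM('a) - 2)) * ((real DIM('a) - 2) / real DIM('a)) = 2" using dim by simp
  then have "(\<bar>c\<bar> powr (2 * real DIM('a) / (real DIM('a) - 2))) powr ((real DIM('a) - 2) / real DIM('a)) = \<bar>c\<bar> powr 2" by (simp only: powr_powr)
  also have "\<dots> = c^2" using powr_realpow[of "\<bar>c\<bar>" 2] False by simp
  finally show ?thesis .
 qed
 ultimately show ?thesis by (simp add: SW_eq eq powr_mult)
qed (simp add: SW_eq)

lemma SW_integrable:
 assumes u: "u \<in> test_functions \<Omega>"
 shows "integrable lebesgue (\<lambda>x. indicator \<Omega> x * (W x * \<bar>u x\<bar> powr (2 * real DIM('a) / (real DIM('a) - 2))))"
proof -
 obtain K where K: "compact K" "K \<subseteq> \<Omega>" "\<forall>x. x \<notin> K \<longrightarrow> u x = 0" using test_support[OF u] by blast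
 have "integrable lebesgue (\<lambda>x. indicator K x * (W x * \<bar>u x\<bar> powr (2 * real DIM('a) / (real DIM('a) - 2))))"
  by (intro integrable_on_compact[OF K(1)] continuous_on_mult continuous_on_powr' continuous_on_const
    continuous_on_rabs continuous_on_subset[OF W(1) K(2)] test_continuous[OF u]) (use dim in auto)
 moreover have "indicator K x * (W x * \<bar>u x\<bar> powr (2 * real DIM('a) / (real DIM('a) - 2))) = indicator \<Omega> x * (W x * \<bar>u x\<bar> powr (2 * real DIM('a) / (real DIM('a) - 2)))" for x
  using K by (auto simp: indicator_def)
 ultimately show ?thesis by simp
qed

text \<open>With \<open>\<beta> = (N - 2)/N\<close> for the dimension \<open>N\<close>, factor \<open>\<bar>P\<bar> u\<^sup>2\<close> into \<open>\<bar>P\<bar> W\<^sup>-\<^sup>\<beta>\<close> and \<open>W\<^sup>\<beta> u\<^sup>2\<close>; the conjugate exponents are \<open>N/2\<close> and \<open>1/\<beta>\<close>.\<close>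

lemma weighted_Hoelder:
 assumes A: "A \<subseteq> \<Omega>"
  and h: "integrable lebesgue (\<lambda>x. indicator A x * (\<bar>P x\<bar> powr (real DIM('a) / 2) * W x powr ((2 - real DIM('a)) / 2)))"
  and u: "u \<in> test_functions \<Omega>"
 shows "integrable lebesgue (\<lambda>x. indicator A x * (\<bar>P x\<bar> * (u x)^2))"
  and "(LINT x|lebesgue. indicator A x * (\<bar>P x\<bar> * (u x)^2))
   \<le> (LINT x|lebesgue. indicator A x * (\<bar>P x\<bar> powr (real DIM('a) / 2) * W x powr ((2 - real DIM('a)) / 2))) powr (2 / real DIM('a)) * SW u"
proof -
 define f where "f x = indicator A x * (\<bar>P x\<bar> powr (real DIM('a) / 2) * W x powr ((2 - real DIM('a)) / 2))" for x
 define g where "g x = indicator \<Omega> x * (W x * \<bar>u x\<bar> powr (2 * real DIM('a) / (real DIM('a) - 2)))" for x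
 have d: "real DIM('a) > 2" using dim by simp
 have f0: "0 \<le> f x" for x by (simp add: f_def)
 have g0: "0 \<le> g x" for x using W(2)[of x] by (cases "x \<in> \<Omega>") (auto simp: g_def)
 have fi: "integrable lebesgue f" using h by (simp add: f_def[abs_def])
 have gi: "integrable lebesgue g" unfolding g_def[abs_def] by (rule SW_integrable[OF u])
 have ab: "2 / real DIM('a) > 0" "(real DIM('a) - 2) / real DIM('a) > 0" "2 / real DIM('a) + (real DIM('a) - 2) / real DIM('a) = 1"
  using d by (simp_all add: field_simps)
 have eq: "f x powr (2 / real DIM('a)) * g x powr ((real DIM('a) - 2) / real DIM('a)) = indicator A x * (\<bar>P x\<bar> * (u x)^2)" for x
 proof (cases "x \<in> A \<and> P x \<noteq> 0 \<and> u x \<noteq> 0")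
  case True
  then have w: "W x > 0" "x \<in> \<Omega>" using W(2) A by auto
  have e: "(2 - real DIM('a)) / 2 * (2 / real DIM('a)) = - ((real DIM('a) - 2) / real DIM('a))" "real DIM('a) / 2 * (2 / real DIM('a)) = 1"
    "(2 * real DIM('a) / (real DIM('a) - 2)) * ((real DIM('a) - 2) / real DIM('a)) = 2" using d by (simp_all add: field_simps)
  have 1: "f x powr (2 / real DIM('a)) = \<bar>P x\<bar> * W x powr (- ((real DIM('a) - 2) / real DIM('a)))"
  proof -
   have "f x powr (2 / real DIM('a)) = (\<bar>P x\<bar> powr (real DIM('a) / 2)) powr (2 / real DIM('a)) * (W x powr ((2 - real DIM('a)) / 2)) powr (2 / real DIM('a))"
    using True by (simp add: f_def powr_mult)
   also have "\<dots> = \<bar>P x\<bar> powr 1 * W x powr (- ((real DIM('a) - 2) / real DIM('a)))" by (simp only: powr_powr e)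
   finally show ?thesis by simp
  qed
  have "(\<bar>u x\<bar> powr (2 * real DIM('a) / (real DIM('a) - 2))) powr ((real DIM('a) - 2) / real DIM('a)) = \<bar>u x\<bar> powr 2" by (simp only: powr_powr e)
  also have "\<dots> = (u x)^2" using powr_realpow[of "\<bar>u x\<bar>" 2] True by simp
  finally have 2: "g x powr ((real DIM('a) - 2) / real DIM('a)) = W x powr ((real DIM('a) - 2) / real DIM('a)) * (u x)^2"
   using w by (simp add: g_def powr_mult)
  have "W x powr (- ((real DIM('a) - 2) / real DIM('a))) * W x powr ((real DIM('a) - 2) / real DIM('a)) = 1"
   using w by (simp add: powr_add[symmetric])
  then show ?thesis unfolding 1 2 using True by (simp add: mult_ac)
 qed (auto simp: f_def g_def)
 show "integrable lebesgue (\<lambda>x. indicator A x * (\<bar>P x\<bar> * (u x)^2))"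
  using Hoelder_powers(1)[OF fi f0 gi g0 ab] by (simp only: eq)
 show "(LINT x|lebesgue. indicator A x * (\<bar>P x\<bar> * (u x)^2))
   \<le> (LINT x|lebesgue. indicator A x * (\<bar>P x\<bar> powr (real DIM('a) / 2) * W x powr ((2 - real DIM('a)) / 2))) powr (2 / real DIM('a)) * SW u"
  using Hoelder_powers(2)[OF fi f0 gi g0 ab] by (simp only: eq) (simp only: f_def g_def SW_eq)
qed

text \<open>On a compact set \<open>W\<close> is bounded below, and the constant potential \<open>1\<close> is admissible there.\<close>

lemma L2_compact_le_SW:
 assumes K: "compact K" "K \<subseteq> \<Omega>"
 shows "\<exists>c\<ge>0. \<forall>u\<in>test_functions \<Omega>. (LINT x|lebesgue. indicator K x * (u x)^2) \<le> c * SW u"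
proof (intro exI conjI ballI)
 have h: "integrable lebesgue (\<lambda>x. indicator K x * (\<bar>1\<bar> powr (real DIM('a) / 2) * W x powr ((2 - real DIM('a)) / 2)))"
  by (intro integrable_on_compact[OF K(1)] continuous_on_mult continuous_on_powr continuous_on_const
    continuous_on_subset[OF W(1) K(2)]) (use W(2) K(2) in force)
 fix u assume u: "u \<in> test_functions \<Omega>"
 show "(LINT x|lebesgue. indicator K x * (u x)^2)
  \<le> (LINT x|lebesgue. indicator K x * (\<bar>1\<bar> powr (real DIM('a) / 2) * W x powr ((2 - real DIM('a)) / 2))) powr (2 / real DIM('a)) * SW u"
  using weighted_Hoelder(2)[OF K(2) h u] by simp
qed simp

text \<open>Cutting \<open>u\<close> into \<open>sin X * u\<close> and \<open>cos X * u\<close> costs only a zero-order error in the energy, and the second piece has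
 nonnegative energy. Hence the energy controls the gradient of the first piece, although the potential itself may be very
 negative.\<close>

lemma local_H1_bound:
 assumes K: "compact K" "K \<subseteq> \<Omega>"
 shows "\<exists>\<eta> L C. smooth \<eta> \<and> compact L \<and> L \<subseteq> \<Omega> \<and> (\<forall>x\<in>K. \<eta> x = 1) \<and> (\<forall>x. x \<notin> L \<longrightarrow> \<eta> x = 0) \<and> 0 \<le> C \<and>
   (\<forall>u\<in>test_functions \<Omega>. (LINT x|lebesgue. (\<eta> x * u x)^2) \<le> C * SW u \<and>
    (LINT x|lebesgue. grad_sq (\<lambda>x. \<eta> x * u x) x) \<le> en V u + C * SW u)"
proof -
 obtain c where c: "c \<in> test_functions \<Omega>" "\<And>x. 0 \<le> c x" "\<And>x. c x \<le> 1" "\<forall>x\<in>K. c x = 1"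
  using compact_cutoff[OF K(1) opn K(2)] by blast
 define X where "X x = (pi / 2) * c x" for x
 have X: "X \<in> test_functions \<Omega>" unfolding X_def[abs_def] by (rule test_cmult[OF c(1)])
 obtain L1 where L1: "compact L1" "L1 \<subseteq> \<Omega>" "\<forall>x. x \<notin> L1 \<longrightarrow> X x = 0" using test_support[OF X] by blast
 obtain L2 where L2: "compact L2" "L2 \<subseteq> \<Omega>" "\<forall>x. x \<notin> L2 \<longrightarrow> grad_sq X x = 0" using test_support[OF test_grad_sq[OF X]] by blast
 define L where "L = L1 \<union> L2"
 have L: "compact L" "L \<subseteq> \<Omega>" using L1 L2 by (auto simp: L_def)
 have off: "X x = 0" "grad_sq X x = 0" if "x \<notin> L" for x using that L1(3) L2(3) by (auto simp: L_def)
 have sX: "smooth X" by (rule test_smooth[OF X])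
 have sm: "smooth (\<lambda>x. sin (X x))" "smooth (\<lambda>x. cos (X x))"
  by (rule smooth_compose[OF smooth_sin sX] smooth_compose[OF smooth_cos sX])+
 obtain cL where cL: "cL \<ge> 0" "\<forall>u\<in>test_functions \<Omega>. (LINT x|lebesgue. indicator L x * (u x)^2) \<le> cL * SW u"
  using L2_compact_le_SW[OF L] by blast
 obtain g where g: "g > 0" "\<forall>x. \<bar>grad_sq X x\<bar> \<le> g"
  using compact_support_bound[OF test_continuous[OF test_grad_sq[OF X]] L2(1) L2(3)] by blast
 obtain m where m: "AE x in lebesgue. x \<in> L \<longrightarrow> \<bar>V x\<bar> \<le> m" using Linf_loc_AE_bound[OF V L] by blast
 define C where "C = (g + \<bar>m\<bar> + 1) * cL"
 have C0: "0 \<le> C" using cL(1) g(1) by (simp add: C_def)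
 have main: "(LINT x|lebesgue. (sin (X x) * u x)^2) \<le> C * SW u \<and>
    (LINT x|lebesgue. grad_sq (\<lambda>x. sin (X x) * u x) x) \<le> en V u + C * SW u" if u: "u \<in> test_functions \<Omega>" for u
 proof -
  define J where "J = (LINT x|lebesgue. indicator L x * (u x)^2)"
  have Ji: "integrable lebesgue (\<lambda>x. indicator L x * (u x)^2)"
   by (rule integrable_on_compact[OF L(1) test_continuous[OF test_square[OF u]]])
  have J0: "0 \<le> J" unfolding J_def by (rule integral_nonneg_AE) simp
  have JS: "J \<le> cL * SW u" using cL(2) u by (simp add: J_def)
  have tu: "(\<lambda>x. sin (X x) * u x) \<in> test_functions \<Omega>" "(\<lambda>x. cos (X x) * u x) \<in> test_functions \<Omega>"
   by (rule test_mult[OF u sm(1)] test_mult[OF u sm(2)])+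
  have pw: "(sin (X x) * u x)^2 \<le> indicator L x * (u x)^2" for x
  proof (cases "x \<in> L")
   case True
   have "(sin (X x))^2 \<le> 1" by (simp add: sin_squared_eq)
   then show ?thesis using True mult_right_mono[of "(sin (X x))^2" 1 "(u x)^2"] by (simp add: power_mult_distrib)
  qed (simp add: off)
  have a: "(LINT x|lebesgue. (sin (X x) * u x)^2) \<le> J" unfolding J_def
   by (rule integral_mono[OF integrable_test[OF test_square[OF tu(1)]] Ji pw])
  have b: "(LINT x|lebesgue. grad_sq X x * (u x)^2) \<le> g * J"
  proof -
   have "(LINT x|lebesgue. grad_sq X x * (u x)^2) \<le> (LINT x|lebesgue. g * (indicator L x * (u x)^2))"
   proof (rule integral_mono')
    show "integrable lebesgue (\<lambda>x. g * (indicator L x * (u x)^2))" using Ji by simp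
    show "grad_sq X x * (u x)^2 \<le> g * (indicator L x * (u x)^2)" for x
     using g(2)[rule_format, of x] by (cases "x \<in> L") (auto simp: off intro!: mult_right_mono)
    show "0 \<le> g * (indicator L x * (u x)^2)" for x using g(1) by simp
   qed
   then show ?thesis by (simp add: J_def)
  qed
  have d: "- (LINT x|lebesgue. V x * (sin (X x) * u x)^2) \<le> \<bar>m\<bar> * J"
  proof -
   have "- (LINT x|lebesgue. V x * (sin (X x) * u x)^2) = (LINT x|lebesgue. - (V x * (sin (X x) * u x)^2))" by simp
   also have "\<dots> \<le> (LINT x|lebesgue. \<bar>m\<bar> * (indicator L x * (u x)^2))"
   proof (rule integral_mono_AE')
    show "integrable lebesgue (\<lambda>x. \<bar>m\<bar> * (indicator L x * (u x)^2))" using Ji by simp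
    show "AE x in lebesgue. - (V x * (sin (X x) * u x)^2) \<le> \<bar>m\<bar> * (indicator L x * (u x)^2)"
     using m
    proof (rule eventually_mono)
     fix x assume h: "x \<in> L \<longrightarrow> \<bar>V x\<bar> \<le> m"
     show "- (V x * (sin (X x) * u x)^2) \<le> \<bar>m\<bar> * (indicator L x * (u x)^2)"
     proof (cases "x \<in> L")
      case True
      have "- V x * (sin (X x) * u x)^2 \<le> \<bar>m\<bar> * (sin (X x) * u x)^2"
       by (rule mult_right_mono) (use h True in auto)
      also have "\<dots> \<le> \<bar>m\<bar> * (indicator L x * (u x)^2)" by (rule mult_left_mono[OF pw]) simp
      finally show ?thesis by simp
     qed (simp add: off)
    qed
    show "AE x in lebesgue. 0 \<le> \<bar>m\<bar> * (indicator L x * (u x)^2)" by simp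
   qed
   finally show ?thesis by (simp add: J_def)
  qed
  have e: "en V (\<lambda>x. sin (X x) * u x) + en V (\<lambda>x. cos (X x) * u x) = en V u + (LINT x|lebesgue. grad_sq X x * (u x)^2)"
   by (rule localization_identity[OF V opn u sX])
  \<comment> \<open>The hypothesis on the unperturbed energy enters here: the discarded piece has nonnegative energy.\<close>
  have "0 \<le> en V (\<lambda>x. cos (X x) * u x)" using en_ge[OF tu(2)] SW_nonneg order_trans by blast
  then have "(LINT x|lebesgue. grad_sq (\<lambda>x. sin (X x) * u x) x) \<le> en V u + g * J + \<bar>m\<bar> * J"
   using e b d by (simp add: en_def[of V "\<lambda>x. sin (X x) * u x"])
  moreover have "(g + \<bar>m\<bar> + 1) * J \<le> C * SW u"
   unfolding C_def mult.assoc by (rule mult_left_mono[OF JS]) (use g(1) in simp)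
  then have "g * J + \<bar>m\<bar> * J + J \<le> C * SW u" by (simp add: algebra_simps)
  moreover have "0 \<le> g * J" "0 \<le> \<bar>m\<bar> * J" using J0 g(1) by auto
  ultimately show ?thesis using a J0 by linarith
 qed
 have "sin (X x) = 1" if "x \<in> K" for x using c(4) that by (simp add: X_def)
 then show ?thesis using sm(1) L off(1) C0 main
  by (intro exI[of _ "\<lambda>x. sin (X x)"] exI[of _ L] exI[of _ C]) auto
qed

text \<open>The cut off functions of \<open>local_H1_bound\<close> are bounded in \<open>H\<^sup>1\<close> and agree with the original ones on the given compact set.\<close>

lemma bounded_energy_compactness:
 assumes u: "\<And>n. u n \<in> test_functions \<Omega>" and b: "\<And>n. SW (u n) \<le> M" "\<And>n. en V (u n) \<le> M"
 shows "\<exists>r w. strict_mono (r :: nat \<Rightarrow> nat) \<and> L2conv \<Omega> (\<lambda>n. u (r n)) w"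
proof -
 have "\<exists>r::nat \<Rightarrow> nat. strict_mono r \<and> (\<forall>i j. (LINT x|lebesgue. indicator K x * (u (s (r i)) x - u (s (r j)) x)^2) \<le> e)"
  if K: "compact K" "K \<subseteq> \<Omega>" and e: "e > 0" for K e and s :: "nat \<Rightarrow> nat"
 proof -
  obtain \<eta> L C where E: "smooth \<eta>" "compact L" "L \<subseteq> \<Omega>" "\<forall>x\<in>K. \<eta> x = 1" "\<forall>x. x \<notin> L \<longrightarrow> \<eta> x = 0" "0 \<le> C"
   "\<forall>u\<in>test_functions \<Omega>. (LINT x|lebesgue. (\<eta> x * u x)^2) \<le> C * SW u \<and>
    (LINT x|lebesgue. grad_sq (\<lambda>x. \<eta> x * u x) x) \<le> en V u + C * SW u"
   using local_H1_bound[OF K] by (elim exE conjE) blast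
  define w where "w n x = \<eta> x * u (s n) x" for n x
  have tO: "w n \<in> test_functions \<Omega>" for n unfolding w_def[abs_def] by (rule test_mult[OF u E(1)])
  then have tw: "w n \<in> test_functions UNIV" for n by (rule test_mono) simp
  have M: "0 \<le> M" using b(1)[of 0] SW_nonneg[of "u 0"] by linarith
  have CM: "C * SW (u k) \<le> C * M" for k by (rule mult_left_mono[OF b(1) E(6)])
  have w1: "(LINT x|lebesgue. (w n x)^2) \<le> M + C * M" for n
  proof -
   have "(LINT x|lebesgue. (w n x)^2) \<le> C * SW (u (s n))" unfolding w_def using E(7) u by blast
   then show ?thesis using CM[of "s n"] M by linarith
  qed
  have w2: "(LINT x|lebesgue. grad_sq (w n) x) \<le> M + C * M" for n
  proof -
   have "(LINT x|lebesgue. grad_sq (w n) x) \<le> en V (u (s n)) + C * SW (u (s n))" unfolding w_def[abs_def] using E(7) u by blast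
   then show ?thesis using CM[of "s n"] b(2)[of "s n"] by linarith
  qed
  have w0: "w n x = 0" if "x \<notin> L" for n x using E(5) that by (simp add: w_def)
  obtain r :: "nat \<Rightarrow> nat" where r: "strict_mono r" "\<forall>i j. (LINT x|lebesgue. (w (r i) x - w (r j) x)^2) \<le> e"
   using Rellich_total_boundedness[where w = w, OF tw E(2) _ w1 w2 e] w0 by blast
  have "(LINT x|lebesgue. indicator K x * (u (s (r i)) x - u (s (r j)) x)^2) \<le> e" for i j
  proof -
   have "(LINT x|lebesgue. indicator K x * (u (s (r i)) x - u (s (r j)) x)^2) \<le> (LINT x|lebesgue. (w (r i) x - w (r j) x)^2)"
   proof (rule integral_mono')
    show "integrable lebesgue (\<lambda>x. (w (r i) x - w (r j) x)^2)"
     by (rule integrable_test[OF test_square[OF test_diff[OF tO tO]]])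
    show "indicator K x * (u (s (r i)) x - u (s (r j)) x)^2 \<le> (w (r i) x - w (r j) x)^2" for x
     using E(4) by (cases "x \<in> K") (auto simp: w_def)
   qed simp
   then show ?thesis using r(2) order_trans by blast
  qed
  then show ?thesis using r(1) by blast
 qed
 from L2_loc_compactness[where u = u, OF opn u this]
 obtain r w where r: "strict_mono (r :: nat \<Rightarrow> nat)" "w \<in> borel_measurable borel"
   "\<forall>K. compact K \<and> K \<subseteq> \<Omega> \<longrightarrow> integrable lebesgue (\<lambda>x. indicator K x * (w x)^2) \<and>
    (\<forall>n. integrable lebesgue (\<lambda>x. indicator K x * (u (r n) x - w x)^2)) \<and>
    (\<lambda>n. LINT x|lebesgue. indicator K x * (u (r n) x - w x)^2) \<longlonglongrightarrow> 0" by blast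
 have "(\<lambda>x. indicator K x * w x) \<in> borel_measurable lebesgue" if "compact K" for K
  by (intro borel_measurable_times borel_measurable_indicator sets_compact that borel_imp_lebesgue r(2))
 then have "L2conv \<Omega> (\<lambda>n. u (r n)) w" unfolding L2conv_def using r(3) by blast
 then show ?thesis using r(1) by blast
qed

end

locale admissible_perturbation = sobolev_weight \<Omega> V W for \<Omega> :: "'a::euclidean_space set" and V W +
 fixes Vt :: "'a \<Rightarrow> real"
 assumes Vt: "Vt \<in> Linf_loc \<Omega>"
  and integ: "set_integrable lebesgue \<Omega>
    (\<lambda>x. \<bar>Vt x\<bar> powr (real DIM('a) / 2) * W x powr ((2 - real DIM('a)) / 2))"
begin

definition Vsum :: "real \<Rightarrow> 'a \<Rightarrow> real" where "Vsum t x = V x + t * Vt x"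

lemma Vsum_Linf: "Vsum t \<in> Linf_loc \<Omega>"
 using Linf_loc_combine[OF V Vt, of t] by (simp add: Vsum_def[abs_def])

lemma perturbed_eq_en: "u \<in> test_functions \<Omega> \<Longrightarrow> perturbed_energy \<Omega> V Vt t u = en (Vsum t) u"
 using perturbed_energy_eq_en(2)[OF V Vt opn] by (simp add: Vsum_def[abs_def])

lemma en_Vsum: "u \<in> test_functions \<Omega> \<Longrightarrow> en (Vsum t) u = en V u + t * (LINT x|lebesgue. Vt x * (u x)^2)"
 using perturbed_energy_eq_en(1)[OF V Vt opn] perturbed_eq_en by simp

definition HW :: "'a \<Rightarrow> real" where
 "HW x = \<bar>Vt x\<bar> powr (real DIM('a) / 2) * W x powr ((2 - real DIM('a)) / 2)"

lemma HW_integrable: "A \<in> sets lebesgue \<Longrightarrow> A \<subseteq> \<Omega> \<Longrightarrow> integrable lebesgue (\<lambda>x. indicator A x * HW x)"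
 using set_integrable_subset[OF integ, of A] by (simp add: set_integrable_def HW_def)

lemma Omega_lebesgue: "\<Omega> \<in> sets lebesgue" using opn by simp

lemma abs_Vt_integral:
 assumes u: "u \<in> test_functions \<Omega>"
 shows "integrable lebesgue (\<lambda>x. \<bar>Vt x\<bar> * (u x)^2)"
  and "\<bar>LINT x|lebesgue. Vt x * (u x)^2\<bar> \<le> (LINT x|lebesgue. \<bar>Vt x\<bar> * (u x)^2)"
proof -
 have i: "integrable lebesgue (\<lambda>x. Vt x * (u x)^2)" by (rule locint_test[OF locint_Linf[OF Vt opn] test_square[OF u]])
 have "integrable lebesgue (\<lambda>x. \<bar>Vt x * (u x)^2\<bar>)" using i by (rule integrable_abs)
 then show "integrable lebesgue (\<lambda>x. \<bar>Vt x\<bar> * (u x)^2)" by (simp add: abs_mult)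
 show "\<bar>LINT x|lebesgue. Vt x * (u x)^2\<bar> \<le> (LINT x|lebesgue. \<bar>Vt x\<bar> * (u x)^2)"
  using integral_abs_bound[of lebesgue "\<lambda>x. Vt x * (u x)^2"] by (simp add: abs_mult)
qed

lemma Vt_le_SW: "\<exists>A\<ge>0. \<forall>u\<in>test_functions \<Omega>. \<bar>LINT x|lebesgue. Vt x * (u x)^2\<bar> \<le> A * SW u"
proof (intro exI conjI ballI)
 fix u assume u: "u \<in> test_functions \<Omega>"
 have "indicator \<Omega> x * (\<bar>Vt x\<bar> * (u x)^2) = \<bar>Vt x\<bar> * (u x)^2" for x
  using test_outside[OF u, of x] by (cases "x \<in> \<Omega>") auto
 then have "(LINT x|lebesgue. \<bar>Vt x\<bar> * (u x)^2) \<le> (LINT x|lebesgue. indicator \<Omega> x * HW x) powr (2 / real DIM('a)) * SW u"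
  using weighted_Hoelder(2)[OF subset_refl HW_integrable[OF Omega_lebesgue subset_refl, unfolded HW_def] u] by (simp only: HW_def)
 then show "\<bar>LINT x|lebesgue. Vt x * (u x)^2\<bar> \<le> (LINT x|lebesgue. indicator \<Omega> x * HW x) powr (2 / real DIM('a)) * SW u"
  using abs_Vt_integral(2)[OF u] by linarith
qed simp

text \<open>The perturbation is small near the boundary and at infinity, because the integrability condition has small tails.\<close>

lemma Vt_tail:
 assumes e: "e > 0"
 shows "\<exists>K. compact K \<and> K \<subseteq> \<Omega> \<and> (\<forall>u\<in>test_functions \<Omega>. (LINT x|lebesgue. indicator (\<Omega> - K) x * (\<bar>Vt x\<bar> * (u x)^2)) \<le> e * SW u)"
proof -
 obtain C where C: "\<And>n. compact (C n)" "\<And>n. C n \<subseteq> \<Omega>" "\<And>n. C n \<subseteq> interior (C (Suc n))" "\<Union>(range C) = \<Omega>"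
  "\<And>K. \<lbrakk>compact K; K \<subseteq> \<Omega>\<rbrakk> \<Longrightarrow> \<exists>N. \<forall>n\<ge>N. K \<subseteq> C n"
  using open_Union_compact_subsets[OF opn] by blast
 have sD: "\<Omega> - C n \<in> sets lebesgue" for n using sets_compact[OF C(1)] Omega_lebesgue by blast
 have i: "integrable lebesgue (\<lambda>x. indicator (\<Omega> - C n) x * HW x)" for n by (rule HW_integrable[OF sD]) blast
 have iO: "integrable lebesgue (\<lambda>x. indicator \<Omega> x * HW x)" by (rule HW_integrable[OF Omega_lebesgue subset_refl])
 have HW0: "0 \<le> HW x" for x by (simp add: HW_def)
 have "(\<lambda>n. LINT x|lebesgue. indicator (\<Omega> - C n) x * HW x) \<longlonglongrightarrow> (\<integral>x. (0::real) \<partial>(lebesgue::'a measure))"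
 proof (rule integral_dominated_convergence[where w = "\<lambda>x. indicator \<Omega> x * HW x"])
  show "AE x in lebesgue. (\<lambda>n. indicator (\<Omega> - C n) x * HW x) \<longlonglongrightarrow> 0"
  proof (rule AE_I2)
   fix x
   have "\<exists>N. \<forall>n\<ge>N. x \<notin> \<Omega> - C n"
   proof (cases "x \<in> \<Omega>")
    case True
    then show ?thesis using C(5)[of "{x}"] by auto
   qed simp
   then obtain N where "\<forall>n\<ge>N. x \<notin> \<Omega> - C n" ..
   then have "eventually (\<lambda>n. indicator (\<Omega> - C n) x * HW x = 0) sequentially"
    unfolding eventually_sequentially by (intro exI[of _ N]) auto
   then show "(\<lambda>n. indicator (\<Omega> - C n) x * HW x) \<longlonglongrightarrow> 0" by (rule tendsto_eventually)
  qed
  show "AE x in lebesgue. norm (indicator (\<Omega> - C n) x * HW x) \<le> indicator \<Omega> x * HW x" for n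
   using HW0 by (auto simp: indicator_def)
 qed (use i iO in \<open>auto intro: borel_measurable_integrable\<close>)
 then have l0: "(\<lambda>n. LINT x|lebesgue. indicator (\<Omega> - C n) x * HW x) \<longlonglongrightarrow> 0" by simp
 have "(\<lambda>n. (LINT x|lebesgue. indicator (\<Omega> - C n) x * HW x) powr (2 / real DIM('a))) \<longlonglongrightarrow> 0"
  by (rule tendsto_zero_powrI[OF l0 tendsto_const])
    (use HW0 in \<open>auto intro!: always_eventually integral_nonneg_AE\<close>)
 then have "eventually (\<lambda>n. (LINT x|lebesgue. indicator (\<Omega> - C n) x * HW x) powr (2 / real DIM('a)) < e) sequentially"
  using e by (rule order_tendstoD(2))
 then obtain n where n: "(LINT x|lebesgue. indicator (\<Omega> - C n) x * HW x) powr (2 / real DIM('a)) < e"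
  by (auto simp: eventually_sequentially)
 have "(LINT x|lebesgue. indicator (\<Omega> - C n) x * (\<bar>Vt x\<bar> * (u x)^2)) \<le> e * SW u" if u: "u \<in> test_functions \<Omega>" for u
 proof -
  have "(LINT x|lebesgue. indicator (\<Omega> - C n) x * (\<bar>Vt x\<bar> * (u x)^2)) \<le> (LINT x|lebesgue. indicator (\<Omega> - C n) x * HW x) powr (2 / real DIM('a)) * SW u"
   using weighted_Hoelder(2)[OF Diff_subset i[of n, unfolded HW_def] u] by (simp add: HW_def)
  also have "\<dots> \<le> e * SW u" by (rule mult_right_mono[OF _ SW_nonneg]) (use n in simp)
  finally show ?thesis .
 qed
 then show ?thesis using C(1,2) by blast
qed

text \<open>A normalised null sequence cannot lose its mass: if it tended to zero locally in \<open>L\<^sup>2\<close>, the perturbation would vanish along it,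
 up to the small tail, and the unperturbed energy would become smaller than the Sobolev term.\<close>

lemma normalised_null_sequence_nonzero:
 assumes u: "\<And>n. u n \<in> test_functions \<Omega>" and S: "\<And>n. SW (u n) = 1"
  and null: "(\<lambda>n. en (Vsum t) (u n)) \<longlonglongrightarrow> 0" and uw: "L2conv \<Omega> u w"
 shows "\<not> (AE x in lebesgue. x \<in> \<Omega> \<longrightarrow> w x = 0)"
proof
 assume w0: "AE x in lebesgue. x \<in> \<Omega> \<longrightarrow> w x = 0"
 \<comment> \<open>The tail of the perturbation then contributes at most one half.\<close>
 define e where "e = 1 / (2 * (\<bar>t\<bar> + 1))"
 have e: "e > 0" "\<bar>t\<bar> * e \<le> 1/2" by (simp_all add: e_def field_simps)
 obtain K where K: "compact K" "K \<subseteq> \<Omega>"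
  "\<forall>u\<in>test_functions \<Omega>. (LINT x|lebesgue. indicator (\<Omega> - K) x * (\<bar>Vt x\<bar> * (u x)^2)) \<le> e * SW u"
  using Vt_tail[OF e(1)] by blast
 obtain c where c: "AE x in lebesgue. x \<in> K \<longrightarrow> \<bar>Vt x\<bar> \<le> c" using Linf_loc_AE_bound[OF Vt K(1,2)] by blast
 have lim: "(\<lambda>n. LINT x|lebesgue. indicator K x * (u n x)^2) \<longlonglongrightarrow> (LINT x|lebesgue. indicator K x * (w x)^2)"
  by (rule L2conv_norm[OF u uw K(1,2)])
 have "(LINT x|lebesgue. indicator K x * (w x)^2) = 0"
  by (rule integral_eq_zero_AE, use w0 in \<open>rule eventually_mono\<close>) (use K(2) in \<open>auto simp: indicator_def\<close>)
 note lim0 = lim[unfolded this]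
 have ge: "1 \<le> en (Vsum t) (u n) + \<bar>t\<bar> * (\<bar>c\<bar> * (LINT x|lebesgue. indicator K x * (u n x)^2)) + 1/2" for n
 proof -
  have i1: "integrable lebesgue (\<lambda>x. indicator K x * (u n x)^2)"
   by (rule integrable_on_compact[OF K(1) test_continuous[OF test_square[OF u]]])
  have sD: "\<Omega> - K \<in> sets lebesgue" using sets_compact[OF K(1)] Omega_lebesgue by blast
  have i2: "integrable lebesgue (\<lambda>x. indicator (\<Omega> - K) x * (\<bar>Vt x\<bar> * (u n x)^2))"
   by (rule weighted_Hoelder(1)[OF Diff_subset HW_integrable[OF sD Diff_subset, unfolded HW_def] u])
  have "(LINT x|lebesgue. \<bar>Vt x\<bar> * (u n x)^2) \<le> (LINT x|lebesgue. \<bar>c\<bar> * (indicator K x * (u n x)^2) + indicator (\<Omega> - K) x * (\<bar>Vt x\<bar> * (u n x)^2))"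
  proof (rule integral_mono_AE)
   show "AE x in lebesgue. \<bar>Vt x\<bar> * (u n x)^2 \<le> \<bar>c\<bar> * (indicator K x * (u n x)^2) + indicator (\<Omega> - K) x * (\<bar>Vt x\<bar> * (u n x)^2)"
    using c
   proof (rule eventually_mono)
    fix x assume h: "x \<in> K \<longrightarrow> \<bar>Vt x\<bar> \<le> c"
    show "\<bar>Vt x\<bar> * (u n x)^2 \<le> \<bar>c\<bar> * (indicator K x * (u n x)^2) + indicator (\<Omega> - K) x * (\<bar>Vt x\<bar> * (u n x)^2)"
    proof (cases "x \<in> K")
     case True
     then have "\<bar>Vt x\<bar> \<le> \<bar>c\<bar>" using h by linarith
     then show ?thesis using True by (simp add: mult_right_mono)
    qed (use test_outside[OF u, of x n] in \<open>cases "x \<in> \<Omega>"; simp\<close>)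
   qed
  qed (use abs_Vt_integral(1)[OF u] i1 i2 in auto)
  also have "\<dots> = \<bar>c\<bar> * (LINT x|lebesgue. indicator K x * (u n x)^2) + (LINT x|lebesgue. indicator (\<Omega> - K) x * (\<bar>Vt x\<bar> * (u n x)^2))"
   using i1 i2 by simp
  also have "\<dots> \<le> \<bar>c\<bar> * (LINT x|lebesgue. indicator K x * (u n x)^2) + e"
   using K(3) u[of n] S[of n] by fastforce
  finally have A: "\<bar>LINT x|lebesgue. Vt x * (u n x)^2\<bar> \<le> \<bar>c\<bar> * (LINT x|lebesgue. indicator K x * (u n x)^2) + e"
   using abs_Vt_integral(2)[OF u[of n]] by linarith
  have "1 \<le> en V (u n)" using en_ge[OF u[of n]] S by simp
  also have "\<dots> = en (Vsum t) (u n) - t * (LINT x|lebesgue. Vt x * (u n x)^2)" using en_Vsum[OF u] by simp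
  also have "\<dots> \<le> en (Vsum t) (u n) + \<bar>t\<bar> * \<bar>LINT x|lebesgue. Vt x * (u n x)^2\<bar>"
   using abs_ge_minus_self[of "t * (LINT x|lebesgue. Vt x * (u n x)^2)"] by (simp add: abs_mult)
  also have "\<dots> \<le> en (Vsum t) (u n) + \<bar>t\<bar> * (\<bar>c\<bar> * (LINT x|lebesgue. indicator K x * (u n x)^2) + e)"
   using mult_left_mono[OF A, of "\<bar>t\<bar>"] by simp
  finally show ?thesis using e(2) by (simp add: distrib_left)
 qed
 have "(\<lambda>n. en (Vsum t) (u n) + \<bar>t\<bar> * (\<bar>c\<bar> * (LINT x|lebesgue. indicator K x * (u n x)^2)) + 1/2) \<longlonglongrightarrow> 0 + \<bar>t\<bar> * (\<bar>c\<bar> * 0) + 1/2"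
  by (intro tendsto_intros null lim0)
 then have "1 \<le> 0 + \<bar>t\<bar> * (\<bar>c\<bar> * 0) + (1/2 :: real)" by (rule LIMSEQ_le_const) (use ge in blast)
 then show False by simp
qed

end

section \<open>Ground states and the spectral gap\<close>

text \<open>Local integrability keeps the pairings with a test function finite, so that they may be added.\<close>

lemma weak_sol_add:
 assumes w: "locint \<Omega> w" "locint \<Omega> (\<lambda>x. U x * w x)" "weak_sol \<Omega> U w"
  and w': "locint \<Omega> w'" "locint \<Omega> (\<lambda>x. U x * w' x)" "weak_sol \<Omega> U w'"
 shows "weak_sol \<Omega> U (\<lambda>x. w x + w' x)"
 unfolding weak_sol_def
proof
 fix \<psi> assume p: "\<psi> \<in> test_functions \<Omega>"
 have i: "integrable lebesgue (\<lambda>x. f x * (U x * \<psi> x - lap \<psi> x))" if "locint \<Omega> f" "locint \<Omega> (\<lambda>x. U x * f x)" for f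
 proof -
  have "integrable lebesgue (\<lambda>x. U x * f x * \<psi> x - f x * lap \<psi> x)"
   using locint_test[OF that(2) p] locint_test[OF that(1) test_lap[OF p]] by simp
  moreover have "U x * f x * \<psi> x - f x * lap \<psi> x = f x * (U x * \<psi> x - lap \<psi> x)" for x by (simp add: algebra_simps)
  ultimately show ?thesis by simp
 qed
 show "(LINT x|lebesgue. (w x + w' x) * (U x * \<psi> x - lap \<psi> x)) = 0"
  using w(3) w'(3) p i[OF w(1,2)] i[OF w'(1,2)] by (simp add: distrib_right weak_sol_def)
qed

lemma cball_integral_pos:
 fixes f :: "'a::euclidean_space \<Rightarrow> real"
 assumes f: "locint \<Omega> f" "AE x in lebesgue. x \<in> \<Omega> \<longrightarrow> 0 < f x" and r: "r > 0" "cball a r \<subseteq> \<Omega>"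
 shows "0 < (LINT x|lebesgue. indicator (cball a r) x * f x)"
proof -
 have i: "integrable lebesgue (\<lambda>x. indicator (cball a r) x * f x)" using f(1) r by (simp add: locint_def)
 have nn: "AE x in lebesgue. 0 \<le> indicator (cball a r) x * f x"
  using f(2) by (rule eventually_mono) (use r(2) in \<open>auto simp: indicator_def\<close>)
 have "(LINT x|lebesgue. indicator (cball a r) x * f x) \<noteq> 0"
 proof
  assume "(LINT x|lebesgue. indicator (cball a r) x * f x) = 0"
  then have "AE x in lebesgue. indicator (cball a r) x * f x = 0"
   using integral_nonneg_eq_0_iff_AE[OF i nn] by simp
  then have "AE x in lebesgue. x \<notin> cball a r"
   using f(2) by eventually_elim (use r(2) in \<open>auto simp: indicator_def\<close>)
  then have "cball a r \<in> null_sets lebesgue"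
   using AE_iff_null_sets[OF sets_compact[OF compact_cball]] by blast
  then have "negligible (cball a r)" by (simp add: negligible_iff_null_sets)
  moreover have "\<not> negligible (ball a r)" by (rule open_not_negligible) (use r(1) in auto)
  ultimately show False using negligible_subset[OF _ ball_subset_cball] by blast
 qed
 then show ?thesis using integral_nonneg_AE[OF nn] by simp
qed

context admissible_perturbation
begin

lemma Vsum_AE_bound: "compact K \<Longrightarrow> K \<subseteq> \<Omega> \<Longrightarrow> \<exists>c. AE x in lebesgue. x \<in> K \<longrightarrow> \<bar>Vsum t x\<bar> \<le> c"
 by (rule Linf_loc_AE_bound[OF Vsum_Linf])

lemma nonneg_functional_iff:
 "nonneg_functional \<Omega> (perturbed_energy \<Omega> V Vt t) \<longleftrightarrow> (\<forall>u\<in>test_functions \<Omega>. 0 \<le> en (Vsum t) u)"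
 unfolding nonneg_functional_def by (intro ball_cong refl) (simp add: perturbed_eq_en)

text \<open>Functions violating the estimate with \<open>C = 1/(n + 1)\<close> are scaled to Sobolev term \<open>1\<close>, which respects the quadratic penalty \<open>g\<close>.\<close>

lemma minimising_sequence:
 assumes nn: "\<And>u. u \<in> test_functions \<Omega> \<Longrightarrow> 0 \<le> en (Vsum t) u"
  and g: "\<And>u. 0 \<le> g u" "\<And>u c. g (\<lambda>x. c * u x) = c^2 * g u"
  and fail: "\<not> (\<exists>C>0. \<forall>u\<in>test_functions \<Omega>. C * SW u \<le> en (Vsum t) u + g u)"
 shows "\<exists>u w. (\<forall>n. u n \<in> test_functions \<Omega>) \<and> (\<lambda>n. en (Vsum t) (u n)) \<longlonglongrightarrow> 0 \<and> (\<lambda>n. g (u n)) \<longlonglongrightarrow> 0 \<and>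
   L2conv \<Omega> u w \<and> \<not> (AE x in lebesgue. x \<in> \<Omega> \<longrightarrow> w x = 0)"
proof -
 have "\<exists>u. u \<in> test_functions \<Omega> \<and> SW u = 1 \<and> en (Vsum t) u + g u < 1 / real (Suc n)" for n
 proof -
  obtain u where u: "u \<in> test_functions \<Omega>" "en (Vsum t) u + g u < 1 / real (Suc n) * SW u"
   using fail[unfolded not_ex, rule_format, of "1 / real (Suc n)"] by (auto simp: not_le)
  have "0 < 1 / real (Suc n) * SW u" using u(2) nn[OF u(1)] g(1)[of u] by linarith
  then have S: "SW u > 0" by (simp add: zero_less_divide_iff)
  define c where "c = 1 / sqrt (SW u)"
  have c2: "c^2 * SW u = 1" using S by (simp add: c_def power_divide)
  have c0: "c^2 > 0" using S by (simp add: c_def)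
  have "en (Vsum t) (\<lambda>x. c * u x) + g (\<lambda>x. c * u x) = c^2 * (en (Vsum t) u + g u)"
   by (simp add: en_scale[OF Vsum_Linf opn u(1)] g(2) distrib_left)
  also have "\<dots> < c^2 * (1 / real (Suc n) * SW u)" by (rule mult_strict_left_mono[OF u(2) c0])
  also have "\<dots> = 1 / real (Suc n)" using c2 by (simp add: field_simps)
  finally show ?thesis using test_cmult[OF u(1), of c] SW_scale[of c u] c2 by auto
 qed
 then have "\<forall>n. \<exists>u. u \<in> test_functions \<Omega> \<and> SW u = 1 \<and> en (Vsum t) u + g u < 1 / real (Suc n)" by blast
 from choice[OF this] obtain v where v: "\<forall>n. v n \<in> test_functions \<Omega> \<and> SW (v n) = 1 \<and> en (Vsum t) (v n) + g (v n) < 1 / real (Suc n)" ..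
 have vt: "v n \<in> test_functions \<Omega>" and vS: "SW (v n) = 1" and ve: "en (Vsum t) (v n) + g (v n) < 1 / real (Suc n)" for n
  using v by blast+
 have lim: "(\<lambda>n. 1 / real (Suc n)) \<longlonglongrightarrow> 0" by (rule LIMSEQ_Suc[OF lim_1_over_n])
 have e0: "(\<lambda>n. en (Vsum t) (v n)) \<longlonglongrightarrow> 0"
 proof (rule tendsto_sandwich[OF _ _ tendsto_const lim]; intro always_eventually allI)
  show "en (Vsum t) (v n) \<le> 1 / real (Suc n)" for n using g(1)[of "v n"] ve[of n] by linarith
 qed (rule nn[OF vt])
 have g0: "(\<lambda>n. g (v n)) \<longlonglongrightarrow> 0"
 proof (rule tendsto_sandwich[OF _ _ tendsto_const lim]; intro always_eventually allI)
  show "g (v n) \<le> 1 / real (Suc n)" for n using nn[OF vt[of n]] ve[of n] by linarith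
 qed (rule g(1))
 obtain A where A: "A \<ge> 0" "\<forall>u\<in>test_functions \<Omega>. \<bar>LINT x|lebesgue. Vt x * (u x)^2\<bar> \<le> A * SW u" using Vt_le_SW by blast
 have enV: "en V (v n) \<le> 1 + \<bar>t\<bar> * A" for n
 proof -
  have "1 / real (Suc n) \<le> 1" by simp
  then have "en (Vsum t) (v n) \<le> 1" using ve[of n] g(1)[of "v n"] by linarith
  moreover have "\<bar>t * (LINT x|lebesgue. Vt x * (v n x)^2)\<bar> \<le> \<bar>t\<bar> * A"
   unfolding abs_mult using A(2) vt[of n] vS[of n] by (intro mult_left_mono) auto
  ultimately show ?thesis using en_Vsum[OF vt, of t n] by linarith
 qed
 have "SW (v n) \<le> 1 + \<bar>t\<bar> * A" for n using vS A(1) by simp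
 from bounded_energy_compactness[where u = v, OF vt this enV] obtain r w where r: "strict_mono (r :: nat \<Rightarrow> nat)" "L2conv \<Omega> (\<lambda>n. v (r n)) w" by blast
 have er: "(\<lambda>n. en (Vsum t) (v (r n))) \<longlonglongrightarrow> 0" using LIMSEQ_subseq_LIMSEQ[OF e0 r(1)] by (simp add: o_def)
 have gr: "(\<lambda>n. g (v (r n))) \<longlonglongrightarrow> 0" using LIMSEQ_subseq_LIMSEQ[OF g0 r(1)] by (simp add: o_def)
 have "\<not> (AE x in lebesgue. x \<in> \<Omega> \<longrightarrow> w x = 0)"
  by (rule normalised_null_sequence_nonzero[OF vt vS er r(2)])
 then show ?thesis using vt er gr r(2) by (intro exI[of _ "\<lambda>n. v (r n)"] exI[of _ w]) blast
qed

lemma null_sequence_limit: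
 assumes nn: "\<And>u. u \<in> test_functions \<Omega> \<Longrightarrow> 0 \<le> en (Vsum t) u"
  and u: "\<And>n. u n \<in> test_functions \<Omega>" "(\<lambda>n. en (Vsum t) (u n)) \<longlonglongrightarrow> 0" "L2conv \<Omega> u w"
 shows "locint \<Omega> w" "locint \<Omega> (\<lambda>x. Vsum t x * w x)" "weak_sol \<Omega> (Vsum t) w"
 using L2conv_locint[OF u(1,3)] locint_mult_Linf[OF Vsum_Linf opn] null_sequence_limit_weak_sol[OF u(1,3) Vsum_Linf opn nn u(2)]
 by blast+

text \<open>Without a gap, the moduli of a minimising sequence converge to a nonnegative solution; normalising them on a compact set where
 the limit does not vanish gives a ground state.\<close>

lemma ground_state_if_no_gap:
 assumes nn: "\<And>u. u \<in> test_functions \<Omega> \<Longrightarrow> 0 \<le> en (Vsum t) u"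
  and fail: "\<not> (\<exists>C>0. \<forall>u\<in>test_functions \<Omega>. C * SW u \<le> en (Vsum t) u)"
 shows "\<exists>v. ground_state \<Omega> (perturbed_energy \<Omega> V Vt t) v"
proof -
 have "\<exists>u w. (\<forall>n. u n \<in> test_functions \<Omega>) \<and> (\<lambda>n. en (Vsum t) (u n)) \<longlonglongrightarrow> 0 \<and> (\<lambda>n. (0::real)) \<longlonglongrightarrow> 0 \<and>
   L2conv \<Omega> u w \<and> \<not> (AE x in lebesgue. x \<in> \<Omega> \<longrightarrow> w x = 0)"
  by (rule minimising_sequence[where g = "\<lambda>_. 0", OF nn]) (use fail in auto)
 then obtain u w where u: "\<And>n. u n \<in> test_functions \<Omega>" "(\<lambda>n. en (Vsum t) (u n)) \<longlonglongrightarrow> 0" "L2conv \<Omega> u w"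
   and w0: "\<not> (AE x in lebesgue. x \<in> \<Omega> \<longrightarrow> w x = 0)" by blast
 obtain \<phi> where ph: "\<And>n. \<phi> n \<in> test_functions \<Omega>" "\<And>n x. 0 \<le> \<phi> n x" "(\<lambda>n. en (Vsum t) (\<phi> n)) \<longlonglongrightarrow> 0" "L2conv \<Omega> \<phi> (\<lambda>x. \<bar>w x\<bar>)"
  using null_sequence_abs[OF u(1,3) Vsum_Linf opn nn u(2)] by blast
 obtain C where C: "\<And>n. compact (C n)" "\<And>n. C n \<subseteq> \<Omega>" "\<And>n. C n \<subseteq> interior (C (Suc n))" "\<Union>(range C) = \<Omega>"
  "\<And>K. \<lbrakk>compact K; K \<subseteq> \<Omega>\<rbrakk> \<Longrightarrow> \<exists>N. \<forall>n\<ge>N. K \<subseteq> C n"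
  using open_Union_compact_subsets[OF opn] by blast
 have iw: "integrable lebesgue (\<lambda>x. indicator (C n) x * \<bar>w x\<bar>^2)" for n by (rule L2conv_integrable(1)[OF ph(1,4) C(1,2)])
 have nnw: "AE x in lebesgue. 0 \<le> indicator (C n) x * \<bar>w x\<bar>^2" for n by simp
 obtain m where m: "(LINT x|lebesgue. indicator (C m) x * \<bar>w x\<bar>^2) \<noteq> 0"
 proof (rule ccontr)
  assume "\<not> thesis"
  then have "\<And>n. (LINT x|lebesgue. indicator (C n) x * \<bar>w x\<bar>^2) = 0" using that by blast
  then have "AE x in lebesgue. indicator (C n) x * \<bar>w x\<bar>^2 = 0" for n
   using integral_nonneg_eq_0_iff_AE[OF iw nnw] by blast
  then have "AE x in lebesgue. \<forall>n. indicator (C n) x * \<bar>w x\<bar>^2 = 0" unfolding AE_all_countable by blast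
  then have "AE x in lebesgue. x \<in> \<Omega> \<longrightarrow> w x = 0"
  proof (rule eventually_mono)
   fix x assume "\<forall>n. indicator (C n) x * \<bar>w x\<bar>^2 = 0"
   then show "x \<in> \<Omega> \<longrightarrow> w x = 0" using C(4) by (auto simp: indicator_def split: if_splits)
  qed
  then show False using w0 by blast
 qed
 define \<beta> where "\<beta> = (LINT x|lebesgue. indicator (C m) x * \<bar>w x\<bar>^2)"
 have beta: "\<beta> > 0" using m integral_nonneg_AE[OF nnw[of m]] unfolding \<beta>_def by (metis less_le)
 define b where "b n = (LINT x|lebesgue. indicator (C m) x * (\<phi> n x)^2)" for n
 have bl: "b \<longlonglongrightarrow> \<beta>" unfolding b_def[abs_def] \<beta>_def by (rule L2conv_norm[OF ph(1,4) C(1,2)])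
 obtain k0 where k0: "\<And>k. k \<ge> k0 \<Longrightarrow> b k > 0" using order_tendstoD(1)[OF bl beta] by (auto simp: eventually_sequentially)
 \<comment> \<open>The first \<open>k0\<close> members may vanish on the chosen compact set.\<close>
 define c where "c k = 1 / sqrt (b (k + k0))" for k
 have c0: "c k > 0" for k using k0[of "k + k0"] by (simp add: c_def)
 have cl: "c \<longlonglongrightarrow> 1 / sqrt \<beta>" unfolding c_def[abs_def]
  by (intro tendsto_intros LIMSEQ_ignore_initial_segment[OF bl]) (use beta in simp)
 have Ls: "L2conv \<Omega> (\<lambda>k. \<phi> (k + k0)) (\<lambda>x. \<bar>w x\<bar>)"
  unfolding L2conv_def
 proof (intro allI impI conjI)
  fix K assume K: "compact K \<and> K \<subseteq> \<Omega>"
  show "(\<lambda>k. LINT x|lebesgue. indicator K x * (\<phi> (k + k0) x - \<bar>w x\<bar>)^2) \<longlonglongrightarrow> 0"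
   by (rule LIMSEQ_ignore_initial_segment[where f = "\<lambda>k. LINT x|lebesgue. indicator K x * (\<phi> k x - \<bar>w x\<bar>)^2"])
     (use ph(4) K in \<open>simp add: L2conv_def\<close>)
 qed (use ph(4) in \<open>simp_all add: L2conv_def\<close>)
 define \<Phi> where "\<Phi> k x = c k * \<phi> (k + k0) x" for k x
 have PT: "\<Phi> k \<in> test_functions \<Omega>" for k unfolding \<Phi>_def[abs_def] by (rule test_cmult[OF ph(1)])
 have PN: "0 \<le> \<Phi> k x" for k x using c0[of k] ph(2) by (simp add: \<Phi>_def)
 have PL: "L2conv \<Omega> \<Phi> (\<lambda>x. 1 / sqrt \<beta> * \<bar>w x\<bar>)" unfolding \<Phi>_def[abs_def] by (rule L2conv_scale[OF ph(1) Ls cl])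
 have PE: "(\<lambda>k. en (Vsum t) (\<Phi> k)) \<longlonglongrightarrow> 0"
 proof -
  have "(\<lambda>k. (c k)^2 * en (Vsum t) (\<phi> (k + k0))) \<longlonglongrightarrow> (1 / sqrt \<beta>)^2 * 0"
   by (intro tendsto_intros cl LIMSEQ_ignore_initial_segment[OF ph(3)])
  then show ?thesis unfolding \<Phi>_def[abs_def] by (simp add: en_scale[OF Vsum_Linf opn ph(1)])
 qed
 have PB: "(LINT x|lebesgue. indicator (C m) x * (\<Phi> k x)^2) = 1" for k
 proof -
  have "(LINT x|lebesgue. indicator (C m) x * (\<Phi> k x)^2) = (LINT x|lebesgue. (c k)^2 * (indicator (C m) x * (\<phi> (k + k0) x)^2))"
   by (simp add: \<Phi>_def power_mult_distrib mult_ac)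
  also have "\<dots> = (c k)^2 * b (k + k0)" by (simp add: b_def)
  also have "\<dots> = 1" using k0[of "k + k0"] by (simp add: c_def power_divide)
  finally show ?thesis .
 qed
 have "AE x in lebesgue. x \<in> \<Omega> \<longrightarrow> 0 \<le> 1 / sqrt \<beta> * \<bar>w x\<bar>" using beta by simp
 from weak_sol_regular[OF dim opn null_sequence_limit[OF nn PT PE PL] this Vsum_AE_bound]
 obtain v where v: "C_k_on 1 \<Omega> v" "AE x in lebesgue. x \<in> \<Omega> \<longrightarrow> 1 / sqrt \<beta> * \<bar>w x\<bar> = v x" by blast
 have "L2conv \<Omega> \<Phi> v" by (rule L2conv_AE_cong[OF PT PL C_1_continuous[OF v(1)] v(2)])
 then have "(\<lambda>k. LINT x:K|lebesgue. \<bar>\<Phi> k x - v x\<bar>\<^sup>2) \<longlonglongrightarrow> 0" if "compact K \<and> K \<subseteq> \<Omega>" for K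
  using that by (simp add: L2conv_def set_lebesgue_integral_def)
 moreover have "(\<lambda>k. perturbed_energy \<Omega> V Vt t (\<Phi> k)) \<longlonglongrightarrow> 0" using PE by (simp add: perturbed_eq_en[OF PT])
 moreover have "(LINT x:C m|lebesgue. \<bar>\<Phi> k x\<bar>\<^sup>2) = 1" for k using PB by (simp add: set_lebesgue_integral_def)
 moreover have "closure (C m) = C m" using compact_imp_closed[OF C(1)] by simp
 ultimately show ?thesis
  unfolding ground_state_def using v(1) PT PN C(1,2)[of m] sets_compact[OF C(1)[of m]]
  by (intro exI[of _ v] conjI exI[of _ \<Phi>] exI[of _ "C m"]) auto
qed

lemma ground_state_sequence:
 assumes "ground_state \<Omega> (perturbed_energy \<Omega> V Vt t) v"
 obtains \<phi> K where "\<forall>n. \<phi> n \<in> test_functions \<Omega>" "\<forall>n x. 0 \<le> \<phi> n x" "(\<lambda>n. en (Vsum t) (\<phi> n)) \<longlonglongrightarrow> 0" "L2conv \<Omega> \<phi> v"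
  "compact K" "K \<subseteq> \<Omega>" "\<forall>n. 1 \<le> (LINT x|lebesgue. indicator K x * (\<phi> n x)^2)"
proof -
 note gs = assms[unfolded ground_state_def]
 note v = conjunct1[OF gs]
 from conjunct2[OF gs] obtain \<phi> B where G:
  "(\<forall>k. \<phi> k \<in> test_functions \<Omega> \<and> (\<forall>x. \<phi> k x \<ge> 0)) \<and>
   (\<forall>K. compact K \<and> K \<subseteq> \<Omega> \<longrightarrow> (\<lambda>k. LINT x:K|lebesgue. \<bar>\<phi> k x - v x\<bar>\<^sup>2) \<longlonglongrightarrow> 0) \<and>
   (\<lambda>k. perturbed_energy \<Omega> V Vt t (\<phi> k)) \<longlonglongrightarrow> 0 \<and>
   B \<in> sets lebesgue \<and> compact (closure B) \<and> closure B \<subseteq> \<Omega> \<and>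
   (\<forall>k. (LINT x:B|lebesgue. \<bar>\<phi> k x\<bar>\<^sup>2) = 1)" by (elim exE)
 then have ph: "\<phi> k \<in> test_functions \<Omega>" "\<phi> k x \<ge> 0" for k x by simp_all
 have lim: "(\<lambda>k. LINT x:K|lebesgue. \<bar>\<phi> k x - v x\<bar>\<^sup>2) \<longlonglongrightarrow> 0" if "compact K" "K \<subseteq> \<Omega>" for K
  using G that by simp
 have F: "(\<lambda>k. perturbed_energy \<Omega> V Vt t (\<phi> k)) \<longlonglongrightarrow> 0" using G by (elim conjE)
 have Bc: "compact (closure B)" using G by (elim conjE)
 have Bs: "closure B \<subseteq> \<Omega>" using G by (elim conjE)
 note B = Bc Bs
 have B1: "(LINT x:B|lebesgue. \<bar>\<phi> k x\<bar>\<^sup>2) = 1" for k using G by (elim conjE) (erule spec)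
 have e: "(\<lambda>n. en (Vsum t) (\<phi> n)) \<longlonglongrightarrow> 0" using F by (simp add: perturbed_eq_en[OF ph(1)])
 have L: "L2conv \<Omega> \<phi> v" unfolding L2conv_def
 proof (intro allI impI)
  fix K assume K: "compact K \<and> K \<subseteq> \<Omega>"
  then have cv: "continuous_on K v" using continuous_on_subset[OF C_1_continuous[OF v]] by blast
  have i: "integrable lebesgue (\<lambda>x. indicator K x * v x)" "integrable lebesgue (\<lambda>x. indicator K x * (v x)^2)"
   by (intro integrable_on_compact continuous_on_power cv conjunct1[OF K])+
  show "(\<lambda>x. indicator K x * v x) \<in> borel_measurable lebesgue \<and> integrable lebesgue (\<lambda>x. indicator K x * (v x)^2) \<and>
    (\<lambda>n. LINT x|lebesgue. indicator K x * (\<phi> n x - v x)^2) \<longlonglongrightarrow> 0"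
   using i lim[of K] K by (simp add: set_lebesgue_integral_def borel_measurable_integrable)
 qed
 have one: "1 \<le> (LINT x|lebesgue. indicator (closure B) x * (\<phi> n x)^2)" for n
 proof -
  have "(LINT x|lebesgue. indicator B x * (\<phi> n x)^2) \<le> (LINT x|lebesgue. indicator (closure B) x * (\<phi> n x)^2)"
  proof (rule integral_mono')
   show "integrable lebesgue (\<lambda>x. indicator (closure B) x * (\<phi> n x)^2)"
    by (rule integrable_on_compact[OF B(1) test_continuous[OF test_square[OF ph(1)]]])
   show "indicator B x * (\<phi> n x)^2 \<le> indicator (closure B) x * (\<phi> n x)^2" for x
    using closure_subset[of B] by (auto simp: indicator_def)
  qed simp
  then show ?thesis using B1[of n] by (simp add: set_lebesgue_integral_def)
 qed
 show ?thesis by (rule that[OF _ _ e L B]) (use ph one in auto)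
qed

text \<open>A gap bounds the mass on a fixed compact set by the energy, which tends to \<open>0\<close> along a ground state sequence.\<close>

lemma no_ground_state_if_gap:
 assumes C: "C > 0" "\<And>u. u \<in> test_functions \<Omega> \<Longrightarrow> C * SW u \<le> en (Vsum t) u"
 shows "\<not> ground_state \<Omega> (perturbed_energy \<Omega> V Vt t) v"
proof
 assume "ground_state \<Omega> (perturbed_energy \<Omega> V Vt t) v"
 then obtain \<phi> K where ph: "\<forall>n. \<phi> n \<in> test_functions \<Omega>" "(\<lambda>n. en (Vsum t) (\<phi> n)) \<longlonglongrightarrow> 0"
  "compact K" "K \<subseteq> \<Omega>" "\<forall>n. 1 \<le> (LINT x|lebesgue. indicator K x * (\<phi> n x)^2)" by (rule ground_state_sequence) blast
 obtain c where c: "c \<ge> 0" "\<forall>u\<in>test_functions \<Omega>. (LINT x|lebesgue. indicator K x * (u x)^2) \<le> c * SW u"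
  using L2_compact_le_SW[OF ph(3,4)] by blast
 have "1 \<le> c / C * en (Vsum t) (\<phi> n)" for n
 proof -
  have "1 \<le> c * SW (\<phi> n)" using c(2) ph(1,5) order_trans by blast
  also have "\<dots> \<le> c * (en (Vsum t) (\<phi> n) / C)"
   using C(2)[of "\<phi> n"] ph(1) C(1) by (intro mult_left_mono c(1)) (simp add: pos_le_divide_eq mult.commute)
  finally show ?thesis by simp
 qed
 moreover have "(\<lambda>n. c / C * en (Vsum t) (\<phi> n)) \<longlonglongrightarrow> c / C * 0" by (intro tendsto_intros ph(2))
 ultimately have "1 \<le> c / C * 0" using LIMSEQ_le_const by blast
 then show False by simp
qed

text \<open>The limit is nonnegative when tested with squares, and the unit mass on a compact set survives in the limit, so the dichotomy applies.\<close>

lemma ground_state_positive: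
 assumes nn: "\<And>u. u \<in> test_functions \<Omega> \<Longrightarrow> 0 \<le> en (Vsum t) u"
  and ph: "\<And>n. \<phi> n \<in> test_functions \<Omega>" "\<And>n x. 0 \<le> \<phi> n x" "(\<lambda>n. en (Vsum t) (\<phi> n)) \<longlonglongrightarrow> 0" "L2conv \<Omega> \<phi> v"
  and K: "compact K" "K \<subseteq> \<Omega>" "\<And>n. 1 \<le> (LINT x|lebesgue. indicator K x * (\<phi> n x)^2)"
 shows "AE x in lebesgue. x \<in> \<Omega> \<longrightarrow> 0 < v x"
proof -
 note sol = null_sequence_limit[OF nn ph(1,3,4)]
 have ge: "AE x in lebesgue. x \<in> \<Omega> \<longrightarrow> 0 \<le> v x"
 proof (rule nonneg_AE_of_test_squares[OF opn sol(1)])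
  fix \<theta> assume th: "\<theta> \<in> test_functions \<Omega>"
  obtain L where L: "compact L" "L \<subseteq> \<Omega>" "\<forall>x. x \<notin> L \<longrightarrow> (\<theta> x)^2 = 0" using test_support[OF test_square[OF th]] by blast
  have t2: "integrable lebesgue (\<lambda>x. (\<theta> x)^2)" "integrable lebesgue (\<lambda>x. ((\<theta> x)^2)^2)"
   by (intro integrable_test[OF test_square[OF th]] integrable_test[OF test_square[OF test_square[OF th]]])+
  have "(\<lambda>n. LINT x|lebesgue. \<phi> n x * (\<theta> x)^2) \<longlonglongrightarrow> (LINT x|lebesgue. v x * (\<theta> x)^2)"
   by (rule L2conv_pairing(1)[OF ph(1,4) L(1,2) borel_measurable_integrable[OF t2(1)] t2(2)]) (use L(3) in blast)
  then show "0 \<le> (LINT x|lebesgue. v x * (\<theta> x)^2)"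
   by (rule LIMSEQ_le_const) (use ph(2) in \<open>auto intro!: integral_nonneg_AE\<close>)
 qed
 have "\<not> (AE x in lebesgue. x \<in> \<Omega> \<longrightarrow> v x = 0)"
 proof
  assume "AE x in lebesgue. x \<in> \<Omega> \<longrightarrow> v x = 0"
  then have "AE x in lebesgue. indicator K x * (v x)^2 = 0"
   by (rule eventually_mono) (use K(2) in \<open>auto simp: indicator_def\<close>)
  then have "(LINT x|lebesgue. indicator K x * (v x)^2) = 0" by (rule integral_eq_zero_AE)
  moreover have "1 \<le> (LINT x|lebesgue. indicator K x * (v x)^2)"
   by (rule LIMSEQ_le_const[OF L2conv_norm[OF ph(1,4) K(1,2)]]) (use K(3) in blast)
  ultimately show False by simp
 qed
 then show ?thesis using weak_sol_dichotomy[OF dim opn conn sol ge Vsum_AE_bound] by blast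
qed

text \<open>A limit of a null sequence is a multiple of the positive ground state \<open>v\<close>. Subtract the multiple \<open>s * v\<close> that makes the
 mean \<open>d\<close> over one ball vanish; \<open>\<bar>d\<bar>\<close> and \<open>\<bar>d\<bar> + d\<close> are nonnegative solutions, each of which vanishes or is positive throughout,
 so \<open>d\<close> has a fixed sign and, having mean zero, vanishes.\<close>

lemma null_limits_proportional:
 assumes nn: "\<And>u. u \<in> test_functions \<Omega> \<Longrightarrow> 0 \<le> en (Vsum t) u"
  and ph: "\<And>n. \<phi> n \<in> test_functions \<Omega>" "(\<lambda>n. en (Vsum t) (\<phi> n)) \<longlonglongrightarrow> 0" "L2conv \<Omega> \<phi> v"
  and v: "AE x in lebesgue. x \<in> \<Omega> \<longrightarrow> 0 < v x"
  and u: "\<And>n. u n \<in> test_functions \<Omega>" "(\<lambda>n. en (Vsum t) (u n)) \<longlonglongrightarrow> 0" "L2conv \<Omega> u w"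
 shows "\<exists>s. AE x in lebesgue. x \<in> \<Omega> \<longrightarrow> w x = s * v x"
proof -
 obtain x0 where "x0 \<in> \<Omega>" using ne by blast
 then obtain r where r: "r > 0" "cball x0 r \<subseteq> \<Omega>" using opn open_contains_cball by blast
 define I where "I f = (LINT x|lebesgue. indicator (cball x0 r) x * f x)" for f :: "'a \<Rightarrow> real"
 note lw = null_sequence_limit(1)[OF nn u] and lv = null_sequence_limit(1)[OF nn ph]
 have Iv: "I v > 0" unfolding I_def by (rule cball_integral_pos[OF lv v r])
 \<comment> \<open>The multiple for which the difference has mean zero over the ball.\<close>
 define s where "s = I w / I v"
 define d where "d x = w x - s * v x" for x
 define q where "q n x = u n x - s * \<phi> n x" for n x
 have qT: "q n \<in> test_functions \<Omega>" for n unfolding q_def[abs_def] by (rule test_diff[OF u(1) test_cmult[OF ph(1)]])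
 have qL: "L2conv \<Omega> q d" unfolding q_def[abs_def] d_def[abs_def]
 proof (rule L2conv_diff[OF u(1,3) ph(1)])
  fix K assume K: "compact K" "K \<subseteq> \<Omega>"
  show "(\<lambda>x. indicator K x * v x) \<in> borel_measurable lebesgue \<and> integrable lebesgue (\<lambda>x. indicator K x * (v x)^2) \<and>
   (\<forall>n. integrable lebesgue (\<lambda>x. indicator K x * (\<phi> n x - v x)^2)) \<and>
   (\<lambda>n. LINT x|lebesgue. indicator K x * (\<phi> n x - v x)^2) \<longlonglongrightarrow> 0"
   using L2conv_integrable(3)[OF ph(1,3) K] ph(3) K by (simp add: L2conv_def)
 qed
 have qE: "(\<lambda>n. en (Vsum t) (q n)) \<longlonglongrightarrow> 0"
 proof (rule tendsto_sandwich[OF _ _ tendsto_const])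
  show "eventually (\<lambda>n. en (Vsum t) (q n) \<le> 2 * en (Vsum t) (u n) + 2 * (s^2 * en (Vsum t) (\<phi> n))) sequentially"
   unfolding q_def[abs_def] by (intro always_eventually allI en_diff_le[OF Vsum_Linf opn u(1) ph(1) nn])
  have "(\<lambda>n. 2 * en (Vsum t) (u n) + 2 * (s^2 * en (Vsum t) (\<phi> n))) \<longlonglongrightarrow> 2 * 0 + 2 * (s^2 * 0)"
   by (intro tendsto_intros u(2) ph(2))
  then show "(\<lambda>n. 2 * en (Vsum t) (u n) + 2 * (s^2 * en (Vsum t) (\<phi> n))) \<longlonglongrightarrow> 0" by simp
  show "eventually (\<lambda>n. 0 \<le> en (Vsum t) (q n)) sequentially" using nn[OF qT] by simp
 qed
 obtain \<chi>' where c: "\<And>n. \<chi>' n \<in> test_functions \<Omega>" "(\<lambda>n. en (Vsum t) (\<chi>' n)) \<longlonglongrightarrow> 0" "L2conv \<Omega> \<chi>' (\<lambda>x. \<bar>d x\<bar>)"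
  using null_sequence_abs[OF qT qL Vsum_Linf opn nn qE] by blast
 note ds = null_sequence_limit[OF nn qT qE qL] and as = null_sequence_limit[OF nn c]
 have Id: "I d = 0"
 proof -
  have i: "integrable lebesgue (\<lambda>x. indicator (cball x0 r) x * w x)" "integrable lebesgue (\<lambda>x. indicator (cball x0 r) x * v x)"
   using lw lv r(2) by (simp_all add: locint_def)
  have "indicator (cball x0 r) x * d x = indicator (cball x0 r) x * w x - s * (indicator (cball x0 r) x * v x)" for x
   by (simp add: d_def right_diff_distrib)
  then have "I d = I w - s * I v" unfolding I_def using i by simp
  then show ?thesis using Iv by (simp add: s_def)
 qed
 define p where "p x = \<bar>d x\<bar> + d x" for x
 have ps1: "locint \<Omega> p" unfolding p_def[abs_def] by (rule locint_add[OF as(1) ds(1)])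
 have ps2: "weak_sol \<Omega> (Vsum t) p" unfolding p_def[abs_def] by (rule weak_sol_add[OF as ds])
 note ps = ps1 ps2
 have p0: "AE x in lebesgue. x \<in> \<Omega> \<longrightarrow> 0 \<le> p x"
  using abs_ge_minus_self[of "d _"] by (intro AE_I2) (simp add: p_def abs_if)
 have "(AE x in lebesgue. x \<in> \<Omega> \<longrightarrow> p x = 0) \<or> (AE x in lebesgue. x \<in> \<Omega> \<longrightarrow> 0 < p x)"
  by (rule weak_sol_dichotomy[OF dim opn conn ps(1) locint_mult_Linf[OF Vsum_Linf opn ps(1)] ps(2) p0 Vsum_AE_bound])
 moreover have "\<not> (AE x in lebesgue. x \<in> \<Omega> \<longrightarrow> 0 < p x)"
 proof
  assume "AE x in lebesgue. x \<in> \<Omega> \<longrightarrow> 0 < p x"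
  then have "AE x in lebesgue. x \<in> \<Omega> \<longrightarrow> 0 < d x" by (rule eventually_mono) (auto simp: p_def abs_if split: if_splits)
  then show False using cball_integral_pos[OF ds(1) _ r] Id by (simp add: I_def)
 qed
 ultimately have le: "AE x in lebesgue. x \<in> \<Omega> \<longrightarrow> p x = 0" by blast
 have d0: "AE x in lebesgue. x \<in> \<Omega> \<longrightarrow> 0 \<le> \<bar>d x\<bar>" by (intro AE_I2) simp
 have "(AE x in lebesgue. x \<in> \<Omega> \<longrightarrow> \<bar>d x\<bar> = 0) \<or> (AE x in lebesgue. x \<in> \<Omega> \<longrightarrow> 0 < \<bar>d x\<bar>)"
  by (rule weak_sol_dichotomy[OF dim opn conn as d0 Vsum_AE_bound])
 moreover have "\<not> (AE x in lebesgue. x \<in> \<Omega> \<longrightarrow> 0 < \<bar>d x\<bar>)"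
 proof
  assume "AE x in lebesgue. x \<in> \<Omega> \<longrightarrow> 0 < \<bar>d x\<bar>"
  then have "AE x in lebesgue. x \<in> \<Omega> \<longrightarrow> 0 < (-1) * d x"
   using le by eventually_elim (auto simp: p_def)
  from cball_integral_pos[OF locint_cmult[OF ds(1)] this r] show False using Id by (simp add: I_def)
 qed
 ultimately have "AE x in lebesgue. x \<in> \<Omega> \<longrightarrow> \<bar>d x\<bar> = 0" by blast
 then have "AE x in lebesgue. x \<in> \<Omega> \<longrightarrow> w x = s * v x" by (rule eventually_mono) (simp add: d_def)
 then show ?thesis ..
qed

text \<open>Without the estimate, a normalised sequence has a nonzero limit \<open>s * v\<close>; since the penalty vanishes in the limit, \<open>s \<integral>\<psi> v = 0\<close>.\<close>

lemma gap_modulo_pairing: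
 assumes nn: "\<And>u. u \<in> test_functions \<Omega> \<Longrightarrow> 0 \<le> en (Vsum t) u"
  and gs: "ground_state \<Omega> (perturbed_energy \<Omega> V Vt t) v"
  and psi: "\<psi> \<in> test_functions \<Omega>" "(LINT x|lebesgue. \<psi> x * v x) \<noteq> 0"
 shows "\<exists>C>0. \<forall>u\<in>test_functions \<Omega>. C * SW u \<le> en (Vsum t) u + (LINT x|lebesgue. \<psi> x * u x)^2"
proof (rule ccontr)
 define g where "g u = (LINT x|lebesgue. \<psi> x * u x)^2" for u
 assume "\<not> ?thesis"
 then have fail: "\<not> (\<exists>C>0. \<forall>u\<in>test_functions \<Omega>. C * SW u \<le> en (Vsum t) u + g u)" by (simp add: g_def)
 have g: "0 \<le> g u" "g (\<lambda>x. c * u x) = c^2 * g u" for u c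
  by (simp_all add: g_def mult.left_commute power_mult_distrib)
 obtain u w where u: "\<And>n. u n \<in> test_functions \<Omega>" "(\<lambda>n. en (Vsum t) (u n)) \<longlonglongrightarrow> 0" "L2conv \<Omega> u w"
  and gl: "(\<lambda>n. g (u n)) \<longlonglongrightarrow> 0" and w0: "\<not> (AE x in lebesgue. x \<in> \<Omega> \<longrightarrow> w x = 0)"
  using minimising_sequence[OF nn g fail] by blast
 obtain \<phi> K where ph: "\<forall>n. \<phi> n \<in> test_functions \<Omega>" "\<forall>n x. 0 \<le> \<phi> n x" "(\<lambda>n. en (Vsum t) (\<phi> n)) \<longlonglongrightarrow> 0" "L2conv \<Omega> \<phi> v"
  and K: "compact K" "K \<subseteq> \<Omega>" "\<forall>n. 1 \<le> (LINT x|lebesgue. indicator K x * (\<phi> n x)^2)"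
  using ground_state_sequence[OF gs] by blast
 have pos: "AE x in lebesgue. x \<in> \<Omega> \<longrightarrow> 0 < v x"
  by (rule ground_state_positive[OF nn ph(1)[rule_format] ph(2)[rule_format] ph(3,4) K(1,2) K(3)[rule_format]])
 obtain s where s: "AE x in lebesgue. x \<in> \<Omega> \<longrightarrow> w x = s * v x"
  using null_limits_proportional[OF nn ph(1)[rule_format] ph(3,4) pos u] by blast
 obtain L where L: "compact L" "L \<subseteq> \<Omega>" "\<forall>x. x \<notin> L \<longrightarrow> \<psi> x = 0" using test_support[OF psi(1)] by blast
 have pl: "(\<lambda>n. LINT x|lebesgue. u n x * \<psi> x) \<longlonglongrightarrow> (LINT x|lebesgue. w x * \<psi> x)"
  by (rule L2conv_pairing(1)[OF u(1,3) L(1,2) borel_measurable_integrable[OF integrable_test[OF psi(1)]] integrable_test[OF test_square[OF psi(1)]]])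
    (use L(3) in blast)
 have "(\<lambda>n. (LINT x|lebesgue. u n x * \<psi> x)^2) \<longlonglongrightarrow> (LINT x|lebesgue. w x * \<psi> x)^2" by (intro tendsto_intros pl)
 moreover have "(\<lambda>n. (LINT x|lebesgue. u n x * \<psi> x)^2) \<longlonglongrightarrow> 0" using gl by (simp add: g_def mult.commute)
 ultimately have "(LINT x|lebesgue. w x * \<psi> x) = 0" using LIMSEQ_unique by fastforce
 moreover have "(LINT x|lebesgue. w x * \<psi> x) = (LINT x|lebesgue. s * (v x * \<psi> x))"
 proof (rule integral_cong_AE)
  note lw = null_sequence_limit(1)[OF nn u] and lv = null_sequence_limit(1)[OF nn ph(1)[rule_format] ph(3,4)]
  show "(\<lambda>x. w x * \<psi> x) \<in> borel_measurable lebesgue" by (rule borel_measurable_integrable[OF locint_test[OF lw psi(1)]])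
  show "(\<lambda>x. s * (v x * \<psi> x)) \<in> borel_measurable lebesgue"
   by (rule borel_measurable_integrable[OF integrable_mult_right[OF locint_test[OF lv psi(1)]]])
  show "AE x in lebesgue. w x * \<psi> x = s * (v x * \<psi> x)"
   using s by (rule eventually_mono) (use test_outside[OF psi(1)] in fastforce)
 qed
 ultimately have "s = 0" using psi(2) by (simp add: mult.commute)
 then show False using s w0 by simp
qed

section \<open>The set of admissible coupling constants\<close>

lemma nonneg_params_eq: "nonneg_params \<Omega> V Vt = {t. \<forall>u\<in>test_functions \<Omega>. 0 \<le> en V u + t * (LINT x|lebesgue. Vt x * (u x)^2)}"
 by (simp add: nonneg_params_def nonneg_functional_iff en_Vsum)

lemma closed_nonneg_params: "closed (nonneg_params \<Omega> V Vt)"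
proof -
 have "nonneg_params \<Omega> V Vt = (\<Inter>u\<in>test_functions \<Omega>. {t. 0 \<le> en V u + t * (LINT x|lebesgue. Vt x * (u x)^2)})"
  by (auto simp: nonneg_params_eq)
 then show ?thesis by (auto intro!: closed_Collect_le continuous_intros)
qed

lemma interval_nonneg_params: "is_interval (nonneg_params \<Omega> V Vt)"
 unfolding is_interval_1
proof (intro ballI allI impI)
 fix a b x assume a: "a \<in> nonneg_params \<Omega> V Vt" and b: "b \<in> nonneg_params \<Omega> V Vt" and x: "a \<le> x \<and> x \<le> b"
 have "0 \<le> en V u + x * (LINT x|lebesgue. Vt x * (u x)^2)" if u: "u \<in> test_functions \<Omega>" for u
 proof (cases "0 \<le> (LINT x|lebesgue. Vt x * (u x)^2)")
  case True
  then have "a * (LINT x|lebesgue. Vt x * (u x)^2) \<le> x * (LINT x|lebesgue. Vt x * (u x)^2)" using x by (intro mult_right_mono) auto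
  moreover have "0 \<le> en V u + a * (LINT x|lebesgue. Vt x * (u x)^2)" using a u by (simp add: nonneg_params_eq)
  ultimately show ?thesis by linarith
 next
  case False
  then have "b * (LINT x|lebesgue. Vt x * (u x)^2) \<le> x * (LINT x|lebesgue. Vt x * (u x)^2)" using x by (intro mult_right_mono_neg) auto
  moreover have "0 \<le> en V u + b * (LINT x|lebesgue. Vt x * (u x)^2)" using b u by (simp add: nonneg_params_eq)
  ultimately show ?thesis by linarith
 qed
 then show "x \<in> nonneg_params \<Omega> V Vt" by (simp add: nonneg_params_eq)
qed

text \<open>Interior parameters are exactly those with a gap: the perturbation is bounded by the Sobolev term, and conversely at an interior
 parameter the energy is a convex combination of an energy slightly further away from \<open>0\<close> and the unperturbed one.\<close>

lemma interior_nonneg_params_iff: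
 "t \<in> interior (nonneg_params \<Omega> V Vt) \<longleftrightarrow> (\<exists>C>0. \<forall>u\<in>test_functions \<Omega>. C * SW u \<le> en (Vsum t) u)"
proof
 assume "t \<in> interior (nonneg_params \<Omega> V Vt)"
 then obtain e where e: "e > 0" "ball t e \<subseteq> nonneg_params \<Omega> V Vt" by (auto simp: mem_interior)
 \<comment> \<open>So that \<open>t * (1 + \<delta>)\<close> stays in the ball around \<open>t\<close>.\<close>
 define \<delta> where "\<delta> = e / (2 * (\<bar>t\<bar> + 1))"
 have d: "\<delta> > 0" using e(1) by (simp add: \<delta>_def)
 have "\<delta> * (\<bar>t\<bar> + 1) = e / 2" by (simp add: \<delta>_def field_simps)
 then have "\<bar>t\<bar> * \<delta> < e" using d e(1) by (simp add: algebra_simps)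
 then have "t * (1 + \<delta>) \<in> nonneg_params \<Omega> V Vt"
  using e(2) d by (auto simp: dist_real_def distrib_left abs_mult subset_iff)
 then have s: "0 \<le> en V u + t * (1 + \<delta>) * (LINT x|lebesgue. Vt x * (u x)^2)" if "u \<in> test_functions \<Omega>" for u
  using that by (simp add: nonneg_params_eq)
 show "\<exists>C>0. \<forall>u\<in>test_functions \<Omega>. C * SW u \<le> en (Vsum t) u"
 proof (intro exI[of _ "\<delta> / (1 + \<delta>)"] conjI ballI)
  fix u assume u: "u \<in> test_functions \<Omega>"
  have "\<delta> * SW u \<le> \<delta> * en V u" using en_ge[OF u] d by simp
  also have "\<dots> \<le> (1 + \<delta>) * en (Vsum t) u" using s[OF u] by (simp add: en_Vsum[OF u] algebra_simps)
  finally show "\<delta> / (1 + \<delta>) * SW u \<le> en (Vsum t) u" using d by (simp add: field_simps)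
 qed (use d in simp)
next
 assume "\<exists>C>0. \<forall>u\<in>test_functions \<Omega>. C * SW u \<le> en (Vsum t) u"
 then obtain C where C: "C > 0" "\<And>u. u \<in> test_functions \<Omega> \<Longrightarrow> C * SW u \<le> en (Vsum t) u" by blast
 obtain A where A: "A \<ge> 0" "\<forall>u\<in>test_functions \<Omega>. \<bar>LINT x|lebesgue. Vt x * (u x)^2\<bar> \<le> A * SW u" using Vt_le_SW by blast
 show "t \<in> interior (nonneg_params \<Omega> V Vt)"
  unfolding mem_interior
 proof (intro exI conjI subsetI)
  show "C / (A + 1) > 0" using C(1) A(1) by simp
  fix s assume "s \<in> ball t (C / (A + 1))"
  then have st: "\<bar>s - t\<bar> * (A + 1) \<le> C" using A(1) by (simp add: dist_real_def abs_minus_commute field_simps)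
  have "0 \<le> en V u + s * (LINT x|lebesgue. Vt x * (u x)^2)" if u: "u \<in> test_functions \<Omega>" for u
  proof -
   have "\<bar>(s - t) * (LINT x|lebesgue. Vt x * (u x)^2)\<bar> \<le> \<bar>s - t\<bar> * (A * SW u)"
    unfolding abs_mult by (rule mult_left_mono) (use A(2) u in auto)
   also have "\<dots> \<le> \<bar>s - t\<bar> * ((A + 1) * SW u)"
    by (intro mult_left_mono mult_right_mono SW_nonneg) auto
   also have "\<dots> = (\<bar>s - t\<bar> * (A + 1)) * SW u" by simp
   also have "\<dots> \<le> C * SW u" by (rule mult_right_mono[OF st SW_nonneg])
   finally have "\<bar>(s - t) * (LINT x|lebesgue. Vt x * (u x)^2)\<bar> \<le> en (Vsum t) u" using C(2)[OF u] by linarith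
   moreover have "en V u + s * (LINT x|lebesgue. Vt x * (u x)^2) = en (Vsum t) u + (s - t) * (LINT x|lebesgue. Vt x * (u x)^2)"
    by (simp add: en_Vsum[OF u] algebra_simps)
   ultimately show ?thesis by linarith
  qed
  then show "s \<in> nonneg_params \<Omega> V Vt" by (simp add: nonneg_params_eq)
 qed
qed

lemma zero_interior_nonneg_params: "0 \<in> interior (nonneg_params \<Omega> V Vt)"
 unfolding interior_nonneg_params_iff by (intro exI[of _ 1]) (use en_ge in \<open>auto simp: en_Vsum\<close>)

text \<open>For a nonnegative functional, a ground state exists exactly if there is no gap, that is, off the interior.\<close>

lemma frontier_nonneg_params_iff:
 "t \<in> frontier (nonneg_params \<Omega> V Vt) \<longleftrightarrow> critical \<Omega> (perturbed_energy \<Omega> V Vt t)"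
proof -
 have nn: "t \<in> nonneg_params \<Omega> V Vt \<longleftrightarrow> nonneg_functional \<Omega> (perturbed_energy \<Omega> V Vt t)"
  by (simp add: nonneg_params_def)
 have "(\<exists>v. ground_state \<Omega> (perturbed_energy \<Omega> V Vt t) v) \<longleftrightarrow> t \<notin> interior (nonneg_params \<Omega> V Vt)"
  if "nonneg_functional \<Omega> (perturbed_energy \<Omega> V Vt t)"
  unfolding interior_nonneg_params_iff
  using ground_state_if_no_gap no_ground_state_if_gap that[unfolded nonneg_functional_iff] by blast
 then show ?thesis
  unfolding frontier_def closure_closed[OF closed_nonneg_params] critical_def using nn by blast
qed

lemma negative_part_test_function:
 assumes f: "locint \<Omega> f" "(\<lambda>x. indicator \<Omega> x * f x) \<in> borel_measurable lebesgue"
 shows "0 < emeasure lebesgue {x \<in> \<Omega>. f x < 0} \<longleftrightarrow> (\<exists>\<theta>\<in>test_functions \<Omega>. (LINT x|lebesgue. f x * (\<theta> x)^2) < 0)"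
proof -
 have "{x \<in> \<Omega>. f x < 0} = {x \<in> space lebesgue. indicator \<Omega> x * f x < 0}" by (auto simp: indicator_def split: if_splits)
 then have m: "{x \<in> \<Omega>. f x < 0} \<in> sets lebesgue" using borel_measurable_less[OF f(2) borel_measurable_const[of 0]] by (simp only:)
 have "emeasure lebesgue {x \<in> \<Omega>. f x < 0} = 0 \<longleftrightarrow> (AE x in lebesgue. x \<notin> {x \<in> \<Omega>. f x < 0})"
  using AE_iff_null_sets[OF m] m by (simp add: null_sets_def)
 also have "\<dots> \<longleftrightarrow> (AE x in lebesgue. x \<in> \<Omega> \<longrightarrow> 0 \<le> f x)" by (auto simp: not_less)
 also have "\<dots> \<longleftrightarrow> (\<forall>\<theta>\<in>test_functions \<Omega>. 0 \<le> (LINT x|lebesgue. f x * (\<theta> x)^2))"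
 proof
  assume ae: "AE x in lebesgue. x \<in> \<Omega> \<longrightarrow> 0 \<le> f x"
  show "\<forall>\<theta>\<in>test_functions \<Omega>. 0 \<le> (LINT x|lebesgue. f x * (\<theta> x)^2)"
  proof
   fix \<theta> assume th: "\<theta> \<in> test_functions \<Omega>"
   show "0 \<le> (LINT x|lebesgue. f x * (\<theta> x)^2)"
    by (rule integral_nonneg_AE, use ae in \<open>rule eventually_mono\<close>) (use test_outside[OF th] in fastforce)
  qed
 next
  assume "\<forall>\<theta>\<in>test_functions \<Omega>. 0 \<le> (LINT x|lebesgue. f x * (\<theta> x)^2)"
  then show "AE x in lebesgue. x \<in> \<Omega> \<longrightarrow> 0 \<le> f x" using nonneg_AE_of_test_squares[OF opn f(1)] by blast
 qed
 finally have "emeasure lebesgue {x \<in> \<Omega>. f x < 0} = 0 \<longleftrightarrow> (\<forall>\<theta>\<in>test_functions \<Omega>. 0 \<le> (LINT x|lebesgue. f x * (\<theta> x)^2))" .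
 then show ?thesis by (simp only: zero_less_iff_neq_zero) (simp add: not_le)
qed

text \<open>If \<open>I \<theta> = \<integral>Vt \<theta>\<^sup>2 < 0\<close> then \<open>0 \<le> en V \<theta> + t I \<theta>\<close> bounds \<open>t\<close> from above; if no such \<open>\<theta>\<close> exists, every \<open>t \<ge> 0\<close> is admissible.
 The other side is symmetric.\<close>

lemma bounded_nonneg_params_iff:
 "bounded (nonneg_params \<Omega> V Vt) \<longleftrightarrow>
   emeasure lebesgue {x \<in> \<Omega>. Vt x > 0} > 0 \<and> emeasure lebesgue {x \<in> \<Omega>. Vt x < 0} > 0"
proof -
 define I where "I u = (LINT x|lebesgue. Vt x * (u x)^2)" for u
 note lV = locint_Linf[OF Vt opn]
 have lm: "locint \<Omega> (\<lambda>x. (-1) * Vt x)" by (rule locint_cmult[OF lV])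
 have mm: "(\<lambda>x. indicator \<Omega> x * ((-1) * Vt x)) \<in> borel_measurable lebesgue"
  using borel_measurable_uminus[OF Linf_loc_measurable[OF Vt opn]] by simp
 have neg: "emeasure lebesgue {x \<in> \<Omega>. Vt x < 0} > 0 \<longleftrightarrow> (\<exists>\<theta>\<in>test_functions \<Omega>. I \<theta> < 0)"
  unfolding I_def by (rule negative_part_test_function[OF lV Linf_loc_measurable[OF Vt opn]])
 have pos: "emeasure lebesgue {x \<in> \<Omega>. Vt x > 0} > 0 \<longleftrightarrow> (\<exists>\<theta>\<in>test_functions \<Omega>. I \<theta> > 0)"
  using negative_part_test_function[OF lm mm] by (simp add: I_def)
 have V0: "0 \<le> en V u" if "u \<in> test_functions \<Omega>" for u using en_ge[OF that] SW_nonneg[of u] by linarith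
 have mem: "s \<in> nonneg_params \<Omega> V Vt \<longleftrightarrow> (\<forall>u\<in>test_functions \<Omega>. 0 \<le> en V u + s * I u)" for s
  by (simp add: nonneg_params_eq I_def)
 show ?thesis unfolding neg pos
 proof
  assume "bounded (nonneg_params \<Omega> V Vt)"
  then obtain b where b: "\<And>s. s \<in> nonneg_params \<Omega> V Vt \<Longrightarrow> \<bar>s\<bar> \<le> b" by (auto simp: bounded_iff)
  have "\<bar>b\<bar> + 1 \<notin> nonneg_params \<Omega> V Vt" "- (\<bar>b\<bar> + 1) \<notin> nonneg_params \<Omega> V Vt"
   using b[of "\<bar>b\<bar> + 1"] b[of "- (\<bar>b\<bar> + 1)"] by auto
  then obtain u1 u2 where u: "u1 \<in> test_functions \<Omega>" "en V u1 + (\<bar>b\<bar> + 1) * I u1 < 0"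
    "u2 \<in> test_functions \<Omega>" "en V u2 + (- (\<bar>b\<bar> + 1)) * I u2 < 0" unfolding mem by (auto simp: not_le)
  have "(\<bar>b\<bar> + 1) * I u1 < 0" "(\<bar>b\<bar> + 1) * I u2 > 0" using u V0[OF u(1)] V0[OF u(3)] by linarith+
  then have "I u1 < 0" "I u2 > 0" by (auto simp: mult_less_0_iff zero_less_mult_iff)
  then show "(\<exists>\<theta>\<in>test_functions \<Omega>. I \<theta> > 0) \<and> (\<exists>\<theta>\<in>test_functions \<Omega>. I \<theta> < 0)" using u by blast
 next
  assume "(\<exists>\<theta>\<in>test_functions \<Omega>. I \<theta> > 0) \<and> (\<exists>\<theta>\<in>test_functions \<Omega>. I \<theta> < 0)"
  then obtain a b where ab: "a \<in> test_functions \<Omega>" "I a > 0" "b \<in> test_functions \<Omega>" "I b < 0" by blast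
  have "nonneg_params \<Omega> V Vt \<subseteq> {- en V a / I a .. - en V b / I b}"
  proof
   fix s assume "s \<in> nonneg_params \<Omega> V Vt"
   then have "0 \<le> en V a + s * I a" "0 \<le> en V b + s * I b" using ab unfolding mem by blast+
   then have "- en V a \<le> s * I a" "- en V b \<le> s * I b" by linarith+
   then have "- en V a / I a \<le> s" "s \<le> - en V b / I b"
    using pos_divide_le_eq[OF ab(2), of "- en V a" s] neg_le_divide_eq[OF ab(4), of s "- en V b"] by blast+
   then show "s \<in> {- en V a / I a .. - en V b / I b}" by simp
  qed
  then show "bounded (nonneg_params \<Omega> V Vt)" by (rule bounded_subset[OF bounded_closed_interval])
 qed
qed

end

theorem theorem2p9:
  fixes \<Omega> :: "'a::euclidean_space set" and V Vt W :: "'a \<Rightarrow> real"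
  assumes dim: "DIM('a) > 2"
    and domain: "open \<Omega>" "connected \<Omega>" "\<Omega> \<noteq> {}"
    and V: "V \<in> Linf_loc \<Omega>"
    and W: "continuous_on \<Omega> W" "\<And>x. x \<in> \<Omega> \<Longrightarrow> W x > 0"
    and Q: "\<And>u. u \<in> test_functions \<Omega> \<Longrightarrow> energy \<Omega> V u \<ge> weighted_sobolev_term \<Omega> W u"
    and Vt: "Vt \<in> Linf_loc \<Omega>" "\<not> (AE x in lebesgue_on \<Omega>. Vt x = 0)"
    and integ: "set_integrable lebesgue \<Omega>
       (\<lambda>x. \<bar>Vt x\<bar> powr (real DIM('a) / 2) * W x powr ((2 - real DIM('a)) / 2))"
  shows "(\<forall>t. nonneg_functional \<Omega> (perturbed_energy \<Omega> V Vt t) \<and>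
              \<not> (\<exists>v. ground_state \<Omega> (perturbed_energy \<Omega> V Vt t) v) \<longrightarrow>
            (\<exists>C>0. \<forall>u\<in>test_functions \<Omega>.
               perturbed_energy \<Omega> V Vt t u \<ge> C * weighted_sobolev_term \<Omega> W u)) \<and>
         (\<forall>t v. nonneg_functional \<Omega> (perturbed_energy \<Omega> V Vt t) \<and>
                ground_state \<Omega> (perturbed_energy \<Omega> V Vt t) v \<longrightarrow>
            (\<forall>\<psi>\<in>test_functions \<Omega>. (LINT x:\<Omega>|lebesgue. \<psi> x * v x) \<noteq> 0 \<longrightarrow>
               (\<exists>C>0. \<exists>C1>0. \<forall>u\<in>test_functions \<Omega>.
                  perturbed_energy \<Omega> V Vt t u + C1 * (LINT x:\<Omega>|lebesgue. \<psi> x * u x)\<^sup>2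
                    \<ge> C * weighted_sobolev_term \<Omega> W u))) \<and>
         closed (nonneg_params \<Omega> V Vt) \<and>
         is_interval (nonneg_params \<Omega> V Vt) \<and>
         interior (nonneg_params \<Omega> V Vt) \<noteq> {} \<and>
         (bounded (nonneg_params \<Omega> V Vt) \<longleftrightarrow>
            emeasure lebesgue {x \<in> \<Omega>. Vt x > 0} > 0 \<and>
            emeasure lebesgue {x \<in> \<Omega>. Vt x < 0} > 0) \<and>
         (\<forall>t. t \<in> frontier (nonneg_params \<Omega> V Vt) \<longleftrightarrow>
              critical \<Omega> (perturbed_energy \<Omega> V Vt t))"
proof -
 interpret admissible_perturbation \<Omega> V W Vt
  by unfold_locales (use assms in blast)+
 have pair: "(LINT x:\<Omega>|lebesgue. \<psi> x * v x) = (LINT x|lebesgue. \<psi> x * v x)" if "\<psi> \<in> test_functions \<Omega>" for \<psi> v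
  by (rule set_lint_supported) (simp add: test_outside[OF that])
 have i: "\<exists>C>0. \<forall>u\<in>test_functions \<Omega>. perturbed_energy \<Omega> V Vt t u \<ge> C * weighted_sobolev_term \<Omega> W u"
  if "nonneg_functional \<Omega> (perturbed_energy \<Omega> V Vt t) \<and> \<not> (\<exists>v. ground_state \<Omega> (perturbed_energy \<Omega> V Vt t) v)" for t
 proof -
  have "\<exists>C>0. \<forall>u\<in>test_functions \<Omega>. C * SW u \<le> en (Vsum t) u"
   using ground_state_if_no_gap[of t] that unfolding nonneg_functional_iff by blast
  then show ?thesis by (simp add: perturbed_eq_en)
 qed
 have ii: "\<exists>C>0. \<exists>C1>0. \<forall>u\<in>test_functions \<Omega>.
   perturbed_energy \<Omega> V Vt t u + C1 * (LINT x:\<Omega>|lebesgue. \<psi> x * u x)\<^sup>2 \<ge> C * weighted_sobolev_term \<Omega> W u"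
  if h: "nonneg_functional \<Omega> (perturbed_energy \<Omega> V Vt t) \<and> ground_state \<Omega> (perturbed_energy \<Omega> V Vt t) v"
   and p: "\<psi> \<in> test_functions \<Omega>" "(LINT x:\<Omega>|lebesgue. \<psi> x * v x) \<noteq> 0" for t v \<psi>
 proof -
  have "(LINT x|lebesgue. \<psi> x * v x) \<noteq> 0" using p(2) by (simp add: pair[OF p(1)])
  then obtain C where "C > 0" "\<forall>u\<in>test_functions \<Omega>. C * SW u \<le> en (Vsum t) u + (LINT x|lebesgue. \<psi> x * u x)^2"
   using gap_modulo_pairing[of t v \<psi>] h p(1) unfolding nonneg_functional_iff by blast
  then show ?thesis by (intro exI[of _ C] exI[of _ 1] conjI) (simp_all add: perturbed_eq_en pair[OF p(1)])
 qed
 show ?thesis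
  by (intro conjI allI impI ballI i ii closed_nonneg_params interval_nonneg_params bounded_nonneg_params_iff frontier_nonneg_params_iff)
    (use zero_interior_nonneg_params in auto)
qed

end
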